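(* Let $k=1$ and $Re\ge1$, let $\{(u_h^n,p_h^n)\}$ solve the extrapolated Crank-Nicolson scheme described in the context, and set $y_h^n=\delta u_h^n$ and $Y_h^n:=y_h^n-\pi_0y_h^n$. Then, for $n=1,\dots,N-1$, $$\|Y_h^{n+1}\|^2\le C\Bigl(\frac{Co}{Re}\tau\|\bar u_h^{n+1}\|_A^2+\tau^2\beta_{1,\infty}^2\|\hat u_h^{n+1}\|^2+\tau\,Co\,|\bar u_h^{n+1}|_{s_u}^2+\tau\,Co\,|p_h^{n+1}|_{s_p}^2+\tau\|L^{n+1}\|_h^2+Co\,\|\delta\delta u_h^{n+1}\|^2\Bigr).$$
   Context: **Setting.** Let $\Omega\subset\mathbb R^d$, $d\in\{2,3\}$, be an open polygonal domain, $T>0$, $\mathcal M=\Omega\times(0,T)$, $\mu>0$, and $\beta\in[W^{1,\infty}(\mathcal M)]^d$ with $\nabla\cdot\beta=0$ and $\beta\cdot n=0$ on $\partial\Omega$. Put $\beta_\infty=\|\beta\|_{[L^\infty(\mathcal M)]^d}>0$ and $\beta_{1,\infty}=\|\beta\|_{[W^{1,\infty}(\mathcal M)]^d}$. $(\cdot,\cdot)_X$ is the $L^2(X)$ inner product and $\|\cdot\|$ the $L^2(\Omega)$ norm. **Meshes and spaces.** $\{\mathcal T_h\}_h$ is a quasi-uniform family of affine simplicial meshes of $\Omega$, $h=\max_{T\in\mathcal T_h}\mathrm{diam}(T)<1$, $\mathcal F_h^{int}$ is the set of interior faces, $h_F$ the diameter of the face $F$, $n$ a unit normal to the face (outward on $\partial\Omega$),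 and $[\![\cdot]\!]$ the jump across an interior face. $X_h^k$ is the space of discontinuous piecewise polynomials of total degree $\le k$, $W_h=X_h^k\cap C^0(\bar\Omega)$, $V_h=[W_h]^d$, $Q_h=W_h\cap L^2_0(\Omega)$ ($L^2_0$: zero mean). $\pi_h$ is the $L^2$-projection onto $W_h$ (or $V_h$); $\pi_0$ is the (componentwise) $L^2$-projection onto the piecewise constants $X_h^0$. **Numbers.** $Re=h\beta_\infty/\mu$, $\xi=\min\{1,Re^{-1}\}$, $Co=(\beta_\infty+1)\tau/h$. The stabilization parameters $\gamma_u,\gamma_p,\varepsilon^\perp$ are positive, and $\gamma$ is sufficiently large that $\|\cdot\|_E$ below is a norm on $V_h$. **Operators.** $C_h(t)w\in V_h$ is defined by $(C_h(t)w,v_h)_\Omega=\sum_{T\in\mathcal T_h}(\beta(t)\cdot\nabla w,v_h)_T+s_u(w,v_h)$ for all $v_h\in V_h$, where $$s_u(w,v)=\gamma_u\sum_{F\in\mathcal F_h^{int}}\int_F h_F^2(|\beta(t)\cdot n|+\beta_\infty\varepsilon^\perp)[\![\nabla w]\!]:[\![\nabla v]\!]\,ds+(\beta_\infty w\cdot n,v\cdot n)_{\partial\Omega}.$$ $A_hw\in V_h$: $(A_hw,v_h)_\Omega=\int_\Omega\mu\nabla w:\nabla v_h\,dx-(\mu n\cdot\nabla w,v_h)_{\partial\Omega}-(\mu n\cdot\nabla v_h,w)_{\partial\Omega}+\frac{\gamma\mu}{h}(w,v_h)_{\partial\Omega}$. $G_hq\in V_h$: $(G_hq,v_h)_\Omega=-(q,\nabla\cdot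 v_h)_\Omega+(q,v_h\cdot n)_{\partial\Omega}$ for $v_h\in V_h$. $G_h^*w\in W_h$: $(G_h^*w,q_h)_\Omega=(q_h,\nabla\cdot w)_\Omega-(q_h,w\cdot n)_{\partial\Omega}$ for $q_h\in W_h$. $S_h^p$: $(S_h^pq,q_h)_\Omega=s_p(q,q_h)$ for $q_h\in Q_h$, with $s_p(q,q_h)=\frac{\gamma_p\xi h^3}{\mu}\sum_{F\in\mathcal F_h^{int}}\int_F[\![\nabla q]\!]\cdot[\![\nabla q_h]\!]\,ds$. **Norms.** $|v|_{s_u}^2=s_u(v,v)$, $|q|_{s_p}^2=s_p(q,q)$, $\|v\|_A^2=(A_hv,v)_\Omega$, $\|v\|_E^2=|v|_{s_u}^2+\|v\|_A^2$. For a linear functional $L$ on $V_h$, $\|L\|_h=\sup_{v_h\in V_h}L(v_h)/(\|v_h\|_E^2+\|v_h\|^2)^{1/2}$. (The norms $|\cdot|_{s_u}$, $\|\cdot\|_E$ depend on $t$ through $\beta$; in quantities attached to step $n+1$, $\beta$ is taken at $t^{n+1/2}$.) **Scheme.** $\tau$ is the time step, $t^n=n\tau$, $\delta v^{n+1}=v^{n+1}-v^n$, $\delta\delta v^{n+1}=\delta v^{n+1}-\delta v^n$, $\hat u_h^{n+1}=\frac32u_h^n-\frac12u_h^{n-1}$, $\bar u_h^{n+1}=\frac12(u_h^{n+1}+u_h^n)$, $C_h^{n+1/2}=C_h(t^{n+1/2})$. Given $u^0,u^1$, set $u_h^0=\pi_hu^0$, $u_h^1=\pi_hu^1$; for $n=1,\dots,N-1$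 find $(u_h^{n+1},p_h^{n+1})\in V_h\times Q_h$ with $$\tau^{-1}(\delta u_h^{n+1},v_h)_\Omega+(G_hp_h^{n+1},v_h)_\Omega+(C_h^{n+1/2}\hat u_h^{n+1},v_h)_\Omega+(A_h\bar u_h^{n+1},v_h)_\Omega=L^{n+1}(v_h)\quad\forall v_h\in V_h,$$ $$(G_h^*u_h^{n+1},q_h)_\Omega+(S_h^pp_h^{n+1},q_h)_\Omega=\tilde L^{n+1}(q_h)\quad\forall q_h\in Q_h,$$ where $L^n$ and $\tilde L^n$ are given bounded linear functionals on $V_h$ and $Q_h$. **Constants.** $C$ is a generic positive constant independent of $h$, $\mu$, the time step $\tau$ and the discrete functions; it may depend on upper bounds for $Co$ and $\tau$. *)

theory Defs
  imports "HOL-Analysis.Analysis" "HOL-Probability.Essential_Supremum"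
begin

section \<open>Lebesgue and Sobolev spaces\<close>

definition L2_inner :: "'a::euclidean_space set \<Rightarrow> ('a \<Rightarrow> 'b::real_inner) \<Rightarrow> ('a \<Rightarrow> 'b) \<Rightarrow> real" where
  "L2_inner X f g = (LINT x:X|lebesgue. f x \<bullet> g x)"

definition L2_norm :: "'a::euclidean_space set \<Rightarrow> ('a \<Rightarrow> 'b::real_inner) \<Rightarrow> real" where
  "L2_norm X f = sqrt (L2_inner X f f)"

definition L2_space :: "'a::euclidean_space set \<Rightarrow> ('a \<Rightarrow> 'b::euclidean_space) set" where
  "L2_space X = {f \<in> borel_measurable (lebesgue_on X).
     set_integrable lebesgue X (\<lambda>x. (norm (f x))\<^sup>2)}"

definition Linf_space :: "'a::euclidean_space set \<Rightarrow> ('a \<Rightarrow> 'b::euclidean_space) set" where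
  "Linf_space X = {f \<in> borel_measurable (lebesgue_on X).
     \<exists>c. AE x in lebesgue_on X. norm (f x) \<le> c}"

definition Linf_norm :: "'a::euclidean_space set \<Rightarrow> ('a \<Rightarrow> 'b::euclidean_space) \<Rightarrow> real" where
  "Linf_norm X f = real_of_ereal (esssup (lebesgue_on X) (\<lambda>x. ereal (norm (f x))))"

definition C1c_functions :: "'a::euclidean_space set \<Rightarrow> ('a \<Rightarrow> real) set" where
  "C1c_functions U = {\<phi>.
     (\<exists>\<phi>' :: 'a \<Rightarrow> ('a \<Rightarrow>\<^sub>L real). continuous_on UNIV \<phi>' \<and>
        (\<forall>x. (\<phi> has_derivative blinfun_apply (\<phi>' x)) (at x))) \<and>
     (\<exists>K. compact K \<and> K \<subseteq> U \<and> (\<forall>x. x \<notin> K \<longrightarrow> \<phi> x = 0))}"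

text \<open>First-order weak derivatives, tested with compactly supported C1 functions as in
  Gilbarg--Trudinger.\<close>

definition has_weak_derivative ::
  "'a::euclidean_space set \<Rightarrow> ('a \<Rightarrow> 'b::euclidean_space) \<Rightarrow> 'a \<Rightarrow> ('a \<Rightarrow> 'b) \<Rightarrow> bool" where
  "has_weak_derivative U f e g \<longleftrightarrow>
     (\<forall>K. compact K \<and> K \<subseteq> U \<longrightarrow> set_integrable lebesgue K f \<and> set_integrable lebesgue K g) \<and>
     (\<forall>\<phi>\<in>C1c_functions U.
        (LINT x:U|lebesgue. frechet_derivative \<phi> (at x) e *\<^sub>R f x)
          = - (LINT x:U|lebesgue. \<phi> x *\<^sub>R g x))"

definition weak_derivative ::
  "'a::euclidean_space set \<Rightarrow> ('a \<Rightarrow> 'b::euclidean_space) \<Rightarrow> 'a \<Rightarrow> 'a \<Rightarrow> 'b" where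
  "weak_derivative U f e = (SOME g. has_weak_derivative U f e g)"

definition W1inf_space :: "'a::euclidean_space set \<Rightarrow> ('a \<Rightarrow> 'b::euclidean_space) set" where
  "W1inf_space U = {f \<in> Linf_space U.
     \<forall>e\<in>Basis. \<exists>g\<in>Linf_space U. has_weak_derivative U f e g}"

definition W1inf_norm :: "'a::euclidean_space set \<Rightarrow> ('a \<Rightarrow> 'b::euclidean_space) \<Rightarrow> real" where
  "W1inf_norm U f =
     Max (insert (Linf_norm U f) ((\<lambda>e. Linf_norm U (weak_derivative U f e)) ` Basis))"


section \<open>Domain, meshes and faces\<close>

text \<open>The last two conditions express that the domain lies locally on one side of its boundary
  (no slits) and does not touch itself; every Lipschitz polygonal or polyhedral domain satisfies
  them.\<close>

definition polygonal_domain :: "(real^'d) set \<Rightarrow> bool" where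
  "polygonal_domain \<Omega> \<longleftrightarrow>
     open \<Omega> \<and> connected \<Omega> \<and> \<Omega> \<noteq> {} \<and> bounded \<Omega> \<and>
     (\<exists>\<P>. finite \<P> \<and> (\<forall>P\<in>\<P>. polytope P) \<and> closure \<Omega> = \<Union>\<P>) \<and>
     interior (closure \<Omega>) = \<Omega> \<and>
     (\<forall>x\<in>frontier \<Omega>. \<exists>r0>0. \<forall>r. 0 < r \<and> r < r0 \<longrightarrow> connected (\<Omega> \<inter> ball x r))"

definition simplicial_mesh :: "(real^'d) set \<Rightarrow> (real^'d) set set \<Rightarrow> bool" where
  "simplicial_mesh \<Omega> \<T> \<longleftrightarrow>
     triangulation \<T> \<and> (\<forall>K\<in>\<T>. int CARD('d) simplex K) \<and> \<Union>\<T> = closure \<Omega>"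

definition mesh_size :: "(real^'d) set set \<Rightarrow> real" where
  "mesh_size \<T> = Max (diameter ` \<T>)"

text \<open>Quasi-uniformity: shape regularity (the diameter of an element is bounded by a multiple of
  the radius of a ball inside it) and comparability of all diameters with the mesh size, with a
  constant common to all meshes.\<close>

definition quasi_uniform_family :: "(real^'d) set \<Rightarrow> (real^'d) set set set \<Rightarrow> bool" where
  "quasi_uniform_family \<Omega> \<M> \<longleftrightarrow>
     (\<forall>\<T>\<in>\<M>. simplicial_mesh \<Omega> \<T> \<and> mesh_size \<T> < 1) \<and>
     (\<exists>\<sigma>>0. \<forall>\<T>\<in>\<M>. \<forall>K\<in>\<T>.
        (\<exists>c r. cball c r \<subseteq> K \<and> diameter K \<le> \<sigma> * r) \<and> mesh_size \<T> \<le> \<sigma> * diameter K)"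

definition interior_faces :: "(real^'d) set set \<Rightarrow> (real^'d) set set" where
  "interior_faces \<T> = {F. \<exists>K1\<in>\<T>. \<exists>K2\<in>\<T>. K1 \<noteq> K2 \<and> F = K1 \<inter> K2 \<and> F facet_of K1 \<and> F facet_of K2}"

definition boundary_faces :: "(real^'d) set \<Rightarrow> (real^'d) set set \<Rightarrow> (real^'d) set set" where
  "boundary_faces \<Omega> \<T> = {F. F \<subseteq> frontier \<Omega> \<and> (\<exists>K\<in>\<T>. F facet_of K)}"

definition unit_normal :: "(real^'d) set \<Rightarrow> real^'d" where
  "unit_normal F = (SOME n. norm n = 1 \<and> (\<forall>x\<in>F. \<forall>y\<in>F. (x - y) \<bullet> n = 0))"

definition outer_normal :: "(real^'d) set \<Rightarrow> (real^'d) set \<Rightarrow> real^'d" where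
  "outer_normal K F =
     (SOME n. norm n = 1 \<and> (\<forall>x\<in>F. \<forall>y\<in>F. (x - y) \<bullet> n = 0) \<and> (\<forall>x\<in>F. \<forall>y\<in>K. (y - x) \<bullet> n \<le> 0))"

text \<open>Integral over a flat face with respect to its surface measure: by Fubini's theorem this is
  the Lebesgue integral, over the right prism of height one with base \<open>F\<close>, of the extension of
  the integrand that is constant in the normal direction.\<close>

definition prism :: "(real^'d) set \<Rightarrow> (real^'d) set" where
  "prism F = {y + s *\<^sub>R unit_normal F | y s. y \<in> F \<and> 0 \<le> s \<and> s \<le> 1}"

definition foot :: "(real^'d) set \<Rightarrow> real^'d \<Rightarrow> real^'d" where
  "foot F x = x - ((x - (SOME a. a \<in> F)) \<bullet> unit_normal F) *\<^sub>R unit_normal F"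

definition face_integral :: "(real^'d) set \<Rightarrow> (real^'d \<Rightarrow> real) \<Rightarrow> real" where
  "face_integral F f = (LINT x:prism F|lebesgue. f (foot F x))"

definition side_value :: "(real^'d) set \<Rightarrow> (real^'d \<Rightarrow> 'b::t2_space) \<Rightarrow> real^'d \<Rightarrow> 'b" where
  "side_value K f x = Lim (at x within interior K) f"

text \<open>The orientation of the jump is arbitrary; it cancels wherever jumps are used below.\<close>

definition sides :: "(real^'d) set set \<Rightarrow> (real^'d) set \<Rightarrow> (real^'d) set \<times> (real^'d) set" where
  "sides \<T> F = (SOME (K1, K2). K1 \<in> \<T> \<and> K2 \<in> \<T> \<and> K1 \<noteq> K2 \<and> F = K1 \<inter> K2)"

definition jump ::
  "(real^'d) set set \<Rightarrow> (real^'d) set \<Rightarrow> (real^'d \<Rightarrow> 'b::real_normed_vector) \<Rightarrow> real^'d \<Rightarrow> 'b" where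
  "jump \<T> F f x = side_value (fst (sides \<T> F)) f x - side_value (snd (sides \<T> F)) f x"

text \<open>The integrand of a boundary integral may refer to the element \<open>K\<close> adjacent to the face
  (for the trace of a broken gradient) and to the outward normal \<open>n\<close>.\<close>

definition boundary_integral :: "(real^'d) set \<Rightarrow> (real^'d) set set
    \<Rightarrow> ((real^'d) set \<Rightarrow> real^'d \<Rightarrow> real^'d \<Rightarrow> real) \<Rightarrow> real" where
  "boundary_integral \<Omega> \<T> f =
     (\<Sum>F\<in>boundary_faces \<Omega> \<T>.
        let K = (SOME K. K \<in> \<T> \<and> F facet_of K) in face_integral F (f K (outer_normal K F)))"


section \<open>Finite element spaces\<close>

definition poly_degree_le :: "nat \<Rightarrow> (real^'d \<Rightarrow> real) \<Rightarrow> bool" where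
  "poly_degree_le k f \<longleftrightarrow>
     (\<exists>c. \<forall>x. f x = (\<Sum>\<alpha> | (\<Sum>i\<in>UNIV. \<alpha> i) \<le> k. c \<alpha> * (\<Prod>i\<in>UNIV. (x $ i) ^ (\<alpha> i :: nat))))"

text \<open>Discrete functions live on the closure of the domain and are extended by zero. The values of
  a member of \<open>X_space\<close> on the (null) mesh skeleton are irrelevant.\<close>

definition X_space :: "nat \<Rightarrow> (real^'d) set \<Rightarrow> (real^'d) set set \<Rightarrow> (real^'d \<Rightarrow> real) set" where
  "X_space k \<Omega> \<T> = {f.
     (\<forall>K\<in>\<T>. \<exists>g. poly_degree_le k g \<and> (\<forall>x\<in>interior K. f x = g x)) \<and>
     (\<forall>x. x \<notin> closure \<Omega> \<longrightarrow> f x = 0)}"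

definition X_space_vec :: "nat \<Rightarrow> (real^'d) set \<Rightarrow> (real^'d) set set \<Rightarrow> (real^'d \<Rightarrow> real^'d) set" where
  "X_space_vec k \<Omega> \<T> = {v. \<forall>i. (\<lambda>x. v x $ i) \<in> X_space k \<Omega> \<T>}"

definition W_space :: "nat \<Rightarrow> (real^'d) set \<Rightarrow> (real^'d) set set \<Rightarrow> (real^'d \<Rightarrow> real) set" where
  "W_space k \<Omega> \<T> = {f \<in> X_space k \<Omega> \<T>. continuous_on (closure \<Omega>) f}"

definition V_space :: "nat \<Rightarrow> (real^'d) set \<Rightarrow> (real^'d) set set \<Rightarrow> (real^'d \<Rightarrow> real^'d) set" where
  "V_space k \<Omega> \<T> = {v. \<forall>i. (\<lambda>x. v x $ i) \<in> W_space k \<Omega> \<T>}"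

definition Q_space :: "nat \<Rightarrow> (real^'d) set \<Rightarrow> (real^'d) set set \<Rightarrow> (real^'d \<Rightarrow> real) set" where
  "Q_space k \<Omega> \<T> = {q \<in> W_space k \<Omega> \<T>. (LINT x:\<Omega>|lebesgue. q x) = 0}"

definition represent ::
  "'a::euclidean_space set \<Rightarrow> ('a \<Rightarrow> 'b::real_inner) set \<Rightarrow> (('a \<Rightarrow> 'b) \<Rightarrow> real) \<Rightarrow> 'a \<Rightarrow> 'b" where
  "represent \<Omega> V l = (SOME z. z \<in> V \<and> (\<forall>v\<in>V. L2_inner \<Omega> z v = l v))"

definition L2_proj ::
  "'a::euclidean_space set \<Rightarrow> ('a \<Rightarrow> 'b::real_inner) set \<Rightarrow> ('a \<Rightarrow> 'b) \<Rightarrow> 'a \<Rightarrow> 'b" where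
  "L2_proj \<Omega> V f = represent \<Omega> V (\<lambda>v. L2_inner \<Omega> f v)"

definition norm_on :: "('a \<Rightarrow> 'b::real_vector) set \<Rightarrow> (('a \<Rightarrow> 'b) \<Rightarrow> real) \<Rightarrow> bool" where
  "norm_on V N \<longleftrightarrow>
     (\<forall>v\<in>V. 0 \<le> N v \<and> (N v = 0 \<longleftrightarrow> v = (\<lambda>x. 0))) \<and>
     (\<forall>v\<in>V. \<forall>c. N (\<lambda>x. c *\<^sub>R v x) = \<bar>c\<bar> * N v) \<and>
     (\<forall>v\<in>V. \<forall>w\<in>V. N (\<lambda>x. v x + w x) \<le> N v + N w)"

definition bounded_functional ::
  "'a::euclidean_space set \<Rightarrow> ('a \<Rightarrow> 'b::real_inner) set \<Rightarrow> (('a \<Rightarrow> 'b) \<Rightarrow> real) \<Rightarrow> bool" where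
  "bounded_functional \<Omega> V l \<longleftrightarrow>
     (\<forall>v\<in>V. \<forall>w\<in>V. l (\<lambda>x. v x + w x) = l v + l w) \<and>
     (\<forall>v\<in>V. \<forall>c. l (\<lambda>x. c *\<^sub>R v x) = c * l v) \<and>
     (\<exists>B. \<forall>v\<in>V. \<bar>l v\<bar> \<le> B * L2_norm \<Omega> v)"


section \<open>Advection field\<close>

text \<open>A field in the Sobolev space has a representative that is continuous up to the boundary;
  \<open>\<beta>\<close> is taken to be that representative, so that its values at fixed times and on
  faces make sense.\<close>

definition advection_field :: "(real^'d) set \<Rightarrow> real \<Rightarrow> ((real^'d) \<times> real \<Rightarrow> real^'d) \<Rightarrow> bool" where
  "advection_field \<Omega> T \<beta> \<longleftrightarrow>
     (let M = \<Omega> \<times> {0<..<T} in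
       continuous_on (closure \<Omega> \<times> {0..T}) \<beta> \<and> \<beta> \<in> W1inf_space M \<and>
       (AE z in lebesgue_on M. (\<Sum>i\<in>UNIV. weak_derivative M \<beta> (axis i 1, 0) z $ i) = 0) \<and>
       (\<forall>K F x t. int CARD('d) simplex K \<and> K \<subseteq> closure \<Omega> \<and> F facet_of K \<and> F \<subseteq> frontier \<Omega> \<and>
          x \<in> F \<and> t \<in> {0..T} \<longrightarrow> \<beta> (x, t) \<bullet> outer_normal K F = 0) \<and>
       0 < Linf_norm M \<beta>)"


section \<open>Discrete operators and norms\<close>

definition grad :: "(real^'d \<Rightarrow> real) \<Rightarrow> real^'d \<Rightarrow> real^'d" where
  "grad q x = (\<chi> i. frechet_derivative q (at x) (axis i 1))"

definition jac :: "(real^'d \<Rightarrow> real^'d) \<Rightarrow> real^'d \<Rightarrow> real^'d^'d" where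
  "jac v x = matrix (frechet_derivative v (at x))"

definition divergence :: "(real^'d \<Rightarrow> real^'d) \<Rightarrow> real^'d \<Rightarrow> real" where
  "divergence v x = trace (jac v x)"

text \<open>In what follows, \<open>b\<close> is the advection field at a fixed time and \<open>B\<close> is the maximum norm of
  the field in space-time. The inner product on \<open>real^'d^'d\<close> is the Frobenius product.\<close>

definition s_u :: "real \<Rightarrow> real \<Rightarrow> real \<Rightarrow> (real^'d \<Rightarrow> real^'d) \<Rightarrow> (real^'d) set \<Rightarrow> (real^'d) set set
    \<Rightarrow> (real^'d \<Rightarrow> real^'d) \<Rightarrow> (real^'d \<Rightarrow> real^'d) \<Rightarrow> real" where
  "s_u \<gamma>\<^sub>u \<epsilon> B b \<Omega> \<T> w v =
     \<gamma>\<^sub>u * (\<Sum>F\<in>interior_faces \<T>. face_integral F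
        (\<lambda>x. (diameter F)\<^sup>2 * (\<bar>b x \<bullet> unit_normal F\<bar> + B * \<epsilon>)
              * (jump \<T> F (jac w) x \<bullet> jump \<T> F (jac v) x)))
     + boundary_integral \<Omega> \<T> (\<lambda>K n x. (B * (w x \<bullet> n)) * (v x \<bullet> n))"

definition C_op :: "nat \<Rightarrow> real \<Rightarrow> real \<Rightarrow> real \<Rightarrow> (real^'d \<Rightarrow> real^'d) \<Rightarrow> (real^'d) set
    \<Rightarrow> (real^'d) set set \<Rightarrow> (real^'d \<Rightarrow> real^'d) \<Rightarrow> real^'d \<Rightarrow> real^'d" where
  "C_op k \<gamma>\<^sub>u \<epsilon> B b \<Omega> \<T> w = represent \<Omega> (V_space k \<Omega> \<T>)
     (\<lambda>v. (\<Sum>K\<in>\<T>. L2_inner K (\<lambda>x. jac w x *v b x) v) + s_u \<gamma>\<^sub>u \<epsilon> B b \<Omega> \<T> w v)"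

definition A_op :: "nat \<Rightarrow> real \<Rightarrow> real \<Rightarrow> (real^'d) set \<Rightarrow> (real^'d) set set
    \<Rightarrow> (real^'d \<Rightarrow> real^'d) \<Rightarrow> real^'d \<Rightarrow> real^'d" where
  "A_op k \<gamma> \<mu> \<Omega> \<T> w = represent \<Omega> (V_space k \<Omega> \<T>)
     (\<lambda>v. (LINT x:\<Omega>|lebesgue. \<mu> * (jac w x \<bullet> jac v x))
       - boundary_integral \<Omega> \<T> (\<lambda>K n x. (\<mu> *\<^sub>R (side_value K (jac w) x *v n)) \<bullet> v x)
       - boundary_integral \<Omega> \<T> (\<lambda>K n x. (\<mu> *\<^sub>R (side_value K (jac v) x *v n)) \<bullet> w x)
       + \<gamma> * \<mu> / mesh_size \<T> * boundary_integral \<Omega> \<T> (\<lambda>K n x. w x \<bullet> v x))"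

definition G_op :: "nat \<Rightarrow> (real^'d) set \<Rightarrow> (real^'d) set set \<Rightarrow> (real^'d \<Rightarrow> real) \<Rightarrow> real^'d \<Rightarrow> real^'d" where
  "G_op k \<Omega> \<T> q = represent \<Omega> (V_space k \<Omega> \<T>)
     (\<lambda>v. - L2_inner \<Omega> q (divergence v) + boundary_integral \<Omega> \<T> (\<lambda>K n x. q x * (v x \<bullet> n)))"

definition G_adj :: "nat \<Rightarrow> (real^'d) set \<Rightarrow> (real^'d) set set \<Rightarrow> (real^'d \<Rightarrow> real^'d) \<Rightarrow> real^'d \<Rightarrow> real" where
  "G_adj k \<Omega> \<T> w = represent \<Omega> (W_space k \<Omega> \<T>)
     (\<lambda>q. L2_inner \<Omega> q (divergence w) - boundary_integral \<Omega> \<T> (\<lambda>K n x. q x * (w x \<bullet> n)))"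

definition reynolds :: "real \<Rightarrow> real \<Rightarrow> (real^'d) set set \<Rightarrow> real" where
  "reynolds \<mu> B \<T> = mesh_size \<T> * B / \<mu>"

definition courant :: "real \<Rightarrow> real \<Rightarrow> (real^'d) set set \<Rightarrow> real" where
  "courant \<tau> B \<T> = (B + 1) * \<tau> / mesh_size \<T>"

definition s_p :: "real \<Rightarrow> real \<Rightarrow> real \<Rightarrow> (real^'d) set set
    \<Rightarrow> (real^'d \<Rightarrow> real) \<Rightarrow> (real^'d \<Rightarrow> real) \<Rightarrow> real" where
  "s_p \<gamma>\<^sub>p \<mu> B \<T> q r =
     (let \<xi> = min 1 (inverse (reynolds \<mu> B \<T>)) in
       \<gamma>\<^sub>p * \<xi> * mesh_size \<T> ^ 3 / \<mu> *
       (\<Sum>F\<in>interior_faces \<T>. face_integral F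
          (\<lambda>x. jump \<T> F (grad q) x \<bullet> jump \<T> F (grad r) x)))"

definition Sp_op :: "nat \<Rightarrow> real \<Rightarrow> real \<Rightarrow> real \<Rightarrow> (real^'d) set \<Rightarrow> (real^'d) set set
    \<Rightarrow> (real^'d \<Rightarrow> real) \<Rightarrow> real^'d \<Rightarrow> real" where
  "Sp_op k \<gamma>\<^sub>p \<mu> B \<Omega> \<T> q = represent \<Omega> (Q_space k \<Omega> \<T>) (s_p \<gamma>\<^sub>p \<mu> B \<T> q)"

text \<open>\<open>A_norm_sq\<close> and \<open>E_norm_sq\<close> are squared norms.\<close>

definition A_norm_sq :: "nat \<Rightarrow> real \<Rightarrow> real \<Rightarrow> (real^'d) set \<Rightarrow> (real^'d) set set
    \<Rightarrow> (real^'d \<Rightarrow> real^'d) \<Rightarrow> real" where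
  "A_norm_sq k \<gamma> \<mu> \<Omega> \<T> v = L2_inner \<Omega> (A_op k \<gamma> \<mu> \<Omega> \<T> v) v"

definition E_norm_sq :: "nat \<Rightarrow> real \<Rightarrow> real \<Rightarrow> real \<Rightarrow> real \<Rightarrow> real \<Rightarrow> (real^'d \<Rightarrow> real^'d)
    \<Rightarrow> (real^'d) set \<Rightarrow> (real^'d) set set \<Rightarrow> (real^'d \<Rightarrow> real^'d) \<Rightarrow> real" where
  "E_norm_sq k \<gamma>\<^sub>u \<epsilon> \<gamma> \<mu> B b \<Omega> \<T> v = s_u \<gamma>\<^sub>u \<epsilon> B b \<Omega> \<T> v v + A_norm_sq k \<gamma> \<mu> \<Omega> \<T> v"

definition dual_norm :: "nat \<Rightarrow> real \<Rightarrow> real \<Rightarrow> real \<Rightarrow> real \<Rightarrow> real \<Rightarrow> (real^'d \<Rightarrow> real^'d)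
    \<Rightarrow> (real^'d) set \<Rightarrow> (real^'d) set set \<Rightarrow> ((real^'d \<Rightarrow> real^'d) \<Rightarrow> real) \<Rightarrow> real" where
  "dual_norm k \<gamma>\<^sub>u \<epsilon> \<gamma> \<mu> B b \<Omega> \<T> l =
     (SUP v\<in>V_space k \<Omega> \<T>. l v / sqrt (E_norm_sq k \<gamma>\<^sub>u \<epsilon> \<gamma> \<mu> B b \<Omega> \<T> v + (L2_norm \<Omega> v)\<^sup>2))"

text \<open>The Nitsche parameter \<open>\<gamma>\<close> is a fixed number that works for all meshes of the family, all
  viscosities and all advection fields.\<close>

definition sufficiently_large :: "nat \<Rightarrow> real \<Rightarrow> real \<Rightarrow> (real^'d) set \<Rightarrow> (real^'d) set set set
    \<Rightarrow> real \<Rightarrow> bool" where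
  "sufficiently_large k \<gamma>\<^sub>u \<epsilon> \<Omega> \<M> \<gamma> \<longleftrightarrow>
     (\<forall>T \<beta> \<mu>. \<forall>\<T>\<in>\<M>. \<forall>t\<in>{0..T}. 0 < T \<and> advection_field \<Omega> T \<beta> \<and> 0 < \<mu> \<longrightarrow>
        norm_on (V_space k \<Omega> \<T>) (\<lambda>v. sqrt (E_norm_sq k \<gamma>\<^sub>u \<epsilon> \<gamma> \<mu>
          (Linf_norm (\<Omega> \<times> {0<..<T}) \<beta>) (\<lambda>x. \<beta> (x, t)) \<Omega> \<T> v)))"


section \<open>Extrapolated Crank--Nicolson scheme\<close>

text \<open>The argument of these sequence operations is the upper index in the usual notation;
  \<open>extrapolated u (n + 1)\<close> involves \<open>u n\<close> and \<open>u (n - 1)\<close>.\<close>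

definition delta :: "(nat \<Rightarrow> 'a \<Rightarrow> 'b::real_vector) \<Rightarrow> nat \<Rightarrow> 'a \<Rightarrow> 'b" where
  "delta u n = (\<lambda>x. u n x - u (n - 1) x)"

definition extrapolated :: "(nat \<Rightarrow> 'a \<Rightarrow> 'b::real_vector) \<Rightarrow> nat \<Rightarrow> 'a \<Rightarrow> 'b" where
  "extrapolated u n = (\<lambda>x. (3/2) *\<^sub>R u (n - 1) x - (1/2) *\<^sub>R u (n - 2) x)"

definition averaged :: "(nat \<Rightarrow> 'a \<Rightarrow> 'b::real_vector) \<Rightarrow> nat \<Rightarrow> 'a \<Rightarrow> 'b" where
  "averaged u n = (\<lambda>x. (1/2) *\<^sub>R (u n x + u (n - 1) x))"

definition at_half :: "((real^'d) \<times> real \<Rightarrow> real^'d) \<Rightarrow> real \<Rightarrow> nat \<Rightarrow> real^'d \<Rightarrow> real^'d" where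
  "at_half \<beta> \<tau> n = (\<lambda>x. \<beta> (x, (real n + 1/2) * \<tau>))"

definition CN_solution :: "nat \<Rightarrow> real \<Rightarrow> real \<Rightarrow> real \<Rightarrow> real \<Rightarrow> real \<Rightarrow> real
    \<Rightarrow> ((real^'d) \<times> real \<Rightarrow> real^'d) \<Rightarrow> (real^'d) set \<Rightarrow> (real^'d) set set \<Rightarrow> real \<Rightarrow> nat
    \<Rightarrow> (real^'d \<Rightarrow> real^'d) \<Rightarrow> (real^'d \<Rightarrow> real^'d)
    \<Rightarrow> (nat \<Rightarrow> (real^'d \<Rightarrow> real^'d) \<Rightarrow> real) \<Rightarrow> (nat \<Rightarrow> (real^'d \<Rightarrow> real) \<Rightarrow> real)
    \<Rightarrow> (nat \<Rightarrow> real^'d \<Rightarrow> real^'d) \<Rightarrow> (nat \<Rightarrow> real^'d \<Rightarrow> real) \<Rightarrow> bool" where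
  "CN_solution k \<gamma>\<^sub>u \<gamma>\<^sub>p \<epsilon> \<gamma> \<mu> B \<beta> \<Omega> \<T> \<tau> N u0 u1 L L' u p \<longleftrightarrow>
     u 0 = L2_proj \<Omega> (V_space k \<Omega> \<T>) u0 \<and>
     u 1 = L2_proj \<Omega> (V_space k \<Omega> \<T>) u1 \<and>
     (\<forall>n. 1 \<le> n \<and> n < N \<longrightarrow>
        u (n + 1) \<in> V_space k \<Omega> \<T> \<and> p (n + 1) \<in> Q_space k \<Omega> \<T> \<and>
        (\<forall>v\<in>V_space k \<Omega> \<T>.
           inverse \<tau> * L2_inner \<Omega> (delta u (n + 1)) v
           + L2_inner \<Omega> (G_op k \<Omega> \<T> (p (n + 1))) v
           + L2_inner \<Omega> (C_op k \<gamma>\<^sub>u \<epsilon> B (at_half \<beta> \<tau> n) \<Omega> \<T> (extrapolated u (n + 1))) v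
           + L2_inner \<Omega> (A_op k \<gamma> \<mu> \<Omega> \<T> (averaged u (n + 1))) v
           = L (n + 1) v) \<and>
        (\<forall>q\<in>Q_space k \<Omega> \<T>.
           L2_inner \<Omega> (G_adj k \<Omega> \<T> (u (n + 1))) q
           + L2_inner \<Omega> (Sp_op k \<gamma>\<^sub>p \<mu> B \<Omega> \<T> (p (n + 1))) q
           = L' (n + 1) q))"

end

theory Submission
  imports Defs
begin

text \<open>
  Let \<open>y\<close> be the increment of the velocity and \<open>Y = y - \<pi>\<^sub>0 y\<close>. Since \<open>Y\<close> is orthogonal to the piecewise
  constants, \<open>\<parallel>Y\<parallel>\<^sup>2 = (Y, y) = (v, y)\<close>, where \<open>v\<close> is the projection of \<open>Y\<close> onto the velocity space. So
  \<open>v\<close> is an admissible test function, and the scheme expresses \<open>\<parallel>Y\<parallel>\<^sup>2\<close> as \<open>\<tau>\<close> times the difference of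
  the load and the pressure, convection and diffusion terms at \<open>v\<close>. It is enough to bound the square
  of each of them by \<open>\<parallel>Y\<parallel>\<^sup>2\<close> times one of the quantities on the right (\<open>one_step\<close>).

  Load and diffusion are bounded by Cauchy--Schwarz and the inverse inequality
  \<open>\<parallel>v\<parallel>\<^sub>E\<^sup>2 \<le> C (B / h) \<parallel>v\<parallel>\<^sup>2\<close> with \<open>B\<close> the maximum of the field, which uses \<open>\<mu> / h \<le> B\<close>, that is
  \<open>Re \<ge> 1\<close> (\<open>nitsche_bound\<close>, \<open>s_u_bound\<close>); a factor \<open>\<tau> B / h\<close> is at most \<open>Co\<close>.

  For pressure and convection such a bound would lose the power of \<open>h\<close> that matters. Here the lowest
  order of the elements enters. If \<open>z\<close> is piecewise constant and \<open>w\<close> is continuous and piecewise affine,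
  then \<open>(Y, z) = 0\<close> and \<open>(v - Y, w) = 0\<close>, so \<open>(z, v) = (z - w, v - Y)\<close>: a piecewise constant function is
  felt only through its distance to the continuous space (\<open>orthogonality_estimate\<close>). The distance is
  bounded by jumps over the interior faces (\<open>oswald\<close>), because the elements around a node are connected
  through faces that contain the node (\<open>star_connected\<close>) and their number is bounded (\<open>card_star\<close>). The
  pressure gradient is piecewise constant and its jumps are those of \<open>s\<^sub>p\<close>. The convection term becomes
  piecewise constant once the field is frozen at one point of each element; its jumps are those of
  \<open>s\<^sub>u\<close>, while the change of the field within an element is of order \<open>h\<close>, a factor that the inverse
  inequality for the gradient uses up (\<open>convection_estimate\<close>). This produces the term with the Lipschitz
  constant of the field. The extrapolated velocity is the averaged one minus half of the second
  difference, which accounts for the last term.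

  Three classical facts are proved along the way in the form in which they occur: integration by parts
  over a simplex with the face integrals defined by prisms (\<open>simplex_divergence\<close>), the combinatorial
  topology of a mesh of a polygonal domain (\<open>facet_cases\<close>, \<open>star_connected\<close>), and the Lipschitz continuity
  of a continuous function with bounded weak derivatives (\<open>lipschitz_on_segment\<close>).
\<close>

section \<open>Semi-inner products on spaces of functions\<close>

text \<open>Positive semidefinite symmetric forms on a space of functions. Definiteness is left out so that one
  Cauchy--Schwarz inequality serves the \<open>L2\<close> inner product, where functions are not identified up to
  null sets, as well as the stabilization and diffusion forms.\<close>

locale psd_form =
  fixes V :: "('a \<Rightarrow> 'b::real_vector) set" and ip :: "('a \<Rightarrow> 'b) \<Rightarrow> ('a \<Rightarrow> 'b) \<Rightarrow> real"
  assumes add_closed: "\<And>f g. f \<in> V \<Longrightarrow> g \<in> V \<Longrightarrow> (\<lambda>x. f x + g x) \<in> V"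
    and scale_closed: "\<And>f c. f \<in> V \<Longrightarrow> (\<lambda>x. c *\<^sub>R f x) \<in> V"
    and sym: "\<And>f g. f \<in> V \<Longrightarrow> g \<in> V \<Longrightarrow> ip f g = ip g f"
    and add_left: "\<And>f g h. f \<in> V \<Longrightarrow> g \<in> V \<Longrightarrow> h \<in> V \<Longrightarrow> ip (\<lambda>x. f x + g x) h = ip f h + ip g h"
    and scale_left: "\<And>f h c. f \<in> V \<Longrightarrow> h \<in> V \<Longrightarrow> ip (\<lambda>x. c *\<^sub>R f x) h = c * ip f h"
    and nonneg: "\<And>f. f \<in> V \<Longrightarrow> 0 \<le> ip f f"
begin

lemma add_right: "f \<in> V \<Longrightarrow> g \<in> V \<Longrightarrow> h \<in> V \<Longrightarrow> ip h (\<lambda>x. f x + g x) = ip h f + ip h g"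
  by (simp add: sym[of h] add_closed add_left)

lemma scale_right: "f \<in> V \<Longrightarrow> h \<in> V \<Longrightarrow> ip h (\<lambda>x. c *\<^sub>R f x) = c * ip h f"
  by (simp add: sym[of h] scale_closed scale_left)

lemma diff_closed: "f \<in> V \<Longrightarrow> g \<in> V \<Longrightarrow> (\<lambda>x. f x - g x) \<in> V"
  using add_closed[of f "\<lambda>x. (-1) *\<^sub>R g x"] scale_closed[of g "-1"] by simp

lemma diff_left: "f \<in> V \<Longrightarrow> g \<in> V \<Longrightarrow> h \<in> V \<Longrightarrow> ip (\<lambda>x. f x - g x) h = ip f h - ip g h"
  using add_left[of f "\<lambda>x. (-1) *\<^sub>R g x" h] scale_closed[of g "-1"] scale_left[of g h "-1"] by simp

lemma diff_right: "f \<in> V \<Longrightarrow> g \<in> V \<Longrightarrow> h \<in> V \<Longrightarrow> ip h (\<lambda>x. f x - g x) = ip h f - ip h g"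
  by (simp add: sym[of h] diff_closed diff_left)

lemma expand: "f \<in> V \<Longrightarrow> g \<in> V \<Longrightarrow>
    ip (\<lambda>x. f x + t *\<^sub>R g x) (\<lambda>x. f x + t *\<^sub>R g x) = ip f f + 2 * t * ip f g + t\<^sup>2 * ip g g"
  by (simp add: add_left add_right scale_closed add_closed scale_left scale_right sym[of g f]
      power2_eq_square algebra_simps)

lemma cauchy_schwarz:
  assumes "f \<in> V" "g \<in> V"
  shows "(ip f g)\<^sup>2 \<le> ip f f * ip g g"
proof -
  have q: "0 \<le> ip f f + 2 * t * ip f g + t\<^sup>2 * ip g g" for t
    using nonneg[OF add_closed[OF assms(1) scale_closed[OF assms(2), of t]]] expand[OF assms, of t]
    by simp
  show ?thesis
  proof (cases "ip g g = 0")
    case True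
    have "ip f g = 0"
    proof (rule ccontr)
      assume "ip f g \<noteq> 0"
      then show False using q[of "- (ip f f + 1) / (2 * ip f g)"] True by (simp add: field_simps)
    qed
    then show ?thesis by (simp add: True)
  next
    case False
    then have p: "ip g g > 0" using nonneg[OF assms(2)] by simp
    have "ip f f - (ip f g)\<^sup>2 / ip g g \<ge> 0"
      using q[of "- ip f g / ip g g"] p by (simp add: field_simps power2_eq_square)
    then show ?thesis using p by (simp add: field_simps)
  qed
qed

text \<open>Parallelogram law: the form at \<open>f - t g\<close> is dropped.\<close>

lemma sum_sq_le:
  assumes "f \<in> V" "g \<in> V"
  shows "ip (\<lambda>x. f x + t *\<^sub>R g x) (\<lambda>x. f x + t *\<^sub>R g x) \<le> 2 * ip f f + 2 * t\<^sup>2 * ip g g"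
  using nonneg[OF add_closed[OF assms(1) scale_closed[OF assms(2), of "-t"]]]
    expand[OF assms, of t] expand[OF assms, of "-t"] by (simp add: algebra_simps)

end

text \<open>Finite dimension enters through finitely many linear functionals that separate the points of
  the space, which for finite elements are the nodal values; the induction splits off one functional
  at a time and orthogonalises the one new direction, so that no basis is needed.\<close>

lemma riesz_finite:
  fixes ip :: "('a \<Rightarrow> 'b::real_vector) \<Rightarrow> ('a \<Rightarrow> 'b) \<Rightarrow> real" and E :: "(('a \<Rightarrow> 'b) \<Rightarrow> real) set"
  assumes "finite E" and "psd_form V ip"
    and "\<And>f. f \<in> V \<Longrightarrow> ip f f = 0 \<Longrightarrow> f = (\<lambda>x. 0)"
    and "\<And>e f g. e \<in> E \<Longrightarrow> f \<in> V \<Longrightarrow> g \<in> V \<Longrightarrow> e (\<lambda>x. f x + g x) = e f + e g"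
    and "\<And>e f c. e \<in> E \<Longrightarrow> f \<in> V \<Longrightarrow> e (\<lambda>x. c *\<^sub>R f x) = c * e f"
    and "\<And>f. f \<in> V \<Longrightarrow> (\<forall>e\<in>E. e f = 0) \<Longrightarrow> f = (\<lambda>x. 0)"
    and "(\<lambda>x. 0) \<in> V"
    and "\<And>f g. f \<in> V \<Longrightarrow> g \<in> V \<Longrightarrow> l (\<lambda>x. f x + g x) = l f + l g"
    and "\<And>f c. f \<in> V \<Longrightarrow> l (\<lambda>x. c *\<^sub>R f x) = c * l f"
  shows "\<exists>z\<in>V. \<forall>v\<in>V. ip z v = l v"
  using assms
proof (induction E arbitrary: V l rule: finite_induct)
  case empty
  interpret psd_form V ip by fact
  have V0: "f = (\<lambda>x. 0)" if "f \<in> V" for f using empty.prems(5)[OF that] by simp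
  have z: "ip (\<lambda>x. 0) (\<lambda>x. 0) = 0" "l (\<lambda>x. 0) = 0"
    using scale_left[of "\<lambda>x. 0" "\<lambda>x. 0" 0] empty.prems(6) empty.prems(8)[of "\<lambda>x. 0" 0] by simp_all
  show ?case
  proof (rule bexI[of _ "\<lambda>x. 0"])
    show "\<forall>v\<in>V. ip (\<lambda>x. 0) v = l v" using V0 z by metis
  qed (fact empty.prems(6))
next
  case (insert e E)
  interpret psd_form V ip by fact
  define V0 where "V0 = {v \<in> V. e v = 0}"
  have e_add: "e (\<lambda>x. f x + g x) = e f + e g" if "f \<in> V" "g \<in> V" for f g
    using insert.prems(3)[of e f g] that by simp
  have e_scale: "e (\<lambda>x. c *\<^sub>R f x) = c * e f" if "f \<in> V" for f c
    using insert.prems(4)[of e f c] that by simp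
  have e_zero: "e (\<lambda>x. 0) = 0" using e_scale[OF insert.prems(6), of 0] by simp
  have psd0: "psd_form V0 ip"
    by unfold_locales
      (auto simp: V0_def e_add e_scale add_closed scale_closed add_left scale_left nonneg intro: sym)
  have sub0: "f \<in> V0 \<Longrightarrow> f \<in> V" for f by (simp add: V0_def)
  have riesz0: "\<exists>z\<in>V0. \<forall>v\<in>V0. ip z v = m v"
    if m: "\<And>f g. f \<in> V0 \<Longrightarrow> g \<in> V0 \<Longrightarrow> m (\<lambda>x. f x + g x) = m f + m g"
      "\<And>f c. f \<in> V0 \<Longrightarrow> m (\<lambda>x. c *\<^sub>R f x) = c * m f" for m
  proof (rule insert.IH[OF psd0])
    show "f = (\<lambda>x. 0)" if "f \<in> V0" "\<forall>e\<in>E. e f = 0" for f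
      using insert.prems(5)[of f] that by (simp add: V0_def)
    show "(\<lambda>x. 0) \<in> V0" using e_zero insert.prems(6) by (simp add: V0_def)
  qed (use insert.prems(2) insert.prems(3) insert.prems(4) m sub0 in auto)
  show ?case
  proof (cases "\<forall>v\<in>V. e v = 0")
    case True
    then have "V0 = V" by (auto simp: V0_def)
    then show ?thesis using riesz0[of l] insert.prems(7,8) by simp
  next
    case False
    then obtain b0 where b0: "b0 \<in> V" "e b0 \<noteq> 0" by blast
    define b where "b = (\<lambda>x. (1 / e b0) *\<^sub>R b0 x)"
    have b: "b \<in> V" "e b = 1" using b0 by (simp_all add: b_def scale_closed e_scale)
    obtain b' where b': "b' \<in> V0" "\<forall>v\<in>V0. ip b' v = ip b v"
      using riesz0[of "ip b"] add_right scale_right sub0 b(1) by blast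
    define q where "q = (\<lambda>x. b x - b' x)"
    have q: "q \<in> V" unfolding q_def by (intro diff_closed b sub0 b')
    have "e q = e b + e (\<lambda>x. (-1) *\<^sub>R b' x)"
      unfolding q_def using e_add[OF b(1) scale_closed[OF sub0[OF b'(1)], of "-1"]] by simp
    then have eq: "e q = 1" using b' b(2) e_scale[OF sub0[OF b'(1)], of "-1"] by (simp add: V0_def)
    have orth: "ip q v = 0" if "v \<in> V0" for v
      unfolding q_def using that b' sub0 b by (simp add: diff_left)
    have "q \<noteq> (\<lambda>x. 0)" using eq e_zero by auto
    then have qq: "ip q q \<noteq> 0" using insert.prems(2)[OF q] by blast
    obtain z' where z': "z' \<in> V0" "\<forall>v\<in>V0. ip z' v = l v"
      using riesz0[of l] insert.prems(7,8) sub0 by blast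
    define z where "z = (\<lambda>x. z' x + (l q / ip q q) *\<^sub>R q x)"
    have "z \<in> V" unfolding z_def by (intro add_closed scale_closed q sub0 z')
    moreover have "ip z v = l v" if v: "v \<in> V" for v
    proof -
      define w where "w = (\<lambda>x. v x + (- e v) *\<^sub>R q x)"
      have w: "w \<in> V" unfolding w_def by (intro add_closed scale_closed q v)
      have w0: "w \<in> V0" using w eq e_add[OF v scale_closed[OF q, of "- e v"]]
        by (simp add: V0_def w_def e_scale[OF q] del: scaleR_minus_left)
      have v_eq: "v = (\<lambda>x. w x + e v *\<^sub>R q x)" by (simp add: w_def)
      have qw: "ip q w = 0" using orth w0 by blast
      have zq: "ip z' q = 0" using orth[OF z'(1)] sym[OF q sub0[OF z'(1)]] by simp
      have "ip z (\<lambda>x. w x + e v *\<^sub>R q x) = l w + e v * l q"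
        unfolding z_def using qw zq qq z' w0
        by (simp add: add_left add_right scale_left scale_right add_closed scale_closed q w sub0)
      also have "\<dots> = l (\<lambda>x. w x + e v *\<^sub>R q x)"
        using insert.prems(7)[OF w scale_closed[OF q]] insert.prems(8)[OF q] by simp
      finally show ?thesis by (simp add: v_eq[symmetric])
    qed
    ultimately show ?thesis by blast
  qed
qed

section \<open>Square integrable functions\<close>

lemma L2_inner_eq:
  assumes "X \<in> sets lebesgue"
  shows "L2_inner X f g = (\<integral>x. f x \<bullet> g x \<partial>lebesgue_on X)"
  unfolding L2_inner_def set_lebesgue_integral_def using assms by (simp add: integral_restrict_space)

lemma L2_space_iff:
  assumes "X \<in> sets lebesgue"
  shows "f \<in> L2_space X \<longleftrightarrow>
    f \<in> borel_measurable (lebesgue_on X) \<and> integrable (lebesgue_on X) (\<lambda>x. (norm (f x))\<^sup>2)"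
  unfolding L2_space_def set_integrable_def using assms by (simp add: integrable_restrict_space)

lemma L2_inner_integrable:
  fixes f g :: "'a::euclidean_space \<Rightarrow> 'b::euclidean_space"
  assumes "X \<in> sets lebesgue" "f \<in> L2_space X" "g \<in> L2_space X"
  shows "integrable (lebesgue_on X) (\<lambda>x. f x \<bullet> g x)"
proof (rule Bochner_Integration.integrable_bound)
  show "integrable (lebesgue_on X) (\<lambda>x. (norm (f x))\<^sup>2 + (norm (g x))\<^sup>2)"
    using assms by (simp add: L2_space_iff)
  show "(\<lambda>x. f x \<bullet> g x) \<in> borel_measurable (lebesgue_on X)"
    using assms by (intro borel_measurable_inner) (simp_all add: L2_space_iff)
  have "\<bar>f x \<bullet> g x\<bar> \<le> (norm (f x))\<^sup>2 + (norm (g x))\<^sup>2" for x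
  proof -
    have "\<bar>f x \<bullet> g x\<bar> \<le> norm (f x) * norm (g x)" by (rule Cauchy_Schwarz_ineq2)
    also have "\<dots> \<le> (norm (f x))\<^sup>2 + (norm (g x))\<^sup>2"
      using zero_le_power2[of "norm (f x) - norm (g x)"] zero_le_power2[of "norm (f x)"]
        zero_le_power2[of "norm (g x)"] unfolding power2_diff by linarith
    finally show ?thesis .
  qed
  then show "AE x in lebesgue_on X. norm (f x \<bullet> g x) \<le> norm ((norm (f x))\<^sup>2 + (norm (g x))\<^sup>2)"
    by simp
qed

lemma psd_form_L2:
  fixes X :: "'a::euclidean_space set"
  assumes X: "X \<in> sets lebesgue"
  shows "psd_form (L2_space X :: ('a \<Rightarrow> 'b::euclidean_space) set) (L2_inner X)"
proof
  fix f g h :: "'a \<Rightarrow> 'b" and c :: real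
  assume f: "f \<in> L2_space X"
  show "(\<lambda>x. c *\<^sub>R f x) \<in> L2_space X"
    using f X by (auto simp: L2_space_iff power_mult_distrib intro!: borel_measurable_scaleR)
  show "0 \<le> L2_inner X f f" unfolding L2_inner_eq[OF X] by simp
  assume g: "g \<in> L2_space X"
  show "L2_inner X f g = L2_inner X g f" by (simp add: L2_inner_def inner_commute)
  show "L2_inner X (\<lambda>x. c *\<^sub>R f x) g = c * L2_inner X f g"
    unfolding L2_inner_eq[OF X] by simp
  have "integrable (lebesgue_on X) (\<lambda>x. (norm (f x))\<^sup>2 + 2 * (f x \<bullet> g x) + (norm (g x))\<^sup>2)"
    using f g X L2_inner_integrable[OF X f g] by (simp add: L2_space_iff)
  then show "(\<lambda>x. f x + g x) \<in> L2_space X"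
    using f g X by (auto simp: L2_space_iff power2_norm_eq_inner inner_add_left inner_add_right
        inner_commute algebra_simps intro!: borel_measurable_add)
  assume h: "h \<in> L2_space X"
  show "L2_inner X (\<lambda>x. f x + g x) h = L2_inner X f h + L2_inner X g h"
    unfolding L2_inner_eq[OF X] inner_add_left
    by (rule Bochner_Integration.integral_add) (intro L2_inner_integrable X f g h)+
qed

lemma L2_norm_sq:
  assumes "X \<in> sets lebesgue"
  shows "(L2_norm X f)\<^sup>2 = L2_inner X f f"
  unfolding L2_norm_def L2_inner_eq[OF assms] by simp

lemma L2_norm_nonneg: "X \<in> sets lebesgue \<Longrightarrow> 0 \<le> L2_norm X f"
  unfolding L2_norm_def L2_inner_eq by simp

section \<open>Integrals over flat faces\<close>

text \<open>After an orthogonal transformation \<open>N\<close> is a coordinate axis; then the matrix differs from the identity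
  in one column, and Cramer's rule gives its determinant.\<close>

lemma det_rank_one_update:
  fixes N u :: "real^'n"
  assumes "norm N = 1"
  shows "det (matrix (\<lambda>x. x + (x \<bullet> N) *\<^sub>R u)) = 1 + u \<bullet> N"
proof -
  obtain k :: 'n where True by simp
  obtain T :: "real^'n \<Rightarrow> real^'n" where T: "orthogonal_transformation T" "T N = axis k 1"
    by (rule orthogonal_transformation_exists_1[OF assms norm_axis_1[of k]]) blast
  have linT: "linear T" using T by (simp add: orthogonal_transformation_def)
  define f where "f = (\<lambda>x. x + (x \<bullet> N) *\<^sub>R u)"
  define g where "g = (\<lambda>x. x + (x $ k) *\<^sub>R T u)"
  have linf: "linear f" unfolding f_def
    by (auto intro!: linearI simp: inner_add_left algebra_simps)
  have ling: "linear g" unfolding g_def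
    by (auto intro!: linearI simp: algebra_simps)
  have ip: "T x \<bullet> T y = x \<bullet> y" for x y
    using T by (simp add: orthogonal_transformation_def)
  have comp: "T \<circ> f = g \<circ> T"
  proof
    fix x
    have "T x $ k = x \<bullet> N"
      using ip[of x N] T(2) by (simp add: inner_axis)
    then show "(T \<circ> f) x = (g \<circ> T) x"
      using linT by (simp add: f_def g_def linear_add linear_scale)
  qed
  have "det (matrix T) * det (matrix f) = det (matrix g) * det (matrix T)"
    using arg_cong[OF comp, of "\<lambda>h. det (matrix h)"] matrix_compose[OF linf linT]
      matrix_compose[OF linT ling] by (simp add: det_mul)
  moreover have "det (matrix T) \<noteq> 0"
    using orthogonal_transformation_inj[OF T(1)] det_nz_iff_inj[OF linT] by blast
  ultimately have "det (matrix f) = det (matrix g)" by simp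
  also have "matrix g = (\<chi> i j. if j = k then (mat 1 *v (axis k 1 + T u)) $ i else mat 1 $ i $ j)"
    unfolding matrix_vector_mul_lid by (simp add: matrix_def g_def vec_eq_iff axis_def mat_def)
  also have "det \<dots> = (axis k 1 + T u) $ k * det (mat 1 :: real^'n^'n)"
    by (rule cramer_lemma)
  also have "\<dots> = 1 + u \<bullet> N"
    using ip[of u N] T(2) by (simp add: inner_axis)
  finally show ?thesis by (simp add: f_def)
qed

lemma Basis_vec_real: "(Basis :: (real^'n) set) = range (\<lambda>i. axis i 1)"
  by (auto simp: Basis_vec_def)

lemma prod_Basis_vec: "(\<Prod>b\<in>(Basis :: (real^'n) set). f b) = (\<Prod>i\<in>UNIV. f (axis i 1))"
  unfolding Basis_vec_real by (subst prod.reindex) (auto simp: inj_def axis_eq_axis)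

text \<open>Renaming coordinates preserves Lebesgue measure; this moves statements between index types of the
  same cardinality.\<close>

lemma lborel_reindex:
  fixes \<pi> :: "'n::finite \<Rightarrow> 'd::finite"
  assumes \<pi>: "bij \<pi>"
  shows "distr lborel borel (\<lambda>x::real^'d. (\<chi> j. x $ \<pi> j) :: real^'n) = lborel"
proof (rule lborel_eqI[symmetric])
  define T where "T = (\<lambda>x::real^'d. (\<chi> j. x $ \<pi> j) :: real^'n)"
  define T' where "T' = (\<lambda>y::real^'n. (\<chi> i. y $ inv \<pi> i) :: real^'d)"
  have "continuous_on UNIV T" unfolding T_def by (intro continuous_intros)
  then have [measurable]: "T \<in> borel \<rightarrow>\<^sub>M borel" by (rule borel_measurable_continuous_onI)
  fix l u :: "real^'n"
  assume lu: "\<And>b. b \<in> Basis \<Longrightarrow> l \<bullet> b \<le> u \<bullet> b"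
  then have lu': "l $ i \<le> u $ i" for i
    using lu[of "axis i 1"] by (simp add: inner_axis axis_in_Basis_iff)
  have pre: "T -` box l u = box (T' l) (T' u)"
  proof (intro set_eqI iffI)
    fix x assume "x \<in> T -` box l u"
    then show "x \<in> box (T' l) (T' u)"
      unfolding mem_box_cart T_def T'_def vimage_eq
      using \<pi> by (simp add: mem_box_cart) (metis bij_inv_eq_iff)
  next
    fix x assume "x \<in> box (T' l) (T' u)"
    then show "x \<in> T -` box l u"
      unfolding mem_box_cart T_def T'_def vimage_eq
      using \<pi> by (simp add: mem_box_cart) (metis bij_inv_eq_iff)
  qed
  have "emeasure (distr lborel borel T) (box l u) = emeasure lborel (box (T' l) (T' u))"
    by (simp add: emeasure_distr pre)
  also have "\<dots> = (\<Prod>b\<in>Basis. (T' u - T' l) \<bullet> b)"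
    by (subst emeasure_lborel_box) (auto simp: Basis_vec_real T'_def inner_axis lu')
  also have "(\<Prod>b\<in>Basis. (T' u - T' l) \<bullet> b) = (\<Prod>i\<in>UNIV. (u - l) $ inv \<pi> i)"
    by (simp add: prod_Basis_vec T'_def inner_axis)
  also have "\<dots> = (\<Prod>j\<in>UNIV. (u - l) $ j)"
    using prod.reindex_bij_betw[OF bij_imp_bij_inv[OF \<pi>], of "\<lambda>j. (u - l) $ j"] by simp
  also have "\<dots> = (\<Prod>b\<in>Basis. (u - l) \<bullet> b)"
    by (simp add: prod_Basis_vec inner_axis)
  finally show "emeasure (distr lborel borel (\<lambda>x::real^'d. (\<chi> j. x $ \<pi> j) :: real^'n)) (box l u)
      = (\<Prod>b\<in>Basis. (u - l) \<bullet> b)"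
    by (simp add: T_def)
qed simp

lemma linear_rank_one_update: "linear (\<lambda>x. x + (x \<bullet> N) *\<^sub>R u)"
  by (auto intro!: linearI simp: inner_add_left algebra_simps)

text \<open>The tilt fixes the hyperplane orthogonal to \<open>N\<close> and carries \<open>N\<close> to \<open>e\<close>. It is a rank one
  update of the identity, hence so is its inverse.\<close>

lemma tilt_bij:
  fixes N e :: "real^'n"
  assumes "norm N = 1" "e \<bullet> N \<noteq> 0"
  shows "(\<lambda>x. x + (x \<bullet> N) *\<^sub>R (e - N)) -` A = (\<lambda>y. y + (y \<bullet> N) *\<^sub>R ((1 / (e \<bullet> N)) *\<^sub>R (N - e))) ` A"
proof -
  have NN: "N \<bullet> N = 1" using assms(1) by (simp add: norm_eq_1)
  show ?thesis
  proof (intro set_eqI iffI)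
    fix x assume "x \<in> (\<lambda>x. x + (x \<bullet> N) *\<^sub>R (e - N)) -` A"
    moreover have "(x + (x \<bullet> N) *\<^sub>R (e - N)) \<bullet> N = (x \<bullet> N) * (e \<bullet> N)"
      by (simp add: inner_simps NN) (simp add: algebra_simps)
    then have "x = (x + (x \<bullet> N) *\<^sub>R (e - N)) +
       ((x + (x \<bullet> N) *\<^sub>R (e - N)) \<bullet> N) *\<^sub>R ((1 / (e \<bullet> N)) *\<^sub>R (N - e))"
      by (simp only:) (use assms(2) in \<open>simp add: scaleR_right_diff_distrib\<close>)
    ultimately show "x \<in> (\<lambda>y. y + (y \<bullet> N) *\<^sub>R ((1 / (e \<bullet> N)) *\<^sub>R (N - e))) ` A" by blast
  next
    fix x assume "x \<in> (\<lambda>y. y + (y \<bullet> N) *\<^sub>R ((1 / (e \<bullet> N)) *\<^sub>R (N - e))) ` A"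
    then obtain y where y: "y \<in> A" "x = y + (y \<bullet> N) *\<^sub>R ((1 / (e \<bullet> N)) *\<^sub>R (N - e))" by blast
    have "x \<bullet> N = (y \<bullet> N) / (e \<bullet> N)" using assms(2) by (simp add: y(2) inner_simps NN) (simp add: field_simps)
    then have "x + (x \<bullet> N) *\<^sub>R (e - N) = y"
      by (simp only:) (simp add: y(2) scaleR_right_diff_distrib)
    then show "x \<in> (\<lambda>x. x + (x \<bullet> N) *\<^sub>R (e - N)) -` A" using y(1) by simp
  qed
qed

text \<open>A linear map scales volumes by the modulus of its determinant, which for the inverse of the tilt is
  \<open>1 / (e \<bullet> N)\<close>.\<close>

lemma lborel_tilt_wellorder:
  fixes N e :: "real^'n::{finite,wellorder}"
  assumes "norm N = 1" "e \<bullet> N \<noteq> 0"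
  shows "lborel = density (distr lborel borel (\<lambda>x. x + (x \<bullet> N) *\<^sub>R (e - N))) (\<lambda>_. ennreal \<bar>e \<bullet> N\<bar>)"
proof (rule lborel_eqI)
  have NN: "N \<bullet> N = 1" using assms(1) by (simp add: norm_eq_1)
  define L where "L = (\<lambda>x. x + (x \<bullet> N) *\<^sub>R (e - N))"
  define M where "M = (\<lambda>y. y + (y \<bullet> N) *\<^sub>R ((1 / (e \<bullet> N)) *\<^sub>R (N - e)))"
  have linM: "linear M" unfolding M_def by (rule linear_rank_one_update)
  have "continuous_on UNIV L" unfolding L_def by (intro continuous_intros)
  then have [measurable]: "L \<in> borel \<rightarrow>\<^sub>M borel" by (rule borel_measurable_continuous_onI)
  have detM: "det (matrix M) = 1 / (e \<bullet> N)"
    unfolding M_def det_rank_one_update[OF assms(1)] using assms(2)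
    by (simp add: inner_simps NN) (simp add: field_simps)
  fix l u :: "real^'n::{finite,wellorder}" assume lu: "\<And>b. b \<in> Basis \<Longrightarrow> l \<bullet> b \<le> u \<bullet> b"
  have box: "box l u \<in> lmeasurable" by simp
  have "measure lebesgue (M ` box l u) = \<bar>1 / (e \<bullet> N)\<bar> * measure lebesgue (box l u)"
    using measure_linear_image[OF linM box] by (simp add: detM)
  moreover have meas: "M ` box l u \<in> lmeasurable" by (rule measurable_linear_image[OF linM box])
  moreover have pre: "L -` box l u = M ` box l u"
    unfolding L_def M_def by (rule tilt_bij[OF assms])
  moreover have "emeasure lborel (L -` box l u) = emeasure lebesgue (L -` box l u)"
    using measurable_sets[of L borel borel "box l u"] by simp
  ultimately have em: "emeasure lborel (L -` box l u) = ennreal (\<bar>1 / (e \<bullet> N)\<bar> * measure lebesgue (box l u))"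
    using emeasure_eq_measure2[OF meas] by (simp only:)
  have "emeasure (density (distr lborel borel L) (\<lambda>_. ennreal \<bar>e \<bullet> N\<bar>)) (box l u)
      = ennreal \<bar>e \<bullet> N\<bar> * emeasure lborel (L -` box l u)"
    by (simp add: emeasure_density emeasure_distr nn_integral_cmult)
  also have "\<dots> = ennreal (\<bar>e \<bullet> N\<bar> * (\<bar>1 / (e \<bullet> N)\<bar> * measure lebesgue (box l u)))"
    unfolding em by (rule ennreal_mult[symmetric]) simp_all
  also have "\<dots> = ennreal (measure lebesgue (box l u))"
    using assms(2) by (simp add: abs_mult[symmetric] mult.assoc[symmetric])
  also have "\<dots> = emeasure lborel (box l u)"
    using emeasure_eq_measure2[OF box] by simp
  also have "\<dots> = (\<Prod>b\<in>Basis. (u - l) \<bullet> b)"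
    using lu by (simp add: emeasure_lborel_box)
  finally show "emeasure (density (distr lborel borel (\<lambda>x. x + (x \<bullet> N) *\<^sub>R (e - N)))
      (\<lambda>_. ennreal \<bar>e \<bullet> N\<bar>)) (box l u) = (\<Prod>b\<in>Basis. (u - l) \<bullet> b)"
    by (simp add: L_def)
qed simp

text \<open>The permutation of coordinates is an isometry that conjugates tilts to tilts.\<close>

lemma lborel_tilt_transfer:
  fixes \<pi> :: "'n::{finite,wellorder} \<Rightarrow> 'd::finite" and N e :: "real^'d"
  assumes \<pi>: "bij \<pi>" and N: "norm N = 1" "e \<bullet> N \<noteq> 0"
  shows "lborel = density (distr lborel borel (\<lambda>x. x + (x \<bullet> N) *\<^sub>R (e - N))) (\<lambda>_. ennreal \<bar>e \<bullet> N\<bar>)"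
proof -
  define T where "T = (\<lambda>x::real^'d. (\<chi> j. x $ \<pi> j) :: real^'n::_)"
  define T' where "T' = (\<lambda>y::real^'n::_. (\<chi> i. y $ inv \<pi> i) :: real^'d)"
  have TT': "T (T' y) = y" "T' (T x) = x" for x y
    using \<pi> by (simp_all add: T_def T'_def vec_eq_iff bij_is_inj bij_is_surj surj_f_inv_f)
  have dT': "distr lborel borel T' = lborel"
    unfolding T'_def by (rule lborel_reindex[OF bij_imp_bij_inv[OF \<pi>]])
  have ip: "T x \<bullet> T y = x \<bullet> y" for x y
    unfolding inner_vec_def T_def using sum.reindex_bij_betw[OF \<pi>, of "\<lambda>i. x $ i * y $ i"] by simp
  have N': "norm (T N) = 1" "T e \<bullet> T N \<noteq> 0" using N by (simp_all add: norm_eq_sqrt_inner ip)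
  define L where "L = (\<lambda>x. x + (x \<bullet> N) *\<^sub>R (e - N))"
  define L' where "L' = (\<lambda>x. x + (x \<bullet> T N) *\<^sub>R (T e - T N))"
  have [measurable]: "L \<in> borel \<rightarrow>\<^sub>M borel" "L' \<in> borel \<rightarrow>\<^sub>M borel" "T' \<in> borel \<rightarrow>\<^sub>M borel"
    unfolding L_def L'_def T'_def by (intro borel_measurable_continuous_onI continuous_intros)+
  have comm: "L (T' y) = T' (L' y)" for y
  proof -
    have "y \<bullet> T N = T' y \<bullet> N" using ip[of "T' y" N] by (simp add: TT')
    moreover have "T' (a + c *\<^sub>R (T b - T d)) = T' a + c *\<^sub>R (b - d)" for a b c d
      using TT'(2)[of b] TT'(2)[of d] by (simp add: T'_def T_def vec_eq_iff)
    ultimately show ?thesis by (simp add: L_def L'_def)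
  qed
  have "lborel = distr lborel borel T'" by (rule dT'[symmetric])
  also have "\<dots> = distr (density (distr lborel borel L') (\<lambda>_. ennreal \<bar>e \<bullet> N\<bar>)) borel T'"
    using lborel_tilt_wellorder[OF N'] by (simp add: L'_def ip)
  also have "\<dots> = density (distr lborel borel (\<lambda>y. L (T' y))) (\<lambda>_. ennreal \<bar>e \<bullet> N\<bar>)"
    by (subst density_distr[symmetric]) (simp_all add: distr_distr comp_def comm)
  also have "distr lborel borel (\<lambda>y. L (T' y)) = distr lborel borel L"
    using dT' distr_distr[of L borel borel T' lborel] by (simp add: comp_def)
  finally show ?thesis by (simp add: L_def)
qed

text \<open>An index type with two or three elements is in bijection with the numeral type \<open>2\<close> or \<open>3\<close>, which is
  well-ordered.\<close>

lemma lborel_tilt: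
  fixes N e :: "real^'d"
  assumes d: "CARD('d) = 2 \<or> CARD('d) = 3" and N: "norm N = 1" "e \<bullet> N \<noteq> 0"
  shows "lborel = density (distr lborel borel (\<lambda>x. x + (x \<bullet> N) *\<^sub>R (e - N))) (\<lambda>_. ennreal \<bar>e \<bullet> N\<bar>)"
  using d
proof
  assume "CARD('d) = 2"
  then obtain \<pi> :: "2 \<Rightarrow> 'd" where "bij \<pi>"
    using finite_same_card_bij[of "UNIV :: 2 set" "UNIV :: 'd set"] by auto
  then show ?thesis by (rule lborel_tilt_transfer[OF _ N])
next
  assume "CARD('d) = 3"
  then obtain \<pi> :: "3 \<Rightarrow> 'd" where "bij \<pi>"
    using finite_same_card_bij[of "UNIV :: 3 set" "UNIV :: 'd set"] by auto
  then show ?thesis by (rule lborel_tilt_transfer[OF _ N])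
qed

lemma lborel_integral_tilt:
  fixes N e a :: "real^'d" and h :: "real^'d \<Rightarrow> real"
  assumes d: "CARD('d) = 2 \<or> CARD('d) = 3" and N: "norm N = 1" "e \<bullet> N \<noteq> 0"
    and [measurable]: "h \<in> borel_measurable borel"
  shows "(\<integral>x. h x \<partial>lborel) = \<bar>e \<bullet> N\<bar> * (\<integral>x. h (x + ((x - a) \<bullet> N) *\<^sub>R (e - N)) \<partial>lborel)"
proof -
  have [measurable]: "(\<lambda>x. x + ((x - c) \<bullet> N) *\<^sub>R (e - N)) \<in> borel \<rightarrow>\<^sub>M borel" for c
    by (intro borel_measurable_continuous_onI continuous_intros)
  note this[of 0, simplified, measurable]
  have tr: "(\<integral>x. g x \<partial>lborel) = (\<integral>x. g (t + x) \<partial>lborel)"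
    if [measurable]: "g \<in> borel_measurable borel" for g :: "real^'d \<Rightarrow> real" and t
    by (subst lborel_affine[of 1 t]) (simp_all add: integral_density integral_distr density_1)
  have "(\<integral>x. h x \<partial>lborel) = (\<integral>x. h (a + x) \<partial>lborel)" by (rule tr) simp
  also have "\<dots> = \<bar>e \<bullet> N\<bar> * (\<integral>x. h (a + (x + (x \<bullet> N) *\<^sub>R (e - N))) \<partial>lborel)"
    by (subst lborel_tilt[OF d N]) (simp add: integral_density integral_distr)
  also have "(\<integral>x. h (a + (x + (x \<bullet> N) *\<^sub>R (e - N))) \<partial>lborel)
      = (\<integral>x. h (x + ((x - a) \<bullet> N) *\<^sub>R (e - N)) \<partial>lborel)"
    by (subst (2) tr[of _ a]) (simp_all add: add.assoc)
  finally show ?thesis .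
qed

text \<open>The oblique prism over \<open>F\<close> with edge \<open>e\<close>, and below it the projection along \<open>e\<close> onto the plane of
  the face, which for \<open>e\<close> the unit normal are \<open>prism\<close> and \<open>foot\<close>.\<close>

definition slab :: "(real^'d) set \<Rightarrow> real^'d \<Rightarrow> (real^'d) set" where
  "slab F e = {y + s *\<^sub>R e | y s. y \<in> F \<and> 0 \<le> s \<and> s \<le> 1}"

definition slab_foot :: "(real^'d) set \<Rightarrow> real^'d \<Rightarrow> real^'d \<Rightarrow> real^'d" where
  "slab_foot F e x = x - (((x - (SOME a. a \<in> F)) \<bullet> unit_normal F) / (e \<bullet> unit_normal F)) *\<^sub>R e"

definition flat :: "(real^'d) set \<Rightarrow> bool" where
  "flat F \<longleftrightarrow> compact F \<and> F \<noteq> {} \<and> norm (unit_normal F) = 1 \<and>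
     (\<forall>x\<in>F. \<forall>y\<in>F. (x - y) \<bullet> unit_normal F = 0)"

lemma compact_slab: "compact F \<Longrightarrow> compact (slab F e)"
proof -
  assume F: "compact F"
  have "slab F e = (\<lambda>(y, s). y + s *\<^sub>R e) ` (F \<times> {0..1})"
    unfolding slab_def by (fastforce simp: image_iff)
  moreover have "compact ((\<lambda>(y, s). y + s *\<^sub>R e) ` (F \<times> {0..1::real}))"
    by (intro compact_continuous_image compact_Times F compact_Icc)
      (auto intro!: continuous_intros simp: split_beta)
  ultimately show ?thesis by simp
qed

lemma slab_foot_slab:
  assumes "flat F" "e \<bullet> unit_normal F \<noteq> 0" "y \<in> F"
  shows "slab_foot F e (y + s *\<^sub>R e) = y"
proof -
  have "(y - (SOME a. a \<in> F)) \<bullet> unit_normal F = 0"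
    using assms(1,3) someI[of "\<lambda>a. a \<in> F" y] by (auto simp: flat_def)
  then have "(y + s *\<^sub>R e - (SOME a. a \<in> F)) \<bullet> unit_normal F = s * (e \<bullet> unit_normal F)"
    by (simp add: inner_simps)
  then show ?thesis using assms(2) by (simp add: slab_foot_def)
qed

lemma prism_slab: "prism F = slab F (unit_normal F)"
  by (simp add: prism_def slab_def)

lemma foot_slab_foot: "flat F \<Longrightarrow> foot F = slab_foot F (unit_normal F)"
  by (auto simp: foot_def slab_foot_def flat_def norm_eq_1)

lemma foot_in: "flat F \<Longrightarrow> x \<in> prism F \<Longrightarrow> foot F x \<in> F"
proof -
  assume F: "flat F" and "x \<in> prism F"
  then obtain y s where "y \<in> F" "x = y + s *\<^sub>R unit_normal F" by (auto simp: prism_def)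
  moreover have "unit_normal F \<bullet> unit_normal F \<noteq> 0" using F by (simp add: flat_def norm_eq_1)
  ultimately show ?thesis using slab_foot_slab[OF F, of "unit_normal F" y s]
    by (simp add: foot_slab_foot[OF F])
qed

lemma slab_integrand_borel:
  assumes F: "flat F" and e: "e \<bullet> unit_normal F \<noteq> 0" and f: "continuous_on F f"
  shows "(\<lambda>x. indicator (slab F e) x * f (slab_foot F e x) :: real) \<in> borel_measurable borel"
    and "set_integrable lebesgue (slab F e) (\<lambda>x. f (slab_foot F e x))"
proof -
  have c: "compact (slab F e)" using F by (simp add: flat_def compact_slab)
  have "continuous_on (slab F e) (slab_foot F e)"
    unfolding slab_foot_def using e by (intro continuous_intros) auto
  moreover have "slab_foot F e ` slab F e \<subseteq> F"
    using slab_foot_slab[OF F e] by (auto simp: slab_def)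
  ultimately have cont: "continuous_on (slab F e) (\<lambda>x. f (slab_foot F e x))"
    by (rule continuous_on_compose2[OF f])
  then show "(\<lambda>x. indicator (slab F e) x * f (slab_foot F e x) :: real) \<in> borel_measurable borel"
    using borel_measurable_continuous_on_indicator[of "slab F e" "\<lambda>x. f (slab_foot F e x)"]
      borel_closed[OF compact_imp_closed[OF c]] by simp
  have "integrable lborel (\<lambda>x. indicator (slab F e) x *\<^sub>R f (slab_foot F e x))"
    by (rule borel_integrable_compact[OF c cont])
  then show "set_integrable lebesgue (slab F e) (\<lambda>x. f (slab_foot F e x))"
    unfolding set_integrable_def
    using integrable_completion[OF borel_measurable_integrable] by blast
qed

text \<open>Cavalieri's principle: sliding the layers of the prism over a face into an oblique one changes
  its volume only through its height.\<close>

lemma slab_integral: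
  fixes F :: "(real^'d) set" and f :: "real^'d \<Rightarrow> real"
  assumes d: "CARD('d) = 2 \<or> CARD('d) = 3"
    and F: "flat F" and e: "e \<bullet> unit_normal F \<noteq> 0" and f: "continuous_on F f"
  shows "(LINT x:slab F e|lebesgue. f (slab_foot F e x)) = \<bar>e \<bullet> unit_normal F\<bar> * face_integral F f"
proof -
  define N where "N = unit_normal F"
  define a where "a = (SOME a. a \<in> F)"
  have N: "norm N = 1" "N \<bullet> N = 1" using F by (simp_all add: flat_def N_def norm_eq_1)
  have a: "a \<in> F" unfolding a_def using F by (auto simp: flat_def intro: someI)
  have ya: "(y - a) \<bullet> N = 0" if "y \<in> F" for y using F that a by (simp add: flat_def N_def)
  define h where "h = (\<lambda>x. indicator (slab F e) x * f (slab_foot F e x))"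
  have [measurable]: "h \<in> borel_measurable borel"
    unfolding h_def by (rule slab_integrand_borel[OF F e f])
  have NN: "N \<bullet> unit_normal F \<noteq> 0" using N by (simp add: N_def)
  note nborel = slab_integrand_borel(1)[OF F NN f]
  have key: "h (x + ((x - a) \<bullet> N) *\<^sub>R (e - N)) = indicator (slab F N) x * f (slab_foot F N x)" for x
  proof (cases "x \<in> slab F N")
    case True
    then obtain y s where y: "y \<in> F" "x = y + s *\<^sub>R N" "0 \<le> s" "s \<le> 1" by (auto simp: slab_def)
    have "(x - a) \<bullet> N = s" using ya[OF y(1)] N by (simp add: y(2) inner_simps)
    then have eq: "x + ((x - a) \<bullet> N) *\<^sub>R (e - N) = y + s *\<^sub>R e"
      by (simp only:) (simp add: y(2) scaleR_right_diff_distrib)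
    moreover have "y + s *\<^sub>R e \<in> slab F e" using y by (auto simp: slab_def)
    ultimately show ?thesis
      using True slab_foot_slab[OF F e y(1)] slab_foot_slab[OF F NN y(1)] unfolding h_def eq by (simp add: y(2) N_def)
  next
    case False
    have "x + ((x - a) \<bullet> N) *\<^sub>R (e - N) \<notin> slab F e"
    proof
      assume "x + ((x - a) \<bullet> N) *\<^sub>R (e - N) \<in> slab F e"
      then obtain y s where y: "y \<in> F" "x + ((x - a) \<bullet> N) *\<^sub>R (e - N) = y + s *\<^sub>R e" "0 \<le> s" "s \<le> 1"
        by (auto simp: slab_def)
      have "(x - a) \<bullet> N * (e \<bullet> N) = s * (e \<bullet> N)"
        using arg_cong[OF y(2), of "\<lambda>z. (z - a) \<bullet> N"] ya[OF y(1)] N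
        by (simp add: inner_simps algebra_simps)
      then have "(x - a) \<bullet> N = s" using e by (simp add: N_def)
      then have "x = y + s *\<^sub>R N" using y(2) by (simp add: algebra_simps)
      then show False using False y by (auto simp: slab_def)
    qed
    then show ?thesis using False by (simp add: h_def)
  qed
  have "(LINT x:slab F e|lebesgue. f (slab_foot F e x)) = (\<integral>x. h x \<partial>lborel)"
    unfolding set_lebesgue_integral_def h_def[symmetric] real_scaleR_def
    by (rule integral_completion) simp
  also have "\<dots> = \<bar>e \<bullet> N\<bar> * (\<integral>x. h (x + ((x - a) \<bullet> N) *\<^sub>R (e - N)) \<partial>lborel)"
    by (rule lborel_integral_tilt[OF d]) (use N e N_def in auto)
  also have "(\<integral>x. h (x + ((x - a) \<bullet> N) *\<^sub>R (e - N)) \<partial>lborel)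
      = (\<integral>x. indicator (slab F N) x * f (slab_foot F N x) \<partial>lborel)"
    by (simp add: key)
  also have "\<dots> = (\<integral>x. indicator (slab F N) x * f (slab_foot F N x) \<partial>lebesgue)"
    by (rule integral_completion[symmetric]) (use nborel in simp)
  also have "\<dots> = face_integral F f"
    by (simp add: face_integral_def prism_slab foot_slab_foot[OF F] set_lebesgue_integral_def N_def)
  finally show ?thesis by (simp add: N_def)
qed

lemma face_integrable:
  assumes "flat F" "continuous_on F f"
  shows "set_integrable lebesgue (prism F) (\<lambda>x. f (foot F x) :: real)"
proof -
  have "unit_normal F \<bullet> unit_normal F \<noteq> 0" using assms(1) by (simp add: flat_def norm_eq_1)
  from slab_integrand_borel(2)[OF assms(1) this assms(2)] show ?thesis
    by (simp add: prism_slab foot_slab_foot[OF assms(1)])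
qed

lemma face_integral_cong:
  assumes "flat F" "\<And>x. x \<in> F \<Longrightarrow> f x = g x"
  shows "face_integral F f = face_integral F g"
  unfolding face_integral_def set_lebesgue_integral_def
  by (rule Bochner_Integration.integral_cong)
    (auto simp: assms(2) foot_in[OF assms(1)] split: split_indicator)

lemma face_integral_add:
  assumes "flat F" "continuous_on F f" "continuous_on F g"
  shows "face_integral F (\<lambda>x. f x + g x) = face_integral F f + face_integral F g"
  unfolding face_integral_def
  using set_integral_add(2)[OF face_integrable[OF assms(1,2)] face_integrable[OF assms(1,3)]] by simp

lemma face_integral_cmult: "face_integral F (\<lambda>x. c * f x) = c * face_integral F f"
  unfolding face_integral_def by simp

lemma face_integral_mono:
  assumes "flat F" "continuous_on F f" "continuous_on F g" "\<And>x. x \<in> F \<Longrightarrow> f x \<le> g x"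
  shows "face_integral F f \<le> face_integral F g"
  unfolding face_integral_def
  by (rule set_integral_mono[OF face_integrable[OF assms(1,2)] face_integrable[OF assms(1,3)]])
    (simp add: assms(4) foot_in[OF assms(1)])

lemma face_integral_sum:
  assumes "flat F" "finite I" "\<And>i. i \<in> I \<Longrightarrow> continuous_on F (f i)"
  shows "face_integral F (\<lambda>x. \<Sum>i\<in>I. f i x) = (\<Sum>i\<in>I. face_integral F (f i))"
  using assms(2,3)
proof (induction I rule: finite_induct)
  case empty
  then show ?case by (simp add: face_integral_def)
next
  case (insert i I)
  then show ?case by (simp add: face_integral_add[OF assms(1)] continuous_on_sum)
qed

definition area :: "(real^'d) set \<Rightarrow> real" where
  "area F = face_integral F (\<lambda>x. 1)"

lemma area_nonneg: "0 \<le> area F"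
  by (simp add: area_def face_integral_def set_lebesgue_integral_def)

lemma face_integral_const: "face_integral F (\<lambda>x. c) = c * area F"
  using face_integral_cmult[of F c "\<lambda>x. 1"] by (simp add: area_def)

lemma face_integral_abs_le:
  assumes "flat F" "continuous_on F f" "\<And>x. x \<in> F \<Longrightarrow> \<bar>f x\<bar> \<le> c"
  shows "\<bar>face_integral F f\<bar> \<le> c * area F"
proof -
  have "face_integral F f \<le> face_integral F (\<lambda>x. c)" "face_integral F (\<lambda>x. - c) \<le> face_integral F f"
    by (rule face_integral_mono[OF assms(1)]; use assms in \<open>fastforce simp: abs_le_iff\<close>)+
  then show ?thesis by (simp add: face_integral_const)
qed

text \<open>Volumes of oblique prisms over a face measure its area; both area estimates for shape regular
  simplices come from comparing such a prism with a simplex or a ball.\<close>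

lemma area_slab:
  fixes F :: "(real^'d) set"
  assumes "CARD('d) = 2 \<or> CARD('d) = 3" "flat F" "e \<bullet> unit_normal F \<noteq> 0"
  shows "measure lebesgue (slab F e) = \<bar>e \<bullet> unit_normal F\<bar> * area F"
  using slab_integral[OF assms, of "\<lambda>x. 1"] assms(2)
  by (simp add: area_def set_lebesgue_integral_def lmeasurable_compact compact_slab flat_def)

section \<open>Barycentric coordinates on a simplex\<close>

abbreviation full_simplex :: "(real^'d) set \<Rightarrow> bool" where
  "full_simplex K \<equiv> int CARD('d) simplex K"

definition verts :: "(real^'d) set \<Rightarrow> (real^'d) set" where
  "verts K = {x. x extreme_point_of K}"

lemma verts_props:
  fixes K :: "(real^'d) set"
  assumes "full_simplex K"
  shows "finite (verts K)" "card (verts K) = CARD('d) + 1" "\<not> affine_dependent (verts K)"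
    "K = convex hull (verts K)" "affine hull (verts K) = UNIV"
proof -
  obtain C where C: "\<not> affine_dependent C" "int (card C) = int CARD('d) + 1" "K = convex hull C"
    using assms unfolding simplex_def by blast
  have "verts K = C" unfolding verts_def C(3) using extreme_point_of_convex_hull_affine_independent[OF C(1)] by auto
  moreover have "finite C" by (rule aff_independent_finite[OF C(1)])
  moreover have "affine hull C = UNIV" by (rule affine_independent_span_eq[OF C(1)]) (use C(2) in auto)
  ultimately show "finite (verts K)" "card (verts K) = CARD('d) + 1" "\<not> affine_dependent (verts K)"
    "K = convex hull (verts K)" "affine hull (verts K) = UNIV" using C by auto
qed

lemma full_simplex_compact: "full_simplex K \<Longrightarrow> compact K"
  using verts_props(1,4)[of K] finite_imp_compact_convex_hull by metis

lemma full_simplex_convex: "full_simplex K \<Longrightarrow> convex K"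
  using verts_props(4)[of K] by (metis convex_convex_hull)

lemma verts_subset: "verts K \<subseteq> K"
  by (auto simp: verts_def extreme_point_of_def)

text \<open>Gradient and constant term of the affine function that is 1 at the vertex \<open>a\<close> and 0 at the others.
  Being defined on the whole space, it describes the simplex by inequalities and its facets by
  equations.\<close>

definition bcoef :: "(real^'d) set \<Rightarrow> real^'d \<Rightarrow> (real^'d) \<times> real" where
  "bcoef K a = (SOME gc. \<forall>b\<in>verts K. fst gc \<bullet> b + snd gc = (if b = a then 1 else 0))"

definition bgrad :: "(real^'d) set \<Rightarrow> real^'d \<Rightarrow> real^'d" where
  "bgrad K a = fst (bcoef K a)"

definition bary :: "(real^'d) set \<Rightarrow> real^'d \<Rightarrow> real^'d \<Rightarrow> real" where
  "bary K a x = bgrad K a \<bullet> x + snd (bcoef K a)"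

lemma other_vertex:
  fixes K :: "(real^'d) set"
  assumes "full_simplex K"
  obtains w where "w \<in> verts K" "w \<noteq> a"
proof -
  have "\<not> verts K \<subseteq> {a}"
    using verts_props(2)[OF assms] card_mono[of "{a}" "verts K"] by auto
  then show ?thesis using that by blast
qed

text \<open>Affine independence makes the interpolation conditions solvable.\<close>

lemma bary_vertex:
  fixes K :: "(real^'d) set"
  assumes K: "full_simplex K" and ab: "a \<in> verts K" "b \<in> verts K"
  shows "bary K a b = (if b = a then 1 else 0)"
proof -
  obtain w where w: "w \<in> verts K" "w \<noteq> a" using other_vertex[OF K] by metis
  have "independent ((\<lambda>x. - w + x) ` (verts K - {w}))"
    using verts_props(3)[OF K] affine_dependent_iff_dependent2[OF w(1)] by blast
  then obtain g where g: "linear g"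
      "\<forall>x\<in>(\<lambda>x. - w + x) ` (verts K - {w}). g x = (if x = - w + a then 1 else (0::real))"
    using linear_independent_extend[of "(\<lambda>x. - w + x) ` (verts K - {w})" "\<lambda>x. if x = - w + a then 1 else (0::real)"]
    by blast
  have rep: "adjoint g 1 \<bullet> x = g x" for x
    using adjoint_works[OF g(1), of x 1] by (simp add: inner_commute)
  have "adjoint g 1 \<bullet> b + - g w = (if b = a then 1 else 0)" if "b \<in> verts K" for b
  proof (cases "b = w")
    case True
    then show ?thesis using w by (simp add: rep)
  next
    case False
    then have "g (- w + b) = (if b = a then 1 else 0)" using g(2) that by auto
    then show ?thesis using linear_add[OF g(1), of "-w" b] linear_neg[OF g(1), of w] by (simp add: rep)
  qed
  then have "\<exists>gc. \<forall>b\<in>verts K. fst gc \<bullet> b + snd gc = (if b = a then 1 else 0)"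
    by (intro exI[of _ "(adjoint g 1, - g w)"]) simp
  from someI_ex[OF this] show ?thesis
    unfolding bary_def bgrad_def bcoef_def using ab(2) by blast
qed

lemma bary_comb:
  fixes K :: "(real^'d) set"
  assumes K: "full_simplex K" and a: "a \<in> verts K" and u: "sum u (verts K) = 1"
  shows "bary K a (\<Sum>v\<in>verts K. u v *\<^sub>R v) = u a"
proof -
  have "bary K a (\<Sum>v\<in>verts K. u v *\<^sub>R v) = (\<Sum>v\<in>verts K. u v * bary K a v)"
    using u by (simp add: bary_def inner_sum_right distrib_left sum.distrib sum_distrib_right[symmetric])
  also have "\<dots> = (\<Sum>v\<in>verts K. if v = a then u v else 0)"
    by (rule sum.cong) (simp_all add: bary_vertex[OF K a])
  finally show ?thesis using verts_props(1)[OF K] a by simp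
qed

lemma bary_sum:
  fixes K :: "(real^'d) set"
  assumes K: "full_simplex K"
  shows "(\<Sum>a\<in>verts K. bary K a x) = 1" "(\<Sum>a\<in>verts K. bary K a x *\<^sub>R a) = x"
proof -
  have "x \<in> affine hull (verts K)" using verts_props(5)[OF K] by simp
  then obtain u where u: "sum u (verts K) = 1" "(\<Sum>v\<in>verts K. u v *\<^sub>R v) = x"
    unfolding affine_hull_finite[OF verts_props(1)[OF K]] by blast
  have "bary K a x = u a" if "a \<in> verts K" for a using bary_comb[OF K that u(1)] u(2) by simp
  then show "(\<Sum>a\<in>verts K. bary K a x) = 1" "(\<Sum>a\<in>verts K. bary K a x *\<^sub>R a) = x" using u by simp_all
qed

lemma bary_diff: "bary K a x - bary K a y = bgrad K a \<bullet> (x - y)"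
  by (simp add: bary_def inner_diff_right)

lemma bary_add: "bary K a (x + e) = bary K a x + bgrad K a \<bullet> e"
  by (simp add: bary_def inner_add_right)

lemma continuous_on_bary [continuous_intros]:
  "continuous_on S f \<Longrightarrow> continuous_on S (\<lambda>x. bary K a (f x))"
  unfolding bary_def by (intro continuous_intros)

text \<open>Differentiated forms of the two partition of unity identities.\<close>

lemma bgrad_sum:
  fixes K :: "(real^'d) set"
  assumes K: "full_simplex K"
  shows "(\<Sum>a\<in>verts K. bgrad K a \<bullet> e) = 0" "(\<Sum>a\<in>verts K. (bgrad K a \<bullet> e) *\<^sub>R (a - w)) = e"
proof -
  show s0: "(\<Sum>a\<in>verts K. bgrad K a \<bullet> e) = 0"
    using bary_sum(1)[OF K, of "0 + e"] bary_sum(1)[OF K, of 0] unfolding bary_add sum.distrib by simp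
  have "(\<Sum>a\<in>verts K. (bgrad K a \<bullet> e) *\<^sub>R a) = e"
    using bary_sum(2)[OF K, of "0 + e"] bary_sum(2)[OF K, of 0]
    unfolding bary_add scaleR_add_left sum.distrib by simp
  then show "(\<Sum>a\<in>verts K. (bgrad K a \<bullet> e) *\<^sub>R (a - w)) = e"
    using s0 by (simp add: scaleR_diff_right sum_subtractf scaleR_sum_left[symmetric])
qed

lemma mem_simplex_iff:
  fixes K :: "(real^'d) set"
  assumes K: "full_simplex K"
  shows "x \<in> K \<longleftrightarrow> (\<forall>a\<in>verts K. 0 \<le> bary K a x)"
proof
  assume "x \<in> K"
  then have "x \<in> convex hull (verts K)" using verts_props(4)[OF K] by simp
  then obtain u where u: "\<forall>v\<in>verts K. 0 \<le> u v" "sum u (verts K) = 1" "(\<Sum>v\<in>verts K. u v *\<^sub>R v) = x"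
    unfolding convex_hull_finite[OF verts_props(1)[OF K]] by blast
  then show "\<forall>a\<in>verts K. 0 \<le> bary K a x" using bary_comb[OF K] by metis
next
  assume "\<forall>a\<in>verts K. 0 \<le> bary K a x"
  then have "x \<in> convex hull (verts K)"
    unfolding convex_hull_finite[OF verts_props(1)[OF K]] using bary_sum[OF K, of x]
    by (intro CollectI exI[of _ "\<lambda>a. bary K a x"]) simp
  then show "x \<in> K" using verts_props(4)[OF K] by simp
qed

lemma bgrad_nonzero:
  fixes K :: "(real^'d) set"
  assumes K: "full_simplex K" and a: "a \<in> verts K"
  shows "bgrad K a \<noteq> 0"
proof
  assume g0: "bgrad K a = 0"
  obtain w where w: "w \<in> verts K" "w \<noteq> a" using other_vertex[OF K] by metis
  show False using bary_vertex[OF K a a] bary_vertex[OF K a w(1)] w(2) by (simp add: bary_def g0)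
qed

lemma interior_simplex_bary:
  fixes K :: "(real^'d) set"
  assumes K: "full_simplex K"
  shows "interior K = {x. \<forall>a\<in>verts K. 0 < bary K a x}"
proof
  have "open {x. \<forall>a\<in>verts K. 0 < bary K a x}"
  proof -
    have "{x. \<forall>a\<in>verts K. 0 < bary K a x} = (\<Inter>a\<in>verts K. {x. 0 < bary K a x})" by auto
    moreover have "open {x. 0 < bary K a x}" for a
      by (intro open_Collect_less continuous_intros)
    ultimately show ?thesis using verts_props(1)[OF K] by auto
  qed
  then show "{x. \<forall>a\<in>verts K. 0 < bary K a x} \<subseteq> interior K"
    by (intro interior_maximal) (auto simp: mem_simplex_iff[OF K] less_imp_le)
  show "interior K \<subseteq> {x. \<forall>a\<in>verts K. 0 < bary K a x}"
  proof safe
    fix x a assume x: "x \<in> interior K" and a: "a \<in> verts K"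
    obtain e where e: "e > 0" "cball x e \<subseteq> K" using x unfolding mem_interior_cball by blast
    define y where "y = x - (e / norm (bgrad K a)) *\<^sub>R bgrad K a"
    have g: "norm (bgrad K a) > 0" using bgrad_nonzero[OF K a] by simp
    have "dist x y \<le> e" using e g by (simp add: y_def dist_norm)
    then have "y \<in> K" using e by auto
    then have "0 \<le> bary K a y" using mem_simplex_iff[OF K] a by blast
    also have "bary K a y = bary K a x - e * norm (bgrad K a)"
      using bary_diff[of K a y x] g by (simp add: y_def power2_norm_eq_inner[symmetric] power2_eq_square)
    finally show "0 < bary K a x" using e g mult_pos_pos[of e "norm (bgrad K a)"] by linarith
  qed
qed

lemma interior_simplex_nonempty:
  fixes K :: "(real^'d) set"
  assumes K: "full_simplex K"
  shows "interior K \<noteq> {}"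
proof -
  let ?n = "real CARD('d) + 1"
  have "sum (\<lambda>v. 1 / ?n) (verts K) = 1" using verts_props(2)[OF K] by simp
  then have "bary K a (\<Sum>v\<in>verts K. (1 / ?n) *\<^sub>R v) = 1 / ?n" if "a \<in> verts K" for a
    using bary_comb[OF K that, of "\<lambda>v. 1 / ?n"] by blast
  then have "(\<Sum>v\<in>verts K. (1 / ?n) *\<^sub>R v) \<in> interior K"
    unfolding interior_simplex_bary[OF K] by (simp add: add_nonneg_pos)
  then show ?thesis by blast
qed

lemma closure_interior_simplex:
  fixes K :: "(real^'d) set"
  assumes K: "full_simplex K"
  shows "closure (interior K) = K"
  using convex_closure_interior[OF full_simplex_convex[OF K] interior_simplex_nonempty[OF K]]
    full_simplex_compact[OF K] by (simp add: compact_imp_closed)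

text \<open>The facet opposite to the vertex \<open>a\<close>.\<close>

definition bface :: "(real^'d) set \<Rightarrow> real^'d \<Rightarrow> (real^'d) set" where
  "bface K a = {x \<in> K. bary K a x = 0}"

lemma bface_hull:
  fixes K :: "(real^'d) set"
  assumes K: "full_simplex K" and a: "a \<in> verts K"
  shows "bface K a = convex hull (verts K - {a})"
proof
  have fin: "finite (verts K - {a})" using verts_props(1)[OF K] by simp
  show "bface K a \<subseteq> convex hull (verts K - {a})"
  proof
    fix x assume x: "x \<in> bface K a"
    have "sum (\<lambda>b. bary K b x) (verts K - {a}) = 1" "(\<Sum>b\<in>verts K - {a}. bary K b x *\<^sub>R b) = x"
      using bary_sum[OF K, of x] x a verts_props(1)[OF K] by (simp_all add: bface_def sum_diff1)
    moreover have "\<forall>b\<in>verts K - {a}. 0 \<le> bary K b x" using x mem_simplex_iff[OF K] by (auto simp: bface_def)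
    ultimately show "x \<in> convex hull (verts K - {a})" unfolding convex_hull_finite[OF fin]
      by (intro CollectI exI[of _ "\<lambda>b. bary K b x"]) simp
  qed
  have "convex (bface K a)"
  proof -
    have "bface K a = K \<inter> {x. bgrad K a \<bullet> x = - snd (bcoef K a)}" by (auto simp: bface_def bary_def)
    then show ?thesis using full_simplex_convex[OF K] by (simp add: convex_Int convex_hyperplane)
  qed
  then show "convex hull (verts K - {a}) \<subseteq> bface K a"
    by (intro hull_minimal) (use bary_vertex[OF K a] verts_subset in \<open>auto simp: bface_def\<close>)
qed

lemma facet_iff_bface:
  fixes K :: "(real^'d) set"
  assumes K: "full_simplex K"
  shows "F facet_of K \<longleftrightarrow> (\<exists>a\<in>verts K. F = bface K a)"
proof -
  have "F facet_of K \<longleftrightarrow> F \<noteq> {} \<and> (\<exists>u. u \<in> verts K \<and> F = convex hull (verts K - {u}))"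
    using facet_of_convex_hull_affine_independent[OF verts_props(3)[OF K]] verts_props(4)[OF K] by metis
  moreover have "convex hull (verts K - {a}) \<noteq> {}" for a
    using other_vertex[OF K, of a] by (metis Diff_iff empty_iff hull_subset singletonD subsetD)
  ultimately show ?thesis using bface_hull[OF K] by metis
qed

lemma finite_facets: "full_simplex K \<Longrightarrow> finite {F. F facet_of K}"
  using facet_iff_bface[of K] verts_props(1)[of K] by simp

lemma card_facets:
  fixes K :: "(real^'d) set"
  assumes K: "full_simplex K"
  shows "card {F. F facet_of K} \<le> CARD('d) + 1"
proof -
  have "{F. F facet_of K} = bface K ` verts K" using facet_iff_bface[OF K] by auto
  then show ?thesis using card_image_le[OF verts_props(1)[OF K], of "bface K"] verts_props(2)[OF K] by simp
qed

text \<open>The normal direction of a facet is one dimensional: a normal vector is determined by its product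
  with one edge that leaves the facet.\<close>

lemma bface_normal:
  fixes K :: "(real^'d) set"
  assumes K: "full_simplex K" and a: "a \<in> verts K" and w: "w \<in> verts K" "w \<noteq> a"
    and n: "\<forall>x\<in>bface K a. \<forall>y\<in>bface K a. (x - y) \<bullet> n = 0"
  shows "n = ((a - w) \<bullet> n) *\<^sub>R bgrad K a"
proof -
  have mem: "b \<in> bface K a" if "b \<in> verts K" "b \<noteq> a" for b
    using that bary_vertex[OF K a that(1)] verts_subset by (auto simp: bface_def)
  have "e \<bullet> n = e \<bullet> (((a - w) \<bullet> n) *\<^sub>R bgrad K a)" for e
  proof -
    have "e \<bullet> n = (\<Sum>b\<in>verts K. (bgrad K b \<bullet> e) *\<^sub>R (b - w)) \<bullet> n"
      using bgrad_sum(2)[OF K, of e w] by simp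
    also have "\<dots> = (\<Sum>b\<in>verts K. (bgrad K b \<bullet> e) * ((b - w) \<bullet> n))" by (simp add: inner_sum_left)
    also have "\<dots> = (\<Sum>b\<in>verts K. if b = a then (bgrad K a \<bullet> e) * ((a - w) \<bullet> n) else 0)"
      by (rule sum.cong) (use n mem w in auto)
    also have "\<dots> = (bgrad K a \<bullet> e) * ((a - w) \<bullet> n)" using a verts_props(1)[OF K] by simp
    finally show ?thesis by (simp add: inner_commute)
  qed
  then show ?thesis using vector_eq_ldot by blast
qed

lemma bface_inner_bgrad: "x \<in> bface K a \<Longrightarrow> y \<in> bface K a \<Longrightarrow> (x - y) \<bullet> bgrad K a = 0"
  using bary_diff[of K a x y] by (simp add: bface_def inner_commute)

lemma unit_normal_bface:
  fixes K :: "(real^'d) set"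
  assumes K: "full_simplex K" and a: "a \<in> verts K"
  shows "norm (unit_normal (bface K a)) = 1"
    "\<forall>x\<in>bface K a. \<forall>y\<in>bface K a. (x - y) \<bullet> unit_normal (bface K a) = 0"
proof -
  have "norm ((1 / norm (bgrad K a)) *\<^sub>R bgrad K a) = 1 \<and>
      (\<forall>x\<in>bface K a. \<forall>y\<in>bface K a. (x - y) \<bullet> ((1 / norm (bgrad K a)) *\<^sub>R bgrad K a) = 0)"
    using bgrad_nonzero[OF K a] by (auto simp only: inner_scaleR_right bface_inner_bgrad) simp
  from someI[of "\<lambda>n. norm n = 1 \<and> (\<forall>x\<in>bface K a. \<forall>y\<in>bface K a. (x - y) \<bullet> n = 0)", OF this]
  show "norm (unit_normal (bface K a)) = 1"
    "\<forall>x\<in>bface K a. \<forall>y\<in>bface K a. (x - y) \<bullet> unit_normal (bface K a) = 0"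
    unfolding unit_normal_def by blast+
qed

lemma flat_bface:
  fixes K :: "(real^'d) set"
  assumes K: "full_simplex K" and a: "a \<in> verts K"
  shows "flat (bface K a)"
proof -
  have "finite (verts K - {a})" using verts_props(1)[OF K] by simp
  then have "compact (bface K a)" unfolding bface_hull[OF K a] by (rule finite_imp_compact_convex_hull)
  moreover have "bface K a \<noteq> {}"
    using other_vertex[OF K, of a] bface_hull[OF K a] by (metis Diff_iff empty_iff hull_subset singletonD subsetD)
  ultimately show ?thesis using unit_normal_bface[OF K a] by (simp add: flat_def)
qed

lemma flat_facet: "full_simplex K \<Longrightarrow> F facet_of K \<Longrightarrow> flat F"
  using facet_iff_bface[of K F] flat_bface[of K] by blast

text \<open>The barycentric coordinate of the opposite vertex decreases in the outward direction.\<close>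

lemma outer_normal_bface:
  fixes K :: "(real^'d) set"
  assumes K: "full_simplex K" and a: "a \<in> verts K"
  shows "outer_normal K (bface K a) = - (1 / norm (bgrad K a)) *\<^sub>R bgrad K a"
proof -
  define g where "g = norm (bgrad K a)"
  have g: "g > 0" using bgrad_nonzero[OF K a] by (simp add: g_def)
  let ?P = "\<lambda>n. norm n = 1 \<and> (\<forall>x\<in>bface K a. \<forall>y\<in>bface K a. (x - y) \<bullet> n = 0) \<and>
      (\<forall>x\<in>bface K a. \<forall>y\<in>K. (y - x) \<bullet> n \<le> 0)"
  have neg: "(y - x) \<bullet> (- (1 / g) *\<^sub>R bgrad K a) \<le> 0" if "x \<in> bface K a" "y \<in> K" for x y
  proof -
    have "bgrad K a \<bullet> (y - x) \<ge> 0"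
      using bary_diff[of K a y x] that mem_simplex_iff[OF K] a by (auto simp: bface_def)
    then have "0 \<le> (1 / g) * (bgrad K a \<bullet> (y - x))" using g by (intro mult_nonneg_nonneg) auto
    then show ?thesis by (simp add: inner_commute)
  qed
  have "?P (- (1 / g) *\<^sub>R bgrad K a)"
    using neg
  proof (intro conjI ballI)
    show "norm (- (1 / g) *\<^sub>R bgrad K a) = 1" using g by (simp add: g_def)
  qed (simp_all only: inner_scaleR_right bface_inner_bgrad mult_zero_right)
  moreover have "n = - (1 / g) *\<^sub>R bgrad K a" if n: "?P n" for n
  proof -
    obtain w where w: "w \<in> verts K" "w \<noteq> a" using other_vertex[OF K] by metis
    define c where "c = (a - w) \<bullet> n"
    have nc: "n = c *\<^sub>R bgrad K a" unfolding c_def by (rule bface_normal[OF K a w]) (use n in blast)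
    have "w \<in> bface K a" using w bary_vertex[OF K a w(1)] verts_subset by (auto simp: bface_def)
    then have "c \<le> 0" using n a verts_subset unfolding c_def by blast
    moreover have "\<bar>c\<bar> * g = 1" using n nc by (metis g_def norm_scaleR)
    ultimately have "c = - (1 / g)" using g by (simp add: field_simps abs_if split: if_splits)
    then show ?thesis using nc by simp
  qed
  ultimately show ?thesis unfolding outer_normal_def g_def by (rule some_equality)
qed

lemma unit_normal_parallel:
  fixes K :: "(real^'d) set"
  assumes K: "full_simplex K" and a: "a \<in> verts K"
  shows "\<exists>c. unit_normal (bface K a) = c *\<^sub>R bgrad K a \<and> \<bar>c\<bar> * norm (bgrad K a) = 1"
proof -
  obtain w where w: "w \<in> verts K" "w \<noteq> a" using other_vertex[OF K] by metis
  have "unit_normal (bface K a) = ((a - w) \<bullet> unit_normal (bface K a)) *\<^sub>R bgrad K a"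
    by (rule bface_normal[OF K a w unit_normal_bface(2)[OF K a]])
  then show ?thesis using unit_normal_bface(1)[OF K a]
    by (intro exI[of _ "(a - w) \<bullet> unit_normal (bface K a)"] conjI) (assumption, metis norm_scaleR)
qed

lemma norm_outer_normal:
  fixes K :: "(real^'d) set"
  assumes "full_simplex K" "F facet_of K"
  shows "norm (outer_normal K F) = 1"
proof -
  obtain a where a: "a \<in> verts K" "F = bface K a" using assms facet_iff_bface by blast
  show ?thesis unfolding a(2) outer_normal_bface[OF assms(1) a(1)]
    using bgrad_nonzero[OF assms(1) a(1)] by simp
qed

text \<open>The other coordinates stay positive near a relatively interior point of the facet.\<close>

lemma half_ball:
  fixes K :: "(real^'d) set"
  assumes K: "full_simplex K" and a: "a \<in> verts K"
    and x: "bary K a x = 0" "\<forall>b\<in>verts K - {a}. 0 < bary K b x"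
  shows "\<exists>\<rho>>0. \<forall>y\<in>ball x \<rho>. y \<in> K \<longleftrightarrow> 0 \<le> bary K a y"
proof -
  have "open (\<Inter>b\<in>verts K - {a}. {y. 0 < bary K b y})"
    by (intro open_INT) (auto simp: verts_props(1)[OF K] intro!: open_Collect_less continuous_intros)
  moreover have "x \<in> (\<Inter>b\<in>verts K - {a}. {y. 0 < bary K b y})" using x by auto
  ultimately obtain \<rho> where \<rho>: "\<rho> > 0" "ball x \<rho> \<subseteq> (\<Inter>b\<in>verts K - {a}. {y. 0 < bary K b y})"
    unfolding open_contains_ball by blast
  have "y \<in> K \<longleftrightarrow> 0 \<le> bary K a y" if "y \<in> ball x \<rho>" for y
  proof -
    have "0 < bary K b y" if "b \<in> verts K - {a}" for b
      using subsetD[OF \<rho>(2) \<open>y \<in> ball x \<rho>\<close>] that by blast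
    then show ?thesis unfolding mem_simplex_iff[OF K] using a by (metis Diff_iff empty_iff insert_iff less_imp_le)
  qed
  then show ?thesis using \<rho>(1) by blast
qed

text \<open>Moving slightly towards the barycentre of the facet makes all remaining coordinates positive.\<close>

lemma bface_rel_interior_point:
  fixes K :: "(real^'d) set"
  assumes K: "full_simplex K" and a: "a \<in> verts K" and z: "z \<in> bface K a" and e: "e > 0"
  obtains x where "bary K a x = 0" "\<forall>b\<in>verts K - {a}. 0 < bary K b x" "x \<in> bface K a" "dist x z < e"
proof -
  let ?n = "real CARD('d)"
  define u where "u = (\<lambda>v. if v = a then 0 else 1 / ?n)"
  define m where "m = (\<Sum>v\<in>verts K. u v *\<^sub>R v)"
  have "sum u (verts K) = sum u (verts K - {a})"
    using sum.remove[OF verts_props(1)[OF K] a, of u] by (simp add: u_def)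
  also have "\<dots> = (\<Sum>v\<in>verts K - {a}. 1 / ?n)" by (rule sum.cong) (auto simp: u_def)
  also have "\<dots> = 1" using a verts_props(1,2)[OF K] by (simp add: card_Diff_singleton)
  finally have bm: "bary K b m = u b" if "b \<in> verts K" for b
    unfolding m_def using bary_comb[OF K that, of u] by blast
  define t where "t = min 1 (e / (2 * (norm (m - z) + 1)))"
  have t: "0 < t" "t \<le> 1" using e by (auto simp: t_def add_nonneg_pos)
  define x where "x = z + t *\<^sub>R (m - z)"
  have bx: "bary K b x = (1 - t) * bary K b z + t * bary K b m" for b
  proof -
    have "bary K b m = bary K b z + bgrad K b \<bullet> (m - z)" using bary_diff[of K b m z] by linarith
    then show ?thesis unfolding x_def bary_add inner_scaleR_right
      by (simp only: left_diff_distrib distrib_left)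
  qed
  have 1: "bary K a x = 0" using z bm[OF a] unfolding bx by (simp add: bface_def u_def)
  have 2: "\<forall>b\<in>verts K - {a}. 0 < bary K b x"
  proof
    fix b assume b: "b \<in> verts K - {a}"
    have "0 \<le> bary K b z" using z b mem_simplex_iff[OF K] by (auto simp: bface_def)
    moreover have "bary K b m > 0" using b bm[of b] by (auto simp: u_def)
    ultimately show "0 < bary K b x" unfolding bx using t by (simp add: add_nonneg_pos)
  qed
  have "0 \<le> bary K b x" if "b \<in> verts K" for b
    using 1 2 that by (cases "b = a") (auto intro: less_imp_le)
  then have 3: "x \<in> bface K a" unfolding bface_def using 1 mem_simplex_iff[OF K] by blast
  have "t * norm (m - z) \<le> e / (2 * (norm (m - z) + 1)) * norm (m - z)"
    by (intro mult_right_mono) (auto simp: t_def)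
  also have "\<dots> < e"
  proof -
    have "norm (m - z) / (2 * (norm (m - z) + 1)) < 1" by (simp add: divide_less_eq add_nonneg_pos)
    then show ?thesis using e mult_strict_left_mono[of "norm (m - z) / (2 * (norm (m - z) + 1))" 1 e] by simp
  qed
  finally have "dist x z < e" using t by (simp add: x_def dist_norm)
  then show ?thesis using that 1 2 3 by blast
qed

text \<open>A point of a face is a convex combination of the vertices in that face, and these are vertices of
  both simplices.\<close>

lemma bary_common_face:
  fixes K1 K2 :: "(real^'d) set"
  assumes K: "full_simplex K1" "full_simplex K2"
    and f: "K1 \<inter> K2 face_of K1" "K1 \<inter> K2 face_of K2" and x: "x \<in> K1 \<inter> K2"
  shows "a \<in> verts K1 \<Longrightarrow> a \<in> verts K2 \<Longrightarrow> bary K1 a x = bary K2 a x"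
    and "a \<in> verts K1 \<Longrightarrow> a \<notin> K2 \<Longrightarrow> bary K1 a x = 0"
    and "a \<in> verts K1 \<Longrightarrow> a \<in> K2 \<Longrightarrow> a \<in> verts K2"
proof -
  define D where "D = K1 \<inter> K2"
  have v: "verts D = verts K1 \<inter> D" "verts D = verts K2 \<inter> D"
    using extreme_point_of_face[OF f(1)] extreme_point_of_face[OF f(2)] by (auto simp: verts_def D_def)
  show "a \<in> verts K1 \<Longrightarrow> a \<in> K2 \<Longrightarrow> a \<in> verts K2" using v verts_subset[of K1] by (auto simp: D_def)
  have "compact D" "convex D" unfolding D_def
    using full_simplex_compact[OF K(1)] full_simplex_compact[OF K(2)]
      full_simplex_convex[OF K(1)] full_simplex_convex[OF K(2)]
    by (auto simp: compact_Int convex_Int)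
  then have "D = convex hull (verts D)" unfolding verts_def by (rule Krein_Milman_Minkowski)
  moreover have fin: "finite (verts D)" using v(1) verts_props(1)[OF K(1)] by simp
  ultimately have "x \<in> convex hull (verts D)" using x unfolding D_def[symmetric] by blast
  then obtain u where u: "sum u (verts D) = 1" "(\<Sum>v\<in>verts D. u v *\<^sub>R v) = x"
    unfolding convex_hull_finite[OF fin] by blast
  define u' where "u' = (\<lambda>v. if v \<in> D then u v else 0)"
  have b: "bary K a x = u' a" if "full_simplex K" "verts D = verts K \<inter> D" "a \<in> verts K" for K a
  proof -
    have "sum u' (verts K) = sum u (verts D)" unfolding u'_def that(2)
      by (rule sum.inter_restrict[symmetric]) (rule verts_props(1)[OF that(1)])
    moreover have "(\<Sum>v\<in>verts K. u' v *\<^sub>R v) = (\<Sum>v\<in>verts D. u v *\<^sub>R v)"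
      unfolding that(2) sum.inter_restrict[OF verts_props(1)[OF that(1)]]
      by (rule sum.cong) (auto simp: u'_def)
    ultimately show ?thesis using bary_comb[OF that(1,3), of u'] u by simp
  qed
  show "a \<in> verts K1 \<Longrightarrow> a \<in> verts K2 \<Longrightarrow> bary K1 a x = bary K2 a x"
    using b[OF K(1) v(1)] b[OF K(2) v(2)] by simp
  show "a \<in> verts K1 \<Longrightarrow> a \<notin> K2 \<Longrightarrow> bary K1 a x = 0"
    using b[OF K(1) v(1)] by (simp add: u'_def D_def)
qed

section \<open>Shape regularity\<close>

text \<open>The coordinate varies by at most 1 along a diameter of the inscribed ball.\<close>

lemma bgrad_bound:
  fixes K :: "(real^'d) set"
  assumes K: "full_simplex K" and a: "a \<in> verts K" and r: "cball p r \<subseteq> K" "r > 0"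
  shows "norm (bgrad K a) \<le> 1 / (2 * r)"
proof -
  let ?g = "bgrad K a"
  have g: "norm ?g > 0" using bgrad_nonzero[OF K a] by simp
  define e where "e = (r / norm ?g) *\<^sub>R ?g"
  have "p + e \<in> K" "p - e \<in> K" using r g by (auto simp: e_def dist_norm subset_iff)
  then have "bary K b (p + e) \<ge> 0" "bary K b (p - e) \<ge> 0" if "b \<in> verts K" for b
    using that mem_simplex_iff[OF K] by blast+
  then have "bary K a (p - e) \<ge> 0" "bary K a (p + e) \<le> 1"
    using a bary_sum(1)[OF K, of "p + e"] member_le_sum[OF a, of "\<lambda>b. bary K b (p + e)"] verts_props(1)[OF K]
    by auto
  then have "bgrad K a \<bullet> ((p + e) - (p - e)) \<le> 1" using bary_diff[of K a "p + e" "p - e"] by linarith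
  also have "(p + e) - (p - e) = 2 *\<^sub>R e" by (simp add: scaleR_2)
  also have "bgrad K a \<bullet> (2 *\<^sub>R e) = 2 * (bgrad K a \<bullet> e)" by simp
  also have "bgrad K a \<bullet> e = r * norm ?g"
    using g by (simp add: e_def power2_norm_eq_inner[symmetric] power2_eq_square)
  finally show ?thesis using r by (simp add: field_simps)
qed

lemma vertex_distance:
  fixes K :: "(real^'d) set"
  assumes K: "full_simplex K" and ab: "a \<in> verts K" "b \<in> verts K" "a \<noteq> b" and r: "cball p r \<subseteq> K" "r > 0"
  shows "2 * r \<le> dist a b"
proof -
  have "1 = bgrad K a \<bullet> (a - b)"
    using bary_diff[of K a a b] bary_vertex[OF K ab(1,1)] bary_vertex[OF K ab(1,2)] ab(3) by simp
  also have "\<dots> \<le> norm (bgrad K a) * norm (a - b)" by (rule norm_cauchy_schwarz)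
  also have "\<dots> \<le> 1 / (2 * r) * norm (a - b)"
    by (intro mult_right_mono bgrad_bound[OF K ab(1) r]) simp
  finally show ?thesis using r by (simp add: dist_norm field_simps)
qed

text \<open>Sliding a point along the edge from \<open>a\<close> to \<open>w\<close> transfers its \<open>a\<close>-coordinate to \<open>w\<close>, so it reaches
  the opposite facet without leaving the simplex.\<close>

lemma simplex_subset_slab:
  fixes K :: "(real^'d) set"
  assumes K: "full_simplex K" and a: "a \<in> verts K" and w: "w \<in> verts K" "w \<noteq> a"
  shows "K \<subseteq> slab (bface K a) (a - w)"
proof
  fix x assume x: "x \<in> K"
  define t where "t = bary K a x"
  define y where "y = x - t *\<^sub>R (a - w)"
  have x0: "0 \<le> bary K b x" if "b \<in> verts K" for b using x that mem_simplex_iff[OF K] by blast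
  then have t: "0 \<le> t" "t \<le> 1"
    using a bary_sum(1)[OF K, of x] member_le_sum[OF a, of "\<lambda>b. bary K b x"] verts_props(1)[OF K]
    by (auto simp: t_def)
  have bg: "bgrad K b \<bullet> (a - w) = (if b = a then 1 else 0) - (if b = w then 1 else 0)" if "b \<in> verts K" for b
    using bary_diff[of K b a w] bary_vertex[OF K that a] bary_vertex[OF K that w(1)] by auto
  have by': "bary K b y = bary K b x - t * ((if b = a then 1 else 0) - (if b = w then 1 else 0))"
    if "b \<in> verts K" for b
    using bary_diff[of K b y x] bg[OF that] by (simp add: y_def)
  have "y \<in> K" unfolding mem_simplex_iff[OF K]
  proof
    fix b assume b: "b \<in> verts K"
    show "0 \<le> bary K b y" using by'[OF b] x0[OF b] t w(2) by (auto simp: t_def)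
  qed
  moreover have "bary K a y = 0" using by'[OF a] w by (simp add: t_def)
  ultimately show "x \<in> slab (bface K a) (a - w)"
    unfolding slab_def bface_def using t by (auto intro!: exI[of _ y] exI[of _ t] simp: y_def)
qed

text \<open>The simplex lies in an oblique prism over the facet whose height is at most the diameter.\<close>

lemma area_lower:
  fixes K :: "(real^'d) set"
  assumes d: "CARD('d) = 2 \<or> CARD('d) = 3" and K: "full_simplex K" and F: "F facet_of K"
  shows "measure lebesgue K \<le> diameter K * area F"
proof -
  obtain a where a: "a \<in> verts K" "F = bface K a" using F facet_iff_bface[OF K] by blast
  obtain w where w: "w \<in> verts K" "w \<noteq> a" using other_vertex[OF K] by metis
  have flat: "flat F" using flat_bface[OF K a(1)] a(2) by simp
  obtain c where c: "unit_normal F = c *\<^sub>R bgrad K a" "\<bar>c\<bar> * norm (bgrad K a) = 1"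
    using unit_normal_parallel[OF K a(1)] a(2) by blast
  have "(a - w) \<bullet> bgrad K a = 1"
    using bary_diff[of K a a w] bary_vertex[OF K a(1,1)] bary_vertex[OF K a(1) w(1)] w(2)
    by (simp add: inner_commute)
  then have nz: "(a - w) \<bullet> unit_normal F \<noteq> 0" using c by auto
  have cs: "compact (slab F (a - w))" using flat by (simp add: flat_def compact_slab)
  have "measure lebesgue K \<le> measure lebesgue (slab F (a - w))"
    by (rule measure_mono_fmeasurable)
      (use simplex_subset_slab[OF K a(1) w] a(2) full_simplex_compact[OF K] cs
        in \<open>auto intro: lmeasurable_compact dest: lmeasurable_compact simp: fmeasurableD\<close>)
  also have "\<dots> = \<bar>(a - w) \<bullet> unit_normal F\<bar> * area F" by (rule area_slab[OF d flat nz])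
  also have "\<bar>(a - w) \<bullet> unit_normal F\<bar> \<le> diameter K"
  proof -
    have "\<bar>(a - w) \<bullet> unit_normal F\<bar> \<le> norm (a - w) * norm (unit_normal F)" by (rule Cauchy_Schwarz_ineq2)
    also have "\<dots> = dist a w" using flat by (simp add: flat_def dist_norm)
    also have "\<dots> \<le> diameter K"
      by (rule diameter_bounded_bound)
        (use a w verts_subset[of K] full_simplex_compact[OF K] in \<open>auto simp: compact_imp_bounded\<close>)
    finally show ?thesis .
  qed
  finally show ?thesis using area_nonneg by (meson mult_right_mono order.trans order.refl)
qed

text \<open>The upright prism of height \<open>h\<close> over the face lies in a ball of radius \<open>2 h\<close>.\<close>

lemma area_upper:
  fixes F :: "(real^'d) set"
  assumes d: "CARD('d) = 2 \<or> CARD('d) = 3" and F: "flat F" and h: "diameter F \<le> h" "h > 0"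
  shows "h * area F \<le> unit_ball_vol (real CARD('d)) * (2 * h) ^ CARD('d)"
proof -
  let ?N = "unit_normal F"
  have N: "norm ?N = 1" using F by (simp add: flat_def)
  have NN: "(h *\<^sub>R ?N) \<bullet> ?N = h" using N by (simp add: norm_eq_1)
  then have nz: "(h *\<^sub>R ?N) \<bullet> ?N \<noteq> 0" using h(2) by linarith
  obtain y0 where y0: "y0 \<in> F" using F by (auto simp: flat_def)
  have "slab F (h *\<^sub>R ?N) \<subseteq> cball y0 (2 * h)"
  proof
    fix x assume "x \<in> slab F (h *\<^sub>R ?N)"
    then obtain y s where y: "y \<in> F" "x = y + s *\<^sub>R (h *\<^sub>R ?N)" "0 \<le> s" "s \<le> 1" by (auto simp: slab_def)
    have "dist y0 y \<le> h"
      using diameter_bounded_bound[OF _ y0 y(1)] F h by (simp add: flat_def compact_imp_bounded)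
    moreover have "dist y x \<le> h"
      using y h N by (simp add: dist_norm mult_left_le_one_le)
    ultimately show "x \<in> cball y0 (2 * h)" using dist_triangle[of y0 x y] by simp
  qed
  moreover have "slab F (h *\<^sub>R ?N) \<in> sets lebesgue"
    using F compact_slab[of F] by (intro fmeasurableD lmeasurable_compact) (simp add: flat_def)
  ultimately have "measure lebesgue (slab F (h *\<^sub>R ?N)) \<le> measure lebesgue (cball y0 (2 * h))"
    by (intro measure_mono_fmeasurable) auto
  also have "\<dots> = unit_ball_vol (real CARD('d)) * (2 * h) ^ CARD('d)"
    using h content_cball[of "2 * h" y0] by simp
  finally show ?thesis using area_slab[OF d F nz] h unfolding NN by simp
qed

text \<open>An affine function keeps one sign and grows on a ball of a quarter of the radius inside the
  half ball in the direction of its gradient, so its mean square controls its value and gradient.\<close>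

lemma affine_mean_square:
  fixes g p :: "real^'d"
  assumes r: "cball p r \<subseteq> K" "r > 0" and K: "compact K"
  shows "unit_ball_vol (real CARD('d)) * (r / 4) ^ CARD('d) * ((g \<bullet> p + c)\<^sup>2 + (r / 4 * norm g)\<^sup>2)
    \<le> (LINT x:K|lebesgue. (g \<bullet> x + c)\<^sup>2)"
proof -
  define s where "s = (if g \<bullet> p + c \<ge> 0 then 1 else (-1::real))"
  define u where "u = (if g = 0 then 0 else (s / norm g) *\<^sub>R g)"
  have s: "s * (g \<bullet> p + c) = \<bar>g \<bullet> p + c\<bar>" "s * s = 1" "\<bar>s\<bar> = 1" by (auto simp: s_def)
  have nu: "norm u \<le> 1" using s by (auto simp: u_def)
  have gu: "s * (g \<bullet> u) = norm g"
    using s by (auto simp: u_def power2_norm_eq_inner[symmetric] power2_eq_square mult.assoc[symmetric])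
  \<comment> \<open>Shifting the centre in the direction in which the modulus grows leaves a ball of radius \<open>r / 4\<close> on
    which it is at least \<open>r / 4\<close> times the slope above its value at \<open>p\<close>.\<close>
  define q where "q = p + (r / 2) *\<^sub>R u"
  have sub: "cball q (r / 4) \<subseteq> K"
  proof
    fix x assume x: "x \<in> cball q (r / 4)"
    have "dist p q \<le> r / 2" using nu r by (simp add: q_def dist_norm mult_left_le)
    then have "x \<in> cball p r" using x dist_triangle[of p x q] r by simp
    then show "x \<in> K" using r by auto
  qed
  define m where "m = (g \<bullet> p + c)\<^sup>2 + (r / 4 * norm g)\<^sup>2"
  have lower: "m \<le> (g \<bullet> x + c)\<^sup>2" if x: "x \<in> cball q (r / 4)" for x
  proof -
    have "\<bar>g \<bullet> (x - q)\<bar> \<le> norm g * norm (x - q)" by (rule Cauchy_Schwarz_ineq2)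
    also have "\<dots> \<le> norm g * (r / 4)" using x by (intro mult_left_mono) (auto simp: dist_norm norm_minus_commute)
    finally have 1: "\<bar>s * (g \<bullet> (x - q))\<bar> \<le> r / 4 * norm g" using s by (simp add: abs_mult mult.commute)
    have "s * (g \<bullet> x + c) = s * (g \<bullet> p + c) + (r / 2) * (s * (g \<bullet> u)) + s * (g \<bullet> (x - q))"
      by (simp add: q_def inner_simps algebra_simps)
    then have "\<bar>g \<bullet> p + c\<bar> + r / 4 * norm g \<le> s * (g \<bullet> x + c)"
      using 1 unfolding s(1) gu by linarith
    then have "(\<bar>g \<bullet> p + c\<bar> + r / 4 * norm g)\<^sup>2 \<le> (s * (g \<bullet> x + c))\<^sup>2"
      using r by (intro power_mono) auto
    also have "(s * (g \<bullet> x + c))\<^sup>2 = (g \<bullet> x + c)\<^sup>2" using s by (simp add: power_mult_distrib power2_eq_square)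
    also have "m \<le> (\<bar>g \<bullet> p + c\<bar> + r / 4 * norm g)\<^sup>2"
      using r by (simp add: m_def power2_sum)
    finally show ?thesis by simp
  qed
  have int: "set_integrable lebesgue S (\<lambda>x. (g \<bullet> x + c)\<^sup>2)" if "compact S" for S
  proof -
    have "continuous_on S (\<lambda>x. (g \<bullet> x + c)\<^sup>2)" by (intro continuous_intros)
    then have "integrable lborel (\<lambda>x. indicator S x *\<^sub>R (g \<bullet> x + c)\<^sup>2)" by (rule borel_integrable_compact[OF that])
    then show ?thesis unfolding set_integrable_def using integrable_completion[OF borel_measurable_integrable] by blast
  qed
  have "unit_ball_vol (real CARD('d)) * (r / 4) ^ CARD('d) * m = measure lebesgue (cball q (r / 4)) * m"
    using r content_cball[of "r / 4" q] by simp
  also have "\<dots> = (LINT x:cball q (r / 4)|lebesgue. m)" by (simp add: set_lebesgue_integral_def)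
  also have "\<dots> \<le> (LINT x:cball q (r / 4)|lebesgue. (g \<bullet> x + c)\<^sup>2)"
    by (rule set_integral_mono[OF absolutely_integrable_on_const int]) (use lower in auto)
  also have "\<dots> \<le> (LINT x:K|lebesgue. (g \<bullet> x + c)\<^sup>2)"
    unfolding set_lebesgue_integral_def
    by (rule integral_mono[OF int[OF compact_cball, unfolded set_integrable_def] int[OF K, unfolded set_integrable_def]])
      (use sub in \<open>auto split: split_indicator\<close>)
  finally show ?thesis by (simp add: m_def)
qed

section \<open>Integration by parts on a simplex\<close>

text \<open>Cutting an interval by half lines, each cut contributes its end point with the sign of its
  direction as long as that point survives all other cuts.\<close>

lemma integral_cut_interval:
  fixes \<phi> \<phi>' :: "real \<Rightarrow> real"
  assumes "finite I" and "\<And>a. a \<in> I \<Longrightarrow> \<sigma> a = 1 \<or> \<sigma> a = -1" and "inj_on t I"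
    and "\<And>a. a \<in> I \<Longrightarrow> t a \<noteq> l \<and> t a \<noteq> u"
    and \<phi>: "\<And>s. (\<phi> has_real_derivative \<phi>' s) (at s)" "continuous_on UNIV \<phi>'"
  shows "(\<integral>s. indicator {s\<in>{l..u}. \<forall>a\<in>I. 0 \<le> \<sigma> a * (t a - s)} s * \<phi>' s \<partial>lborel)
    = indicator {s\<in>{l..u}. \<forall>a\<in>I. 0 \<le> \<sigma> a * (t a - s)} u * \<phi> u
      - indicator {s\<in>{l..u}. \<forall>a\<in>I. 0 \<le> \<sigma> a * (t a - s)} l * \<phi> l
      + (\<Sum>b\<in>I. \<sigma> b * (indicator {s\<in>{l..u}. \<forall>a\<in>I. 0 \<le> \<sigma> a * (t a - s)} (t b) * \<phi> (t b)))"
  using assms(1-4)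
proof (induction I arbitrary: l u rule: finite_induct)
  case empty
  show ?case
  proof (cases "l \<le> u")
    case True
    have "(\<integral>s. indicator {l..u} s *\<^sub>R \<phi>' s \<partial>lborel) = \<phi> u - \<phi> l"
      by (rule integral_FTC_atLeastAtMost[OF True])
        (use \<phi> in \<open>auto intro: continuous_on_subset has_field_derivative_at_within
          simp: has_real_derivative_iff_has_vector_derivative[symmetric]\<close>)
    moreover have "{s. l \<le> s \<and> s \<le> u} = {l..u}" by auto
    ultimately show ?thesis using True by simp
  next
    case False
    then show ?thesis by simp
  qed
next
  case (insert b I)
  let ?S = "{s\<in>{l..u}. \<forall>a\<in>insert b I. 0 \<le> \<sigma> a * (t a - s)}"
  have inj: "inj_on t I" "\<And>a. a \<in> I \<Longrightarrow> t a \<noteq> t b"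
    using insert.prems(2) insert.hyps(2) by (auto simp: inj_on_def)
  have lu: "\<And>a. a \<in> I \<Longrightarrow> t a \<noteq> l \<and> t a \<noteq> u" "t b \<noteq> l" "t b \<noteq> u" using insert.prems(3) by auto
  have \<sigma>: "\<And>a. a \<in> I \<Longrightarrow> \<sigma> a = 1 \<or> \<sigma> a = -1" using insert.prems(1) by blast
  consider "\<sigma> b = 1" "t b < u" | "\<sigma> b = 1" "u < t b" | "\<sigma> b = -1" "l < t b" | "\<sigma> b = -1" "t b < l"
    using insert.prems(1)[of b] lu(2,3) by fastforce
  then show ?case
  proof cases
    case 1
    have S: "?S = {s\<in>{l..t b}. \<forall>a\<in>I. 0 \<le> \<sigma> a * (t a - s)}" using 1 by auto
    have "u \<notin> ?S" using 1 by auto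
    then show ?thesis unfolding S
      using insert.IH[OF \<sigma> inj(1), of l "t b"] inj(2) lu insert.hyps 1 by simp
  next
    case 2
    have S: "?S = {s\<in>{l..u}. \<forall>a\<in>I. 0 \<le> \<sigma> a * (t a - s)}" using 2 by auto
    have "t b \<notin> ?S" using 2 by auto
    then show ?thesis unfolding S
      using insert.IH[OF \<sigma> inj(1), of l u] inj(2) lu insert.hyps 2 by simp
  next
    case 3
    have S: "?S = {s\<in>{t b..u}. \<forall>a\<in>I. 0 \<le> \<sigma> a * (t a - s)}" using 3 by auto
    have "l \<notin> ?S" using 3 by auto
    then show ?thesis unfolding S
      using insert.IH[OF \<sigma> inj(1), of "t b" u] inj(2) lu insert.hyps 3 by simp
  next
    case 4
    have S: "?S = {s\<in>{l..u}. \<forall>a\<in>I. 0 \<le> \<sigma> a * (t a - s)}" using 4 by auto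
    have "t b \<notin> ?S" using 4 by auto
    then show ?thesis unfolding S
      using insert.IH[OF \<sigma> inj(1), of l u] inj(2) lu insert.hyps 4 by simp
  qed
qed

text \<open>Used to discard the points at which two facets, or a facet and an end point, are met at once.\<close>

lemma null_affine_zero:
  fixes g :: "'a::euclidean_space"
  assumes "g \<noteq> 0"
  shows "{x. g \<bullet> x + c = 0} \<in> null_sets lborel"
proof -
  have "{x. g \<bullet> x + c = 0} = {x. g \<bullet> x = - c}" by auto
  moreover have "negligible {x. g \<bullet> x = - c}" using assms by (intro negligible_hyperplane) auto
  moreover have "closed {x. g \<bullet> x = - c}" by (rule closed_hyperplane)
  ultimately show ?thesis
    by (metis borel_closed negligible_iff_null_sets null_sets_completion_iff sets_lborel)
qed

lemma AE_affine_nonzero: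
  fixes g :: "'a::euclidean_space"
  assumes "g \<noteq> 0"
  shows "AE x in lborel. g \<bullet> x + c \<noteq> 0"
  using AE_not_in[OF null_affine_zero[OF assms, of c]] by simp

lemma indicator_compact_integrable:
  fixes f :: "'a::euclidean_space \<Rightarrow> real"
  assumes "compact S" "continuous_on S f"
  shows "integrable lborel (\<lambda>x. indicator S x * f x)"
  using borel_integrable_compact[OF assms] by simp

lemma lborel_integral_shift:
  fixes g :: "'a::euclidean_space \<Rightarrow> real"
  assumes "integrable lborel g"
  shows "has_bochner_integral lborel (\<lambda>x. g (x - e)) (\<integral>x. g x \<partial>lborel)"
proof -
  have d: "lborel = distr lborel borel (\<lambda>x::'a. - e + x)"
    using lborel_affine[of 1 "- e"] by (simp add: density_1)
  have "integrable (distr lborel borel (\<lambda>x::'a. - e + x)) g" using assms d by simp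
  then have 1: "integrable lborel (\<lambda>x. g (- e + x))"
    by (rule integrable_distr[rotated]) simp
  have "(\<integral>x. g x \<partial>lborel) = (\<integral>x. g x \<partial>distr lborel borel (\<lambda>x::'a. - e + x))" using d by simp
  also have "\<dots> = (\<integral>x. g (- e + x) \<partial>lborel)"
    using assms by (intro integral_distr) auto
  finally show ?thesis using 1 by (simp add: has_bochner_integral_iff)
qed

text \<open>Fubini's theorem and translation invariance: each of the translates has the same integral.\<close>

lemma integral_along_segments:
  fixes g :: "real^'d \<Rightarrow> real"
  assumes K: "compact K" and g: "continuous_on K g"
  shows "has_bochner_integral lborel (\<lambda>x. \<integral>s. indicator {s\<in>{0..1}. x - s *\<^sub>R e \<in> K} s * g (x - s *\<^sub>R e) \<partial>lborel)
    (\<integral>x. indicator K x * g x \<partial>lborel)"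
proof -
  define G where "G = (\<lambda>x s. indicator {s\<in>{0..1::real}. x - s *\<^sub>R e \<in> K} s * g (x - s *\<^sub>R e))"
  define S where "S = (\<lambda>(y, s). (y + s *\<^sub>R e, s)) ` (K \<times> {0..1::real})"
  have cS: "compact S" unfolding S_def
    by (intro compact_continuous_image compact_Times K compact_Icc)
      (auto intro!: continuous_intros simp: split_beta)
  have memS: "z \<in> S \<longleftrightarrow> snd z \<in> {0..1} \<and> fst z - snd z *\<^sub>R e \<in> K" for z
    unfolding S_def by (cases z) (force simp: image_iff)
  have "continuous_on S (\<lambda>z. g (fst z - snd z *\<^sub>R e))"
    by (rule continuous_on_compose2[OF g]) (auto intro!: continuous_intros simp: memS)
  then have "integrable lborel (\<lambda>z. indicator S z * g (fst z - snd z *\<^sub>R e))"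
    by (rule indicator_compact_integrable[OF cS])
  moreover have "(\<lambda>z. indicator S z * g (fst z - snd z *\<^sub>R e)) = (\<lambda>(x, s). G x s)"
    by (auto simp: fun_eq_iff G_def memS split: split_indicator)
  ultimately have int: "integrable (lborel \<Otimes>\<^sub>M lborel) (\<lambda>(x, s). G x s)"
    by (simp add: lborel_prod)
  have K': "integrable lborel (\<lambda>x. indicator K x * g x)" by (rule indicator_compact_integrable[OF K g])
  have inner: "(\<integral>x. G x s \<partial>lborel) = indicator {0..1} s * (\<integral>x. indicator K x * g x \<partial>lborel)" for s
  proof -
    have "(\<integral>x. G x s \<partial>lborel) = (\<integral>x. indicator {0..1} s * (indicator K (x - s *\<^sub>R e) * g (x - s *\<^sub>R e)) \<partial>lborel)"
      by (intro Bochner_Integration.integral_cong) (auto simp: G_def split: split_indicator)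
    also have "\<dots> = indicator {0..1} s * (\<integral>x. indicator K x * g x \<partial>lborel)"
      using has_bochner_integral_integral_eq[OF lborel_integral_shift[OF K', of "s *\<^sub>R e"]] by simp
    finally show ?thesis .
  qed
  have "(\<integral>x. (\<integral>s. G x s \<partial>lborel) \<partial>lborel) = (\<integral>s. (\<integral>x. G x s \<partial>lborel) \<partial>lborel)"
    using lborel_pair.Fubini_integral[OF int] by simp
  also have "\<dots> = (\<integral>x. indicator K x * g x \<partial>lborel)"
    unfolding inner by simp
  finally show ?thesis
    using lborel_pair.integrable_fst'[OF int] by (simp add: has_bochner_integral_iff G_def)
qed

text \<open>The fundamental theorem of calculus on the part of the segment from \<open>x\<close> to \<open>x - e\<close> inside the
  simplex. An end of that part is an end of the segment or lies on a facet, and the latter says that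
  \<open>x\<close> is in the oblique slab swept out by that facet.\<close>

lemma segment_integral:
  fixes K :: "(real^'d) set" and f :: "real^'d \<Rightarrow> real"
  assumes K: "full_simplex K"
    and f: "\<And>x. (f has_derivative (\<lambda>h. Df x \<bullet> h)) (at x)" "continuous_on UNIV Df"
    and x: "\<And>a. a \<in> verts K \<Longrightarrow> bary K a x \<noteq> 0 \<and> bary K a (x - e) \<noteq> 0"
      "\<And>a b. a \<in> verts K \<Longrightarrow> b \<in> verts K \<Longrightarrow> a \<noteq> b \<Longrightarrow> bgrad K a \<bullet> e \<noteq> 0 \<Longrightarrow> bgrad K b \<bullet> e \<noteq> 0 \<Longrightarrow>
        (bgrad K b \<bullet> e) * bary K a x \<noteq> (bgrad K a \<bullet> e) * bary K b x"
  shows "(\<integral>s. indicator {s\<in>{0..1}. x - s *\<^sub>R e \<in> K} s * (Df (x - s *\<^sub>R e) \<bullet> e) \<partial>lborel)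
    = indicator K x * f x - indicator K (x - e) * f (x - e)
      - (\<Sum>a\<in>{a\<in>verts K. bgrad K a \<bullet> e \<noteq> 0}. sgn (bgrad K a \<bullet> e) *
          (indicator (slab (bface K a) e) x * f (slab_foot (bface K a) e x)))"
proof -
  define m where "m = (\<lambda>a. bgrad K a \<bullet> e)"
  define I where "I = {a\<in>verts K. m a \<noteq> 0}"
  define t where "t = (\<lambda>a. bary K a x / m a)"
  define \<phi> where "\<phi> = (\<lambda>s. f (x - s *\<^sub>R e))"
  define \<phi>' where "\<phi>' = (\<lambda>s. - (Df (x - s *\<^sub>R e) \<bullet> e))"
  have fin: "finite I" unfolding I_def using verts_props(1)[OF K] by simp
  have line: "bary K a (x - s *\<^sub>R e) = bary K a x - s * m a" for a s
    using bary_diff[of K a "x - s *\<^sub>R e" x] by (simp add: m_def)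
  have linet: "bary K a (x - s *\<^sub>R e) = m a * (t a - s)" if "a \<in> I" for a s
    using that by (simp add: line I_def t_def right_diff_distrib)
  have d\<phi>: "(\<phi> has_real_derivative \<phi>' s) (at s)" for s
  proof -
    have "((\<lambda>s. x - s *\<^sub>R e) has_derivative (\<lambda>h. - (h *\<^sub>R e))) (at s)"
      by (auto intro!: derivative_eq_intros)
    from diff_chain_at[OF this f(1)]
    have "(\<phi> has_derivative (\<lambda>h. Df (x - s *\<^sub>R e) \<bullet> (- (h *\<^sub>R e)))) (at s)"
      by (simp add: \<phi>_def comp_def)
    moreover have "(\<lambda>h. Df (x - s *\<^sub>R e) \<bullet> (- (h *\<^sub>R e))) = (*) (\<phi>' s)"
      by (auto simp: \<phi>'_def)
    ultimately show ?thesis by (simp add: has_field_derivative_def)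
  qed
  have c\<phi>: "continuous_on UNIV \<phi>'" unfolding \<phi>'_def
    by (intro continuous_intros continuous_on_compose2[OF f(2)]) auto
  have t01: "t a \<noteq> 0 \<and> t a \<noteq> 1" if "a \<in> I" for a
    using x(1)[of a] that linet[OF that, of 1] by (auto simp: I_def t_def)
  have inj: "inj_on t I"
  proof (rule inj_onI)
    fix a b assume ab: "a \<in> I" "b \<in> I" "t a = t b"
    show "a = b"
    proof (rule ccontr)
      assume "a \<noteq> b"
      then have "m b * bary K a x \<noteq> m a * bary K b x" using x(2)[of a b] ab by (auto simp: I_def m_def)
      then show False using ab by (auto simp: I_def t_def field_simps)
    qed
  qed
  have sg: "0 \<le> m a * r \<longleftrightarrow> 0 \<le> sgn (m a) * r" if "a \<in> I" for a r
    using that by (auto simp: I_def sgn_if zero_le_mult_iff)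
  define S where "S = {s\<in>{0..1}. \<forall>a\<in>I. 0 \<le> sgn (m a) * (t a - s)}"
  define Z where "Z \<longleftrightarrow> (\<forall>a\<in>verts K - I. 0 \<le> bary K a x)"
  have memK: "x - s *\<^sub>R e \<in> K \<longleftrightarrow> s \<in> S \<and> Z" if "s \<in> {0..1}" for s
  proof -
    have "x - s *\<^sub>R e \<in> K \<longleftrightarrow> (\<forall>a\<in>I. 0 \<le> bary K a (x - s *\<^sub>R e)) \<and> (\<forall>a\<in>verts K - I. 0 \<le> bary K a (x - s *\<^sub>R e))"
      unfolding mem_simplex_iff[OF K] by (auto simp: I_def)
    also have "(\<forall>a\<in>I. 0 \<le> bary K a (x - s *\<^sub>R e)) \<longleftrightarrow> s \<in> S"
      using that by (simp add: S_def linet sg)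
    also have "(\<forall>a\<in>verts K - I. 0 \<le> bary K a (x - s *\<^sub>R e)) \<longleftrightarrow> Z"
      by (auto simp: Z_def line I_def)
    finally show ?thesis .
  qed
  have slab: "indicator (slab (bface K a) e) x * f (slab_foot (bface K a) e x)
      = (if Z then indicator S (t a) * \<phi> (t a) else 0)" if a: "a \<in> I" for a
  proof -
    have av: "a \<in> verts K" "m a \<noteq> 0" using a by (auto simp: I_def)
    obtain c where c: "unit_normal (bface K a) = c *\<^sub>R bgrad K a" "\<bar>c\<bar> * norm (bgrad K a) = 1"
      using unit_normal_parallel[OF K av(1)] by blast
    have nz: "e \<bullet> unit_normal (bface K a) \<noteq> 0"
      using av(2) c by (auto simp: m_def inner_commute)
    show ?thesis
    proof (cases "x \<in> slab (bface K a) e")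
      case True
      then obtain y s where y: "y \<in> bface K a" "x = y + s *\<^sub>R e" "0 \<le> s" "s \<le> 1" by (auto simp: slab_def)
      have ye: "y = x - s *\<^sub>R e" using y(2) by simp
      have "m a * (t a - s) = 0" using y(1) linet[OF a, of s] by (simp add: ye bface_def)
      then have s: "s = t a" using av by simp
      have "x - t a *\<^sub>R e \<in> K" using y(1) ye s by (simp add: bface_def)
      then have "t a \<in> S \<and> Z" using memK[of "t a"] y s by auto
      moreover have "slab_foot (bface K a) e x = y"
        using slab_foot_slab[OF flat_bface[OF K av(1)] nz y(1), of s] unfolding y(2)[symmetric] .
      then have "slab_foot (bface K a) e x = x - t a *\<^sub>R e" unfolding ye s .
      ultimately show ?thesis using True by (simp add: \<phi>_def)
    next
      case False
      have "\<not> (t a \<in> S \<and> Z)"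
      proof
        assume tS: "t a \<in> S \<and> Z"
        then have t: "t a \<in> {0..1}" by (auto simp: S_def)
        then have "x - t a *\<^sub>R e \<in> bface K a" using memK[OF t] tS linet[OF a, of "t a"] by (simp add: bface_def)
        moreover have "x = (x - t a *\<^sub>R e) + t a *\<^sub>R e" by simp
        ultimately have "x \<in> slab (bface K a) e" unfolding slab_def using t by fastforce
        then show False using False by blast
      qed
      then show ?thesis using False by auto
    qed
  qed
  have cut: "(\<integral>s. indicator S s * \<phi>' s \<partial>lborel) = indicator S 1 * \<phi> 1 - indicator S 0 * \<phi> 0
      + (\<Sum>b\<in>I. sgn (m b) * (indicator S (t b) * \<phi> (t b)))"
    unfolding S_def
    by (rule integral_cut_interval[OF fin _ inj _ d\<phi> c\<phi>]) (use t01 in \<open>auto simp: I_def sgn_if\<close>)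
  have "(\<integral>s. indicator {s\<in>{0..1}. x - s *\<^sub>R e \<in> K} s * (Df (x - s *\<^sub>R e) \<bullet> e) \<partial>lborel)
      = (if Z then - (\<integral>s. indicator S s * \<phi>' s \<partial>lborel) else 0)"
  proof -
    have "indicator {s\<in>{0..1}. x - s *\<^sub>R e \<in> K} s * (Df (x - s *\<^sub>R e) \<bullet> e)
        = (if Z then - (indicator S s * \<phi>' s) else 0)" for s
      using memK[of s] by (cases "s \<in> {0..1}") (auto simp: \<phi>'_def S_def split: split_indicator)
    then show ?thesis by simp
  qed
  moreover have "indicator K x = (if Z then indicator S 0 else (0::real))"
    using memK[of 0] by (auto split: split_indicator)
  moreover have "indicator K (x - e) = (if Z then indicator S 1 else (0::real))"
    using memK[of 1] by (auto split: split_indicator)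
  moreover have "(\<Sum>a\<in>I. sgn (m a) * (indicator (slab (bface K a) e) x * f (slab_foot (bface K a) e x)))
      = (if Z then (\<Sum>b\<in>I. sgn (m b) * (indicator S (t b) * \<phi> (t b))) else 0)"
    by (simp add: slab)
  ultimately have "(\<integral>s. indicator {s\<in>{0..1}. x - s *\<^sub>R e \<in> K} s * (Df (x - s *\<^sub>R e) \<bullet> e) \<partial>lborel)
    = indicator K x * f x - indicator K (x - e) * f (x - e)
      - (\<Sum>a\<in>I. sgn (m a) * (indicator (slab (bface K a) e) x * f (slab_foot (bface K a) e x)))"
    by (simp add: cut) (simp add: \<phi>_def)
  then show ?thesis unfolding I_def m_def .
qed

text \<open>Averaging the derivative along the translates of the simplex by \<open>s e\<close>, \<open>0 \<le> s \<le> 1\<close>, turns the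
  volume integral into integrals over the oblique slabs swept out by the facets; the two terms that do
  not come from the boundary are translates of each other and cancel.\<close>

lemma simplex_divergence:
  fixes K :: "(real^'d) set" and f :: "real^'d \<Rightarrow> real"
  assumes d: "CARD('d) = 2 \<or> CARD('d) = 3" and K: "full_simplex K"
    and f: "\<And>x. (f has_derivative (\<lambda>h. Df x \<bullet> h)) (at x)" "continuous_on UNIV Df"
  shows "(LINT x:K|lebesgue. Df x \<bullet> e)
    = (\<Sum>a\<in>verts K. (outer_normal K (bface K a) \<bullet> e) * face_integral (bface K a) f)"
proof -
  define m where "m = (\<lambda>a. bgrad K a \<bullet> e)"
  define I where "I = {a\<in>verts K. m a \<noteq> 0}"
  have fin: "finite (verts K)" by (rule verts_props(1)[OF K])
  have cK: "compact K" by (rule full_simplex_compact[OF K])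
  have cf: "continuous_on S f" for S
    using f(1) by (meson continuous_at_imp_continuous_on has_derivative_continuous)
  have cDf: "continuous_on S (\<lambda>x. Df x \<bullet> e)" for S
    by (intro continuous_intros continuous_on_subset[OF f(2)]) auto
  have lhs: "(LINT x:K|lebesgue. Df x \<bullet> e) = (\<integral>x. indicator K x * (Df x \<bullet> e) \<partial>lborel)"
    unfolding set_lebesgue_integral_def real_scaleR_def
    by (rule integral_completion) (use indicator_compact_integrable[OF cK cDf] in auto)
  have nz: "e \<bullet> unit_normal (bface K a) \<noteq> 0"
    "\<bar>e \<bullet> unit_normal (bface K a)\<bar> = \<bar>m a\<bar> / norm (bgrad K a)" if a: "a \<in> I" for a
  proof -
    have av: "a \<in> verts K" "m a \<noteq> 0" using a by (auto simp: I_def)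
    obtain c where c: "unit_normal (bface K a) = c *\<^sub>R bgrad K a" "\<bar>c\<bar> * norm (bgrad K a) = 1"
      using unit_normal_parallel[OF K av(1)] by blast
    show "e \<bullet> unit_normal (bface K a) \<noteq> 0" using av(2) c by (auto simp: m_def inner_commute)
    have "\<bar>c\<bar> = 1 / norm (bgrad K a)" using c(2) bgrad_nonzero[OF K av(1)] by (simp add: field_simps)
    then show "\<bar>e \<bullet> unit_normal (bface K a)\<bar> = \<bar>m a\<bar> / norm (bgrad K a)"
      by (simp add: c(1) abs_mult m_def inner_commute)
  qed
  have slab: "has_bochner_integral lborel
      (\<lambda>x. indicator (slab (bface K a) e) x * f (slab_foot (bface K a) e x))
      (\<bar>e \<bullet> unit_normal (bface K a)\<bar> * face_integral (bface K a) f)" if a: "a \<in> I" for a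
  proof -
    have F: "flat (bface K a)" using flat_bface[OF K] a by (simp add: I_def)
    note b = slab_integrand_borel[OF F nz(1)[OF a] cf]
    have "integrable lborel (\<lambda>x. indicator (slab (bface K a) e) x * f (slab_foot (bface K a) e x))"
    proof -
      have "(\<lambda>x. indicator (slab (bface K a) e) x * f (slab_foot (bface K a) e x)) \<in> borel_measurable lborel"
        using b(1) by simp
      from integrable_completion[OF this] b(2) show ?thesis unfolding set_integrable_def by simp
    qed
    moreover have "(\<integral>x. indicator (slab (bface K a) e) x * f (slab_foot (bface K a) e x) \<partial>lborel)
        = (LINT x:slab (bface K a) e|lebesgue. f (slab_foot (bface K a) e x))"
      unfolding set_lebesgue_integral_def real_scaleR_def
      by (rule integral_completion[symmetric]) (use b(1) in simp)
    ultimately show ?thesis using slab_integral[OF d F nz(1)[OF a] cf]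
      by (simp add: has_bochner_integral_iff)
  qed
  \<comment> \<open>For almost every \<open>x\<close> the segment starts and ends off the planes of the facets and meets no two of
    them at once; the gradients of two coordinates are independent because there is a third vertex.\<close>
  have good: "AE x in lborel. (\<forall>a\<in>verts K. bary K a x \<noteq> 0 \<and> bary K a (x - e) \<noteq> 0) \<and>
      (\<forall>a\<in>I. \<forall>b\<in>I. a \<noteq> b \<longrightarrow> m b * bary K a x \<noteq> m a * bary K b x)"
  proof (intro AE_conjI AE_finite_allI fin)
    fix a assume a: "a \<in> verts K"
    show "AE x in lborel. bary K a x \<noteq> 0"
      unfolding bary_def by (rule AE_affine_nonzero[OF bgrad_nonzero[OF K a]])
    show "AE x in lborel. bary K a (x - e) \<noteq> 0"
      using AE_affine_nonzero[OF bgrad_nonzero[OF K a], of "snd (bcoef K a) - bgrad K a \<bullet> e"]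
      by (auto simp: bary_def inner_diff_right algebra_simps)
  next
    show "finite I" "finite I" using fin by (auto simp: I_def)
    fix a b assume ab: "a \<in> I" "b \<in> I"
    show "AE x in lborel. a \<noteq> b \<longrightarrow> m b * bary K a x \<noteq> m a * bary K b x"
    proof (cases "a = b")
      case False
      have av: "a \<in> verts K" "b \<in> verts K" "m b \<noteq> 0" using ab by (auto simp: I_def)
      have "\<not> verts K \<subseteq> {a, b}"
        using verts_props(2)[OF K] card_mono[of "{a, b}" "verts K"] d False by auto
      then obtain c where c: "c \<in> verts K" "c \<noteq> a" "c \<noteq> b" by blast
      have "m b *\<^sub>R bgrad K a - m a *\<^sub>R bgrad K b \<noteq> 0"
      proof
        assume z: "m b *\<^sub>R bgrad K a - m a *\<^sub>R bgrad K b = 0"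
        have 1: "bgrad K a \<bullet> (a - c) = 1"
          using bary_diff[of K a a c] bary_vertex[OF K av(1,1)] bary_vertex[OF K av(1) c(1)] c by simp
        have 2: "bgrad K b \<bullet> (a - c) = 0"
          using bary_diff[of K b a c] bary_vertex[OF K av(2,1)] bary_vertex[OF K av(2) c(1)] c False by simp
        have "(m b *\<^sub>R bgrad K a - m a *\<^sub>R bgrad K b) \<bullet> (a - c) = m b"
          unfolding inner_diff_left inner_scaleR_left 1 2 by simp
        then show False using z av(3) by simp
      qed
      from AE_affine_nonzero[OF this, of "m b * snd (bcoef K a) - m a * snd (bcoef K b)"]
      show ?thesis by (auto simp: bary_def inner_diff_left algebra_simps)
    qed simp
  qed
  have K': "integrable lborel (\<lambda>x. indicator K x * f x)" by (rule indicator_compact_integrable[OF cK cf])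
  have F: "has_bochner_integral lborel
      (\<lambda>x. indicator K x * f x - indicator K (x - e) * f (x - e)
        - (\<Sum>a\<in>I. sgn (m a) * (indicator (slab (bface K a) e) x * f (slab_foot (bface K a) e x))))
      ((\<integral>x. indicator K x * f x \<partial>lborel) - (\<integral>x. indicator K x * f x \<partial>lborel)
        - (\<Sum>a\<in>I. sgn (m a) * (\<bar>e \<bullet> unit_normal (bface K a)\<bar> * face_integral (bface K a) f)))"
    by (intro has_bochner_integral_diff has_bochner_integral_sum has_bochner_integral_mult_right slab
        has_bochner_integral_integrable K' lborel_integral_shift[OF K'])
  have FG: "AE x in lborel. indicator K x * f x - indicator K (x - e) * f (x - e)
        - (\<Sum>a\<in>I. sgn (m a) * (indicator (slab (bface K a) e) x * f (slab_foot (bface K a) e x)))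
      = (\<integral>s. indicator {s\<in>{0..1}. x - s *\<^sub>R e \<in> K} s * (Df (x - s *\<^sub>R e) \<bullet> e) \<partial>lborel)"
    using good
  proof eventually_elim
    case (elim x)
    show ?case unfolding I_def m_def
      by (rule segment_integral[OF K f, symmetric]) (use elim in \<open>auto simp: I_def m_def\<close>)
  qed
  note G = integral_along_segments[OF cK cDf, of e]
  have "(\<integral>x. indicator K x * (Df x \<bullet> e) \<partial>lborel)
      = - (\<Sum>a\<in>I. sgn (m a) * (\<bar>e \<bullet> unit_normal (bface K a)\<bar> * face_integral (bface K a) f))"
    using integral_cong_AE[OF borel_measurable_integrable[OF conjunct1[OF F[unfolded has_bochner_integral_iff]]]
        borel_measurable_integrable[OF conjunct1[OF G[unfolded has_bochner_integral_iff]]] FG]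
    unfolding has_bochner_integral_integral_eq[OF F] has_bochner_integral_integral_eq[OF G] by simp
  also have "\<dots> = (\<Sum>a\<in>I. (outer_normal K (bface K a) \<bullet> e) * face_integral (bface K a) f)"
    unfolding sum_negf[symmetric]
  proof (rule sum.cong)
    fix a assume a: "a \<in> I"
    then have av: "a \<in> verts K" by (simp add: I_def)
    have "sgn (m a) * \<bar>m a\<bar> = m a" by (simp add: sgn_mult_abs)
    then show "- (sgn (m a) * (\<bar>e \<bullet> unit_normal (bface K a)\<bar> * face_integral (bface K a) f))
        = (outer_normal K (bface K a) \<bullet> e) * face_integral (bface K a) f"
      unfolding nz(2)[OF a] outer_normal_bface[OF K av] by (simp add: mult.assoc[symmetric]) (simp add: m_def)
  qed simp
  also have "\<dots> = (\<Sum>a\<in>verts K. (outer_normal K (bface K a) \<bullet> e) * face_integral (bface K a) f)"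
    by (rule sum.mono_neutral_left) (use fin in \<open>auto simp: I_def m_def outer_normal_bface[OF K]\<close>)
  finally show ?thesis using lhs by simp
qed

section \<open>Combinatorial topology of a mesh\<close>

locale mesh =
  fixes \<Omega> :: "(real^'d) set" and \<T> :: "(real^'d) set set"
  assumes dim: "CARD('d) = 2 \<or> CARD('d) = 3"
    and domain: "polygonal_domain \<Omega>"
    and mesh: "simplicial_mesh \<Omega> \<T>"
begin

lemma finite_mesh: "finite \<T>"
  using mesh by (simp add: simplicial_mesh_def triangulation_def)

lemma simplex: "K \<in> \<T> \<Longrightarrow> full_simplex K"
  using mesh by (simp add: simplicial_mesh_def)

lemma Union_mesh: "\<Union>\<T> = closure \<Omega>"
  using mesh by (simp add: simplicial_mesh_def)

lemma face_inter: "K \<in> \<T> \<Longrightarrow> K' \<in> \<T> \<Longrightarrow> K \<inter> K' face_of K"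
  using mesh by (simp add: simplicial_mesh_def triangulation_def)

lemma face_inter': "K \<in> \<T> \<Longrightarrow> K' \<in> \<T> \<Longrightarrow> K \<inter> K' face_of K'"
  using face_inter[of K' K] by (simp add: Int_commute)

lemma open_domain: "open \<Omega>" and domain_nonempty: "\<Omega> \<noteq> {}" and bounded_domain: "bounded \<Omega>"
  and interior_closure_domain: "interior (closure \<Omega>) = \<Omega>"
  using domain by (simp_all add: polygonal_domain_def)

lemma subset_closure: "K \<in> \<T> \<Longrightarrow> K \<subseteq> closure \<Omega>"
  using Union_mesh by blast

lemma interior_subset_domain: "K \<in> \<T> \<Longrightarrow> interior K \<subseteq> \<Omega>"
  using interior_mono[OF subset_closure] interior_closure_domain by blast

lemma mesh_nonempty: "\<T> \<noteq> {}"
  using Union_mesh domain_nonempty closure_subset[of \<Omega>] by auto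

text \<open>The intersection of two elements is a face, and a face through an interior point is everything.\<close>

lemma subset_if_interior_meets:
  assumes "K \<in> \<T>" "K' \<in> \<T>" "interior K \<inter> K' \<noteq> {}"
  shows "K \<subseteq> K'"
proof -
  have "rel_interior K = interior K"
    by (rule rel_interior_nonempty_interior[OF interior_simplex_nonempty[OF simplex[OF assms(1)]]])
  then have "(K \<inter> K') \<inter> rel_interior K \<noteq> {}" using assms(3) interior_subset by blast
  then have "K \<subseteq> K \<inter> K'" by (rule subset_of_face_of[OF face_inter[OF assms(1,2)] order.refl])
  then show ?thesis by blast
qed

lemma eq_if_interior_meets:
  assumes "K \<in> \<T>" "K' \<in> \<T>" "interior K \<inter> K' \<noteq> {}"
  shows "K = K'"
proof
  show "K \<subseteq> K'" by (rule subset_if_interior_meets[OF assms])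
  then have "interior K' \<inter> K \<noteq> {}"
    using interior_mono[of K K'] interior_simplex_nonempty[OF simplex[OF assms(1)]] interior_subset by fast
  then show "K' \<subseteq> K" by (rule subset_if_interior_meets[OF assms(2,1)])
qed

text \<open>Both coordinates are affine and vanish exactly on the plane of the facet, so they are proportional.\<close>

lemma common_facet_bary:
  assumes K: "K \<in> \<T>" "K' \<in> \<T>" and a: "a \<in> verts K" "a' \<in> verts K'" and F: "bface K a = bface K' a'"
  obtains c where "c \<noteq> 0" "\<And>x. bary K' a' x = c * bary K a x" "bgrad K' a' = c *\<^sub>R bgrad K a"
proof -
  note S = simplex[OF K(1)] simplex[OF K(2)]
  obtain w where w: "w \<in> verts K" "w \<noteq> a" using other_vertex[OF S(1)] by metis
  have n: "\<forall>x\<in>bface K a. \<forall>y\<in>bface K a. (x - y) \<bullet> bgrad K' a' = 0"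
    unfolding F using bface_inner_bgrad by blast
  define c where "c = (a - w) \<bullet> bgrad K' a'"
  have c: "bgrad K' a' = c *\<^sub>R bgrad K a" unfolding c_def by (rule bface_normal[OF S(1) a(1) w n])
  have "c \<noteq> 0" using bgrad_nonzero[OF S(2) a(2)] c by auto
  moreover have "bary K' a' x = c * bary K a x" for x
  proof -
    have wF: "w \<in> bface K a" using w bary_vertex[OF S(1) a(1) w(1)] verts_subset by (auto simp: bface_def)
    have "bary K a w = 0" using wF by (simp add: bface_def)
    moreover have "bary K' a' w = 0" using wF unfolding F by (simp add: bface_def)
    ultimately show ?thesis using bary_diff[of K' a' x w] bary_diff[of K a x w] by (simp add: c)
  qed
  ultimately show ?thesis using that c by blast
qed

lemma common_facet_vertex:
  assumes K: "K \<in> \<T>" "K' \<in> \<T>" and a: "a \<in> verts K" "a' \<in> verts K'" and F: "bface K a = bface K' a'"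
    and x: "x \<in> bface K a" "\<forall>b\<in>verts K - {a}. 0 < bary K b x"
  shows "\<forall>b\<in>verts K' - {a'}. 0 < bary K' b x"
proof
  note S = simplex[OF K(1)] simplex[OF K(2)]
  fix b assume b: "b \<in> verts K' - {a'}"
  then have "b \<in> bface K a" unfolding F using bary_vertex[OF S(2) a(2), of b] verts_subset by (auto simp: bface_def)
  then have bK: "b \<in> K" "bary K a b = 0" by (auto simp: bface_def)
  have "b \<in> verts K"
    by (rule bary_common_face(3)[OF S(2,1)]) (use face_inter[OF K] face_inter'[OF K] b bK x F in \<open>auto simp: Int_commute bface_def\<close>)
  moreover have "b \<noteq> a" using bK(2) bary_vertex[OF S(1) a(1,1)] by auto
  moreover have "bary K' b x = bary K b x"
    by (rule bary_common_face(1)[OF S(2,1)]) (use face_inter[OF K] face_inter'[OF K] b x F calculation in \<open>auto simp: Int_commute bface_def\<close>)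
  ultimately show "0 < bary K' b x" using x(2) by simp
qed

text \<open>On the same side of the facet they would share interior points near it.\<close>

lemma common_facet_opposite:
  assumes K: "K \<in> \<T>" "K' \<in> \<T>" "K \<noteq> K'" and a: "a \<in> verts K" "a' \<in> verts K'" and F: "bface K a = bface K' a'"
  obtains c where "c < 0" "\<And>x. bary K' a' x = c * bary K a x" "bgrad K' a' = c *\<^sub>R bgrad K a"
proof -
  note S = simplex[OF K(1)] simplex[OF K(2)]
  obtain c where c: "c \<noteq> 0" "\<And>x. bary K' a' x = c * bary K a x" "bgrad K' a' = c *\<^sub>R bgrad K a"
    using common_facet_bary[OF K(1,2) a F] by metis
  have "bface K a \<noteq> {}" using flat_bface[OF S(1) a(1)] by (simp add: flat_def)
  then obtain z where "z \<in> bface K a" by blast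
  then obtain x where x: "bary K a x = 0" "\<forall>b\<in>verts K - {a}. 0 < bary K b x" "x \<in> bface K a"
    using bface_rel_interior_point[OF S(1) a(1) _ zero_less_one] by metis
  have x': "bary K' a' x = 0" "\<forall>b\<in>verts K' - {a'}. 0 < bary K' b x"
    using c(2) x common_facet_vertex[OF K(1,2) a F x(3,2)] by auto
  obtain \<rho> where \<rho>: "\<rho> > 0" "\<forall>y\<in>ball x \<rho>. y \<in> K \<longleftrightarrow> 0 \<le> bary K a y"
    using half_ball[OF S(1) a(1) x(1,2)] by blast
  obtain \<rho>' where \<rho>': "\<rho>' > 0" "\<forall>y\<in>ball x \<rho>'. y \<in> K' \<longleftrightarrow> 0 \<le> bary K' a' y"
    using half_ball[OF S(2) a(2) x'] by blast
  have "c < 0"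
  proof (rule ccontr)
    assume "\<not> c < 0"
    then have cp: "c > 0" using c(1) by simp
    define U where "U = ball x (min \<rho> \<rho>') \<inter> {y. 0 < bary K a y}"
    have "open U" unfolding U_def by (intro open_Int open_ball open_Collect_less continuous_intros)
    have UK: "U \<subseteq> K" "U \<subseteq> K'" unfolding U_def using \<rho>(2) \<rho>'(2) c(2) cp by (auto simp: less_imp_le)
    define g where "g = norm (bgrad K a)"
    have g: "g > 0" using bgrad_nonzero[OF S(1) a(1)] by (simp add: g_def)
    define y where "y = x + (min \<rho> \<rho>' / (2 * g)) *\<^sub>R bgrad K a"
    have "norm ((min \<rho> \<rho>' / (2 * g)) *\<^sub>R bgrad K a) < min \<rho> \<rho>'"
      using g \<rho>(1) \<rho>'(1) by (simp add: g_def[symmetric]) (auto simp: min_def)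
    then have "y \<in> ball x (min \<rho> \<rho>')" by (simp only: y_def mem_ball dist_norm) (simp add: norm_minus_commute)
    moreover have "0 < bary K a y" using g \<rho>(1) \<rho>'(1) x(1) by (simp add: y_def bary_add g_def)
    ultimately have "y \<in> U" by (simp add: U_def)
    then have "y \<in> interior K" using UK(1) \<open>open U\<close> interior_maximal by blast
    then have "K = K'" using eq_if_interior_meets[OF K(1,2)] UK(2) \<open>y \<in> U\<close> by blast
    then show False using K(3) by simp
  qed
  then show ?thesis using that c(2,3) by blast
qed

lemma facet_bface: "K \<in> \<T> \<Longrightarrow> F facet_of K \<longleftrightarrow> (\<exists>a\<in>verts K. F = bface K a)"
  by (rule facet_iff_bface[OF simplex])

text \<open>Among three elements two would lie on the same side.\<close>

lemma facet_two_elements: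
  assumes "K1 \<in> \<T>" "K2 \<in> \<T>" "K3 \<in> \<T>" "F facet_of K1" "F facet_of K2" "F facet_of K3"
  shows "K1 = K2 \<or> K1 = K3 \<or> K2 = K3"
proof (rule ccontr)
  assume "\<not> (K1 = K2 \<or> K1 = K3 \<or> K2 = K3)"
  then have ne: "K1 \<noteq> K2" "K1 \<noteq> K3" "K2 \<noteq> K3" by auto
  obtain a1 a2 a3 where a: "a1 \<in> verts K1" "F = bface K1 a1" "a2 \<in> verts K2" "F = bface K2 a2"
      "a3 \<in> verts K3" "F = bface K3 a3" using assms facet_bface by meson
  obtain c12 where c12: "c12 < 0" "\<And>x. bary K2 a2 x = c12 * bary K1 a1 x"
    using common_facet_opposite[OF assms(1,2) ne(1) a(1,3)] a(2,4) by metis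
  obtain c13 where c13: "c13 < 0" "\<And>x. bary K3 a3 x = c13 * bary K1 a1 x"
    using common_facet_opposite[OF assms(1,3) ne(2) a(1,5)] a(2,6) by metis
  obtain c23 where c23: "c23 < 0" "\<And>x. bary K3 a3 x = c23 * bary K2 a2 x"
    using common_facet_opposite[OF assms(2,3) ne(3) a(3,5)] a(4,6) by metis
  have "c13 = c23 * c12"
    using c12(2)[of a1] c13(2)[of a1] c23(2)[of a1] bary_vertex[OF simplex[OF assms(1)] a(1,1)] by simp
  then show False using c12(1) c13(1) c23(1) mult_neg_neg[of c23 c12] by linarith
qed

lemma common_facet_outer_normal:
  assumes K: "K \<in> \<T>" "K' \<in> \<T>" "K \<noteq> K'" and F: "F facet_of K" "F facet_of K'"
  shows "outer_normal K' F = - outer_normal K F"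
proof -
  obtain a a' where a: "a \<in> verts K" "F = bface K a" "a' \<in> verts K'" "F = bface K' a'"
    using assms facet_bface by meson
  obtain c where c: "c < 0" "bgrad K' a' = c *\<^sub>R bgrad K a"
    using common_facet_opposite[OF K a(1,3)] a(2,4) by metis
  have "outer_normal K' F = - (1 / norm (bgrad K' a')) *\<^sub>R bgrad K' a'"
    using outer_normal_bface[OF simplex[OF K(2)] a(3)] a(4) by simp
  also have "\<dots> = (1 / norm (bgrad K a)) *\<^sub>R bgrad K a" using c by simp
  also have "\<dots> = - outer_normal K F"
    using outer_normal_bface[OF simplex[OF K(1)] a(1)] a(2) by simp
  finally show ?thesis .
qed

text \<open>Around a relatively interior point of the common facet the two half balls fill a ball.\<close>

lemma common_facet_not_frontier:
  assumes K: "K \<in> \<T>" "K' \<in> \<T>" "K \<noteq> K'" and F: "F facet_of K" "F facet_of K'"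
  shows "\<not> F \<subseteq> frontier \<Omega>"
proof -
  note S = simplex[OF K(1)] simplex[OF K(2)]
  obtain a a' where a: "a \<in> verts K" "F = bface K a" "a' \<in> verts K'" "F = bface K' a'"
    using assms facet_bface by meson
  have FF: "bface K a = bface K' a'" using a by simp
  obtain c where c: "c < 0" "\<And>x. bary K' a' x = c * bary K a x"
    using common_facet_opposite[OF K a(1,3) FF] by metis
  have "bface K a \<noteq> {}" using flat_bface[OF S(1) a(1)] by (simp add: flat_def)
  then obtain z where "z \<in> bface K a" by blast
  then obtain x where x: "bary K a x = 0" "\<forall>b\<in>verts K - {a}. 0 < bary K b x" "x \<in> bface K a"
    using bface_rel_interior_point[OF S(1) a(1) _ zero_less_one] by metis
  have x': "bary K' a' x = 0" "\<forall>b\<in>verts K' - {a'}. 0 < bary K' b x"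
    using c(2) x common_facet_vertex[OF K(1,2) a(1,3) FF x(3,2)] by auto
  obtain \<rho> where \<rho>: "\<rho> > 0" "\<forall>y\<in>ball x \<rho>. y \<in> K \<longleftrightarrow> 0 \<le> bary K a y"
    using half_ball[OF S(1) a(1) x(1,2)] by blast
  obtain \<rho>' where \<rho>': "\<rho>' > 0" "\<forall>y\<in>ball x \<rho>'. y \<in> K' \<longleftrightarrow> 0 \<le> bary K' a' y"
    using half_ball[OF S(2) a(3) x'] by blast
  have "ball x (min \<rho> \<rho>') \<subseteq> K \<union> K'"
  proof
    fix y assume y: "y \<in> ball x (min \<rho> \<rho>')"
    show "y \<in> K \<union> K'"
    proof (cases "0 \<le> bary K a y")
      case True
      then show ?thesis using \<rho>(2) y by simp
    next
      case False
      then have "0 \<le> bary K' a' y" using c by (simp add: mult_nonpos_nonpos less_imp_le)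
      then show ?thesis using \<rho>'(2) y by simp
    qed
  qed
  then have "ball x (min \<rho> \<rho>') \<subseteq> closure \<Omega>" using subset_closure K by blast
  then have "x \<in> interior (closure \<Omega>)" using \<rho>(1) \<rho>'(1) by (auto intro!: interiorI[of "ball x (min \<rho> \<rho>')"])
  then have "x \<in> \<Omega>" using interior_closure_domain by simp
  then have "x \<notin> frontier \<Omega>" using open_domain by (simp add: frontier_def interior_open)
  then show ?thesis using x(3) a(2) by blast
qed

text \<open>A common point off the facet would, together with the facet, span common interior points.\<close>

lemma common_facet_inter:
  assumes K: "K \<in> \<T>" "K' \<in> \<T>" "K \<noteq> K'" and F: "F facet_of K" "F facet_of K'"
  shows "F = K \<inter> K'"
proof
  show "F \<subseteq> K \<inter> K'" using F facet_of_imp_subset by blast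
  note S = simplex[OF K(1)]
  obtain a where a: "a \<in> verts K" "F = bface K a" using F(1) facet_bface[OF K(1)] by blast
  show "K \<inter> K' \<subseteq> F"
  proof
    fix x assume x: "x \<in> K \<inter> K'"
    have bx: "0 \<le> bary K b x" if "b \<in> verts K" for b using x that mem_simplex_iff[OF S] by blast
    show "x \<in> F"
    proof (rule ccontr)
      assume "x \<notin> F"
      then have pos: "0 < bary K a x" using x bx[OF a(1)] a(2) by (auto simp: bface_def order_less_le)
      have "bface K a \<noteq> {}" using flat_bface[OF S a(1)] by (simp add: flat_def)
      then obtain z where "z \<in> bface K a" by blast
      then obtain y where y: "bary K a y = 0" "\<forall>b\<in>verts K - {a}. 0 < bary K b y" "y \<in> bface K a"
        using bface_rel_interior_point[OF S a(1) _ zero_less_one] by metis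
      define m where "m = (1/2) *\<^sub>R x + (1/2) *\<^sub>R y"
      have bm: "bary K b m = (bary K b x + bary K b y) / 2" for b
        by (simp add: m_def bary_def inner_add_right)
      have "m \<in> interior K" unfolding interior_simplex_bary[OF S]
      proof (intro CollectI ballI)
        fix b assume b: "b \<in> verts K"
        show "0 < bary K b m" unfolding bm using b y(1,2) bx[OF b] pos by (cases "b = a") (auto simp: add_nonneg_pos)
      qed
      moreover have "y \<in> K \<inter> K'" using y(3) a(2) F facet_of_imp_subset by blast
      then have "m \<in> K \<inter> K'" unfolding m_def
        using convexD[OF convex_Int[OF full_simplex_convex[OF S] full_simplex_convex[OF simplex[OF K(2)]]] x, of y "1/2" "1/2"]
        by simp
      ultimately have "K = K'" using eq_if_interior_meets[OF K(1,2)] by blast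
      then show False using K(3) by simp
    qed
  qed
qed

lemma interior_face_iff:
  "F \<in> interior_faces \<T> \<longleftrightarrow> (\<exists>K\<in>\<T>. \<exists>K'\<in>\<T>. K \<noteq> K' \<and> F facet_of K \<and> F facet_of K')"
  unfolding interior_faces_def using common_facet_inter by blast

text \<open>If no other element has \<open>F\<close> as a facet, then no other element contains a given relatively interior
  point of \<open>F\<close>, so near that point the elements leave the outer half ball uncovered and the point
  cannot be in the open domain.\<close>

lemma facet_cases:
  assumes K: "K \<in> \<T>" and F: "F facet_of K"
  shows "F \<subseteq> frontier \<Omega> \<or> (\<exists>K'\<in>\<T>. K' \<noteq> K \<and> F facet_of K')"
proof (rule disjCI)
  assume no: "\<not> (\<exists>K'\<in>\<T>. K' \<noteq> K \<and> F facet_of K')"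
  note S = simplex[OF K]
  obtain a where a: "a \<in> verts K" "F = bface K a" using F facet_bface[OF K] by blast
  show "F \<subseteq> frontier \<Omega>"
  proof (rule ccontr)
    assume "\<not> F \<subseteq> frontier \<Omega>"
    then obtain z where z: "z \<in> F" "z \<notin> frontier \<Omega>" by blast
    have "z \<in> closure \<Omega>" using z(1) facet_of_imp_subset[OF F] subset_closure[OF K] by blast
    then have "z \<in> \<Omega>" using z(2) open_domain by (simp add: frontier_def interior_open)
    then obtain e where e: "e > 0" "ball z e \<subseteq> \<Omega>" using open_domain open_contains_ball by blast
    obtain x where x: "bary K a x = 0" "\<forall>b\<in>verts K - {a}. 0 < bary K b x" "x \<in> bface K a" "dist x z < e"
      using bface_rel_interior_point[OF S a(1)] z(1) a(2) e(1) by metis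
    have x\<Omega>: "x \<in> \<Omega>" using e(2) x(4) by (auto simp: dist_commute)
    have out: "x \<notin> K'" if K': "K' \<in> \<T>" "K' \<noteq> K" for K'
    proof
      assume xK': "x \<in> K'"
      have xKK: "x \<in> K \<inter> K'" using xK' x(3) by (simp add: bface_def)
      have sub: "F \<subseteq> K'"
      proof
        fix y assume y: "y \<in> F"
        have v: "b \<in> K'" if b: "b \<in> verts K - {a}" for b
        proof (rule ccontr)
          assume "b \<notin> K'"
          then have "bary K b x = 0"
            using bary_common_face(2)[OF S simplex[OF K'(1)] face_inter[OF K K'(1)] face_inter'[OF K K'(1)] xKK] b
            by blast
          then show False using bspec[OF x(2) b] by simp
        qed
        have "convex hull (verts K - {a}) \<subseteq> K'"
          by (rule hull_minimal) (use v full_simplex_convex[OF simplex[OF K'(1)]] in auto)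
        then show "y \<in> K'" using y a bface_hull[OF S a(1)] by blast
      qed
      have KK: "K \<inter> K' \<noteq> K"
      proof
        assume "K \<inter> K' = K"
        then have "interior K \<inter> K' \<noteq> {}" using interior_simplex_nonempty[OF S] interior_subset by blast
        then show False using eq_if_interior_meets[OF K K'(1)] K'(2) by blast
      qed
      have "F \<subseteq> K \<inter> K'" using sub facet_of_imp_subset[OF F] by blast
      then have "aff_dim F \<le> aff_dim (K \<inter> K')" by (rule aff_dim_subset)
      moreover have "aff_dim (K \<inter> K') < aff_dim K"
        by (rule face_of_aff_dim_lt[OF full_simplex_convex[OF S] face_inter[OF K K'(1)] KK])
      moreover have "aff_dim K = aff_dim K'" using aff_dim_simplex[OF S] aff_dim_simplex[OF simplex[OF K'(1)]] by simp
      moreover have "F = K \<inter> K'"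
      proof -
        have "F face_of K \<inter> K'"
          using face_of_subset[OF facet_of_imp_face_of[OF F] \<open>F \<subseteq> K \<inter> K'\<close>] by simp
        moreover have "aff_dim F = aff_dim K - 1" using F by (simp add: facet_of_def)
        ultimately show ?thesis
          using face_of_aff_dim_lt[OF convex_Int[OF full_simplex_convex[OF S] full_simplex_convex[OF simplex[OF K'(1)]]], of F]
            \<open>aff_dim (K \<inter> K') < aff_dim K\<close> by fastforce
      qed
      ultimately have "F facet_of K'"
        using face_inter'[OF K K'(1)] F by (simp add: facet_of_def)
      then show False using no K' by blast
    qed
    have cl: "closed (\<Union>(\<T> - {K}))"
      using finite_mesh full_simplex_compact[OF simplex] by (intro closed_Union) (auto simp: compact_imp_closed)
    have "x \<in> \<Omega> \<inter> - \<Union>(\<T> - {K})" using x\<Omega> out by blast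
    moreover have "open (\<Omega> \<inter> - \<Union>(\<T> - {K}))" by (rule open_Int[OF open_domain open_Compl[OF cl]])
    ultimately obtain \<rho> where \<rho>: "\<rho> > 0" "ball x \<rho> \<subseteq> \<Omega> \<inter> - \<Union>(\<T> - {K})"
      using open_contains_ball by blast
    define g where "g = norm (bgrad K a)"
    have g: "g > 0" using bgrad_nonzero[OF S a(1)] by (simp add: g_def)
    \<comment> \<open>A point of the domain on the outer side of \<open>F\<close>, which none of the other elements covers.\<close>
    define y where "y = x + (- \<rho> / (2 * g)) *\<^sub>R bgrad K a"
    have "norm ((- \<rho> / (2 * g)) *\<^sub>R bgrad K a) < \<rho>" using g \<rho>(1) by (simp add: g_def[symmetric])
    then have "y \<in> ball x \<rho>" by (simp only: y_def mem_ball dist_norm) (simp add: norm_minus_commute)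
    then have "y \<in> \<Omega>" "y \<notin> \<Union>(\<T> - {K})" using \<rho>(2) by auto
    then have "y \<in> K" using Union_mesh closure_subset by blast
    then have "0 \<le> bary K a y" using a(1) mem_simplex_iff[OF S] by blast
    moreover have "bary K a y = - (\<rho> * g / 2)"
      using g x(1) by (simp add: y_def bary_add g_def power2_norm_eq_inner[symmetric] power2_eq_square del: scaleR_minus_left)
    ultimately show False using mult_pos_pos[OF \<rho>(1) g] by linarith
  qed
qed

lemma boundary_face_unique:
  assumes "F \<in> boundary_faces \<Omega> \<T>"
  shows "\<exists>!K. K \<in> \<T> \<and> F facet_of K"
proof -
  obtain K where K: "F \<subseteq> frontier \<Omega>" "K \<in> \<T>" "F facet_of K" using assms by (auto simp: boundary_faces_def)
  show ?thesis
  proof (rule ex1I[of _ K])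
    fix K' assume K': "K' \<in> \<T> \<and> F facet_of K'"
    show "K' = K"
    proof (rule ccontr)
      assume "K' \<noteq> K"
      then show False using common_facet_not_frontier[of K K' F] K K' by simp
    qed
  qed (use K in simp)
qed

lemma boundary_interior_disjoint: "boundary_faces \<Omega> \<T> \<inter> interior_faces \<T> = {}"
proof -
  have "F \<notin> interior_faces \<T>" if F: "F \<in> boundary_faces \<Omega> \<T>" for F
  proof
    assume "F \<in> interior_faces \<T>"
    then obtain K K' where "K \<in> \<T>" "K' \<in> \<T>" "K \<noteq> K'" "F facet_of K" "F facet_of K'"
      using interior_face_iff by meson
    then have "\<not> F \<subseteq> frontier \<Omega>" by (rule common_facet_not_frontier)
    then show False using F by (simp add: boundary_faces_def)
  qed
  then show ?thesis by auto
qed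

lemma facets_eq: "{F. \<exists>K\<in>\<T>. F facet_of K} = boundary_faces \<Omega> \<T> \<union> interior_faces \<T>"
proof (intro set_eqI iffI)
  fix F assume "F \<in> {F. \<exists>K\<in>\<T>. F facet_of K}"
  then obtain K where K: "K \<in> \<T>" "F facet_of K" by blast
  show "F \<in> boundary_faces \<Omega> \<T> \<union> interior_faces \<T>"
    using facet_cases[OF K]
  proof
    assume "F \<subseteq> frontier \<Omega>"
    then show ?thesis using K by (auto simp: boundary_faces_def)
  next
    assume "\<exists>K'\<in>\<T>. K' \<noteq> K \<and> F facet_of K'"
    then obtain K' where "K' \<in> \<T>" "K' \<noteq> K" "F facet_of K'" by blast
    then have "F \<in> interior_faces \<T>" unfolding interior_face_iff
      by (intro bexI[of _ K] bexI[of _ K'] conjI K) auto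
    then show ?thesis by blast
  qed
next
  fix F assume "F \<in> boundary_faces \<Omega> \<T> \<union> interior_faces \<T>"
  then show "F \<in> {F. \<exists>K\<in>\<T>. F facet_of K}"
    using interior_face_iff[of F] by (auto simp: boundary_faces_def)
qed

lemma finite_faces: "finite (boundary_faces \<Omega> \<T>)" "finite (interior_faces \<T>)"
proof -
  have "{F. \<exists>K\<in>\<T>. F facet_of K} = (\<Union>K\<in>\<T>. {F. F facet_of K})" by auto
  then have "finite {F. \<exists>K\<in>\<T>. F facet_of K}" using finite_mesh finite_facets[OF simplex] by simp
  then show "finite (boundary_faces \<Omega> \<T>)" "finite (interior_faces \<T>)" unfolding facets_eq by simp_all
qed

lemma sides_props:
  assumes F: "F \<in> interior_faces \<T>"
  shows "fst (sides \<T> F) \<in> \<T>" "snd (sides \<T> F) \<in> \<T>" "fst (sides \<T> F) \<noteq> snd (sides \<T> F)"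
    "F facet_of fst (sides \<T> F)" "F facet_of snd (sides \<T> F)"
proof -
  obtain K K' where K: "K \<in> \<T>" "K' \<in> \<T>" "K \<noteq> K'" "F = K \<inter> K'" "F facet_of K"
    using F unfolding interior_faces_def by blast
  have "(case sides \<T> F of (K1, K2) \<Rightarrow> K1 \<in> \<T> \<and> K2 \<in> \<T> \<and> K1 \<noteq> K2 \<and> F = K1 \<inter> K2)"
    unfolding sides_def by (rule someI[of _ "(K, K')"]) (use K in simp)
  then have s: "fst (sides \<T> F) \<in> \<T>" "snd (sides \<T> F) \<in> \<T>" "fst (sides \<T> F) \<noteq> snd (sides \<T> F)"
    "F = fst (sides \<T> F) \<inter> snd (sides \<T> F)" by (auto simp: split_beta)
  have dimF: "F \<noteq> {}" "aff_dim F = int CARD('d) - 1"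
    using K(5) aff_dim_simplex[OF simplex[OF K(1)]] by (auto simp: facet_of_def)
  show "fst (sides \<T> F) \<in> \<T>" "snd (sides \<T> F) \<in> \<T>" "fst (sides \<T> F) \<noteq> snd (sides \<T> F)" by fact+
  show "F facet_of fst (sides \<T> F)" "F facet_of snd (sides \<T> F)"
    using face_inter[OF s(1,2)] face_inter'[OF s(1,2)] s(4) dimF
      aff_dim_simplex[OF simplex[OF s(1)]] aff_dim_simplex[OF simplex[OF s(2)]] by (auto simp: facet_of_def)
qed

lemma sides_cover:
  assumes "F \<in> interior_faces \<T>" "K \<in> \<T>" "F facet_of K"
  shows "K = fst (sides \<T> F) \<or> K = snd (sides \<T> F)"
  using facet_two_elements[OF assms(2) sides_props(1,2)[OF assms(1)] assms(3) sides_props(4,5)[OF assms(1)]]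
    sides_props(3)[OF assms(1)] by blast

text \<open>Contributions of the two sides of an interior face cancel; what remains is the boundary.\<close>

lemma facet_sum_cancel:
  fixes \<phi> :: "(real^'d) set \<Rightarrow> (real^'d) set \<Rightarrow> real"
  assumes "\<And>K K' F. K \<in> \<T> \<Longrightarrow> K' \<in> \<T> \<Longrightarrow> K \<noteq> K' \<Longrightarrow> F facet_of K \<Longrightarrow> F facet_of K' \<Longrightarrow> \<phi> K' F = - \<phi> K F"
  shows "(\<Sum>K\<in>\<T>. \<Sum>F\<in>{F. F facet_of K}. \<phi> K F)
    = (\<Sum>F\<in>boundary_faces \<Omega> \<T>. \<phi> (SOME K. K \<in> \<T> \<and> F facet_of K) F)"
proof -
  let ?B = "boundary_faces \<Omega> \<T>" and ?I = "interior_faces \<T>"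
  have "(\<Sum>K\<in>\<T>. \<Sum>F\<in>{F. F facet_of K}. \<phi> K F)
      = (\<Sum>K\<in>\<T>. \<Sum>F\<in>{F \<in> ?B \<union> ?I. F facet_of K}. \<phi> K F)"
    by (intro sum.cong refl arg_cong2[of _ _ _ _ sum]) (use facets_eq in blast)
  also have "\<dots> = (\<Sum>F\<in>?B \<union> ?I. \<Sum>K\<in>{K\<in>\<T>. F facet_of K}. \<phi> K F)"
    by (rule sum.swap_restrict[OF finite_mesh]) (use finite_faces in simp)
  also have "\<dots> = (\<Sum>F\<in>?B. \<Sum>K\<in>{K\<in>\<T>. F facet_of K}. \<phi> K F) + (\<Sum>F\<in>?I. \<Sum>K\<in>{K\<in>\<T>. F facet_of K}. \<phi> K F)"
    by (rule sum.union_disjoint) (use finite_faces boundary_interior_disjoint in auto)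
  also have "(\<Sum>F\<in>?I. \<Sum>K\<in>{K\<in>\<T>. F facet_of K}. \<phi> K F) = 0"
  proof (rule sum.neutral, rule ballI)
    fix F assume F: "F \<in> ?I"
    note s = sides_props[OF F]
    have "{K\<in>\<T>. F facet_of K} = {fst (sides \<T> F), snd (sides \<T> F)}"
      using s sides_cover[OF F] by blast
    then show "(\<Sum>K\<in>{K\<in>\<T>. F facet_of K}. \<phi> K F) = 0"
      using s(3) assms[OF s] by simp
  qed
  also have "(\<Sum>F\<in>?B. \<Sum>K\<in>{K\<in>\<T>. F facet_of K}. \<phi> K F)
      = (\<Sum>F\<in>?B. \<phi> (SOME K. K \<in> \<T> \<and> F facet_of K) F)"
  proof (rule sum.cong[OF refl])
    fix F assume "F \<in> ?B"
    then obtain K where K: "K \<in> \<T> \<and> F facet_of K" "\<forall>K'. K' \<in> \<T> \<and> F facet_of K' \<longrightarrow> K' = K"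
      using boundary_face_unique[of F] unfolding Ex1_def by metis
    have "{K\<in>\<T>. F facet_of K} = {K}" using K by fast
    moreover have "(SOME K. K \<in> \<T> \<and> F facet_of K) = K"
      by (rule some_equality[of "\<lambda>K. K \<in> \<T> \<and> F facet_of K", OF K(1)]) (use K(2) in blast)
    ultimately
    show "(\<Sum>K\<in>{K\<in>\<T>. F facet_of K}. \<phi> K F) = \<phi> (SOME K. K \<in> \<T> \<and> F facet_of K) F" by simp
  qed
  finally show ?thesis by simp
qed

lemma boundary_element:
  assumes "F \<in> boundary_faces \<Omega> \<T>"
  shows "(SOME K. K \<in> \<T> \<and> F facet_of K) \<in> \<T>" "F facet_of (SOME K. K \<in> \<T> \<and> F facet_of K)"
  using someI_ex[of "\<lambda>K. K \<in> \<T> \<and> F facet_of K"] assms by (auto simp: boundary_faces_def)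

section \<open>The elements around a node\<close>

text \<open>Neighbours across an interior face that contains \<open>x\<close>: the graph along which the stabilization
  controls differences between the elements around \<open>x\<close>.\<close>

definition adjacent_at :: "real^'d \<Rightarrow> ((real^'d) set \<times> (real^'d) set) set" where
  "adjacent_at x = {(K, K'). K \<in> \<T> \<and> K' \<in> \<T> \<and> K \<noteq> K' \<and> x \<in> K \<inter> K' \<and> K \<inter> K' \<in> interior_faces \<T>}"

lemma local_elements:
  obtains r where "r > 0" "\<And>K. K \<in> \<T> \<Longrightarrow> K \<inter> ball x r \<noteq> {} \<Longrightarrow> x \<in> K"
proof -
  have "closed (\<Union>{K\<in>\<T>. x \<notin> K})"
    using finite_mesh full_simplex_compact[OF simplex] by (intro closed_Union) (auto simp: compact_imp_closed)
  then have "open (- \<Union>{K\<in>\<T>. x \<notin> K})" by (rule open_Compl)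
  moreover have "x \<in> - \<Union>{K\<in>\<T>. x \<notin> K}" by blast
  ultimately obtain r where "r > 0" "ball x r \<subseteq> - \<Union>{K\<in>\<T>. x \<notin> K}" using open_contains_ball by blast
  then show ?thesis using that by blast
qed

lemma interior_meets_ball:
  assumes "K \<in> \<T>" "x \<in> K" "r > 0"
  shows "interior K \<inter> ball x r \<noteq> {}"
proof -
  have "x \<in> closure (interior K)" using closure_interior_simplex[OF simplex[OF assms(1)]] assms(2) by simp
  then obtain y where "y \<in> interior K" "dist y x < r" using assms(3) unfolding closure_approachable by blast
  then show ?thesis by (auto simp: dist_commute)
qed

text \<open>An intersection of dimension at least \<open>d - 1\<close> is a common facet, since it is a proper face.\<close>

lemma adjacent_if_codim_one:
  assumes "K \<in> \<T>" "K' \<in> \<T>" "K \<noteq> K'" "x \<in> K \<inter> K'" "aff_dim (K \<inter> K') \<ge> int CARD('d) - 1"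
  shows "(K, K') \<in> adjacent_at x"
proof -
  have lt: "aff_dim (K1 \<inter> K2) < int CARD('d)" if "K1 \<in> \<T>" "K2 \<in> \<T>" "K1 \<noteq> K2" for K1 K2
  proof -
    have "K1 \<inter> K2 \<noteq> K1"
    proof
      assume "K1 \<inter> K2 = K1"
      then have "interior K1 \<inter> K2 \<noteq> {}" using interior_simplex_nonempty[OF simplex[OF that(1)]] interior_subset by blast
      then show False using eq_if_interior_meets[OF that(1,2)] that(3) by blast
    qed
    then show ?thesis
      using face_of_aff_dim_lt[OF full_simplex_convex[OF simplex[OF that(1)]] face_inter[OF that(1,2)]]
        aff_dim_simplex[OF simplex[OF that(1)]] by simp
  qed
  have "aff_dim (K \<inter> K') = int CARD('d) - 1" using lt[OF assms(1-3)] assms(5) by linarith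
  then have "K \<inter> K' facet_of K" "K \<inter> K' facet_of K'"
    using face_inter[OF assms(1,2)] face_inter'[OF assms(1,2)] assms(4)
      aff_dim_simplex[OF simplex[OF assms(1)]] aff_dim_simplex[OF simplex[OF assms(2)]]
    by (auto simp: facet_of_def)
  then show ?thesis using assms unfolding adjacent_at_def interior_faces_def by blast
qed

text \<open>A generic segment near an interior point misses all intersections of codimension two, so that
  it passes from element to element through facets.\<close>

lemma star_connected_interior:
  assumes x: "x \<in> \<Omega>" and K: "K \<in> \<T>" "x \<in> K" and K': "K' \<in> \<T>" "x \<in> K'"
  shows "(K, K') \<in> (adjacent_at x)\<^sup>*"
proof -
  obtain r1 where r1: "r1 > 0" "\<And>K. K \<in> \<T> \<Longrightarrow> K \<inter> ball x r1 \<noteq> {} \<Longrightarrow> x \<in> K" using local_elements by metis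
  obtain r2 where r2: "r2 > 0" "ball x r2 \<subseteq> \<Omega>" using x open_domain open_contains_ball by blast
  define r where "r = min r1 r2"
  have sub: "ball x r \<subseteq> ball x r1" "ball x r \<subseteq> ball x r2" by (auto simp: r_def)
  have r: "r > 0" "ball x r \<subseteq> \<Omega>" using r1(1) r2 sub(2) by (auto simp: r_def)
  have r3: "x \<in> K1" if "K1 \<in> \<T>" "K1 \<inter> ball x r \<noteq> {}" for K1
    using r1(2)[OF that(1)] that(2) sub(1) by blast
  obtain z where z: "z \<in> interior K" "z \<in> ball x r" using interior_meets_ball[OF K r(1)] by blast
  define D where "D = {(K1, K2). K1 \<in> \<T> \<and> K2 \<in> \<T> \<and> aff_dim (K1 \<inter> K2) < int CARD('d) - 1}"
  have finD: "finite D" by (rule finite_subset[of _ "\<T> \<times> \<T>"]) (auto simp: D_def finite_mesh)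
  \<comment> \<open>Cones from \<open>z\<close> over the intersections of codimension two; a segment from \<open>z\<close> that ends outside of
    them crosses no such intersection.\<close>
  define Bad where "Bad = (\<Union>p\<in>D. affine hull (insert z (fst p \<inter> snd p)))"
  have "negligible Bad" unfolding Bad_def
  proof (intro negligible_Union ballI finite_imageI finD)
    fix S assume "S \<in> (\<lambda>p. affine hull (insert z (fst p \<inter> snd p))) ` D"
    then obtain p where p: "p \<in> D" "S = affine hull (insert z (fst p \<inter> snd p))" by blast
    have "aff_dim (insert z (fst p \<inter> snd p)) \<le> aff_dim (fst p \<inter> snd p) + 1"
      by (simp add: aff_dim_insert)
    then have "aff_dim S < int CARD('d)" using p by (auto simp: D_def)
    then have "affine hull S \<noteq> UNIV" using aff_dim_lt_full[of S] by simp
    then have "interior S = {}" using affine_hull_nonempty_interior[of S] by blast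
    moreover have "convex S" unfolding p(2) by (rule affine_imp_convex[OF affine_affine_hull])
    ultimately show "negligible S" by (simp add: negligible_convex_interior)
  qed
  moreover have "\<not> negligible (interior K' \<inter> ball x r)"
    using interior_meets_ball[OF K' r(1)] by (intro open_not_negligible) auto
  ultimately have "\<not> interior K' \<inter> ball x r \<subseteq> Bad" using negligible_subset by metis
  then obtain z' where z': "z' \<in> interior K'" "z' \<in> ball x r" "z' \<notin> Bad" by blast
  define C where "C = closed_segment z z'"
  have C: "C \<subseteq> ball x r" unfolding C_def using z z' by (intro closed_segment_subset) auto
  define A where "A = {K1\<in>\<T>. x \<in> K1 \<and> (K, K1) \<in> (adjacent_at x)\<^sup>*}"
  define B where "B = {K1\<in>\<T>. x \<in> K1 \<and> (K, K1) \<notin> (adjacent_at x)\<^sup>*}"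
  have "C \<subseteq> \<Union>A \<union> \<Union>B"
  proof
    fix y assume y: "y \<in> C"
    then have "y \<in> closure \<Omega>" using C r(2) closure_subset by blast
    then obtain K1 where "K1 \<in> \<T>" "y \<in> K1" using Union_mesh by blast
    then have "x \<in> K1" using r3[of K1] y C by blast
    then have "K1 \<in> A \<or> K1 \<in> B" using \<open>K1 \<in> \<T>\<close> by (auto simp: A_def B_def)
    then show "y \<in> \<Union>A \<union> \<Union>B" using \<open>y \<in> K1\<close> by blast
  qed
  have closed: "closed (\<Union>A)" "closed (\<Union>B)"
    using finite_mesh full_simplex_compact[OF simplex] by (auto intro!: closed_Union simp: A_def B_def compact_imp_closed)
  show ?thesis
  proof (rule ccontr)
    assume not: "(K, K') \<notin> (adjacent_at x)\<^sup>*"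
    have "C \<inter> \<Union>A \<noteq> {}" using z K interior_subset unfolding C_def A_def by auto
    moreover have "C \<inter> \<Union>B \<noteq> {}" using z' K' not interior_subset unfolding C_def B_def by auto
    moreover have "C = (C \<inter> \<Union>A) \<union> (C \<inter> \<Union>B)" using \<open>C \<subseteq> \<Union>A \<union> \<Union>B\<close> by blast
    moreover have "connected C" "closed C" by (simp_all add: C_def)
    ultimately have "(C \<inter> \<Union>A) \<inter> (C \<inter> \<Union>B) \<noteq> {}"
      using closed connected_as_closed_union[of C "C \<inter> \<Union>A" "C \<inter> \<Union>B"] by (simp add: closed_Int)
    then obtain y K1 K2 where y: "y \<in> C" "K1 \<in> A" "y \<in> K1" "K2 \<in> B" "y \<in> K2" by blast
    have ne: "K1 \<noteq> K2" using y by (auto simp: A_def B_def)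
    have "aff_dim (K1 \<inter> K2) \<ge> int CARD('d) - 1"
    proof (rule ccontr)
      assume "\<not> ?thesis"
      then have p: "(K1, K2) \<in> D" using y by (auto simp: D_def A_def B_def)
      have "z' \<in> affine hull (insert z (K1 \<inter> K2))"
      proof (cases "y = z")
        case True
        then have "interior K \<inter> K1 \<noteq> {}" "interior K \<inter> K2 \<noteq> {}" using z y by auto
        then show ?thesis using eq_if_interior_meets[OF K(1)] y ne by (auto simp: A_def B_def)
      next
        case False
        obtain u where u: "y = (1 - u) *\<^sub>R z + u *\<^sub>R z'" using y(1) by (auto simp: C_def closed_segment_def)
        then have "u \<noteq> 0" using False by auto
        then have "(1 / u) *\<^sub>R y = (1 / u - 1) *\<^sub>R z + z'"
          by (simp add: u scaleR_right_distrib diff_divide_distrib)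
        then have "z' = (1 - 1 / u) *\<^sub>R z + (1 / u) *\<^sub>R y"
          by (simp add: scaleR_left_diff_distrib)
        moreover have "(1 - 1 / u) *\<^sub>R z + (1 / u) *\<^sub>R y \<in> affine hull (insert z (K1 \<inter> K2))"
          by (rule mem_affine[OF affine_affine_hull]) (use y in \<open>auto intro: hull_inc\<close>)
        ultimately show ?thesis by simp
      qed
      then have "z' \<in> Bad" unfolding Bad_def using p by force
      then show False using z'(3) by simp
    qed
    then have "(K1, K2) \<in> adjacent_at x"
      using adjacent_if_codim_one[of K1 K2 x] y ne by (auto simp: A_def B_def)
    then have "(K, K2) \<in> (adjacent_at x)\<^sup>*" using y(2) by (auto simp: A_def intro: rtrancl_into_rtrancl)
    then show False using y(4) by (simp add: B_def)
  qed
qed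

text \<open>At a boundary point the same follows from the connectedness of small balls intersected with the
  domain.\<close>

lemma star_connected:
  assumes K: "K \<in> \<T>" "x \<in> K" and K': "K' \<in> \<T>" "x \<in> K'"
  shows "(K, K') \<in> (adjacent_at x)\<^sup>*"
proof (cases "x \<in> \<Omega>")
  case True
  then show ?thesis by (rule star_connected_interior[OF _ K K'])
next
  case False
  have "x \<in> closure \<Omega>" using K subset_closure by blast
  then have "x \<in> frontier \<Omega>" using False open_domain by (simp add: frontier_def interior_open)
  then obtain r0 where r0: "r0 > 0" "\<And>r. 0 < r \<Longrightarrow> r < r0 \<Longrightarrow> connected (\<Omega> \<inter> ball x r)"
    using domain unfolding polygonal_domain_def by blast
  obtain r1 where r1: "r1 > 0" "\<And>K. K \<in> \<T> \<Longrightarrow> K \<inter> ball x r1 \<noteq> {} \<Longrightarrow> x \<in> K" using local_elements by metis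
  define r where "r = min r1 (r0 / 2)"
  have sub: "ball x r \<subseteq> ball x r1" by (rule subset_ball) (simp add: r_def)
  have r: "r > 0" "r < r0" using r1(1) r0(1) by (auto simp: r_def)
  note con = r0(2)[OF r]
  have r3: "x \<in> K1" if "K1 \<in> \<T>" "K1 \<inter> ball x r \<noteq> {}" for K1
    using r1(2)[OF that(1)] that(2) sub by blast
  define C where "C = \<Omega> \<inter> ball x r"
  define A where "A = {K1\<in>\<T>. x \<in> K1 \<and> (K, K1) \<in> (adjacent_at x)\<^sup>*}"
  define B where "B = {K1\<in>\<T>. x \<in> K1 \<and> (K, K1) \<notin> (adjacent_at x)\<^sup>*}"
  have cov: "C \<subseteq> \<Union>A \<union> \<Union>B"
  proof
    fix y assume y: "y \<in> C"
    then have "y \<in> closure \<Omega>" using closure_subset by (auto simp: C_def)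
    then obtain K1 where "K1 \<in> \<T>" "y \<in> K1" using Union_mesh by blast
    moreover have "y \<in> ball x r" using y by (simp add: C_def)
    ultimately have "x \<in> K1" using r3[of K1] by blast
    then have "K1 \<in> A \<or> K1 \<in> B" using \<open>K1 \<in> \<T>\<close> by (auto simp: A_def B_def)
    then show "y \<in> \<Union>A \<union> \<Union>B" using \<open>y \<in> K1\<close> by blast
  qed
  have closed: "closed (\<Union>A)" "closed (\<Union>B)"
    using finite_mesh full_simplex_compact[OF simplex] by (auto intro!: closed_Union simp: A_def B_def compact_imp_closed)
  show ?thesis
  proof (rule ccontr)
    assume not: "(K, K') \<notin> (adjacent_at x)\<^sup>*"
    have meet: "C \<inter> K1 \<noteq> {}" if "K1 \<in> \<T>" "x \<in> K1" for K1
      using interior_meets_ball[OF that r(1)] interior_subset_domain[OF that(1)] interior_subset[of K1] by (auto simp: C_def)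
    have "C \<inter> \<Union>A \<noteq> {}" using meet[OF K] K unfolding A_def by auto
    moreover have "C \<inter> \<Union>B \<noteq> {}" using meet[OF K'] K' not unfolding B_def by auto
    moreover have "C \<subseteq> (C \<inter> \<Union>A) \<union> (C \<inter> \<Union>B)" using cov by blast
    moreover have "connected C" using con by (simp add: C_def)
    moreover have "closedin (top_of_set C) (C \<inter> \<Union>A)" "closedin (top_of_set C) (C \<inter> \<Union>B)"
      using closed by (simp_all add: closedin_closed_Int)
    ultimately have "(C \<inter> \<Union>A) \<inter> (C \<inter> \<Union>B) \<noteq> {}" unfolding connected_closedin by blast
    then obtain y K1 K2 where y: "y \<in> C" "K1 \<in> A" "y \<in> K1" "K2 \<in> B" "y \<in> K2" by blast
    have "(K1, K2) \<in> (adjacent_at y)\<^sup>*"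
      by (rule star_connected_interior) (use y in \<open>auto simp: A_def B_def C_def\<close>)
    moreover have "adjacent_at y \<subseteq> adjacent_at x"
    proof -
      have "y \<in> ball x r" using y(1) by (simp add: C_def)
      then have "x \<in> K3" if "K3 \<in> \<T>" "y \<in> K3" for K3 using r3[OF that(1)] that(2) by blast
      then show ?thesis unfolding adjacent_at_def by blast
    qed
    ultimately have "(K1, K2) \<in> (adjacent_at x)\<^sup>*" using rtrancl_mono by blast
    then have "(K, K2) \<in> (adjacent_at x)\<^sup>*" using y(2) by (auto simp: A_def)
    then show False using y(4) by (simp add: B_def)
  qed
qed

end

section \<open>Lipschitz continuity from bounded weak derivatives\<close>

text \<open>The gradient is carried along as a function so that test functions can be built without
  differentiating again.\<close>

definition C1_with :: "('a::euclidean_space \<Rightarrow> real) \<Rightarrow> ('a \<Rightarrow> 'a) \<Rightarrow> bool" where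
  "C1_with f G \<longleftrightarrow> continuous_on UNIV G \<and> (\<forall>x. (f has_derivative (\<lambda>h. G x \<bullet> h)) (at x))"

lemma C1_with_continuous: "C1_with f G \<Longrightarrow> continuous_on S f"
  unfolding C1_with_def by (meson continuous_at_imp_continuous_on has_derivative_continuous)

lemma C1_with_mult:
  assumes "C1_with f F" "C1_with g G"
  shows "C1_with (\<lambda>x. f x * g x) (\<lambda>x. f x *\<^sub>R G x + g x *\<^sub>R F x)"
  unfolding C1_with_def
proof (intro conjI allI)
  show "continuous_on UNIV (\<lambda>x. f x *\<^sub>R G x + g x *\<^sub>R F x)"
    using assms by (intro continuous_intros C1_with_continuous) (auto simp: C1_with_def)
  show "((\<lambda>x. f x * g x) has_derivative (\<lambda>h. (f x *\<^sub>R G x + g x *\<^sub>R F x) \<bullet> h)) (at x)" for x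
    using has_derivative_mult[of f "\<lambda>h. F x \<bullet> h" x UNIV g "\<lambda>h. G x \<bullet> h"] assms
    by (simp add: C1_with_def inner_add_left mult.commute)
qed

lemma C1_with_compose:
  assumes f: "C1_with f F" and \<psi>: "\<And>s. s \<in> S \<Longrightarrow> (\<psi> has_real_derivative \<psi>' s) (at s)" "continuous_on S \<psi>'"
    and S: "\<And>x. f x \<in> S"
  shows "C1_with (\<lambda>x. \<psi> (f x)) (\<lambda>x. \<psi>' (f x) *\<^sub>R F x)"
  unfolding C1_with_def
proof (intro conjI allI)
  have "continuous_on UNIV (\<lambda>x. \<psi>' (f x))"
    by (rule continuous_on_compose2[OF \<psi>(2) C1_with_continuous[OF f]]) (use S in auto)
  then show "continuous_on UNIV (\<lambda>x. \<psi>' (f x) *\<^sub>R F x)"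
    using f by (intro continuous_intros) (auto simp: C1_with_def)
  fix x
  have "(f has_derivative (\<lambda>h. F x \<bullet> h)) (at x)" using f by (simp add: C1_with_def)
  moreover have "(\<psi> has_derivative (*) (\<psi>' (f x))) (at (f x))"
    using \<psi>(1)[OF S[of x]] by (simp add: has_field_derivative_def)
  ultimately have "(\<psi> \<circ> f has_derivative (*) (\<psi>' (f x)) \<circ> (\<lambda>h. F x \<bullet> h)) (at x)"
    by (rule diff_chain_at)
  then show "((\<lambda>x. \<psi> (f x)) has_derivative (\<lambda>h. (\<psi>' (f x) *\<^sub>R F x) \<bullet> h)) (at x)"
    by (simp add: comp_def)
qed

lemma C1_with_prod:
  assumes "finite I" "\<And>i. i \<in> I \<Longrightarrow> \<exists>G. C1_with (f i) G"
  shows "\<exists>G. C1_with (\<lambda>x. \<Prod>i\<in>I. f i x) G"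
  using assms
proof (induction I rule: finite_induct)
  case empty
  then show ?case by (intro exI[of _ "\<lambda>x. 0"]) (simp add: C1_with_def)
next
  case (insert i I)
  then obtain F G where "C1_with (f i) F" "C1_with (\<lambda>x. \<Prod>i\<in>I. f i x) G" by blast
  from C1_with_mult[OF this] show ?case using insert.hyps by auto
qed

text \<open>The square makes the positive part continuously differentiable, which is all the smoothness that
  test functions have to have.\<close>

lemma pos_part_square_derivative:
  "((\<lambda>s::real. (max 0 s)\<^sup>2) has_real_derivative 2 * max 0 s) (at s)"
proof -
  consider "s < 0" | "s > 0" | "s = 0" by linarith
  then show ?thesis
  proof cases
    case 1
    have "((\<lambda>s::real. 0) has_real_derivative 2 * max 0 s) (at s)" using 1 by simp
    then show ?thesis
      by (rule has_field_derivative_transform_within_open[of _ _ _ "{..<0}"]) (use 1 in auto)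
  next
    case 2
    have "((\<lambda>s::real. s\<^sup>2) has_real_derivative 2 * max 0 s) (at s)"
      using 2 by (auto intro!: derivative_eq_intros)
    then show ?thesis
      by (rule has_field_derivative_transform_within_open[of _ _ _ "{0<..}"]) (use 2 in auto)
  next
    case 3
    have "((\<lambda>h::real. ((max 0 (0 + h))\<^sup>2 - (max 0 0)\<^sup>2) / h) \<longlongrightarrow> 0) (at 0)"
    proof (rule Lim_null_comparison)
      show "\<forall>\<^sub>F h::real in at 0. norm (((max 0 (0 + h))\<^sup>2 - (max 0 0)\<^sup>2) / h) \<le> \<bar>h\<bar>"
        by (rule always_eventually) (auto simp: max_def power2_eq_square)
      show "((\<lambda>h::real. \<bar>h\<bar>) \<longlongrightarrow> 0) (at 0)" by (auto intro!: tendsto_eq_intros)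
    qed
    then show ?thesis using 3 by (simp add: DERIV_def)
  qed
qed

text \<open>A continuously differentiable function that is positive exactly on the open box; it replaces the
  usual smooth mollifier.\<close>

definition box_bump :: "'a::euclidean_space \<Rightarrow> 'a \<Rightarrow> 'a \<Rightarrow> real" where
  "box_bump l u z = (\<Prod>b\<in>Basis. (max 0 ((z - l) \<bullet> b))\<^sup>2 * (max 0 ((u - z) \<bullet> b))\<^sup>2)"

lemma box_bump_nonneg: "0 \<le> box_bump l u z"
  unfolding box_bump_def by (intro prod_nonneg) auto

lemma box_bump_pos: "z \<in> box l u \<Longrightarrow> 0 < box_bump l u z"
  unfolding box_bump_def by (intro prod_pos) (auto simp: mem_box inner_diff_left)

lemma box_bump_outside:
  assumes "z \<notin> box l u"
  shows "box_bump l u z = 0"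
proof -
  obtain b where "b \<in> Basis" "(z - l) \<bullet> b \<le> 0 \<or> (u - z) \<bullet> b \<le> 0"
    using assms by (auto simp: mem_box inner_diff_left not_less)
  then show ?thesis unfolding box_bump_def by (auto intro!: prod_zero bexI[of _ b] simp: max_def)
qed

lemma box_bump_C1: "\<exists>G. C1_with (box_bump l u) G"
  unfolding box_bump_def
proof (rule C1_with_prod)
  fix b :: 'a assume "b \<in> Basis"
  have aff: "C1_with (\<lambda>z. (z - l) \<bullet> b) (\<lambda>z. b)" "C1_with (\<lambda>z. (u - z) \<bullet> b) (\<lambda>z. - b)"
    unfolding C1_with_def by (auto intro!: derivative_eq_intros simp: inner_commute)
  have sq: "C1_with (\<lambda>z. (max 0 (f z))\<^sup>2) (\<lambda>z. (2 * max 0 (f z)) *\<^sub>R F z)" if "C1_with f F" for f :: "'a \<Rightarrow> real" and F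
    by (rule C1_with_compose[OF that, of UNIV "\<lambda>s. (max 0 s)\<^sup>2"])
      (auto intro!: pos_part_square_derivative continuous_intros)
  show "\<exists>G. C1_with (\<lambda>z. (max 0 ((z - l) \<bullet> b))\<^sup>2 * (max 0 ((u - z) \<bullet> b))\<^sup>2) G"
    using C1_with_mult[OF sq[OF aff(1)] sq[OF aff(2)]] by blast
qed simp

lemma C1c_if_C1_with:
  assumes "C1_with f G" "compact K" "K \<subseteq> U" "\<And>x. x \<notin> K \<Longrightarrow> f x = 0"
  shows "f \<in> C1c_functions U"
proof -
  have "continuous_on UNIV (\<lambda>x. blinfun_inner_left (G x))"
    using assms(1) by (intro continuous_intros bounded_linear.continuous_on[OF bounded_linear_blinfun_inner_left])
      (auto simp: C1_with_def)
  moreover have "(f has_derivative blinfun_apply (blinfun_inner_left (G x))) (at x)" for x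
    using assms(1) by (simp add: C1_with_def blinfun_inner_left.rep_eq inner_commute)
  ultimately show ?thesis unfolding C1c_functions_def using assms(2-4) by blast
qed

lemma C1_with_frechet: "C1_with f G \<Longrightarrow> frechet_derivative f (at x) h = G x \<bullet> h"
  using frechet_derivative_at[of f "\<lambda>h. G x \<bullet> h" x] by (auto simp: C1_with_def fun_eq_iff)

text \<open>The functions \<open>k q / (1 + k q)\<close>, with \<open>q\<close> the bump of a box, increase to the indicator of the
  open box.\<close>

lemma null_integral_boxes:
  fixes w :: "'a::euclidean_space \<Rightarrow> 'b::euclidean_space"
  assumes w: "\<And>K. compact K \<Longrightarrow> K \<subseteq> U \<Longrightarrow> set_integrable lebesgue K w"
    and z: "\<And>\<phi>. \<phi> \<in> C1c_functions U \<Longrightarrow> (LINT x:U|lebesgue. \<phi> x *\<^sub>R w x) = 0"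
    and lu: "cbox l u \<subseteq> U"
  shows "(LINT x:box l u|lebesgue. w x) = 0"
proof -
  define \<phi> where "\<phi> = (\<lambda>(k::nat) x. real k * box_bump l u x / (1 + real k * box_bump l u x))"
  obtain G where G: "C1_with (box_bump l u) G" using box_bump_C1 by blast
  have "\<phi> k \<in> C1c_functions U" for k
  proof -
    have pos: "1 + real k * s > 0" if "s \<in> {0..}" for s using that by (simp add: add_pos_nonneg)
    have "C1_with (\<phi> k) (\<lambda>x. (real k / (1 + real k * box_bump l u x)\<^sup>2) *\<^sub>R G x)"
      unfolding \<phi>_def
    proof (rule C1_with_compose[OF G, of "{0..}" "\<lambda>s. real k * s / (1 + real k * s)"])
      fix s :: real assume s: "s \<in> {0..}"
      show "((\<lambda>s. real k * s / (1 + real k * s)) has_real_derivative real k / (1 + real k * s)\<^sup>2) (at s)"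
        using pos[OF s] by (auto intro!: derivative_eq_intros simp: power2_eq_square field_simps)
    next
      show "continuous_on {0..} (\<lambda>s. real k / (1 + real k * s)\<^sup>2)"
        using pos by (intro continuous_intros) (metis less_irrefl zero_eq_power2)
    qed (use box_bump_nonneg in auto)
    then show ?thesis
      by (rule C1c_if_C1_with[OF _ compact_cbox lu])
        (use box_bump_outside[of _ l u] box_subset_cbox[of l u] in \<open>force simp: \<phi>_def\<close>)
  qed
  then have z': "(LINT x:U|lebesgue. \<phi> k x *\<^sub>R w x) = 0" for k by (rule z)
  have wi: "integrable lebesgue (\<lambda>x. indicator (cbox l u) x *\<^sub>R w x)"
    using w[OF compact_cbox lu] by (simp add: set_integrable_def)
  have \<phi>b: "0 \<le> \<phi> k x" "\<phi> k x \<le> 1" for k x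
    using box_bump_nonneg[of l u x] by (auto simp: \<phi>_def add_pos_nonneg divide_le_eq)
  have \<phi>0: "\<phi> k x = 0" if "x \<notin> box l u" for k x using box_bump_outside[OF that] by (simp add: \<phi>_def)
  have eq: "indicator U x *\<^sub>R \<phi> k x *\<^sub>R w x = \<phi> k x *\<^sub>R (indicator (cbox l u) x *\<^sub>R w x)" for k x
    using \<phi>0[of x k] lu box_subset_cbox[of l u] by (auto split: split_indicator)
  have "(\<lambda>k. \<integral>x. \<phi> k x *\<^sub>R (indicator (cbox l u) x *\<^sub>R w x) \<partial>lebesgue)
      \<longlonglongrightarrow> (\<integral>x. indicator (box l u) x *\<^sub>R w x \<partial>lebesgue)"
  proof (rule integral_dominated_convergence[where w="\<lambda>x. norm (indicator (cbox l u) x *\<^sub>R w x)"])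
    have i2: "(\<lambda>x. indicator (box l u) x *\<^sub>R w x) = (\<lambda>x. indicator (box l u) x *\<^sub>R (indicator (cbox l u) x *\<^sub>R w x))"
      using box_subset_cbox[of l u] by (auto split: split_indicator simp: fun_eq_iff)
    show "(\<lambda>x. indicator (box l u) x *\<^sub>R w x) \<in> borel_measurable lebesgue"
      unfolding i2 by (rule borel_measurable_scaleR[OF borel_measurable_indicator[OF fmeasurableD[OF lmeasurable_box]]
            borel_measurable_integrable[OF wi]])
    show "integrable lebesgue (\<lambda>x. norm (indicator (cbox l u) x *\<^sub>R w x))" using wi by (rule integrable_norm)
    show "AE x in lebesgue. norm (\<phi> k x *\<^sub>R (indicator (cbox l u) x *\<^sub>R w x)) \<le> norm (indicator (cbox l u) x *\<^sub>R w x)" for k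
    proof (intro AE_I2)
      fix x
      have "norm (\<phi> k x *\<^sub>R y) = \<phi> k x * norm y" for y :: 'b using \<phi>b(1) by simp
      then show "norm (\<phi> k x *\<^sub>R (indicator (cbox l u) x *\<^sub>R w x)) \<le> norm (indicator (cbox l u) x *\<^sub>R w x)"
        by (simp only:) (rule mult_left_le_one_le[OF norm_ge_zero \<phi>b])
    qed
    have "continuous_on UNIV (\<phi> k)" for k
      unfolding \<phi>_def using box_bump_nonneg[of l u]
      by (intro continuous_intros C1_with_continuous[OF G]) (metis add_pos_nonneg less_irrefl mult_nonneg_nonneg of_nat_0_le_iff zero_less_one)
    then have "\<phi> k \<in> borel_measurable borel" for k by (rule borel_measurable_continuous_onI)
    then have "\<phi> k \<in> borel_measurable lebesgue" for k by (intro measurable_completion) simp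
    then show "(\<lambda>x. \<phi> k x *\<^sub>R (indicator (cbox l u) x *\<^sub>R w x)) \<in> borel_measurable lebesgue" for k
      by (intro borel_measurable_scaleR borel_measurable_integrable[OF wi])
    show "AE x in lebesgue. (\<lambda>k. \<phi> k x *\<^sub>R (indicator (cbox l u) x *\<^sub>R w x)) \<longlonglongrightarrow> indicator (box l u) x *\<^sub>R w x"
    proof (intro AE_I2)
      fix x
      show "(\<lambda>k. \<phi> k x *\<^sub>R (indicator (cbox l u) x *\<^sub>R w x)) \<longlonglongrightarrow> indicator (box l u) x *\<^sub>R w x"
      proof (cases "x \<in> box l u")
        case True
        define q where "q = box_bump l u x"
        have q: "q > 0" using box_bump_pos[OF True] by (simp add: q_def)
        have "(\<lambda>k. real k * q / (1 + real k * q)) \<longlonglongrightarrow> 1" using q by real_asymp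
        then have "(\<lambda>k. \<phi> k x *\<^sub>R w x) \<longlonglongrightarrow> 1 *\<^sub>R w x"
          by (intro tendsto_intros) (simp add: \<phi>_def q_def)
        then show ?thesis using True box_subset_cbox[of l u] by auto
      qed (simp add: \<phi>0)
    qed
  qed
  moreover have "(\<integral>x. \<phi> k x *\<^sub>R (indicator (cbox l u) x *\<^sub>R w x) \<partial>lebesgue) = 0" for k
    using z'[of k] unfolding set_lebesgue_integral_def eq .
  ultimately show ?thesis unfolding set_lebesgue_integral_def by (simp add: LIMSEQ_const_iff)
qed

text \<open>Lebesgue differentiation along the boxes with lower corner \<open>x\<close>.\<close>

lemma null_if_null_integral_boxes:
  fixes w :: "'a::euclidean_space \<Rightarrow> 'b::euclidean_space"
  assumes wi: "set_integrable lebesgue (cbox a b) w"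
    and z: "\<And>l u. cbox l u \<subseteq> cbox a b \<Longrightarrow> (LINT x:box l u|lebesgue. w x) = 0"
  shows "AE x in lebesgue. x \<in> cbox a b \<longrightarrow> w x = 0"
proof -
  define f where "f = (\<lambda>x. indicator (cbox a b) x *\<^sub>R w x)"
  have fi: "f absolutely_integrable_on UNIV" using wi by (simp add: set_integrable_def f_def)
  then have "f integrable_on cbox l u" for l u
    by (intro integrable_on_subcbox[of f UNIV]) (auto simp: absolutely_integrable_on_def)
  then obtain N where N: "negligible N"
      "\<And>x e. x \<notin> N \<Longrightarrow> 0 < e \<Longrightarrow> \<exists>d>0. \<forall>h. 0 < h \<and> h < d \<longrightarrow>
          norm (integral (cbox x (x + h *\<^sub>R One)) f /\<^sub>R h ^ DIM('a) - f x) < e"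
    using integrable_ccontinuous_explicit[of f] by metis
  have zero: "w x = 0" if x: "x \<in> box a b" "x \<notin> N" for x
  proof (rule ccontr)
    assume "w x \<noteq> 0"
    obtain d0 where d0: "d0 > 0" "ball x d0 \<subseteq> box a b" using x(1) open_box open_contains_ball by blast
    obtain d where d: "d > 0" "\<forall>h. 0 < h \<and> h < d \<longrightarrow>
        norm (integral (cbox x (x + h *\<^sub>R One)) f /\<^sub>R h ^ DIM('a) - f x) < norm (w x)"
      using N(2)[OF x(2), of "norm (w x)"] \<open>w x \<noteq> 0\<close> by auto
    define h where "h = min (d / 2) (d0 / (2 * real DIM('a)))"
    have h: "0 < h" "h < d" using d(1) d0(1) by (auto simp: h_def)
    have sub: "cbox x (x + h *\<^sub>R One) \<subseteq> cbox a b"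
    proof
      fix y assume y: "y \<in> cbox x (x + h *\<^sub>R One)"
      have "norm (y - x) \<le> (\<Sum>i\<in>Basis. \<bar>(y - x) \<bullet> i\<bar>)" by (rule norm_le_l1)
      also have "\<dots> \<le> (\<Sum>i\<in>(Basis::'a set). h)"
        using y by (intro sum_mono) (auto simp: mem_box inner_diff_left inner_add_left)
      also have "\<dots> = real DIM('a) * h" by simp
      also have "\<dots> \<le> real DIM('a) * (d0 / (2 * real DIM('a)))" by (intro mult_left_mono) (auto simp: h_def)
      also have "\<dots> < d0" using d0(1) by simp
      finally have "y \<in> ball x d0" by (simp add: dist_norm norm_minus_commute)
      then show "y \<in> cbox a b" using d0(2) box_subset_cbox by blast
    qed
    have "set_integrable lebesgue (cbox x (x + h *\<^sub>R One)) w"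
      by (rule set_integrable_subset[OF wi _ sub]) simp
    note 1 = this
    have "set_integrable lebesgue (box x (x + h *\<^sub>R One)) w"
      by (rule set_integrable_subset[OF wi]) (use sub box_subset_cbox in auto)
    then have "integral (box x (x + h *\<^sub>R One)) w = 0"
      using z[OF sub] set_lebesgue_integral_eq_integral(2) by metis
    then have "integral (cbox x (x + h *\<^sub>R One)) w = 0" by (simp add: integral_open_interval)
    moreover have "integral (cbox x (x + h *\<^sub>R One)) f = integral (cbox x (x + h *\<^sub>R One)) w"
      by (rule integral_cong) (use sub in \<open>auto simp: f_def\<close>)
    ultimately have "norm (f x) < norm (w x)" using d(2) h by (metis diff_0 norm_minus_cancel scaleR_zero_right)
    then show False using x(1) box_subset_cbox[of a b] by (auto simp: f_def)
  qed
  have "N \<union> (cbox a b - box a b) \<in> null_sets lebesgue"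
    using N(1) negligible_frontier_interval[of a b] by (simp add: negligible_iff_null_sets null_sets.Un)
  then show ?thesis by (rule AE_I') (use zero in auto)
qed

text \<open>The open set is a countable union of boxes, and on each of them the integrals over sub-boxes vanish.\<close>

lemma fundamental_lemma_variations:
  fixes w :: "'a::euclidean_space \<Rightarrow> 'b::euclidean_space"
  assumes U: "open U" and w: "\<And>K. compact K \<Longrightarrow> K \<subseteq> U \<Longrightarrow> set_integrable lebesgue K w"
    and z: "\<And>\<phi>. \<phi> \<in> C1c_functions U \<Longrightarrow> (LINT x:U|lebesgue. \<phi> x *\<^sub>R w x) = 0"
  shows "AE x in lebesgue. x \<in> U \<longrightarrow> w x = 0"
proof -
  obtain \<D> where D: "countable \<D>" "\<D> \<subseteq> Pow U" "\<And>X. X \<in> \<D> \<Longrightarrow> \<exists>a b. X = cbox a b" "\<Union>\<D> = U"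
    using open_countable_Union_open_cbox[OF U] by metis
  have "AE x in lebesgue. x \<in> X \<longrightarrow> w x = 0" if X: "X \<in> \<D>" for X
  proof -
    obtain a b where ab: "X = cbox a b" using D(3)[OF X] by blast
    have XU: "cbox a b \<subseteq> U" using D(2) X ab by blast
    show ?thesis unfolding ab
      by (rule null_if_null_integral_boxes[OF w[OF compact_cbox XU]])
        (rule null_integral_boxes[OF w z], use XU in auto)
  qed
  then have "AE x in lebesgue. \<forall>X\<in>\<D>. x \<in> X \<longrightarrow> w x = 0" unfolding AE_ball_countable[OF D(1)] by blast
  then show ?thesis by eventually_elim (use D(4) in blast)
qed

lemma C1c_product_integrable:
  fixes g :: "'a::euclidean_space \<Rightarrow> 'b::euclidean_space"
  assumes \<phi>: "continuous_on UNIV (\<phi> :: 'a \<Rightarrow> real)" and K: "compact K" "K \<subseteq> U" "\<And>x. x \<notin> K \<Longrightarrow> \<phi> x = 0"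
    and g: "set_integrable lebesgue K g"
  shows "set_integrable lebesgue U (\<lambda>x. \<phi> x *\<^sub>R g x)"
    "(LINT x:U|lebesgue. \<phi> x *\<^sub>R g x) = (\<integral>x. \<phi> x *\<^sub>R (indicator K x *\<^sub>R g x) \<partial>lebesgue)"
proof -
  have gi: "integrable lebesgue (\<lambda>x. indicator K x *\<^sub>R g x)" using g by (simp add: set_integrable_def)
  have "compact (\<phi> ` K)" using \<phi> K(1) by (intro compact_continuous_image) (auto intro: continuous_on_subset)
  then obtain c where c: "\<And>x. x \<in> K \<Longrightarrow> \<bar>\<phi> x\<bar> \<le> c" using compact_imp_bounded bounded_real by (metis imageI)
  have \<phi>m: "\<phi> \<in> borel_measurable lebesgue"
    by (intro measurable_completion) (use borel_measurable_continuous_onI[OF \<phi>] in simp)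
  have int: "integrable lebesgue (\<lambda>x. \<phi> x *\<^sub>R (indicator K x *\<^sub>R g x))"
  proof (rule Bochner_Integration.integrable_bound)
    show "integrable lebesgue (\<lambda>x. c *\<^sub>R (indicator K x *\<^sub>R g x))"
      by (rule integrable_scaleR_right) (rule gi)
    show "(\<lambda>x. \<phi> x *\<^sub>R (indicator K x *\<^sub>R g x)) \<in> borel_measurable lebesgue"
      by (intro borel_measurable_scaleR \<phi>m borel_measurable_integrable[OF gi])
    show "AE x in lebesgue. norm (\<phi> x *\<^sub>R (indicator K x *\<^sub>R g x)) \<le> norm (c *\<^sub>R (indicator K x *\<^sub>R g x))"
      using c by (intro AE_I2) (fastforce split: split_indicator intro!: mult_right_mono)
  qed
  have eq: "indicator U x *\<^sub>R (\<phi> x *\<^sub>R g x) = \<phi> x *\<^sub>R (indicator K x *\<^sub>R g x)" for x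
    using K(2,3) by (auto split: split_indicator)
  show "set_integrable lebesgue U (\<lambda>x. \<phi> x *\<^sub>R g x)" using int unfolding set_integrable_def eq .
  show "(LINT x:U|lebesgue. \<phi> x *\<^sub>R g x) = (\<integral>x. \<phi> x *\<^sub>R (indicator K x *\<^sub>R g x) \<partial>lebesgue)"
    unfolding set_lebesgue_integral_def eq ..
qed

lemma weak_derivative_unique:
  fixes f :: "'a::euclidean_space \<Rightarrow> 'b::euclidean_space"
  assumes U: "open U" and g: "has_weak_derivative U f e g" "has_weak_derivative U f e g'"
  shows "AE x in lebesgue. x \<in> U \<longrightarrow> g x = g' x"
proof -
  have gK: "set_integrable lebesgue K g" "set_integrable lebesgue K g'" if "compact K" "K \<subseteq> U" for K
    using g that by (auto simp: has_weak_derivative_def)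
  have "AE x in lebesgue. x \<in> U \<longrightarrow> g x - g' x = 0"
  proof (rule fundamental_lemma_variations[OF U])
    show "set_integrable lebesgue K (\<lambda>x. g x - g' x)" if "compact K" "K \<subseteq> U" for K
      using gK[OF that] by (rule set_integral_diff)
    fix \<phi> assume \<phi>: "\<phi> \<in> C1c_functions U"
    then obtain K where K: "compact K" "K \<subseteq> U" "\<And>x. x \<notin> K \<Longrightarrow> \<phi> x = 0" unfolding C1c_functions_def by blast
    have "continuous_on UNIV \<phi>" using \<phi> unfolding C1c_functions_def
      by (auto intro!: continuous_at_imp_continuous_on dest: has_derivative_continuous)
    note i = C1c_product_integrable(1)[OF this K gK(1)[OF K(1,2)]] C1c_product_integrable(1)[OF this K gK(2)[OF K(1,2)]]
    have "(LINT x:U|lebesgue. \<phi> x *\<^sub>R g x) = (LINT x:U|lebesgue. \<phi> x *\<^sub>R g' x)"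
    proof -
      have "(LINT x:U|lebesgue. frechet_derivative \<phi> (at x) e *\<^sub>R f x) = - (LINT x:U|lebesgue. \<phi> x *\<^sub>R g x)"
        "(LINT x:U|lebesgue. frechet_derivative \<phi> (at x) e *\<^sub>R f x) = - (LINT x:U|lebesgue. \<phi> x *\<^sub>R g' x)"
        using g \<phi> unfolding has_weak_derivative_def by blast+
      then show ?thesis by simp
    qed
    then show "(LINT x:U|lebesgue. \<phi> x *\<^sub>R (g x - g' x)) = 0"
      using set_integral_diff(2)[OF i] by (simp add: scaleR_right_diff_distrib)
  qed
  then show ?thesis by simp
qed

lemma Linf_norm_AE:
  fixes f :: "'a::euclidean_space \<Rightarrow> 'b::euclidean_space"
  assumes f: "f \<in> Linf_space U"
  shows "AE x in lebesgue_on U. norm (f x) \<le> Linf_norm U f"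
proof -
  define s where "s = esssup (lebesgue_on U) (\<lambda>x. ereal (norm (f x)))"
  obtain c where c: "AE x in lebesgue_on U. norm (f x) \<le> c" using f by (auto simp: Linf_space_def)
  have "s \<le> ereal c" unfolding s_def
    by (rule esssup_I) (use f c in \<open>auto simp: Linf_space_def\<close>)
  moreover have AE: "AE x in lebesgue_on U. ereal (norm (f x)) \<le> s" unfolding s_def by (rule esssup_AE)
  ultimately show ?thesis
  proof (cases s)
    case (real r)
    then show ?thesis using AE by (simp add: Linf_norm_def s_def)
  next
    case MInf
    then have "AE x in lebesgue_on U. False" using AE by simp
    then show ?thesis by eventually_elim simp
  qed auto
qed

text \<open>The norm is defined through a chosen weak derivative; uniqueness almost everywhere transfers to it
  the boundedness of the one that witnesses membership in the space.\<close>

lemma weak_derivative_bound: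
  fixes f :: "'a::euclidean_space \<Rightarrow> 'b::euclidean_space"
  assumes U: "open U" and f: "f \<in> W1inf_space U" and b: "b \<in> Basis"
  shows "has_weak_derivative U f b (weak_derivative U f b)"
    "AE x in lebesgue. x \<in> U \<longrightarrow> norm (weak_derivative U f b x) \<le> W1inf_norm U f"
proof -
  have Um: "U \<in> sets lebesgue" using U by (simp add: borel_open)
  obtain g0 where g0: "g0 \<in> Linf_space U" "has_weak_derivative U f b g0"
    using f b by (auto simp: W1inf_space_def)
  define g where "g = weak_derivative U f b"
  show w: "has_weak_derivative U f b (weak_derivative U f b)"
    unfolding weak_derivative_def by (rule someI[of _ g0]) (rule g0(2))
  have ae: "AE x in lebesgue. x \<in> U \<longrightarrow> g0 x = g x"
    unfolding g_def by (rule weak_derivative_unique[OF U g0(2) w])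
  have "(\<lambda>x. indicator U x *\<^sub>R g0 x) \<in> borel_measurable lebesgue"
    using g0(1) Um by (simp add: Linf_space_def borel_measurable_restrict_space_iff)
  moreover have "AE x in lebesgue. indicator U x *\<^sub>R g0 x = indicator U x *\<^sub>R g x"
    using ae by eventually_elim (auto split: split_indicator)
  ultimately have "(\<lambda>x. indicator U x *\<^sub>R g x) \<in> borel_measurable lebesgue"
    by (rule borel_measurable_AE)
  then have "g \<in> borel_measurable (lebesgue_on U)"
    using Um by (simp add: borel_measurable_restrict_space_iff)
  moreover obtain c where "AE x in lebesgue_on U. norm (g0 x) \<le> c" using g0(1) by (auto simp: Linf_space_def)
  then have "AE x in lebesgue. x \<in> U \<longrightarrow> norm (g0 x) \<le> c" using Um by (simp add: AE_restrict_space_iff)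
  then have "AE x in lebesgue. x \<in> U \<longrightarrow> norm (g x) \<le> c" using ae by eventually_elim auto
  then have "AE x in lebesgue_on U. norm (g x) \<le> c" using Um by (simp add: AE_restrict_space_iff)
  ultimately have "g \<in> Linf_space U" by (auto simp: Linf_space_def)
  then have "AE x in lebesgue_on U. norm (g x) \<le> Linf_norm U g" by (rule Linf_norm_AE)
  then have "AE x in lebesgue. x \<in> U \<longrightarrow> norm (g x) \<le> Linf_norm U g" using Um by (simp add: AE_restrict_space_iff)
  moreover have le: "Linf_norm U g \<le> W1inf_norm U f"
    unfolding W1inf_norm_def g_def using b by (intro Max_ge) auto
  ultimately show "AE x in lebesgue. x \<in> U \<longrightarrow> norm (weak_derivative U f b x) \<le> W1inf_norm U f"
    unfolding g_def[symmetric] by (elim eventually_mono) (use le in auto)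
qed

text \<open>Mollification: the convolution of \<open>f\<close> with a bump is differentiable along the segment, and its
  derivative is the convolution with the weak derivative.\<close>

lemma lipschitz_on_segment:
  fixes f :: "'a::euclidean_space \<Rightarrow> 'b::euclidean_space"
  assumes U: "open U" and f: "continuous_on U f"
    and g: "\<And>b. b \<in> Basis \<Longrightarrow> has_weak_derivative U f b (g b)"
      "\<And>b. b \<in> Basis \<Longrightarrow> AE x in lebesgue. x \<in> U \<longrightarrow> norm (g b x) \<le> L"
    and seg: "closed_segment z (z + e) \<subseteq> U"
  shows "norm (f (z + e) - f z) \<le> L * (\<Sum>b\<in>Basis. \<bar>e \<bullet> b\<bar>)"
proof (rule ccontr)
  assume not: "\<not> ?thesis"
  define v where "v = f (z + e) - f z"
  define M where "M = L * (\<Sum>b\<in>Basis. \<bar>e \<bullet> b\<bar>) * norm v"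
  have vM: "M < v \<bullet> v"
  proof -
    have "L * (\<Sum>b\<in>Basis. \<bar>e \<bullet> b\<bar>) < norm v" using not by (simp add: v_def)
    moreover have "norm v > 0"
    proof (rule ccontr)
      assume "\<not> norm v > 0"
      then have v0: "v = 0" by simp
      obtain b :: 'a where b: "b \<in> Basis" using nonempty_Basis by blast
      have "\<not> (AE x in lebesgue. x \<in> U \<longrightarrow> False)"
      proof
        assume "AE x in lebesgue. x \<in> U \<longrightarrow> False"
        then have "negligible U" using U
          by (simp add: negligible_iff_null_sets AE_iff_null_sets borel_open)
        then show False using open_not_negligible[OF U] seg by auto
      qed
      have "0 \<le> L"
      proof (rule ccontr)
        assume "\<not> 0 \<le> L"
        then have "\<not> norm (g b x) \<le> L" for x using norm_ge_zero[of "g b x"] by linarith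
        then show False using g(2)[OF b] \<open>\<not> (AE x in lebesgue. x \<in> U \<longrightarrow> False)\<close> by simp
      qed
      then show False using not v0 by (simp add: v_def sum_nonneg)
    qed
    ultimately have "L * (\<Sum>b\<in>Basis. \<bar>e \<bullet> b\<bar>) * norm v < norm v * norm v" by (intro mult_strict_right_mono)
    then show ?thesis by (simp add: M_def dot_square_norm power2_eq_square)
  qed
  obtain \<epsilon> where \<epsilon>: "\<epsilon> > 0" "\<And>x y. x \<in> closed_segment z (z + e) \<Longrightarrow> dist x y < \<epsilon> \<Longrightarrow> y \<in> U"
  proof -
    have "\<exists>\<epsilon>>0. \<forall>x\<in>closed_segment z (z + e). \<forall>y\<in>- U. \<epsilon> \<le> dist x y"
      by (rule separate_compact_closed) (use U seg in \<open>auto simp: open_closed\<close>)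
    then obtain \<epsilon> where e: "\<epsilon> > 0" "\<forall>x\<in>closed_segment z (z + e). \<forall>y\<in>- U. \<epsilon> \<le> dist x y" by blast
    show ?thesis by (rule that[OF e(1)]) (use e(2) in \<open>force simp: not_less[symmetric]\<close>)
  qed
  have inseg: "z + s *\<^sub>R e \<in> closed_segment z (z + e)" if "s \<in> {0..1}" for s
    using that by (auto simp: closed_segment_def algebra_simps intro!: exI[of _ s])
  have cont: "isCont f z" "isCont f (z + e)"
    using f U seg inseg[of 0] inseg[of 1] by (auto simp: continuous_on_eq_continuous_at)
  have "isCont (\<lambda>x. (f (x + e) - f x) \<bullet> v) z"
    by (intro continuous_intros cont(1) isCont_o2[where f="\<lambda>x. x + e" and g=f] cont(2))
  then have "((\<lambda>x. (f (x + e) - f x) \<bullet> v) \<longlongrightarrow> (f (z + e) - f z) \<bullet> v) (at z)"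
    by (simp add: isCont_def)
  then have "\<forall>\<^sub>F x in at z. M < (f (x + e) - f x) \<bullet> v"
    using vM by (intro order_tendstoD) (auto simp: v_def)
  then obtain \<epsilon>' where \<epsilon>': "\<epsilon>' > 0" "\<And>x. dist x z < \<epsilon>' \<Longrightarrow> M < (f (x + e) - f x) \<bullet> v"
    using vM unfolding eventually_at by (metis UNIV_I v_def)
  define \<delta> where "\<delta> = min \<epsilon> \<epsilon>' / (2 * real DIM('a))"
  have \<delta>: "\<delta> > 0" using \<epsilon>(1) \<epsilon>'(1) by (simp add: \<delta>_def)
  define l u where "l = z - \<delta> *\<^sub>R One" and "u = z + \<delta> *\<^sub>R One"
  have P: "dist z x < min \<epsilon> \<epsilon>'" if "x \<in> cbox l u" for x
  proof -
    have "norm (x - z) \<le> (\<Sum>i\<in>Basis. \<bar>(x - z) \<bullet> i\<bar>)" by (rule norm_le_l1)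
    also have "\<dots> \<le> (\<Sum>i\<in>(Basis::'a set). \<delta>)"
      using that by (intro sum_mono) (auto simp: mem_box l_def u_def inner_diff_left inner_add_left abs_le_iff)
    also have "\<dots> = real DIM('a) * \<delta>" by simp
    also have "\<dots> < min \<epsilon> \<epsilon>'" using \<epsilon>(1) \<epsilon>'(1) by (simp add: \<delta>_def) (auto simp: min_def)
    finally show ?thesis by (simp add: dist_norm norm_minus_commute)
  qed
  define Tube where "Tube = (\<lambda>(x, s). x + s *\<^sub>R e) ` (cbox l u \<times> {0..1::real})"
  have cT: "compact Tube" unfolding Tube_def
    by (intro compact_continuous_image compact_Times compact_cbox compact_Icc)
      (auto intro!: continuous_intros simp: split_beta)
  have TU: "Tube \<subseteq> U"
  proof
    fix y assume "y \<in> Tube"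
    then obtain x s where xs: "x \<in> cbox l u" "s \<in> {0..1}" "y = x + s *\<^sub>R e" by (auto simp: Tube_def)
    have "dist (z + s *\<^sub>R e) y < \<epsilon>" using P[OF xs(1)] by (simp add: xs(3) dist_norm)
    then show "y \<in> U" using \<epsilon>(2)[OF inseg[OF xs(2)]] by blast
  qed
  have cfT: "continuous_on Tube (\<lambda>x. f x \<bullet> v)" by (intro continuous_intros continuous_on_subset[OF f TU])
  then have "compact ((\<lambda>x. f x \<bullet> v) ` Tube)" using cT compact_continuous_image by blast
  then obtain Bd where Bd: "\<And>x. x \<in> Tube \<Longrightarrow> norm (f x \<bullet> v) \<le> Bd"
    using compact_imp_bounded bounded_iff by (metis imageI)
  have cl: "closedin (top_of_set UNIV) Tube" using compact_imp_closed[OF cT] by simp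
  have nb: "norm (f x \<bullet> v) \<le> max 0 Bd" if "x \<in> Tube" for x using Bd[OF that] by simp
  \<comment> \<open>Off the tube the bump vanishes, so an extension of \<open>f\<close> only serves to differentiate under an
    integral over a fixed box.\<close>
  obtain F where F: "continuous_on UNIV F" "\<And>x. x \<in> Tube \<Longrightarrow> F x = f x \<bullet> v"
    by (rule Tietze[OF cfT cl max.cobounded1[of 0 Bd] nb]) auto
  obtain c d where cd: "Tube \<subseteq> cbox c d" using cT compact_imp_bounded bounded_subset_cbox_symmetric by metis
  define \<phi> where "\<phi> = box_bump l u"
  obtain G where G: "C1_with \<phi> G" unfolding \<phi>_def using box_bump_C1 by blast
  have \<phi>0: "\<phi> x = 0" if "x \<notin> cbox l u" for x
    using that box_bump_outside[of x l u] box_subset_cbox[of l u] by (auto simp: \<phi>_def)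
  have G0: "G x = 0" if "x \<notin> cbox l u" for x
  proof -
    have "((\<lambda>x. 0) has_derivative (\<lambda>h. 0)) (at x)" by simp
    then have "(\<phi> has_derivative (\<lambda>h. 0)) (at x)"
      by (rule has_derivative_transform_within_open[of _ _ _ _ "- cbox l u"])
        (use that \<phi>0 in \<open>auto intro: open_Compl[OF closed_cbox]\<close>)
    then have "(\<lambda>h. G x \<bullet> h) = (\<lambda>h. 0)" using G has_derivative_unique unfolding C1_with_def by blast
    then show ?thesis by (metis inner_eq_zero_iff)
  qed
  \<comment> \<open>The mollified function at the points \<open>z + s e\<close>, up to the mass \<open>I\<close> of the bump.\<close>
  define H where "H = (\<lambda>s. integral (cbox c d) (\<lambda>x. \<phi> (x - s *\<^sub>R e) * F x))"
  define H' where "H' = (\<lambda>s. integral (cbox c d) (\<lambda>x. - (G (x - s *\<^sub>R e) \<bullet> e) * F x))"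
  have c\<phi>: "continuous_on UNIV \<phi>" by (rule C1_with_continuous[OF G])
  have cG: "continuous_on UNIV G" using G by (simp add: C1_with_def)
  have dH: "(H has_real_derivative H' s) (at s within {0..1})" if "s \<in> {0..1}" for s
    unfolding H_def H'_def
  proof (rule leibniz_rule_field_derivative)
    fix s :: real and x
    have "((\<lambda>s. x - s *\<^sub>R e) has_derivative (\<lambda>h. - (h *\<^sub>R e))) (at s)" by (auto intro!: derivative_eq_intros)
    moreover have "(\<phi> has_derivative (\<lambda>h. G (x - s *\<^sub>R e) \<bullet> h)) (at (x - s *\<^sub>R e))" using G by (simp add: C1_with_def)
    ultimately have "(\<phi> \<circ> (\<lambda>s. x - s *\<^sub>R e) has_derivative (\<lambda>h. G (x - s *\<^sub>R e) \<bullet> h) \<circ> (\<lambda>h. - (h *\<^sub>R e))) (at s)"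
      by (rule diff_chain_at)
    moreover have "(\<lambda>h. G (x - s *\<^sub>R e) \<bullet> h) \<circ> (\<lambda>h. - (h *\<^sub>R e)) = (*) (- (G (x - s *\<^sub>R e) \<bullet> e))" by auto
    ultimately have "((\<lambda>s. \<phi> (x - s *\<^sub>R e)) has_real_derivative - (G (x - s *\<^sub>R e) \<bullet> e)) (at s)"
      by (simp add: has_field_derivative_def comp_def)
    then have "((\<lambda>s. \<phi> (x - s *\<^sub>R e) * F x) has_real_derivative - (G (x - s *\<^sub>R e) \<bullet> e) * F x) (at s)"
      by (rule DERIV_cmult_right)
    then show "((\<lambda>s. \<phi> (x - s *\<^sub>R e) * F x) has_real_derivative - (G (x - s *\<^sub>R e) \<bullet> e) * F x) (at s within {0..1})"
      by (rule has_field_derivative_at_within)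
  next
    fix s :: real
    have "continuous_on (cbox c d) (\<lambda>x. \<phi> (x - s *\<^sub>R e) * F x)"
      by (intro continuous_intros continuous_on_compose2[OF c\<phi>] continuous_on_subset[OF F(1)]) auto
    then show "(\<lambda>x. \<phi> (x - s *\<^sub>R e) * F x) integrable_on cbox c d" by (rule integrable_continuous)
  next
    show "continuous_on ({0..1} \<times> cbox c d) (\<lambda>(s, x). - (G (x - s *\<^sub>R e) \<bullet> e) * F x)"
      unfolding split_beta
      by (intro continuous_intros continuous_on_compose2[OF cG] continuous_on_compose2[OF F(1)]) auto
  qed (use that in auto)
  define I where "I = (\<integral>x. \<phi> x \<partial>lebesgue)"
  have \<phi>i: "integrable lebesgue \<phi>"
  proof -
    have "integrable lborel (\<lambda>x. indicator (cbox l u) x * \<phi> x)"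
      by (rule indicator_compact_integrable[OF compact_cbox]) (rule continuous_on_subset[OF c\<phi>], simp)
    moreover have "(\<lambda>x. indicator (cbox l u) x * \<phi> x) = \<phi>" using \<phi>0 by (auto simp: fun_eq_iff split: split_indicator)
    ultimately have "integrable lborel \<phi>" by simp
    then show ?thesis using integrable_completion[OF borel_measurable_integrable] by blast
  qed
  have \<phi>shift: "has_bochner_integral lebesgue (\<lambda>x. \<phi> (x - s *\<^sub>R e)) I" for s
  proof -
    have b: "\<phi> \<in> borel_measurable lborel" "(\<lambda>x. \<phi> (x - s *\<^sub>R e)) \<in> borel_measurable lborel"
      by (auto intro!: borel_measurable_continuous_onI continuous_intros continuous_on_compose2[OF c\<phi>] c\<phi>)
    have "integrable lborel \<phi>" using \<phi>i integrable_completion[OF b(1)] by simp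
    from lborel_integral_shift[OF this, of "s *\<^sub>R e"] show ?thesis
      using integrable_completion[OF b(2)] integral_completion[OF b(2)] integral_completion[OF b(1)]
      by (simp add: has_bochner_integral_iff I_def)
  qed
  have H'bound: "\<bar>H' s\<bar> \<le> M * I" if s: "s \<in> {0..1}" for s
  proof -
    define Ps where "Ps = (\<lambda>x. x + s *\<^sub>R e) ` cbox l u"
    have Ps: "compact Ps" "Ps \<subseteq> Tube" unfolding Ps_def
      by (auto intro!: compact_continuous_image continuous_intros) (use s in \<open>force simp: Tube_def\<close>)
    have PsU: "Ps \<subseteq> U" using Ps TU by blast
    have outP: "x - s *\<^sub>R e \<notin> cbox l u" if "x \<notin> Ps" for x
      using that unfolding Ps_def by (metis diff_add_cancel imageI)
    define \<psi> where "\<psi> = (\<lambda>x. \<phi> (x - s *\<^sub>R e))"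
    have \<psi>C1: "C1_with \<psi> (\<lambda>x. G (x - s *\<^sub>R e))" unfolding C1_with_def \<psi>_def
    proof (intro conjI allI)
      show "continuous_on UNIV (\<lambda>x. G (x - s *\<^sub>R e))"
        by (intro continuous_intros continuous_on_compose2[OF cG]) auto
      fix x
      have "((\<lambda>x. x - s *\<^sub>R e) has_derivative (\<lambda>h. h)) (at x)" by (auto intro!: derivative_eq_intros)
      moreover have "(\<phi> has_derivative (\<lambda>h. G (x - s *\<^sub>R e) \<bullet> h)) (at (x - s *\<^sub>R e))" using G by (simp add: C1_with_def)
      ultimately show "((\<lambda>x. \<phi> (x - s *\<^sub>R e)) has_derivative (\<lambda>h. G (x - s *\<^sub>R e) \<bullet> h)) (at x)"
        using diff_chain_at by (fastforce simp: comp_def)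
    qed
    have \<psi>0: "\<psi> x = 0" if "x \<notin> Ps" for x using \<phi>0[OF outP[OF that]] by (simp add: \<psi>_def)
    have \<psi>c: "\<psi> \<in> C1c_functions U" by (rule C1c_if_C1_with[OF \<psi>C1 Ps(1) PsU \<psi>0])
    have \<psi>cont: "continuous_on UNIV \<psi>" by (rule C1_with_continuous[OF \<psi>C1])
    have fK: "set_integrable lebesgue Ps f" "\<And>b. b \<in> Basis \<Longrightarrow> set_integrable lebesgue Ps (g b)"
      using g(1) Ps(1) PsU nonempty_Basis unfolding has_weak_derivative_def by blast+
    have Gb0: "G (x - s *\<^sub>R e) \<bullet> b = 0" if "x \<notin> Ps" for x b using G0[OF outP[OF that]] by simp
    have Gbc: "continuous_on UNIV (\<lambda>x. G (x - s *\<^sub>R e) \<bullet> b)" for b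
      by (intro continuous_intros continuous_on_compose2[OF cG]) auto
    note iG = C1c_product_integrable[OF Gbc Ps(1) PsU Gb0 fK(1)]
    have ibp: "(LINT x:U|lebesgue. (G (x - s *\<^sub>R e) \<bullet> b) *\<^sub>R f x) = - (LINT x:U|lebesgue. \<psi> x *\<^sub>R g b x)"
      if "b \<in> Basis" for b
      using g(1)[OF that] \<psi>c C1_with_frechet[OF \<psi>C1] unfolding has_weak_derivative_def by force
    have "H' s = - (LINT x:U|lebesgue. (G (x - s *\<^sub>R e) \<bullet> e) *\<^sub>R f x) \<bullet> v"
    proof -
      have cc: "continuous_on (cbox c d) (\<lambda>x. - (G (x - s *\<^sub>R e) \<bullet> e) * F x)"
        by (intro continuous_intros continuous_on_compose2[OF cG] continuous_on_subset[OF F(1)]) auto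
      have "H' s = (LINT x:cbox c d|lebesgue. - (G (x - s *\<^sub>R e) \<bullet> e) * F x)"
        unfolding H'_def by (rule set_lebesgue_integral_eq_integral(2)[symmetric])
          (rule absolutely_integrable_continuous[OF cc])
      also have "\<dots> = (\<integral>x. - ((G (x - s *\<^sub>R e) \<bullet> e) *\<^sub>R (indicator Ps x *\<^sub>R f x)) \<bullet> v \<partial>lebesgue)"
        unfolding set_lebesgue_integral_def
      proof (rule Bochner_Integration.integral_cong[OF refl])
        fix x
        show "indicator (cbox c d) x *\<^sub>R (- (G (x - s *\<^sub>R e) \<bullet> e) * F x)
            = - ((G (x - s *\<^sub>R e) \<bullet> e) *\<^sub>R (indicator Ps x *\<^sub>R f x)) \<bullet> v"
        proof (cases "x \<in> Ps")
          case True
          then have "x \<in> Tube" "x \<in> cbox c d" using Ps cd by auto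
          then show ?thesis using True F(2) by simp
        next
          case False
          then show ?thesis using Gb0[of x e] by simp
        qed
      qed
      also have "\<dots> = - (\<integral>x. (G (x - s *\<^sub>R e) \<bullet> e) *\<^sub>R (indicator Ps x *\<^sub>R f x) \<partial>lebesgue) \<bullet> v"
      proof -
        have "integrable lebesgue (\<lambda>x. (G (x - s *\<^sub>R e) \<bullet> e) *\<^sub>R (indicator Ps x *\<^sub>R f x))"
        proof -
          have "(\<lambda>x. (G (x - s *\<^sub>R e) \<bullet> e) *\<^sub>R (indicator Ps x *\<^sub>R f x)) = (\<lambda>x. indicator U x *\<^sub>R ((G (x - s *\<^sub>R e) \<bullet> e) *\<^sub>R f x))"
            using PsU Gb0 by (auto simp: fun_eq_iff split: split_indicator)
          then show ?thesis using iG(1)[of e] by (simp add: set_integrable_def)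
        qed
        then have "(\<integral>x. ((G (x - s *\<^sub>R e) \<bullet> e) *\<^sub>R (indicator Ps x *\<^sub>R f x)) \<bullet> v \<partial>lebesgue)
            = (\<integral>x. (G (x - s *\<^sub>R e) \<bullet> e) *\<^sub>R (indicator Ps x *\<^sub>R f x) \<partial>lebesgue) \<bullet> v"
          by (rule integral_inner_left)
        then show ?thesis by (simp only: inner_minus_left Bochner_Integration.integral_minus)
      qed
      moreover have "(LINT x:U|lebesgue. (G (x - s *\<^sub>R e) \<bullet> e) *\<^sub>R f x)
          = (\<integral>x. (G (x - s *\<^sub>R e) \<bullet> e) *\<^sub>R (indicator Ps x *\<^sub>R f x) \<partial>lebesgue)" by (rule iG(2))
      ultimately show ?thesis by (simp only:)
    qed
    also have "(LINT x:U|lebesgue. (G (x - s *\<^sub>R e) \<bullet> e) *\<^sub>R f x)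
        = (\<Sum>b\<in>Basis. (e \<bullet> b) *\<^sub>R (LINT x:U|lebesgue. (G (x - s *\<^sub>R e) \<bullet> b) *\<^sub>R f x))"
    proof -
      have "G y \<bullet> e = (\<Sum>b\<in>Basis. (e \<bullet> b) * (G y \<bullet> b))" for y
        by (subst euclidean_inner) (simp add: mult.commute)
      then have "(LINT x:U|lebesgue. (G (x - s *\<^sub>R e) \<bullet> e) *\<^sub>R f x)
          = (\<integral>x. (\<Sum>b\<in>Basis. (e \<bullet> b) *\<^sub>R (indicator U x *\<^sub>R ((G (x - s *\<^sub>R e) \<bullet> b) *\<^sub>R f x))) \<partial>lebesgue)"
        unfolding set_lebesgue_integral_def
        by (intro Bochner_Integration.integral_cong refl)
          (simp add: scaleR_sum_left scaleR_sum_right mult.assoc mult.left_commute)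
      also have "\<dots> = (\<Sum>b\<in>Basis. (e \<bullet> b) *\<^sub>R (LINT x:U|lebesgue. (G (x - s *\<^sub>R e) \<bullet> b) *\<^sub>R f x))"
      proof -
        have "integrable lebesgue (\<lambda>x. indicator U x *\<^sub>R ((G (x - s *\<^sub>R e) \<bullet> b) *\<^sub>R f x))" for b
          using iG(1)[of b] unfolding set_integrable_def .
        then show ?thesis unfolding set_lebesgue_integral_def
          by (subst Bochner_Integration.integral_sum) (rule integrable_scaleR_right, blast, simp only: integral_scaleR_right)
      qed
      finally show ?thesis .
    qed
    finally have Hs: "H' s = (\<Sum>b\<in>Basis. (e \<bullet> b) * ((LINT x:U|lebesgue. \<psi> x *\<^sub>R g b x) \<bullet> v))"
      by (simp add: ibp inner_sum_left sum_negf)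
    have gb: "norm (LINT x:U|lebesgue. \<psi> x *\<^sub>R g b x) \<le> L * I" if b: "b \<in> Basis" for b
    proof -
      note ig = C1c_product_integrable[OF \<psi>cont Ps(1) PsU \<psi>0 fK(2)[OF b]]
      have "norm (LINT x:U|lebesgue. \<psi> x *\<^sub>R g b x) \<le> (\<integral>x. norm (indicator U x *\<^sub>R (\<psi> x *\<^sub>R g b x)) \<partial>lebesgue)"
        unfolding set_lebesgue_integral_def by (rule integral_norm_bound)
      also have "\<dots> \<le> (\<integral>x. L * \<psi> x \<partial>lebesgue)"
      proof (rule integral_mono_AE)
        show "integrable lebesgue (\<lambda>x. norm (indicator U x *\<^sub>R (\<psi> x *\<^sub>R g b x)))"
          using ig(1) by (intro integrable_norm) (simp add: set_integrable_def)
        show "integrable lebesgue (\<lambda>x. L * \<psi> x)"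
          using \<phi>shift[of s] by (simp add: has_bochner_integral_iff \<psi>_def)
        show "AE x in lebesgue. norm (indicator U x *\<^sub>R (\<psi> x *\<^sub>R g b x)) \<le> L * \<psi> x"
          using g(2)[OF b]
        proof eventually_elim
          case (elim x)
          have nn: "0 \<le> \<psi> x" by (simp add: \<psi>_def \<phi>_def box_bump_nonneg)
          show ?case
          proof (cases "x \<in> U")
            case True
            then have "\<psi> x * norm (g b x) \<le> \<psi> x * L" using elim nn by (intro mult_left_mono) auto
            then show ?thesis using True nn by (simp add: mult.commute[of L])
          next
            case False
            then have "\<psi> x = 0" using \<psi>0[of x] PsU by blast
            then show ?thesis by simp
          qed
        qed
      qed
      also have "\<dots> = L * I" using \<phi>shift[of s] by (simp add: has_bochner_integral_iff \<psi>_def)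
      finally show ?thesis .
    qed
    have "\<bar>H' s\<bar> \<le> (\<Sum>b\<in>Basis. \<bar>e \<bullet> b\<bar> * (L * I * norm v))"
      unfolding Hs
    proof (rule order.trans[OF sum_abs], rule sum_mono)
      fix b :: 'a assume b: "b \<in> Basis"
      have "\<bar>(LINT x:U|lebesgue. \<psi> x *\<^sub>R g b x) \<bullet> v\<bar> \<le> norm (LINT x:U|lebesgue. \<psi> x *\<^sub>R g b x) * norm v"
        by (rule Cauchy_Schwarz_ineq2)
      also have "\<dots> \<le> L * I * norm v" by (intro mult_right_mono gb[OF b]) simp
      finally show "\<bar>e \<bullet> b * ((LINT x:U|lebesgue. \<psi> x *\<^sub>R g b x) \<bullet> v)\<bar> \<le> \<bar>e \<bullet> b\<bar> * (L * I * norm v)"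
        by (simp add: abs_mult mult_left_mono)
    qed
    also have "\<dots> = M * I" by (simp add: M_def sum_distrib_left sum_distrib_right mult_ac)
    finally show ?thesis .
  qed
  have "H 1 - H 0 \<le> M * I"
  proof -
    have "\<exists>s\<in>{0<..<1}. H 1 - H 0 = H' s * (1 - 0)"
      by (rule mvt_simple) (use dH in \<open>auto simp: has_field_derivative_def\<close>)
    then obtain s where s: "s \<in> {0<..<1}" "H 1 - H 0 = H' s" by auto
    then show ?thesis using H'bound[of s] by auto
  qed
  moreover have "H 1 - H 0 > M * I"
  proof -
    have Hs: "H s = (\<integral>x. \<phi> x * F (x + s *\<^sub>R e) \<partial>lborel)" "integrable lborel (\<lambda>x. \<phi> x * F (x + s *\<^sub>R e))" if s: "s \<in> {0..1}" for s
    proof -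
      have cc: "continuous_on (cbox c d) (\<lambda>x. \<phi> (x - s *\<^sub>R e) * F x)"
        by (intro continuous_intros continuous_on_compose2[OF c\<phi>] continuous_on_subset[OF F(1)]) auto
      have "(\<lambda>x. indicator (cbox l u) x * (\<phi> x * F (x + s *\<^sub>R e))) = (\<lambda>x. \<phi> x * F (x + s *\<^sub>R e))"
        using \<phi>0 by (auto simp: fun_eq_iff split: split_indicator)
      moreover have "integrable lborel (\<lambda>x. indicator (cbox l u) x * (\<phi> x * F (x + s *\<^sub>R e)))"
        by (intro indicator_compact_integrable compact_cbox continuous_intros continuous_on_subset[OF c\<phi>]
            continuous_on_compose2[OF F(1)]) auto
      ultimately show i: "integrable lborel (\<lambda>x. \<phi> x * F (x + s *\<^sub>R e))" by simp
      have "H s = (LINT x:cbox c d|lebesgue. \<phi> (x - s *\<^sub>R e) * F x)"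
        unfolding H_def by (rule set_lebesgue_integral_eq_integral(2)[symmetric])
          (rule absolutely_integrable_continuous[OF cc])
      also have "\<dots> = (\<integral>x. \<phi> (x - s *\<^sub>R e) * F x \<partial>lebesgue)"
        unfolding set_lebesgue_integral_def
      proof (rule Bochner_Integration.integral_cong[OF refl])
        fix x
        have "x \<in> cbox c d" if "x - s *\<^sub>R e \<in> cbox l u"
        proof -
          have "x \<in> Tube" unfolding Tube_def using that s by (intro image_eqI[of _ _ "(x - s *\<^sub>R e, s)"]) auto
          then show ?thesis using cd by blast
        qed
        then show "indicator (cbox c d) x *\<^sub>R (\<phi> (x - s *\<^sub>R e) * F x) = \<phi> (x - s *\<^sub>R e) * F x"
          using \<phi>0[of "x - s *\<^sub>R e"] by (auto split: split_indicator)
      qed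
      also have "\<dots> = (\<integral>x. \<phi> (x - s *\<^sub>R e) * F x \<partial>lborel)"
        by (rule integral_completion)
          (auto intro!: borel_measurable_continuous_onI continuous_intros continuous_on_compose2[OF c\<phi>] F(1))
      also have "\<dots> = (\<integral>x. \<phi> x * F (x + s *\<^sub>R e) \<partial>lborel)"
        using has_bochner_integral_integral_eq[OF lborel_integral_shift[OF i, of "s *\<^sub>R e"]] by simp
      finally show "H s = (\<integral>x. \<phi> x * F (x + s *\<^sub>R e) \<partial>lborel)" .
    qed
    define D where "D = (\<lambda>x. \<phi> x * (F (x + e) - F x - M))"
    have \<phi>b: "\<phi> \<in> borel_measurable lborel" using borel_measurable_continuous_onI[OF c\<phi>] by simp
    have \<phi>il: "integrable lborel \<phi>" "(\<integral>x. \<phi> x \<partial>lborel) = I"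
      using \<phi>i integrable_completion[OF \<phi>b] integral_completion[OF \<phi>b] by (simp_all add: I_def)
    have Di: "integrable lborel D" "(\<integral>x. D x \<partial>lborel) = H 1 - H 0 - M * I"
      using Hs[of 0] Hs[of 1] \<phi>il unfolding D_def
      by (simp_all add: right_diff_distrib)
    have Dpos: "D x > 0" if "x \<in> box l u" for x
    proof -
      have xc: "x \<in> cbox l u" using that box_subset_cbox by blast
      have "x \<in> Tube" unfolding Tube_def using xc by (intro image_eqI[of _ _ "(x, 0)"]) auto
      moreover have "x + e \<in> Tube" unfolding Tube_def using xc by (intro image_eqI[of _ _ "(x, 1)"]) auto
      ultimately
      have "F (x + e) - F x = (f (x + e) - f x) \<bullet> v" by (simp add: F(2) inner_diff_left)
      moreover have "M < (f (x + e) - f x) \<bullet> v" using \<epsilon>'(2)[of x] P[OF xc] by (simp add: dist_commute)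
      moreover have "\<phi> x > 0" unfolding \<phi>_def by (rule box_bump_pos[OF that])
      ultimately show ?thesis by (simp add: D_def)
    qed
    have D0: "D x = 0" if "x \<notin> box l u" for x using box_bump_outside[OF that] by (simp add: D_def \<phi>_def)
    have Dnn: "0 \<le> D x" for x using Dpos[of x] D0[of x] by (cases "x \<in> box l u") auto
    have "(\<integral>x. D x \<partial>lborel) \<noteq> 0"
    proof
      assume "(\<integral>x. D x \<partial>lborel) = 0"
      then have "AE x in lborel. D x = 0" using integral_nonneg_eq_0_iff_AE[OF Di(1)] Dnn by simp
      then have "AE x in lborel. x \<notin> box l u" by eventually_elim (use Dpos in force)
      then have "box l u \<in> null_sets lborel" by (simp add: AE_iff_null_sets)
      then have "negligible (box l u)" by (simp add: negligible_iff_null_sets null_sets_completionI)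
      moreover have "z \<in> box l u" using \<delta> by (auto simp: mem_box l_def u_def inner_diff_left inner_add_left)
      ultimately show False using open_not_negligible[OF open_box] by blast
    qed
    moreover have "(\<integral>x. D x \<partial>lborel) \<ge> 0" by (rule integral_nonneg_AE) (use Dnn in simp)
    ultimately show ?thesis using Di(2) by linarith
  qed
  ultimately show False by linarith
qed

section \<open>Finite element functions\<close>

lemma poly_degree_0_iff: "poly_degree_le 0 f \<longleftrightarrow> (\<exists>c. \<forall>x. f x = c)"
proof -
  have "{\<alpha> :: 'a \<Rightarrow> nat. (\<Sum>i\<in>UNIV. \<alpha> i) \<le> 0} = {\<lambda>i. 0}" by (auto simp: fun_eq_iff)
  then have "poly_degree_le 0 f \<longleftrightarrow> (\<exists>c :: ('a \<Rightarrow> nat) \<Rightarrow> real. \<forall>x. f x = c (\<lambda>i. 0))"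
    by (simp add: poly_degree_le_def)
  also have "\<dots> \<longleftrightarrow> (\<exists>c. \<forall>x. f x = c)" by (metis (full_types))
  finally show ?thesis .
qed

text \<open>A multi-index of length at most one is zero or a unit vector.\<close>

lemma poly_degree_1_iff:
  fixes f :: "real^'d \<Rightarrow> real"
  shows "poly_degree_le 1 f \<longleftrightarrow> (\<exists>g c. \<forall>x. f x = g \<bullet> x + c)"
proof -
  define \<delta> :: "'d \<Rightarrow> 'd \<Rightarrow> nat" where "\<delta> = (\<lambda>i j. if j = i then 1 else 0)"
  have inj: "inj \<delta>" by (rule injI) (auto simp: \<delta>_def fun_eq_iff split: if_splits)
  have set: "{\<alpha> :: 'd \<Rightarrow> nat. (\<Sum>i\<in>UNIV. \<alpha> i) \<le> 1} = insert (\<lambda>i. 0) (range \<delta>)"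
  proof (intro set_eqI iffI)
    fix \<alpha> :: "'d \<Rightarrow> nat" assume a: "\<alpha> \<in> {\<alpha>. (\<Sum>i\<in>UNIV. \<alpha> i) \<le> 1}"
    show "\<alpha> \<in> insert (\<lambda>i. 0) (range \<delta>)"
    proof (cases "\<exists>i. \<alpha> i \<noteq> 0")
      case True
      then obtain i where i: "\<alpha> i \<noteq> 0" by blast
      have "\<alpha> i + (\<Sum>j\<in>UNIV - {i}. \<alpha> j) \<le> 1" using a by (simp add: sum.remove[of UNIV i])
      then have "\<alpha> i = 1" "(\<Sum>j\<in>UNIV - {i}. \<alpha> j) = 0" using i by linarith+
      then have "\<alpha> = \<delta> i" by (auto simp: fun_eq_iff \<delta>_def)
      then show ?thesis by blast
    qed (auto simp: fun_eq_iff)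
  next
    fix \<alpha> assume "\<alpha> \<in> insert (\<lambda>i. 0) (range \<delta>)"
    then show "\<alpha> \<in> {\<alpha>. (\<Sum>i\<in>UNIV. \<alpha> i) \<le> 1}" by (auto simp: \<delta>_def)
  qed
  have nin: "(\<lambda>i. 0) \<notin> range \<delta>" by (auto simp: \<delta>_def fun_eq_iff) (metis zero_neq_one)
  have mono: "(\<Prod>j\<in>UNIV. (x $ j) ^ \<delta> i j) = x $ i" for i and x :: "real^'d"
  proof -
    have "(\<Prod>j\<in>UNIV. (x $ j) ^ \<delta> i j) = (\<Prod>j\<in>UNIV. if j = i then x $ j else 1)"
      by (rule prod.cong) (auto simp: \<delta>_def)
    then show ?thesis by simp
  qed
  have ev: "(\<Sum>\<alpha> | (\<Sum>i\<in>UNIV. \<alpha> i) \<le> 1. c \<alpha> * (\<Prod>i\<in>UNIV. (x $ i) ^ (\<alpha> i)))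
      = (\<chi> i. c (\<delta> i)) \<bullet> x + c (\<lambda>i. 0)" for c and x :: "real^'d"
    unfolding set using nin by (simp add: sum.reindex[OF inj] mono inner_vec_def)
  show ?thesis
  proof
    assume "poly_degree_le 1 f"
    then show "\<exists>g c. \<forall>x. f x = g \<bullet> x + c" unfolding poly_degree_le_def ev by blast
  next
    assume "\<exists>g c. \<forall>x. f x = g \<bullet> x + c"
    then obtain g c where gc: "\<And>x. f x = g \<bullet> x + c" by blast
    define C where "C = (\<lambda>\<alpha>. if \<alpha> = (\<lambda>i. 0) then c else g $ (THE i. \<alpha> = \<delta> i))"
    have "(THE i'. \<delta> i = \<delta> i') = i" for i using inj by (auto simp: inj_def)
    moreover have "\<delta> i \<noteq> (\<lambda>i. 0)" for i using nin by (metis rangeI)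
    ultimately have "C (\<delta> i) = g $ i" for i by (simp add: C_def)
    then have "(\<chi> i. C (\<delta> i)) = g" by (simp add: vec_eq_iff)
    moreover have "C (\<lambda>i. 0) = c" by (simp add: C_def)
    ultimately show "poly_degree_le 1 f" unfolding poly_degree_le_def ev
      by (intro exI[of _ C]) (simp add: gc)
  qed
qed

lemma norm_matrix_vector_le:
  fixes A :: "real^'n^'m"
  shows "norm (A *v x) \<le> norm A * norm x"
proof -
  have "(norm (A *v x))\<^sup>2 = (\<Sum>i\<in>UNIV. (A $ i \<bullet> x)\<^sup>2)"
    unfolding power2_norm_eq_inner inner_vec_def[of "A *v x"]
    by (simp add: matrix_vector_mul_component power2_eq_square)
  also have "\<dots> \<le> (\<Sum>i\<in>UNIV. (norm (A $ i))\<^sup>2 * (norm x)\<^sup>2)"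
  proof (rule sum_mono)
    fix i
    have "(A $ i \<bullet> x)\<^sup>2 = \<bar>A $ i \<bullet> x\<bar>\<^sup>2" by simp
    also have "\<dots> \<le> (norm (A $ i) * norm x)\<^sup>2" by (intro power_mono Cauchy_Schwarz_ineq2) simp
    finally show "(A $ i \<bullet> x)\<^sup>2 \<le> (norm (A $ i))\<^sup>2 * (norm x)\<^sup>2" by (simp add: power_mult_distrib)
  qed
  also have "\<dots> = (norm A * norm x)\<^sup>2"
    by (simp add: sum_distrib_right[symmetric] power_mult_distrib power2_norm_eq_inner inner_vec_def[of A])
  finally show ?thesis by (rule power2_le_imp_le) simp
qed

text \<open>Gradients of the discrete functions are constant on each element, so they are read off at one
  interior point; this gives total functions \<open>elem_grad\<close> and \<open>elem_jac\<close> of the element.\<close>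

definition elem_point :: "(real^'d) set \<Rightarrow> real^'d" where
  "elem_point K = (SOME x. x \<in> interior K)"

definition elem_grad :: "(real^'d) set \<Rightarrow> (real^'d \<Rightarrow> real) \<Rightarrow> real^'d" where
  "elem_grad K q = grad q (elem_point K)"

definition elem_jac :: "(real^'d) set \<Rightarrow> (real^'d \<Rightarrow> real^'d) \<Rightarrow> real^'d^'d" where
  "elem_jac K v = (\<chi> i. elem_grad K (\<lambda>x. v x $ i))"

lemma grad_affine:
  assumes "\<And>x. x \<in> interior K \<Longrightarrow> q x = g \<bullet> x + c" "x \<in> interior K"
  shows "grad q x = g"
proof -
  have "((\<lambda>x. g \<bullet> x + c) has_derivative (\<lambda>h. g \<bullet> h)) (at x)" by (auto intro!: derivative_eq_intros)
  then have "(q has_derivative (\<lambda>h. g \<bullet> h)) (at x)"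
    by (rule has_derivative_transform_within_open[OF _ open_interior assms(2)]) (simp add: assms(1))
  then have "frechet_derivative q (at x) = (\<lambda>h. g \<bullet> h)" by (rule frechet_derivative_at[symmetric])
  then show ?thesis by (simp add: grad_def vec_eq_iff inner_axis)
qed

lemma elem_grad_affine:
  assumes "interior K \<noteq> {}" "\<And>x. x \<in> interior K \<Longrightarrow> q x = g \<bullet> x + c"
  shows "elem_grad K q = g"
  unfolding elem_grad_def elem_point_def
  by (rule grad_affine[of K _ _ c]) (use assms in \<open>auto simp: some_in_eq\<close>)

lemma jac_affine:
  fixes M :: "real^'d^'d"
  assumes "\<And>x. x \<in> interior K \<Longrightarrow> v x = M *v x + c" "x \<in> interior K"
  shows "jac v x = M"
proof -
  have "((\<lambda>x. M *v x + c) has_derivative (\<lambda>h. M *v h)) (at x)"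
    by (rule has_derivative_add_const) (rule linear_imp_has_derivative, simp add: matrix_vector_mul_linear)
  then have "(v has_derivative (\<lambda>h. M *v h)) (at x)"
    by (rule has_derivative_transform_within_open[OF _ open_interior assms(2)]) (simp add: assms(1))
  then have "frechet_derivative v (at x) = (\<lambda>h. M *v h)" by (rule frechet_derivative_at[symmetric])
  then show ?thesis by (simp add: jac_def)
qed

lemma side_value_const:
  fixes f :: "real^'d \<Rightarrow> 'b::t2_space"
  assumes K: "full_simplex K" "x \<in> K" and f: "\<And>y. y \<in> interior K \<Longrightarrow> f y = c"
  shows "side_value K f x = c"
proof -
  have "x islimpt interior K"
  proof (cases "x \<in> interior K")
    case True
    then show ?thesis using interior_limit_point[of x "interior K"] by simp
  next
    case False
    have "x \<in> closure (interior K)" using closure_interior_simplex[OF K(1)] K(2) by simp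
    then show ?thesis using False by (simp add: closure_def)
  qed
  then have nt: "at x within interior K \<noteq> bot" by (simp add: trivial_limit_within)
  have "(f \<longlongrightarrow> c) (at x within interior K)"
    by (rule tendsto_eventually) (use f in \<open>auto simp: eventually_at_filter\<close>)
  then show ?thesis unfolding side_value_def using tendsto_Lim[OF nt] by blast
qed

text \<open>The boundary of an element is a null set, so integrals see only interior values; this is how the
  arbitrary values on the mesh skeleton are removed.\<close>

lemma elem_integral:
  fixes f g :: "real^'d \<Rightarrow> 'b::euclidean_space"
  assumes K: "full_simplex K" and fg: "\<And>x. x \<in> interior K \<Longrightarrow> f x = g x" and g: "continuous_on K g"
  shows "set_integrable lebesgue K f" "(LINT x:K|lebesgue. f x) = (LINT x:K|lebesgue. g x)"
proof -
  have "integrable lborel (\<lambda>x. indicator K x *\<^sub>R g x)"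
    by (rule borel_integrable_compact[OF full_simplex_compact[OF K] g])
  then have i: "integrable lebesgue (\<lambda>x. indicator K x *\<^sub>R g x)"
    using integrable_completion[OF borel_measurable_integrable] by blast
  have n: "frontier K \<in> null_sets lebesgue"
    using negligible_convex_frontier[OF full_simplex_convex[OF K]] by (simp add: negligible_iff_null_sets)
  have ae: "AE x in lebesgue. indicator K x *\<^sub>R g x = indicator K x *\<^sub>R f x"
    by (rule AE_I'[OF n]) (use fg full_simplex_compact[OF K] in \<open>auto simp: frontier_def compact_imp_closed indicator_def\<close>)
  have m: "(\<lambda>x. indicator K x *\<^sub>R f x) \<in> borel_measurable lebesgue"
    by (rule borel_measurable_AE[OF borel_measurable_integrable[OF i] ae])
  show "set_integrable lebesgue K f" unfolding set_integrable_def
    by (rule integrable_cong_AE_imp[OF i m]) (use ae in \<open>auto elim: eventually_mono\<close>)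
  show "(LINT x:K|lebesgue. f x) = (LINT x:K|lebesgue. g x)" unfolding set_lebesgue_integral_def
    by (rule integral_cong_AE[OF m borel_measurable_integrable[OF i]]) (use ae in \<open>auto elim: eventually_mono\<close>)
qed

context mesh
begin

text \<open>The class of functions that occur in the forms: continuous on each element up to its boundary, with
  arbitrary values on the skeleton.\<close>

definition piecewise_continuous :: "(real^'d \<Rightarrow> 'b::euclidean_space) \<Rightarrow> bool" where
  "piecewise_continuous f \<longleftrightarrow> (\<forall>K\<in>\<T>. \<exists>g. continuous_on K g \<and> (\<forall>x\<in>interior K. f x = g x))"

lemma domain_sets: "\<Omega> \<in> sets lebesgue"
  using open_domain by (simp add: borel_open)

text \<open>The domain differs from the union of the disjoint interiors of the elements by a null set.\<close>

lemma domain_integral: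
  fixes f :: "real^'d \<Rightarrow> 'b::euclidean_space"
  assumes f: "\<And>K. K \<in> \<T> \<Longrightarrow> set_integrable lebesgue K f"
  shows "set_integrable lebesgue \<Omega> f" "(LINT x:\<Omega>|lebesgue. f x) = (\<Sum>K\<in>\<T>. LINT x:K|lebesgue. f x)"
proof -
  have i: "integrable lebesgue (\<lambda>x. \<Sum>K\<in>\<T>. indicator K x *\<^sub>R f x)"
    by (rule Bochner_Integration.integrable_sum) (use f in \<open>simp add: set_integrable_def\<close>)
  have "frontier K \<in> null_sets lebesgue" if "K \<in> \<T>" for K
    using negligible_convex_frontier[OF full_simplex_convex[OF simplex[OF that]]] by (simp add: negligible_iff_null_sets)
  then have n: "(\<Union>K\<in>\<T>. frontier K) \<in> null_sets lebesgue"
    by (intro null_sets.finite_UN finite_mesh)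
  have sumK: "(\<Sum>K\<in>\<T>. indicator K x *\<^sub>R f x) = indicator \<Omega> x *\<^sub>R f x" if x: "x \<notin> (\<Union>K\<in>\<T>. frontier K)" for x
  proof (cases "x \<in> \<Omega>")
    case True
    then obtain K where K: "K \<in> \<T>" "x \<in> K" using Union_mesh closure_subset by blast
    have xi: "x \<in> interior K" using K x closure_subset by (auto simp: frontier_def)
    have "(\<Sum>K'\<in>\<T>. indicator K' x *\<^sub>R f x) = (\<Sum>K'\<in>\<T>. if K' = K then f x else 0)"
    proof (rule sum.cong[OF refl])
      fix K' assume K': "K' \<in> \<T>"
      show "indicator K' x *\<^sub>R f x = (if K' = K then f x else 0)"
        using eq_if_interior_meets[OF K(1) K'] xi K by (auto split: split_indicator)
    qed
    then show ?thesis using K finite_mesh True by simp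
  next
    case False
    have "x \<notin> K" if "K \<in> \<T>" for K
      using False x that interior_subset_domain[OF that] closure_subset[of K] by (auto simp: frontier_def)
    then show ?thesis using False by simp
  qed
  have ae: "AE x in lebesgue. (\<Sum>K\<in>\<T>. indicator K x *\<^sub>R f x) = indicator \<Omega> x *\<^sub>R f x"
    by (rule AE_I'[OF n]) (use sumK in blast)
  have m: "(\<lambda>x. indicator \<Omega> x *\<^sub>R f x) \<in> borel_measurable lebesgue"
    by (rule borel_measurable_AE[OF borel_measurable_integrable[OF i] ae])
  show "set_integrable lebesgue \<Omega> f" unfolding set_integrable_def
    by (rule integrable_cong_AE_imp[OF i m]) (use ae in \<open>auto elim: eventually_mono\<close>)
  have "(LINT x:\<Omega>|lebesgue. f x) = (\<integral>x. (\<Sum>K\<in>\<T>. indicator K x *\<^sub>R f x) \<partial>lebesgue)"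
    unfolding set_lebesgue_integral_def
    by (rule integral_cong_AE[OF m borel_measurable_integrable[OF i]]) (use ae in \<open>auto elim: eventually_mono\<close>)
  also have "\<dots> = (\<Sum>K\<in>\<T>. LINT x:K|lebesgue. f x)" unfolding set_lebesgue_integral_def
    by (rule Bochner_Integration.integral_sum) (use f in \<open>simp add: set_integrable_def\<close>)
  finally show "(LINT x:\<Omega>|lebesgue. f x) = (\<Sum>K\<in>\<T>. LINT x:K|lebesgue. f x)" .
qed

lemma piecewise_continuous_integrable:
  assumes "piecewise_continuous f" "K \<in> \<T>"
  shows "set_integrable lebesgue K f"
  using assms elem_integral(1)[OF simplex[OF assms(2)]] unfolding piecewise_continuous_def by metis

lemma piecewise_continuous_comb:
  fixes f :: "real^'d \<Rightarrow> 'b::euclidean_space" and g :: "real^'d \<Rightarrow> 'c::euclidean_space"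
    and op :: "'b \<Rightarrow> 'c \<Rightarrow> 'e::euclidean_space"
  assumes "piecewise_continuous f" "piecewise_continuous g"
    and op: "\<And>(S :: (real^'d) set) F G. continuous_on S F \<Longrightarrow> continuous_on S G \<Longrightarrow> continuous_on S (\<lambda>x. op (F x) (G x))"
  shows "piecewise_continuous (\<lambda>x. op (f x) (g x))"
  unfolding piecewise_continuous_def
proof
  fix K assume K: "K \<in> \<T>"
  obtain F where F: "continuous_on K F" "\<forall>x\<in>interior K. f x = F x"
    using assms(1) K unfolding piecewise_continuous_def by blast
  obtain G where G: "continuous_on K G" "\<forall>x\<in>interior K. g x = G x"
    using assms(2) K unfolding piecewise_continuous_def by blast
  show "\<exists>H. continuous_on K H \<and> (\<forall>x\<in>interior K. op (f x) (g x) = H x)"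
    by (rule exI[of _ "\<lambda>x. op (F x) (G x)"]) (use op[OF F(1) G(1)] F(2) G(2) in auto)
qed

lemma piecewise_continuous_inner:
  "piecewise_continuous f \<Longrightarrow> piecewise_continuous g \<Longrightarrow> piecewise_continuous (\<lambda>x. f x \<bullet> g x)"
  by (rule piecewise_continuous_comb) (auto intro: continuous_intros)

lemma piecewise_continuous_L2:
  fixes f :: "real^'d \<Rightarrow> 'b::euclidean_space"
  assumes f: "piecewise_continuous f"
  shows "f \<in> L2_space \<Omega>"
proof -
  have "set_integrable lebesgue \<Omega> f" using f by (intro domain_integral piecewise_continuous_integrable)
  then have "(\<lambda>x. indicator \<Omega> x *\<^sub>R f x) \<in> borel_measurable lebesgue"
    unfolding set_integrable_def by (rule borel_measurable_integrable)
  then have m: "f \<in> borel_measurable (lebesgue_on \<Omega>)"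
    using domain_sets by (simp add: borel_measurable_restrict_space_iff)
  have "set_integrable lebesgue \<Omega> (\<lambda>x. f x \<bullet> f x)"
    by (intro domain_integral piecewise_continuous_integrable piecewise_continuous_inner f)
  then show ?thesis using m by (simp add: L2_space_def power2_norm_eq_inner)
qed

lemma L2_inner_elements:
  assumes "piecewise_continuous f" "piecewise_continuous g"
  shows "L2_inner \<Omega> f g = (\<Sum>K\<in>\<T>. L2_inner K f g)"
  unfolding L2_inner_def
  by (intro domain_integral(2) piecewise_continuous_integrable piecewise_continuous_inner assms)

lemma W_props:
  assumes "q \<in> W_space 1 \<Omega> \<T>"
  shows "continuous_on (closure \<Omega>) q" "\<And>x. x \<notin> closure \<Omega> \<Longrightarrow> q x = 0"
  using assms by (auto simp: W_space_def X_space_def)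

lemma V_component: "v \<in> V_space 1 \<Omega> \<T> \<Longrightarrow> (\<lambda>x. v x $ i) \<in> W_space 1 \<Omega> \<T>"
  by (simp add: V_space_def)

lemma V_props:
  assumes "v \<in> V_space 1 \<Omega> \<T>"
  shows "continuous_on (closure \<Omega>) v" "\<And>x. x \<notin> closure \<Omega> \<Longrightarrow> v x = 0"
proof -
  have "continuous_on (closure \<Omega>) (\<lambda>x. \<chi> i. v x $ i)"
    by (rule continuous_on_vec_lambda) (rule W_props(1)[OF V_component[OF assms]])
  then show "continuous_on (closure \<Omega>) v" by simp
  show "v x = 0" if "x \<notin> closure \<Omega>" for x
    using W_props(2)[OF V_component[OF assms] that] by (simp add: vec_eq_iff)
qed

lemma V_continuous_elem: "v \<in> V_space 1 \<Omega> \<T> \<Longrightarrow> K \<in> \<T> \<Longrightarrow> continuous_on K v"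
  by (rule continuous_on_subset[OF V_props(1) subset_closure])

lemma W_continuous_elem: "q \<in> W_space 1 \<Omega> \<T> \<Longrightarrow> K \<in> \<T> \<Longrightarrow> continuous_on K q"
  by (rule continuous_on_subset[OF W_props(1) subset_closure])

lemma V_piecewise_continuous: "v \<in> V_space 1 \<Omega> \<T> \<Longrightarrow> piecewise_continuous v"
  unfolding piecewise_continuous_def using V_continuous_elem by blast

lemma W_affine:
  assumes q: "q \<in> W_space 1 \<Omega> \<T>" and K: "K \<in> \<T>"
  obtains c where "\<And>x. x \<in> K \<Longrightarrow> q x = elem_grad K q \<bullet> x + c"
proof -
  obtain p where p: "poly_degree_le 1 p" "\<forall>x\<in>interior K. q x = p x"
    using q K by (auto simp: W_space_def X_space_def)
  obtain g c where gc: "\<And>x. p x = g \<bullet> x + c" using p(1) poly_degree_1_iff by blast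
  have qi: "q x = g \<bullet> x + c" if "x \<in> interior K" for x using that p(2) gc by simp
  have eg: "elem_grad K q = g"
    by (rule elem_grad_affine[of _ _ _ c]) (use qi interior_simplex_nonempty[OF simplex[OF K]] in auto)
  have cl: "closure (interior K) = K" by (rule closure_interior_simplex[OF simplex[OF K]])
  have "continuous_on (closure (interior K)) (\<lambda>x. q x - (g \<bullet> x + c))"
    unfolding cl by (intro continuous_intros W_continuous_elem q K)
  then have "q x - (g \<bullet> x + c) = 0" if "x \<in> K" for x
    using continuous_constant_on_closure[of "interior K" "\<lambda>x. q x - (g \<bullet> x + c)" 0 x] that qi cl by simp
  then show ?thesis using that[of c] eg by simp
qed

lemma V_affine:
  assumes v: "v \<in> V_space 1 \<Omega> \<T>" and K: "K \<in> \<T>"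
  obtains c where "\<And>x. x \<in> K \<Longrightarrow> v x = elem_jac K v *v x + c"
proof -
  have "\<exists>c. \<forall>x\<in>K. v x $ i = elem_grad K (\<lambda>x. v x $ i) \<bullet> x + c" for i
    using W_affine[OF V_component[OF v] K] by metis
  then obtain c where c: "\<And>i x. x \<in> K \<Longrightarrow> v x $ i = elem_grad K (\<lambda>x. v x $ i) \<bullet> x + c i" by metis
  show ?thesis
    by (rule that[of "\<chi> i. c i"]) (simp add: vec_eq_iff matrix_vector_mul_component elem_jac_def c)
qed

lemma W_grad: "q \<in> W_space 1 \<Omega> \<T> \<Longrightarrow> K \<in> \<T> \<Longrightarrow> x \<in> interior K \<Longrightarrow> grad q x = elem_grad K q"
  by (rule W_affine[of q K]) (auto intro!: grad_affine[of K] dest: interior_subset[THEN subsetD])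

lemma V_jac: "v \<in> V_space 1 \<Omega> \<T> \<Longrightarrow> K \<in> \<T> \<Longrightarrow> x \<in> interior K \<Longrightarrow> jac v x = elem_jac K v"
  by (rule V_affine[of v K]) (auto intro!: jac_affine[of K] dest: interior_subset[THEN subsetD])

lemma side_value_jac: "v \<in> V_space 1 \<Omega> \<T> \<Longrightarrow> K \<in> \<T> \<Longrightarrow> x \<in> K \<Longrightarrow> side_value K (jac v) x = elem_jac K v"
  by (rule side_value_const[OF simplex]) (auto simp: V_jac)

lemma side_value_grad: "q \<in> W_space 1 \<Omega> \<T> \<Longrightarrow> K \<in> \<T> \<Longrightarrow> x \<in> K \<Longrightarrow> side_value K (grad q) x = elem_grad K q"
  by (rule side_value_const[OF simplex]) (auto simp: W_grad)

lemma elem_grad_add: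
  assumes "p \<in> W_space 1 \<Omega> \<T>" "q \<in> W_space 1 \<Omega> \<T>" "K \<in> \<T>"
  shows "elem_grad K (\<lambda>x. p x + s * q x) = elem_grad K p + s *\<^sub>R elem_grad K q"
proof -
  obtain c where c: "\<And>x. x \<in> K \<Longrightarrow> p x = elem_grad K p \<bullet> x + c" using W_affine[OF assms(1,3)] by metis
  obtain d where d: "\<And>x. x \<in> K \<Longrightarrow> q x = elem_grad K q \<bullet> x + d" using W_affine[OF assms(2,3)] by metis
  show ?thesis
    by (rule elem_grad_affine[OF interior_simplex_nonempty[OF simplex[OF assms(3)]], of _ _ "c + s * d"])
      (use c d interior_subset in \<open>fastforce simp: inner_add_left algebra_simps\<close>)
qed

lemma elem_jac_add:
  assumes "v \<in> V_space 1 \<Omega> \<T>" "w \<in> V_space 1 \<Omega> \<T>" "K \<in> \<T>"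
  shows "elem_jac K (\<lambda>x. v x + s *\<^sub>R w x) = elem_jac K v + s *\<^sub>R elem_jac K w"
  using elem_grad_add[OF V_component[OF assms(1)] V_component[OF assms(2)] assms(3)]
  by (simp add: elem_jac_def vec_eq_iff)

lemma W_comb:
  assumes "p \<in> W_space 1 \<Omega> \<T>" "q \<in> W_space 1 \<Omega> \<T>"
  shows "(\<lambda>x. p x + s * q x) \<in> W_space 1 \<Omega> \<T>"
proof -
  have "\<exists>r. poly_degree_le 1 r \<and> (\<forall>x\<in>interior K. p x + s * q x = r x)" if K: "K \<in> \<T>" for K
  proof -
    obtain c where c: "\<And>x. x \<in> K \<Longrightarrow> p x = elem_grad K p \<bullet> x + c" using W_affine[OF assms(1) K] by metis
    obtain d where d: "\<And>x. x \<in> K \<Longrightarrow> q x = elem_grad K q \<bullet> x + d" using W_affine[OF assms(2) K] by metis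
    have "poly_degree_le 1 (\<lambda>x. (elem_grad K p + s *\<^sub>R elem_grad K q) \<bullet> x + (c + s * d))"
      unfolding poly_degree_1_iff by blast
    then show ?thesis using c d interior_subset[of K]
      by (intro exI[of _ "\<lambda>x. (elem_grad K p + s *\<^sub>R elem_grad K q) \<bullet> x + (c + s * d)"])
        (auto simp: subset_iff inner_add_left algebra_simps)
  qed
  moreover have "continuous_on (closure \<Omega>) (\<lambda>x. p x + s * q x)"
    by (intro continuous_intros W_props(1) assms)
  ultimately show ?thesis using W_props(2)[OF assms(1)] W_props(2)[OF assms(2)]
    by (simp add: W_space_def X_space_def)
qed

lemma V_comb:
  assumes "v \<in> V_space 1 \<Omega> \<T>" "w \<in> V_space 1 \<Omega> \<T>"
  shows "(\<lambda>x. v x + s *\<^sub>R w x) \<in> V_space 1 \<Omega> \<T>"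
  using W_comb[OF V_component[OF assms(1)] V_component[OF assms(2)]] by (simp add: V_space_def)

lemma V_zero: "(\<lambda>x. 0) \<in> V_space 1 \<Omega> \<T>"
proof -
  have "poly_degree_le 1 (\<lambda>x::real^'d. 0)" unfolding poly_degree_1_iff by (intro exI[of _ 0]) simp
  then show ?thesis by (auto simp: V_space_def W_space_def X_space_def)
qed

lemma V_add: "v \<in> V_space 1 \<Omega> \<T> \<Longrightarrow> w \<in> V_space 1 \<Omega> \<T> \<Longrightarrow> (\<lambda>x. v x + w x) \<in> V_space 1 \<Omega> \<T>"
  using V_comb[of v w 1] by simp

lemma V_scale: "v \<in> V_space 1 \<Omega> \<T> \<Longrightarrow> (\<lambda>x. s *\<^sub>R v x) \<in> V_space 1 \<Omega> \<T>"
  using V_comb[OF V_zero, of v s] by simp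

lemma V_diff: "v \<in> V_space 1 \<Omega> \<T> \<Longrightarrow> w \<in> V_space 1 \<Omega> \<T> \<Longrightarrow> (\<lambda>x. v x - w x) \<in> V_space 1 \<Omega> \<T>"
  using V_comb[of v w "-1"] by simp

text \<open>Discrete functions are determined by their nodal values, which is the source of finite dimension.\<close>

lemma V_nodal:
  assumes v: "v \<in> V_space 1 \<Omega> \<T>" and K: "K \<in> \<T>" and x: "x \<in> K"
  shows "v x = (\<Sum>a\<in>verts K. bary K a x *\<^sub>R v a)"
proof -
  note S = simplex[OF K]
  obtain c where c: "\<And>x. x \<in> K \<Longrightarrow> v x = elem_jac K v *v x + c" using V_affine[OF v K] by metis
  have "(\<Sum>a\<in>verts K. bary K a x *\<^sub>R v a) = (\<Sum>a\<in>verts K. elem_jac K v *v (bary K a x *\<^sub>R a) + bary K a x *\<^sub>R c)"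
    by (rule sum.cong) (use c[OF subsetD[OF verts_subset]] in \<open>auto simp: matrix_vector_mult_scaleR scaleR_right_distrib\<close>)
  also have "\<dots> = elem_jac K v *v (\<Sum>a\<in>verts K. bary K a x *\<^sub>R a) + (\<Sum>a\<in>verts K. bary K a x) *\<^sub>R c"
    by (simp add: sum.distrib linear_sum[OF matrix_vector_mul_linear] scaleR_sum_left comp_def)
  also have "\<dots> = v x" using bary_sum[OF S, of x] c[OF x] by simp
  finally show ?thesis by simp
qed

definition nodes :: "(real^'d) set" where
  "nodes = (\<Union>K\<in>\<T>. verts K)"

lemma finite_nodes: "finite nodes"
  unfolding nodes_def using finite_mesh verts_props(1)[OF simplex] by blast

lemma psd_form_V: "psd_form (V_space 1 \<Omega> \<T>) (L2_inner \<Omega>)"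
proof -
  interpret L: psd_form "L2_space \<Omega> :: (real^'d \<Rightarrow> real^'d) set" "L2_inner \<Omega>"
    by (rule psd_form_L2[OF domain_sets])
  have VL: "v \<in> L2_space \<Omega>" if "v \<in> V_space 1 \<Omega> \<T>" for v
    by (rule piecewise_continuous_L2[OF V_piecewise_continuous[OF that]])
  show ?thesis
    by unfold_locales (assumption | rule V_add V_scale L.add_left L.scale_left L.nonneg L.sym VL)+
qed

section \<open>Element integrals, traces and integration by parts\<close>

lemma boundary_integral_eq:
  "boundary_integral \<Omega> \<T> f = (\<Sum>F\<in>boundary_faces \<Omega> \<T>.
     face_integral F (f (SOME K. K \<in> \<T> \<and> F facet_of K) (outer_normal (SOME K. K \<in> \<T> \<and> F facet_of K) F)))"
  by (simp add: boundary_integral_def Let_def)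

lemma flat_boundary: "F \<in> boundary_faces \<Omega> \<T> \<Longrightarrow> flat F"
  by (auto simp: boundary_faces_def intro: flat_facet simplex)

lemma flat_interior: "F \<in> interior_faces \<T> \<Longrightarrow> flat F"
  by (auto simp: interior_face_iff intro: flat_facet simplex)

lemma face_subset_closure: "F \<in> boundary_faces \<Omega> \<T> \<union> interior_faces \<T> \<Longrightarrow> F \<subseteq> closure \<Omega>"
  using facets_eq facet_of_imp_subset subset_closure by blast

lemma inj_bface: "K \<in> \<T> \<Longrightarrow> inj_on (bface K) (verts K)"
proof (rule inj_onI, rule ccontr)
  fix a b assume K: "K \<in> \<T>" and ab: "a \<in> verts K" "b \<in> verts K" "bface K a = bface K b" "a \<noteq> b"
  have "b \<in> bface K a" using bary_vertex[OF simplex[OF K] ab(1,2)] ab(4) ab(2) verts_subset by (auto simp: bface_def)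
  then have "bary K b b = 0" using ab(3) by (auto simp: bface_def)
  then show False using bary_vertex[OF simplex[OF K] ab(2,2)] by simp
qed

text \<open>The divergence theorem applied to the product of two affine functions, one component at a time.\<close>

lemma elem_divergence:
  assumes K: "K \<in> \<T>" and q: "q \<in> W_space 1 \<Omega> \<T>" and v: "v \<in> V_space 1 \<Omega> \<T>"
  shows "(LINT x:K|lebesgue. elem_grad K q \<bullet> v x) + (LINT x:K|lebesgue. q x * trace (elem_jac K v))
    = (\<Sum>F\<in>{F. F facet_of K}. face_integral F (\<lambda>x. q x * (v x \<bullet> outer_normal K F)))"
proof -
  note S = simplex[OF K]
  obtain c where c: "\<And>x. x \<in> K \<Longrightarrow> q x = elem_grad K q \<bullet> x + c" using W_affine[OF q K] by metis
  obtain d where d: "\<And>x. x \<in> K \<Longrightarrow> v x = elem_jac K v *v x + d" using V_affine[OF v K] by metis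
  define Q where "Q = (\<lambda>x. elem_grad K q \<bullet> x + c)"
  define P where "P = (\<lambda>i x. elem_jac K v $ i \<bullet> x + d $ i)"
  define D where "D = (\<lambda>i x. Q x *\<^sub>R elem_jac K v $ i + P i x *\<^sub>R elem_grad K q)"
  have vP: "v x $ i = P i x" if "x \<in> K" for x i using d[OF that] by (simp add: P_def matrix_vector_mul_component)
  have qQ: "q x = Q x" if "x \<in> K" for x using c[OF that] by (simp add: Q_def)
  have cont: "continuous_on A Q" "continuous_on A (P i)" for A i unfolding Q_def P_def by (intro continuous_intros)+
  have der: "((\<lambda>x. Q x * P i x) has_derivative (\<lambda>h. D i x \<bullet> h)) (at x)" for i x
    unfolding Q_def P_def D_def
    by (auto intro!: derivative_eq_intros simp: inner_add_left algebra_simps)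
  have contD: "continuous_on A (D i)" for A i unfolding D_def by (intro continuous_intros cont)
  have intc: "set_integrable lebesgue K f" if "continuous_on K f" for f :: "real^'d \<Rightarrow> real"
    by (rule elem_integral(1)[OF S _ that]) simp
  have "(LINT x:K|lebesgue. elem_grad K q \<bullet> v x) + (LINT x:K|lebesgue. q x * trace (elem_jac K v))
      = (LINT x:K|lebesgue. elem_grad K q \<bullet> v x + q x * trace (elem_jac K v))"
    by (rule set_integral_add(2)[symmetric])
      (intro intc continuous_intros V_continuous_elem[OF v K] W_continuous_elem[OF q K])+
  also have "\<dots> = (LINT x:K|lebesgue. (\<Sum>i\<in>UNIV. D i x \<bullet> axis i 1))"
    unfolding set_lebesgue_integral_def
  proof (rule Bochner_Integration.integral_cong[OF refl])
    fix x
    show "indicat_real K x *\<^sub>R (elem_grad K q \<bullet> v x + q x * trace (elem_jac K v))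
        = indicat_real K x *\<^sub>R (\<Sum>i\<in>UNIV. D i x \<bullet> axis i 1)"
    proof (cases "x \<in> K")
      case True
      then show ?thesis
        by (simp add: D_def inner_axis trace_def inner_vec_def[of "elem_grad K q"] vP qQ sum.distrib
            sum_distrib_left mult.commute add.commute inner_add_left)
    qed simp
  qed
  also have "\<dots> = (\<Sum>i\<in>UNIV. LINT x:K|lebesgue. D i x \<bullet> axis i 1)"
    unfolding set_lebesgue_integral_def scaleR_sum_right
    by (rule Bochner_Integration.integral_sum)
      (use intc[OF continuous_on_inner[OF contD continuous_on_const]] in \<open>simp add: set_integrable_def\<close>)
  also have "\<dots> = (\<Sum>i\<in>UNIV. \<Sum>a\<in>verts K. outer_normal K (bface K a) $ i * face_integral (bface K a) (\<lambda>x. Q x * P i x))"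
    by (rule sum.cong[OF refl], subst simplex_divergence[OF dim S der contD]) (simp add: inner_axis)
  also have "\<dots> = (\<Sum>a\<in>verts K. \<Sum>i\<in>UNIV. outer_normal K (bface K a) $ i * face_integral (bface K a) (\<lambda>x. Q x * P i x))"
    by (rule sum.swap)
  also have "\<dots> = (\<Sum>a\<in>verts K. face_integral (bface K a) (\<lambda>x. q x * (v x \<bullet> outer_normal K (bface K a))))"
  proof (rule sum.cong[OF refl])
    fix a assume a: "a \<in> verts K"
    have flat: "flat (bface K a)" by (rule flat_bface[OF S a])
    let ?n = "outer_normal K (bface K a)"
    have "(\<Sum>i\<in>UNIV. ?n $ i * face_integral (bface K a) (\<lambda>x. Q x * P i x))
        = face_integral (bface K a) (\<lambda>x. \<Sum>i\<in>UNIV. ?n $ i * (Q x * P i x))"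
      unfolding face_integral_cmult[symmetric]
      by (rule face_integral_sum[OF flat, symmetric]) (auto intro!: continuous_intros cont)
    also have "\<dots> = face_integral (bface K a) (\<lambda>x. q x * (v x \<bullet> ?n))"
      by (rule face_integral_cong[OF flat])
        (simp add: bface_def qQ inner_vec_def vP sum_distrib_left mult_ac)
    finally show "(\<Sum>i\<in>UNIV. ?n $ i * face_integral (bface K a) (\<lambda>x. Q x * P i x))
        = face_integral (bface K a) (\<lambda>x. q x * (v x \<bullet> ?n))" .
  qed
  also have "\<dots> = (\<Sum>F\<in>bface K ` verts K. face_integral F (\<lambda>x. q x * (v x \<bullet> outer_normal K F)))"
    by (simp add: sum.reindex[OF inj_bface[OF K]])
  also have "bface K ` verts K = {F. F facet_of K}" using facet_bface[OF K] by auto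
  finally show ?thesis .
qed

text \<open>Summing \<open>elem_divergence\<close> over the elements, the interior faces cancel because pressure and
  velocity are continuous, and the boundary term of the form cancels the rest. Weakly imposed
  boundary conditions thus leave the piecewise constant pressure gradient itself.\<close>

lemma gradient_form:
  assumes q: "q \<in> W_space 1 \<Omega> \<T>" and v: "v \<in> V_space 1 \<Omega> \<T>"
  shows "- L2_inner \<Omega> q (divergence v) + boundary_integral \<Omega> \<T> (\<lambda>K n x. q x * (v x \<bullet> n))
    = (\<Sum>K\<in>\<T>. LINT x:K|lebesgue. elem_grad K q \<bullet> v x)"
proof -
  have e: "(LINT x:K|lebesgue. q x * divergence v x) = (LINT x:K|lebesgue. q x * trace (elem_jac K v))"
    "set_integrable lebesgue K (\<lambda>x. q x * divergence v x)" if K: "K \<in> \<T>" for K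
  proof -
    have i: "q x * divergence v x = q x * trace (elem_jac K v)" if "x \<in> interior K" for x
      using V_jac[OF v K that] by (simp add: divergence_def)
    have c: "continuous_on K (\<lambda>x. q x * trace (elem_jac K v))"
      by (intro continuous_intros W_continuous_elem[OF q K])
    show "(LINT x:K|lebesgue. q x * divergence v x) = (LINT x:K|lebesgue. q x * trace (elem_jac K v))"
      by (rule elem_integral(2)[OF simplex[OF K] i c])
    show "set_integrable lebesgue K (\<lambda>x. q x * divergence v x)"
      by (rule elem_integral(1)[OF simplex[OF K] i c])
  qed
  have "L2_inner \<Omega> q (divergence v) = (\<Sum>K\<in>\<T>. LINT x:K|lebesgue. q x * trace (elem_jac K v))"
    unfolding L2_inner_def inner_real_def using domain_integral(2)[of "\<lambda>x. q x * divergence v x"] e by simp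
  moreover have "(\<Sum>K\<in>\<T>. \<Sum>F\<in>{F. F facet_of K}. face_integral F (\<lambda>x. q x * (v x \<bullet> outer_normal K F)))
      = boundary_integral \<Omega> \<T> (\<lambda>K n x. q x * (v x \<bullet> n))"
    unfolding boundary_integral_eq
  proof (rule facet_sum_cancel)
    fix K K' F assume "K \<in> \<T>" "K' \<in> \<T>" "K \<noteq> K'" "F facet_of K" "F facet_of K'"
    then have "outer_normal K' F = - outer_normal K F" by (rule common_facet_outer_normal)
    then show "face_integral F (\<lambda>x. q x * (v x \<bullet> outer_normal K' F)) = - face_integral F (\<lambda>x. q x * (v x \<bullet> outer_normal K F))"
      using face_integral_cmult[of F "-1"] by simp
  qed
  moreover have "(\<Sum>K\<in>\<T>. (LINT x:K|lebesgue. elem_grad K q \<bullet> v x) + (LINT x:K|lebesgue. q x * trace (elem_jac K v)))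
      = (\<Sum>K\<in>\<T>. \<Sum>F\<in>{F. F facet_of K}. face_integral F (\<lambda>x. q x * (v x \<bullet> outer_normal K F)))"
    by (rule sum.cong[OF refl elem_divergence[OF _ q v]])
  ultimately show ?thesis by (simp add: sum.distrib)
qed

end

section \<open>Inverse inequalities and operators\<close>

text \<open>The number \<open>\<rho>\<close> combines shape regularity and quasi-uniformity: each element contains a ball whose
  radius is comparable to the mesh size. The constants below depend on the mesh only through \<open>\<rho>\<close>, which
  makes them common to a family; the dimension is named \<open>n\<close> so that they mention no type.\<close>

locale shaped_mesh = mesh \<Omega> \<T> for \<Omega> :: "(real^'d) set" and \<T> +
  fixes \<rho> :: real and n :: nat
  assumes card_dim [simp]: "CARD('d) = n" and shape: "\<And>K. K \<in> \<T> \<Longrightarrow> \<exists>p r. 0 < r \<and> cball p r \<subseteq> K \<and> mesh_size \<T> \<le> \<rho> * r"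
begin

abbreviation "h \<equiv> mesh_size \<T>"
abbreviation "V \<equiv> V_space 1 \<Omega> \<T>"
abbreviation "\<omega> \<equiv> unit_ball_vol (real n)"

lemma ball_vol_pos: "0 < \<omega>"
  by (simp add: unit_ball_vol_pos)

lemma ball_vol_nz: "\<omega> \<noteq> 0"
  using ball_vol_pos by (metis less_irrefl)

lemma diameter_le: "K \<in> \<T> \<Longrightarrow> diameter K \<le> h"
  unfolding mesh_size_def using finite_mesh by (intro Max_ge) auto

lemma dist_le: "K \<in> \<T> \<Longrightarrow> x \<in> K \<Longrightarrow> y \<in> K \<Longrightarrow> dist x y \<le> h"
  using diameter_bounded_bound[OF compact_imp_bounded[OF full_simplex_compact[OF simplex]], of K x y] diameter_le[of K]
  by linarith

lemma h_pos: "0 < h"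
proof -
  obtain K where K: "K \<in> \<T>" using mesh_nonempty by blast
  obtain a where a: "a \<in> verts K" using other_vertex[OF simplex[OF K]] by metis
  obtain b where b: "b \<in> verts K" "b \<noteq> a" using other_vertex[OF simplex[OF K]] by metis
  have "0 < dist a b" using b by simp
  also have "\<dots> \<le> h" by (rule dist_le[OF K]) (use a b verts_subset in auto)
  finally show ?thesis .
qed

lemma \<rho>_pos: "0 < \<rho>"
proof -
  obtain K where K: "K \<in> \<T>" using mesh_nonempty by blast
  obtain p r where r: "0 < r" "h \<le> \<rho> * r" using shape[OF K] by blast
  then have "0 < \<rho> * r" using h_pos by linarith
  then show ?thesis using r(1) by (simp add: zero_less_mult_iff)
qed

text \<open>In this order, constants of the inverse inequalities for gradients and for point values, of the upper
  bound for areas, and of the lower bounds for areas and volumes in powers of the mesh size.\<close>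

definition "c1 = (4 * \<rho>) ^ (n + 2) / \<omega>"
definition "c2 = 2 * (4 * \<rho>) ^ n / \<omega> + 2 * c1"
definition "c3 = \<omega> * 2 ^ n"
definition "c4 = \<rho> ^ n / \<omega>"

lemma c_pos: "0 < c1" "0 < c2" "0 < c3" "0 < c4"
  using ball_vol_pos \<rho>_pos by (auto simp: c1_def c2_def c3_def c4_def add_pos_pos)

text \<open>Applied to each component of \<open>v\<close> with the ball in the element; the centre \<open>p\<close> of the ball is the
  point at which the value is controlled.\<close>

lemma elem_mean_square:
  assumes v: "v \<in> V" and K: "K \<in> \<T>"
  shows "\<exists>p\<in>K. h ^ n * (norm (v p))\<^sup>2 \<le> (4 * \<rho>) ^ n / \<omega> * L2_inner K v v \<and>
    h ^ (n + 2) * (norm (elem_jac K v))\<^sup>2 \<le> c1 * L2_inner K v v"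
proof -
  obtain p r where r: "0 < r" "cball p r \<subseteq> K" "h \<le> \<rho> * r" using shape[OF K] by blast
  obtain c where c: "\<And>x. x \<in> K \<Longrightarrow> v x = elem_jac K v *v x + c" using V_affine[OF v K] by metis
  have pK: "p \<in> K" using r(1,2) by auto
  have vi: "v x $ i = elem_jac K v $ i \<bullet> x + c $ i" if "x \<in> K" for x i
    using c[OF that] by (simp add: matrix_vector_mul_component)
  have int: "set_integrable lebesgue K (\<lambda>x. (v x $ i)\<^sup>2)" for i
    by (rule elem_integral(1)[OF simplex[OF K], of _ "\<lambda>x. (v x $ i)\<^sup>2"])
      (auto intro!: continuous_intros V_continuous_elem[OF v K])
  have comp: "\<omega> * (r / 4) ^ n * ((v p $ i)\<^sup>2 + (r / 4 * norm (elem_jac K v $ i))\<^sup>2) \<le> (LINT x:K|lebesgue. (v x $ i)\<^sup>2)" for i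
  proof -
    have "(LINT x:K|lebesgue. (v x $ i)\<^sup>2) = (LINT x:K|lebesgue. (elem_jac K v $ i \<bullet> x + c $ i)\<^sup>2)"
      unfolding set_lebesgue_integral_def by (rule Bochner_Integration.integral_cong) (auto simp: vi split: split_indicator)
    then show ?thesis
      using affine_mean_square[OF r(2,1) full_simplex_compact[OF simplex[OF K]], of "elem_jac K v $ i" "c $ i"] vi[OF pK, of i]
      by simp
  qed
  have nsq: "(norm w)\<^sup>2 = (\<Sum>i\<in>UNIV. (w $ i)\<^sup>2)" for w :: "real^'d"
    unfolding power2_norm_eq_inner inner_vec_def by (simp add: power2_eq_square)
  have jsq: "(norm M)\<^sup>2 = (\<Sum>i\<in>UNIV. (norm (M $ i))\<^sup>2)" for M :: "real^'d^'d"
    unfolding power2_norm_eq_inner[of M] inner_vec_def[of M] by (simp add: power2_norm_eq_inner)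
  have "\<omega> * (r / 4) ^ n * ((norm (v p))\<^sup>2 + (r / 4)\<^sup>2 * (norm (elem_jac K v))\<^sup>2)
      = (\<Sum>i\<in>UNIV. \<omega> * (r / 4) ^ n * ((v p $ i)\<^sup>2 + (r / 4 * norm (elem_jac K v $ i))\<^sup>2))"
    unfolding nsq[of "v p"] jsq sum_distrib_left sum.distrib[symmetric] power_mult_distrib by simp
  also have "\<dots> \<le> (\<Sum>i\<in>UNIV. LINT x:K|lebesgue. (v x $ i)\<^sup>2)" by (rule sum_mono) (rule comp)
  also have "\<dots> = (LINT x:K|lebesgue. (\<Sum>i\<in>UNIV. (v x $ i)\<^sup>2))"
    unfolding set_lebesgue_integral_def scaleR_sum_right
    by (rule Bochner_Integration.integral_sum[symmetric]) (use int in \<open>simp add: set_integrable_def\<close>)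
  also have "\<dots> = L2_inner K v v" by (simp add: L2_inner_def inner_vec_def power2_eq_square)
  finally have main: "\<omega> * (r / 4) ^ n * ((norm (v p))\<^sup>2 + (r / 4)\<^sup>2 * (norm (elem_jac K v))\<^sup>2) \<le> L2_inner K v v" .
  have hr: "h \<le> 4 * \<rho> * (r / 4)" using r(3) by simp
  have pow: "h ^ k \<le> (4 * \<rho>) ^ k * (r / 4) ^ k" for k
  proof -
    have "h ^ k \<le> (4 * \<rho> * (r / 4)) ^ k" by (rule power_mono[OF hr]) (use h_pos in simp)
    then show ?thesis by (simp only: power_mult_distrib)
  qed
  have 1: "\<omega> * ((r / 4) ^ n * (norm (v p))\<^sup>2) \<le> L2_inner K v v"
  proof -
    have "0 \<le> \<omega> * (r / 4) ^ n * ((r / 4)\<^sup>2 * (norm (elem_jac K v))\<^sup>2)" using ball_vol_pos r by simp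
    then show ?thesis using main by (simp add: distrib_left)
  qed
  have 2: "\<omega> * ((r / 4) ^ (n + 2) * (norm (elem_jac K v))\<^sup>2) \<le> L2_inner K v v"
  proof -
    have "0 \<le> \<omega> * (r / 4) ^ n * (norm (v p))\<^sup>2" using ball_vol_pos r by simp
    moreover have "\<omega> * (r / 4) ^ n * ((r / 4)\<^sup>2 * (norm (elem_jac K v))\<^sup>2) = \<omega> * ((r / 4) ^ (n + 2) * (norm (elem_jac K v))\<^sup>2)"
      by (simp add: power_add power2_eq_square)
    ultimately show ?thesis using main unfolding distrib_left by linarith
  qed
  have use: "h ^ k * y \<le> (4 * \<rho>) ^ k / \<omega> * E" if "\<omega> * ((r / 4) ^ k * y) \<le> E" "0 \<le> y" for k y E
  proof -
    have "h ^ k * y \<le> (4 * \<rho>) ^ k * (r / 4) ^ k * y" by (intro mult_right_mono pow that(2))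
    also have "\<dots> = (4 * \<rho>) ^ k / \<omega> * (\<omega> * ((r / 4) ^ k * y))" using ball_vol_nz by simp
    also have "\<dots> \<le> (4 * \<rho>) ^ k / \<omega> * E" using that(1) ball_vol_pos \<rho>_pos by (intro mult_left_mono) auto
    finally show ?thesis .
  qed
  show ?thesis using pK use[OF 1] use[OF 2] unfolding c1_def by auto
qed

lemma inverse_jac:
  assumes "v \<in> V" "K \<in> \<T>"
  shows "h ^ (n + 2) * (norm (elem_jac K v))\<^sup>2 \<le> c1 * L2_inner K v v"
  using elem_mean_square[OF assms] by blast

lemma sq_sum_le: "(a + b)\<^sup>2 \<le> 2 * a\<^sup>2 + 2 * b\<^sup>2" for a b :: real
  using zero_le_power2[of "a - b"] unfolding power2_sum power2_diff by linarith

text \<open>Other points are reached from the controlled one along a segment of length at most \<open>h\<close>, whose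
  contribution is bounded by the gradient.\<close>

lemma inverse_sup:
  assumes v: "v \<in> V" and K: "K \<in> \<T>" and x: "x \<in> K"
  shows "h ^ n * (norm (v x))\<^sup>2 \<le> c2 * L2_inner K v v"
proof -
  obtain p where p: "p \<in> K" "h ^ n * (norm (v p))\<^sup>2 \<le> (4 * \<rho>) ^ n / \<omega> * L2_inner K v v"
      "h ^ (n + 2) * (norm (elem_jac K v))\<^sup>2 \<le> c1 * L2_inner K v v"
    using elem_mean_square[OF v K] by blast
  obtain c where c: "\<And>x. x \<in> K \<Longrightarrow> v x = elem_jac K v *v x + c" using V_affine[OF v K] by metis
  have "v x = v p + elem_jac K v *v (x - p)" using c[OF x] c[OF p(1)] by (simp add: matrix_vector_mult_diff_distrib)
  then have "norm (v x) \<le> norm (v p) + norm (elem_jac K v) * norm (x - p)"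
    using norm_triangle_ineq[of "v p" "elem_jac K v *v (x - p)"] norm_matrix_vector_le[of "elem_jac K v" "x - p"] by simp
  also have "\<dots> \<le> norm (v p) + norm (elem_jac K v) * h"
    using dist_le[OF K x p(1)] by (intro add_left_mono mult_left_mono) (auto simp: dist_norm)
  finally have "(norm (v x))\<^sup>2 \<le> (norm (v p) + norm (elem_jac K v) * h)\<^sup>2" by (intro power_mono) auto
  also have "\<dots> \<le> 2 * (norm (v p))\<^sup>2 + 2 * (norm (elem_jac K v) * h)\<^sup>2" by (rule sq_sum_le)
  finally have "h ^ n * (norm (v x))\<^sup>2 \<le> h ^ n * (2 * (norm (v p))\<^sup>2 + 2 * (norm (elem_jac K v) * h)\<^sup>2)"
    using h_pos by (intro mult_left_mono) auto
  also have "\<dots> = 2 * (h ^ n * (norm (v p))\<^sup>2) + 2 * (h ^ (n + 2) * (norm (elem_jac K v))\<^sup>2)"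
    by (simp add: power_mult_distrib power_add power2_eq_square distrib_left mult_ac)
  also have "\<dots> \<le> 2 * ((4 * \<rho>) ^ n / \<omega> * L2_inner K v v) + 2 * (c1 * L2_inner K v v)"
    using p by linarith
  also have "\<dots> = c2 * L2_inner K v v" by (simp add: c2_def distrib_right)
  finally show ?thesis .
qed

lemma elem_L2_nonneg: "K \<in> \<T> \<Longrightarrow> 0 \<le> L2_inner K v v"
  unfolding L2_inner_def set_lebesgue_integral_def by simp

lemma measure_elem_le: "K \<in> \<T> \<Longrightarrow> measure lebesgue K \<le> \<omega> * h ^ n"
proof -
  assume K: "K \<in> \<T>"
  obtain p where p: "p \<in> K" using interior_simplex_nonempty[OF simplex[OF K]] interior_subset by blast
  have "K \<subseteq> cball p h" using dist_le[OF K p] by auto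
  moreover have "K \<in> sets lebesgue" by (intro fmeasurableD lmeasurable_compact full_simplex_compact simplex K)
  ultimately have "measure lebesgue K \<le> measure lebesgue (cball p h)"
    by (intro measure_mono_fmeasurable) auto
  then show ?thesis using content_cball[of h p] h_pos by simp
qed

lemma measure_elem_ge: "K \<in> \<T> \<Longrightarrow> h ^ n \<le> c4 * measure lebesgue K"
proof -
  assume K: "K \<in> \<T>"
  obtain p r where r: "0 < r" "cball p r \<subseteq> K" "h \<le> \<rho> * r" using shape[OF K] by blast
  have "\<omega> * r ^ n = measure lebesgue (cball p r)" using content_cball[of r p] r by simp
  also have "\<dots> \<le> measure lebesgue K"
    by (rule measure_mono_fmeasurable[OF r(2) _ lmeasurable_compact[OF full_simplex_compact[OF simplex[OF K]]]]) simp
  finally have m: "\<omega> * r ^ n \<le> measure lebesgue K" .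
  have "h ^ n \<le> (\<rho> * r) ^ n" using r h_pos by (intro power_mono) auto
  also have "\<dots> = c4 * (\<omega> * r ^ n)" using ball_vol_nz by (simp add: c4_def power_mult_distrib)
  also have "\<dots> \<le> c4 * measure lebesgue K" using m c_pos(4) by (intro mult_left_mono) auto
  finally show ?thesis .
qed

lemma area_le:
  assumes "K \<in> \<T>" "F facet_of K"
  shows "h * area F \<le> c3 * h ^ n"
proof -
  have "diameter F \<le> h"
    using diameter_subset[OF facet_of_imp_subset[OF assms(2)] compact_imp_bounded[OF full_simplex_compact[OF simplex[OF assms(1)]]]]
      diameter_le[OF assms(1)] by linarith
  from area_upper[OF dim flat_facet[OF simplex[OF assms(1)] assms(2)] this h_pos]
  show ?thesis by (simp add: c3_def power_mult_distrib mult_ac)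
qed

lemma area_ge:
  assumes "K \<in> \<T>" "F facet_of K"
  shows "h ^ n \<le> c4 * (h * area F)"
proof -
  have "measure lebesgue K \<le> diameter K * area F" by (rule area_lower[OF dim simplex[OF assms(1)] assms(2)])
  also have "\<dots> \<le> h * area F" using diameter_le[OF assms(1)] area_nonneg by (intro mult_right_mono)
  finally have "c4 * measure lebesgue K \<le> c4 * (h * area F)" using c_pos(4) by (intro mult_left_mono) auto
  then show ?thesis using measure_elem_ge[OF assms(1)] by linarith
qed

text \<open>A facet contains two vertices of the element, and these are at least the diameter of the inscribed
  ball apart.\<close>

lemma diameter_facet_ge:
  assumes "K \<in> \<T>" "F facet_of K"
  shows "2 * h \<le> \<rho> * diameter F"
proof -
  note S = simplex[OF assms(1)]
  obtain p r where r: "0 < r" "cball p r \<subseteq> K" "h \<le> \<rho> * r" using shape[OF assms(1)] by blast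
  obtain a where a: "a \<in> verts K" "F = bface K a" using assms facet_bface by blast
  have "\<not> card (verts K - {a}) \<le> 1" using verts_props(1,2)[OF S] a dim by auto
  then obtain b c where bc: "b \<in> verts K" "c \<in> verts K" "b \<noteq> a" "c \<noteq> a" "b \<noteq> c"
    using card_le_Suc0_iff_eq[of "verts K - {a}"] verts_props(1)[OF S] by (metis DiffE One_nat_def finite_Diff insertCI)
  have "b \<in> F" "c \<in> F" unfolding a(2) bface_def
    using bc bary_vertex[OF S a(1)] verts_subset by auto
  moreover have "bounded F" using flat_facet[OF S assms(2)] by (simp add: flat_def compact_imp_bounded)
  ultimately have "dist b c \<le> diameter F" by (intro diameter_bounded_bound)
  then have "2 * r \<le> diameter F" using vertex_distance[OF S bc(1,2,5) r(2,1)] by linarith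
  then have "\<rho> * (2 * r) \<le> \<rho> * diameter F" using \<rho>_pos by (intro mult_left_mono) auto
  then show ?thesis using r(3) by linarith
qed

text \<open>Each element is chosen by at most \<open>n + 1\<close> faces, its facets.\<close>

lemma facet_sum_le:
  assumes "finite S" "\<And>F. F \<in> S \<Longrightarrow> \<kappa> F \<in> \<T> \<and> F facet_of \<kappa> F" "\<And>K. K \<in> \<T> \<Longrightarrow> 0 \<le> \<phi> K"
  shows "(\<Sum>F\<in>S. \<phi> (\<kappa> F)) \<le> (real n + 1) * (\<Sum>K\<in>\<T>. \<phi> K)"
proof -
  have "(\<Sum>F\<in>S. \<phi> (\<kappa> F)) = (\<Sum>K\<in>\<T>. \<Sum>F\<in>{F\<in>S. \<kappa> F = K}. \<phi> (\<kappa> F))"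
    by (rule sum.group[symmetric]) (use assms finite_mesh in auto)
  also have "\<dots> = (\<Sum>K\<in>\<T>. real (card {F\<in>S. \<kappa> F = K}) * \<phi> K)" by (rule sum.cong) auto
  also have "\<dots> \<le> (\<Sum>K\<in>\<T>. (real n + 1) * \<phi> K)"
  proof (intro sum_mono mult_right_mono)
    fix K assume K: "K \<in> \<T>"
    have "card {F\<in>S. \<kappa> F = K} \<le> card {F. F facet_of K}"
      by (rule card_mono[OF finite_facets[OF simplex[OF K]]]) (use assms(2) in auto)
    also have "\<dots> \<le> n + 1" using card_facets[OF simplex[OF K]] by simp
    finally show "real (card {F\<in>S. \<kappa> F = K}) \<le> real n + 1" by linarith
  qed (rule assms(3))
  finally show ?thesis by (simp add: sum_distrib_left)
qed

lemma total_L2: "v \<in> V \<Longrightarrow> (\<Sum>K\<in>\<T>. L2_inner K v v) = L2_inner \<Omega> v v"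
  using L2_inner_elements[OF V_piecewise_continuous V_piecewise_continuous, of v v] by simp

lemma V_definite:
  assumes v: "v \<in> V" and z: "L2_inner \<Omega> v v = 0"
  shows "v = (\<lambda>x. 0)"
proof
  fix x
  show "v x = 0"
  proof (cases "x \<in> closure \<Omega>")
    case True
    then obtain K where K: "K \<in> \<T>" "x \<in> K" using Union_mesh by blast
    have s0: "(\<Sum>K\<in>\<T>. L2_inner K v v) = 0" using total_L2[OF v] z by simp
    have "L2_inner K v v = 0" by (rule sum_nonneg_0[OF finite_mesh elem_L2_nonneg s0 K(1)])
    then have "h ^ n * (norm (v x))\<^sup>2 \<le> 0" using inverse_sup[OF v K] by simp
    moreover have "0 < h ^ n" using h_pos by simp
    ultimately have "(norm (v x))\<^sup>2 \<le> 0" by (simp add: mult_le_0_iff)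
    then show ?thesis by simp
  next
    case False
    then show ?thesis using V_props(2)[OF v] by simp
  qed
qed

lemma V_linear:
  assumes l: "\<And>v w s. v \<in> V \<Longrightarrow> w \<in> V \<Longrightarrow> l (\<lambda>x. v x + s *\<^sub>R w x) = l v + s * l w"
  shows "v \<in> V \<Longrightarrow> w \<in> V \<Longrightarrow> l (\<lambda>x. v x + w x) = l v + (l w :: real)"
    and "v \<in> V \<Longrightarrow> l (\<lambda>x. s *\<^sub>R v x) = s * l v"
proof -
  have l0: "l (\<lambda>x. 0) = 0" using l[OF V_zero V_zero, of 1] by simp
  show "v \<in> V \<Longrightarrow> w \<in> V \<Longrightarrow> l (\<lambda>x. v x + w x) = l v + l w" using l[of v w 1] by simp
  show "v \<in> V \<Longrightarrow> l (\<lambda>x. s *\<^sub>R v x) = s * l v" using l[OF V_zero, of v s] l0 by simp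
qed

text \<open>The nodal values of the components are the finitely many separating functionals.\<close>

lemma V_riesz:
  assumes l: "\<And>v w s. v \<in> V \<Longrightarrow> w \<in> V \<Longrightarrow> l (\<lambda>x. v x + s *\<^sub>R w x) = l v + s * l w"
  shows "\<exists>z\<in>V. \<forall>v\<in>V. L2_inner \<Omega> z v = (l v :: real)"
proof (rule riesz_finite[of "(\<lambda>(a, i) v. v a $ i) ` (nodes \<times> UNIV)"])
  show "f = (\<lambda>x. 0)" if f: "f \<in> V" and z: "\<forall>e\<in>(\<lambda>(a, i) v. v a $ i) ` (nodes \<times> UNIV). e f = 0" for f
  proof
    fix x
    show "f x = 0"
    proof (cases "x \<in> closure \<Omega>")
      case True
      then obtain K where K: "K \<in> \<T>" "x \<in> K" using Union_mesh by blast
      have "f a = 0" if "a \<in> verts K" for a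
        using z that K(1) by (force simp: nodes_def vec_eq_iff)
      then show ?thesis using V_nodal[OF f K] by simp
    next
      case False
      then show ?thesis using V_props(2)[OF f] by simp
    qed
  qed
next
  show "l (\<lambda>x. f x + g x) = l f + l g" if "f \<in> V" "g \<in> V" for f g
    by (rule V_linear(1)[of l, OF l that])
  show "l (\<lambda>x. c *\<^sub>R f x) = c * l f" if "f \<in> V" for f c
    by (rule V_linear(2)[of l, OF l that])
next
  show "psd_form V (L2_inner \<Omega>)" by (rule psd_form_V)
  show "(\<lambda>x. 0) \<in> V" by (rule V_zero)
qed (use finite_nodes in \<open>auto intro: V_definite simp: algebra_simps\<close>)

text \<open>The operators of the scheme are chosen representatives of their forms; for linear forms the choice
  is justified by the Riesz representation.\<close>

lemma V_represent:
  assumes l: "\<And>v w s. v \<in> V \<Longrightarrow> w \<in> V \<Longrightarrow> l (\<lambda>x. v x + s *\<^sub>R w x) = l v + s * (l w :: real)"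
  shows "represent \<Omega> V l \<in> V" "\<And>v. v \<in> V \<Longrightarrow> L2_inner \<Omega> (represent \<Omega> V l) v = l v"
proof -
  have "\<exists>z. z \<in> V \<and> (\<forall>v\<in>V. L2_inner \<Omega> z v = l v)" using V_riesz[of l, OF l] by blast
  from someI_ex[OF this] show "represent \<Omega> V l \<in> V" "\<And>v. v \<in> V \<Longrightarrow> L2_inner \<Omega> (represent \<Omega> V l) v = l v"
    unfolding represent_def by blast+
qed

lemma V_L2: "v \<in> V \<Longrightarrow> v \<in> L2_space \<Omega>"
  by (rule piecewise_continuous_L2[OF V_piecewise_continuous])

sublocale L2: psd_form "L2_space \<Omega> :: (real^'d \<Rightarrow> real^'d) set" "L2_inner \<Omega>"
  by (rule psd_form_L2[OF domain_sets])

lemma L2_linear: "f \<in> L2_space \<Omega> \<Longrightarrow> v \<in> V \<Longrightarrow> w \<in> V \<Longrightarrow>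
    L2_inner \<Omega> f (\<lambda>x. v x + s *\<^sub>R w x) = L2_inner \<Omega> f v + s * L2_inner \<Omega> f w"
  by (simp add: L2.add_right L2.scale_right L2.scale_closed V_L2)

lemma elem_linear:
  assumes K: "K \<in> \<T>" and g: "continuous_on K g" and v: "v \<in> V" "w \<in> V"
  shows "(LINT x:K|lebesgue. g x \<bullet> (v x + s *\<^sub>R w x)) = (LINT x:K|lebesgue. g x \<bullet> v x) + s * (LINT x:K|lebesgue. g x \<bullet> w x)"
proof -
  have "set_integrable lebesgue K (\<lambda>x. g x \<bullet> u x)" if "u \<in> V" for u
    by (rule elem_integral(1)[OF simplex[OF K], of _ "\<lambda>x. g x \<bullet> u x"]) (auto intro!: continuous_intros g V_continuous_elem[OF that K])
  then show ?thesis using set_integral_add(2)[of lebesgue K "\<lambda>x. g x \<bullet> v x" "\<lambda>x. s * (g x \<bullet> w x)"] v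
    by (simp add: inner_add_right)
qed

lemma V_continuous_face: "v \<in> V \<Longrightarrow> F \<in> boundary_faces \<Omega> \<T> \<union> interior_faces \<T> \<Longrightarrow> continuous_on F v"
  by (rule continuous_on_subset[OF V_props(1) face_subset_closure])

definition "bK F = (SOME K. K \<in> \<T> \<and> F facet_of K)"
definition "bn F = outer_normal (bK F) F"

lemma bK: "F \<in> boundary_faces \<Omega> \<T> \<Longrightarrow> bK F \<in> \<T>" "F \<in> boundary_faces \<Omega> \<T> \<Longrightarrow> F facet_of bK F"
  unfolding bK_def by (rule boundary_element, assumption)+

lemma norm_bn: "F \<in> boundary_faces \<Omega> \<T> \<Longrightarrow> norm (bn F) = 1"
  unfolding bn_def by (rule norm_outer_normal[OF simplex[OF bK(1)] bK(2)])

lemma boundary_eq: "boundary_integral \<Omega> \<T> f = (\<Sum>F\<in>boundary_faces \<Omega> \<T>. face_integral F (f (bK F) (bn F)))"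
  by (simp add: boundary_integral_eq bK_def bn_def)

subsection \<open>Diffusion\<close>

text \<open>The diffusion form for unit viscosity.\<close>

definition nitsche :: "real \<Rightarrow> (real^'d \<Rightarrow> real^'d) \<Rightarrow> (real^'d \<Rightarrow> real^'d) \<Rightarrow> real" where
  "nitsche \<gamma> w v = (\<Sum>K\<in>\<T>. measure lebesgue K * (elem_jac K w \<bullet> elem_jac K v))
     - (\<Sum>F\<in>boundary_faces \<Omega> \<T>. face_integral F (\<lambda>x. (elem_jac (bK F) w *v bn F) \<bullet> v x))
     - (\<Sum>F\<in>boundary_faces \<Omega> \<T>. face_integral F (\<lambda>x. (elem_jac (bK F) v *v bn F) \<bullet> w x))
     + \<gamma> / h * (\<Sum>F\<in>boundary_faces \<Omega> \<T>. face_integral F (\<lambda>x. w x \<bullet> v x))"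

lemma nitsche_sym: "nitsche \<gamma> w v = nitsche \<gamma> v w"
  by (simp add: nitsche_def inner_commute)

lemma nitsche_linear:
  assumes "u \<in> V" "v \<in> V" "w \<in> V"
  shows "nitsche \<gamma> u (\<lambda>x. v x + s *\<^sub>R w x) = nitsche \<gamma> u v + s * nitsche \<gamma> u w"
proof -
  have 1: "(\<Sum>K\<in>\<T>. measure lebesgue K * (elem_jac K u \<bullet> elem_jac K (\<lambda>x. v x + s *\<^sub>R w x)))
      = (\<Sum>K\<in>\<T>. measure lebesgue K * (elem_jac K u \<bullet> elem_jac K v)) + s * (\<Sum>K\<in>\<T>. measure lebesgue K * (elem_jac K u \<bullet> elem_jac K w))"
    unfolding sum_distrib_left sum.distrib[symmetric]
    by (rule sum.cong) (auto simp: elem_jac_add[OF assms(2,3)] inner_add_right algebra_simps)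
  have lin: "face_integral F (\<lambda>x. f x + s * g x) = face_integral F f + s * face_integral F g"
    if "F \<in> boundary_faces \<Omega> \<T>" "continuous_on F f" "continuous_on F g" for F f g
    using face_integral_add[OF flat_boundary[OF that(1)] that(2), of "\<lambda>x. s * g x"] that(3)
    by (simp add: face_integral_cmult continuous_on_mult_left)
  note cont = V_continuous_face[OF assms(1)] V_continuous_face[OF assms(2)] V_continuous_face[OF assms(3)]
  have 2: "(\<Sum>F\<in>boundary_faces \<Omega> \<T>. face_integral F (\<lambda>x. (elem_jac (bK F) u *v bn F) \<bullet> (v x + s *\<^sub>R w x)))
      = (\<Sum>F\<in>boundary_faces \<Omega> \<T>. face_integral F (\<lambda>x. (elem_jac (bK F) u *v bn F) \<bullet> v x))
        + s * (\<Sum>F\<in>boundary_faces \<Omega> \<T>. face_integral F (\<lambda>x. (elem_jac (bK F) u *v bn F) \<bullet> w x))"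
    unfolding sum_distrib_left sum.distrib[symmetric] inner_add_right inner_scaleR_right
    by (rule sum.cong) (auto intro!: lin continuous_intros cont)
  have 3: "(\<Sum>F\<in>boundary_faces \<Omega> \<T>. face_integral F (\<lambda>x. (elem_jac (bK F) (\<lambda>x. v x + s *\<^sub>R w x) *v bn F) \<bullet> u x))
      = (\<Sum>F\<in>boundary_faces \<Omega> \<T>. face_integral F (\<lambda>x. (elem_jac (bK F) v *v bn F) \<bullet> u x))
        + s * (\<Sum>F\<in>boundary_faces \<Omega> \<T>. face_integral F (\<lambda>x. (elem_jac (bK F) w *v bn F) \<bullet> u x))"
    unfolding sum_distrib_left sum.distrib[symmetric]
  proof (rule sum.cong[OF refl])
    fix F assume F: "F \<in> boundary_faces \<Omega> \<T>"
    have "(elem_jac (bK F) (\<lambda>x. v x + s *\<^sub>R w x) *v bn F) \<bullet> u x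
        = (elem_jac (bK F) v *v bn F) \<bullet> u x + s * ((elem_jac (bK F) w *v bn F) \<bullet> u x)" for x
      by (simp add: elem_jac_add[OF assms(2,3) bK(1)[OF F]] matrix_vector_mult_add_rdistrib
          scaleR_matrix_vector_assoc[symmetric] inner_add_left)
    then show "face_integral F (\<lambda>x. (elem_jac (bK F) (\<lambda>x. v x + s *\<^sub>R w x) *v bn F) \<bullet> u x)
      = face_integral F (\<lambda>x. (elem_jac (bK F) v *v bn F) \<bullet> u x) + s * face_integral F (\<lambda>x. (elem_jac (bK F) w *v bn F) \<bullet> u x)"
      using F by (auto intro!: lin continuous_intros cont)
  qed
  have 4: "(\<Sum>F\<in>boundary_faces \<Omega> \<T>. face_integral F (\<lambda>x. u x \<bullet> (v x + s *\<^sub>R w x)))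
      = (\<Sum>F\<in>boundary_faces \<Omega> \<T>. face_integral F (\<lambda>x. u x \<bullet> v x)) + s * (\<Sum>F\<in>boundary_faces \<Omega> \<T>. face_integral F (\<lambda>x. u x \<bullet> w x))"
    unfolding sum_distrib_left sum.distrib[symmetric] inner_add_right inner_scaleR_right
    by (rule sum.cong) (auto intro!: lin continuous_intros cont)
  show ?thesis unfolding nitsche_def 1 2 3 4 by (simp add: algebra_simps)
qed

lemma A_form:
  assumes w: "w \<in> V" and v: "v \<in> V"
  shows "(LINT x:\<Omega>|lebesgue. \<mu> * (jac w x \<bullet> jac v x))
       - boundary_integral \<Omega> \<T> (\<lambda>K n x. (\<mu> *\<^sub>R (side_value K (jac w) x *v n)) \<bullet> v x)
       - boundary_integral \<Omega> \<T> (\<lambda>K n x. (\<mu> *\<^sub>R (side_value K (jac v) x *v n)) \<bullet> w x)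
       + \<gamma> * \<mu> / h * boundary_integral \<Omega> \<T> (\<lambda>K n x. w x \<bullet> v x) = \<mu> * nitsche \<gamma> w v"
proof -
  have e: "set_integrable lebesgue K (\<lambda>x. \<mu> * (jac w x \<bullet> jac v x))"
    "(LINT x:K|lebesgue. \<mu> * (jac w x \<bullet> jac v x)) = \<mu> * (measure lebesgue K * (elem_jac K w \<bullet> elem_jac K v))"
    if K: "K \<in> \<T>" for K
  proof -
    have i: "\<mu> * (jac w x \<bullet> jac v x) = \<mu> * (elem_jac K w \<bullet> elem_jac K v)" if "x \<in> interior K" for x
      using V_jac[OF v K that] V_jac[OF w K that] by simp
    show "set_integrable lebesgue K (\<lambda>x. \<mu> * (jac w x \<bullet> jac v x))"
      by (rule elem_integral(1)[OF simplex[OF K] i]) simp_all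
    have "(LINT x:K|lebesgue. \<mu> * (jac w x \<bullet> jac v x)) = (LINT x:K|lebesgue. \<mu> * (elem_jac K w \<bullet> elem_jac K v))"
      by (rule elem_integral(2)[OF simplex[OF K] i]) simp_all
    then show "(LINT x:K|lebesgue. \<mu> * (jac w x \<bullet> jac v x)) = \<mu> * (measure lebesgue K * (elem_jac K w \<bullet> elem_jac K v))"
      using lmeasurable_compact[OF full_simplex_compact[OF simplex[OF K]]]
      by (simp add: set_lebesgue_integral_def fmeasurableD)
  qed
  have 1: "(LINT x:\<Omega>|lebesgue. \<mu> * (jac w x \<bullet> jac v x)) = \<mu> * (\<Sum>K\<in>\<T>. measure lebesgue K * (elem_jac K w \<bullet> elem_jac K v))"
  proof -
    have "(LINT x:\<Omega>|lebesgue. \<mu> * (jac w x \<bullet> jac v x)) = (\<Sum>K\<in>\<T>. LINT x:K|lebesgue. \<mu> * (jac w x \<bullet> jac v x))"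
      by (rule domain_integral(2)[OF e(1)])
    also have "\<dots> = (\<Sum>K\<in>\<T>. \<mu> * (measure lebesgue K * (elem_jac K w \<bullet> elem_jac K v)))" by (rule sum.cong[OF refl e(2)])
    finally show ?thesis by (simp only: sum_distrib_left)
  qed
  have 2: "boundary_integral \<Omega> \<T> (\<lambda>K n x. (\<mu> *\<^sub>R (side_value K (jac w) x *v n)) \<bullet> v x)
      = \<mu> * (\<Sum>F\<in>boundary_faces \<Omega> \<T>. face_integral F (\<lambda>x. (elem_jac (bK F) w *v bn F) \<bullet> v x))" if w: "w \<in> V" for w v
    unfolding boundary_eq sum_distrib_left face_integral_cmult[symmetric]
  proof (rule sum.cong[OF refl], rule face_integral_cong)
    fix F x assume F: "F \<in> boundary_faces \<Omega> \<T>" and x: "x \<in> F"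
    then have "x \<in> bK F" using facet_of_imp_subset[OF bK(2)[OF F]] by blast
    then show "(\<mu> *\<^sub>R (side_value (bK F) (jac w) x *v bn F)) \<bullet> v x = \<mu> * ((elem_jac (bK F) w *v bn F) \<bullet> v x)"
      using side_value_jac[OF w bK(1)[OF F]] by simp
  qed (rule flat_boundary)
  have 3: "boundary_integral \<Omega> \<T> (\<lambda>K n x. w x \<bullet> v x) = (\<Sum>F\<in>boundary_faces \<Omega> \<T>. face_integral F (\<lambda>x. w x \<bullet> v x))"
    unfolding boundary_eq ..
  show ?thesis unfolding 1 2[OF w] 2[OF v] 3 nitsche_def by (simp add: algebra_simps)
qed

lemma A_op_props:
  assumes w: "w \<in> V"
  shows "A_op 1 \<gamma> \<mu> \<Omega> \<T> w \<in> V" "\<And>v. v \<in> V \<Longrightarrow> L2_inner \<Omega> (A_op 1 \<gamma> \<mu> \<Omega> \<T> w) v = \<mu> * nitsche \<gamma> w v"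
proof -
  let ?l = "\<lambda>v. (LINT x:\<Omega>|lebesgue. \<mu> * (jac w x \<bullet> jac v x))
       - boundary_integral \<Omega> \<T> (\<lambda>K n x. (\<mu> *\<^sub>R (side_value K (jac w) x *v n)) \<bullet> v x)
       - boundary_integral \<Omega> \<T> (\<lambda>K n x. (\<mu> *\<^sub>R (side_value K (jac v) x *v n)) \<bullet> w x)
       + \<gamma> * \<mu> / h * boundary_integral \<Omega> \<T> (\<lambda>K n x. w x \<bullet> v x)"
  have lin: "?l (\<lambda>x. v x + s *\<^sub>R u x) = ?l v + s * ?l u" if "v \<in> V" "u \<in> V" for v u s
    unfolding A_form[OF w V_comb[OF that]] A_form[OF w that(1)] A_form[OF w that(2)] nitsche_linear[OF w that]
    by (simp add: algebra_simps)
  show "A_op 1 \<gamma> \<mu> \<Omega> \<T> w \<in> V" unfolding A_op_def by (rule V_represent(1)) (rule lin)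
  fix v assume v: "v \<in> V"
  have "L2_inner \<Omega> (A_op 1 \<gamma> \<mu> \<Omega> \<T> w) v = ?l v" unfolding A_op_def by (rule V_represent(2)[OF _ v]) (rule lin)
  then show "L2_inner \<Omega> (A_op 1 \<gamma> \<mu> \<Omega> \<T> w) v = \<mu> * nitsche \<gamma> w v" unfolding A_form[OF w v] .
qed

lemma A_norm_eq: "v \<in> V \<Longrightarrow> A_norm_sq 1 \<gamma> \<mu> \<Omega> \<T> v = \<mu> * nitsche \<gamma> v v"
  unfolding A_norm_sq_def by (rule A_op_props(2))

lemma boundary_sup:
  assumes v: "v \<in> V" and F: "F \<in> boundary_faces \<Omega> \<T>" and x: "x \<in> F"
  shows "h ^ n * (norm (v x))\<^sup>2 \<le> c2 * L2_inner (bK F) v v"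
  using inverse_sup[OF v bK(1)[OF F]] facet_of_imp_subset[OF bK(2)[OF F]] x by blast

lemma boundary_sum_le:
  "v \<in> V \<Longrightarrow> (\<Sum>F\<in>boundary_faces \<Omega> \<T>. L2_inner (bK F) v v) \<le> (real n + 1) * L2_inner \<Omega> v v"
  unfolding total_L2[symmetric]
  by (rule facet_sum_le) (use finite_faces bK elem_L2_nonneg in auto)

text \<open>The area of a face is of the order of a volume divided by \<open>h\<close>; the hypothesis on the integrand has
  the form in which the inverse inequalities deliver it.\<close>

lemma boundary_face_bound:
  assumes F: "F \<in> boundary_faces \<Omega> \<T>" and f: "continuous_on F f" and E: "0 \<le> E"
    and b: "\<And>x. x \<in> F \<Longrightarrow> h ^ n * \<bar>f x\<bar> \<le> E"
  shows "h * \<bar>face_integral F f\<bar> \<le> c3 * E"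
proof -
  have hn: "0 < h ^ n" using h_pos by simp
  have "\<bar>face_integral F f\<bar> \<le> E / h ^ n * area F"
    by (rule face_integral_abs_le[OF flat_boundary[OF F] f]) (use b hn in \<open>auto simp: pos_le_divide_eq mult.commute\<close>)
  then have "h * \<bar>face_integral F f\<bar> \<le> h * (E / h ^ n * area F)" using h_pos by (intro mult_left_mono) auto
  also have "\<dots> = E / h ^ n * (h * area F)" by simp
  also have "\<dots> \<le> E / h ^ n * (c3 * h ^ n)"
    using area_le[OF bK[OF F]] E hn by (intro mult_left_mono) auto
  also have "\<dots> = c3 * E" using h_pos by simp
  finally show ?thesis .
qed

definition "cA \<gamma> = \<omega> * c1 + (real n + 1) * (c3 * (c1 + c2) + \<bar>\<gamma>\<bar> * c3 * c2)"

text \<open>Every term is bounded with inverse and trace inequalities by \<open>h\<close> to the power \<open>-2\<close> times the mass.\<close>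

lemma nitsche_bound:
  assumes v: "v \<in> V"
  shows "h\<^sup>2 * nitsche \<gamma> v v \<le> cA \<gamma> * L2_inner \<Omega> v v"
proof -
  let ?B = "boundary_faces \<Omega> \<T>" and ?N = "L2_inner \<Omega> v v"
  let ?I1 = "\<lambda>F. face_integral F (\<lambda>x. (elem_jac (bK F) v *v bn F) \<bullet> v x)"
  let ?I2 = "\<lambda>F. face_integral F (\<lambda>x. v x \<bullet> v x)"
  have 1: "h\<^sup>2 * (\<Sum>K\<in>\<T>. measure lebesgue K * (elem_jac K v \<bullet> elem_jac K v)) \<le> \<omega> * c1 * ?N"
    unfolding total_L2[OF v, symmetric] sum_distrib_left
  proof (rule sum_mono)
    fix K assume K: "K \<in> \<T>"
    have "h\<^sup>2 * (measure lebesgue K * (elem_jac K v \<bullet> elem_jac K v)) \<le> h\<^sup>2 * ((\<omega> * h ^ n) * (elem_jac K v \<bullet> elem_jac K v))"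
      by (intro mult_left_mono mult_right_mono measure_elem_le[OF K]) auto
    also have "\<dots> = \<omega> * (h ^ (n + 2) * (norm (elem_jac K v))\<^sup>2)" unfolding power_add power2_norm_eq_inner by simp
    also have "\<dots> \<le> \<omega> * (c1 * L2_inner K v v)" using inverse_jac[OF v K] ball_vol_pos by (intro mult_left_mono) auto
    finally show "h\<^sup>2 * (measure lebesgue K * (elem_jac K v \<bullet> elem_jac K v)) \<le> \<omega> * c1 * L2_inner K v v" by simp
  qed
  have i1: "2 * (h\<^sup>2 * \<bar>?I1 F\<bar>) \<le> c3 * (c1 + c2) * L2_inner (bK F) v v" if F: "F \<in> ?B" for F
  proof -
    let ?M = "elem_jac (bK F) v" and ?E = "(c1 + c2) * L2_inner (bK F) v v / 2"
    have "h * \<bar>face_integral F (\<lambda>x. h * ((?M *v bn F) \<bullet> v x))\<bar> \<le> c3 * ?E"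
    proof (rule boundary_face_bound[OF F])
      show "continuous_on F (\<lambda>x. h * ((?M *v bn F) \<bullet> v x))"
        using F by (intro continuous_intros V_continuous_face[OF v]) auto
      show "0 \<le> ?E"
        by (intro divide_nonneg_pos mult_nonneg_nonneg elem_L2_nonneg[OF bK(1)[OF F]]) (use c_pos in auto)
      fix x assume x: "x \<in> F"
      have "\<bar>(?M *v bn F) \<bullet> v x\<bar> \<le> norm (?M *v bn F) * norm (v x)" by (rule Cauchy_Schwarz_ineq2)
      also have "\<dots> \<le> norm ?M * norm (v x)"
        using norm_matrix_vector_le[of ?M "bn F"] norm_bn[OF F] by (intro mult_right_mono) auto
      finally have "\<bar>h * ((?M *v bn F) \<bullet> v x)\<bar> \<le> (h * norm ?M) * norm (v x)"
        using h_pos by (simp add: abs_mult mult.assoc)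
      also have "\<dots> \<le> (h\<^sup>2 * (norm ?M)\<^sup>2 + (norm (v x))\<^sup>2) / 2"
        using sum_squares_bound[of "h * norm ?M" "norm (v x)"] by (simp add: power_mult_distrib)
      finally have "h ^ n * \<bar>h * ((?M *v bn F) \<bullet> v x)\<bar> \<le> h ^ n * ((h\<^sup>2 * (norm ?M)\<^sup>2 + (norm (v x))\<^sup>2) / 2)"
        using h_pos by (intro mult_left_mono) auto
      also have "\<dots> = (h ^ (n + 2) * (norm ?M)\<^sup>2 + h ^ n * (norm (v x))\<^sup>2) / 2"
        by (simp add: power_add power2_eq_square[of h] distrib_left mult_ac)
      also have "\<dots> \<le> ?E" using inverse_jac[OF v bK(1)[OF F]] boundary_sup[OF v F x] by (simp add: distrib_right)
      finally show "h ^ n * \<bar>h * ((?M *v bn F) \<bullet> v x)\<bar> \<le> ?E" .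
    qed
    then show ?thesis using h_pos by (simp add: face_integral_cmult abs_mult power2_eq_square mult_ac)
  qed
  have i2: "h * \<bar>?I2 F\<bar> \<le> c3 * c2 * L2_inner (bK F) v v" if F: "F \<in> ?B" for F
  proof -
    have "h * \<bar>?I2 F\<bar> \<le> c3 * (c2 * L2_inner (bK F) v v)"
    proof (rule boundary_face_bound[OF F])
      show "0 \<le> c2 * L2_inner (bK F) v v"
        by (rule mult_nonneg_nonneg[OF less_imp_le[OF c_pos(2)] elem_L2_nonneg[OF bK(1)[OF F]]])
    qed (use F boundary_sup[OF v F] in
          \<open>auto intro!: continuous_intros V_continuous_face[OF v] simp: power2_norm_eq_inner\<close>)
    then show ?thesis by simp
  qed
  have 2: "- 2 * (h\<^sup>2 * (\<Sum>F\<in>?B. ?I1 F)) \<le> c3 * (c1 + c2) * ((real n + 1) * ?N)"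
  proof -
    have "- 2 * (h\<^sup>2 * (\<Sum>F\<in>?B. ?I1 F)) = (\<Sum>F\<in>?B. - 2 * (h\<^sup>2 * ?I1 F))" by (simp add: sum_distrib_left sum_negf)
    also have "\<dots> \<le> (\<Sum>F\<in>?B. c3 * (c1 + c2) * L2_inner (bK F) v v)"
    proof (rule sum_mono)
      fix F assume F: "F \<in> ?B"
      have "h\<^sup>2 * (- ?I1 F) \<le> h\<^sup>2 * \<bar>?I1 F\<bar>" by (intro mult_left_mono) auto
      then show "- 2 * (h\<^sup>2 * ?I1 F) \<le> c3 * (c1 + c2) * L2_inner (bK F) v v" using i1[OF F] by linarith
    qed
    also have "\<dots> \<le> c3 * (c1 + c2) * ((real n + 1) * ?N)"
      unfolding sum_distrib_left[symmetric] using boundary_sum_le[OF v] c_pos by (intro mult_left_mono) auto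
    finally show ?thesis .
  qed
  have 3: "h\<^sup>2 * (\<gamma> / h * (\<Sum>F\<in>?B. ?I2 F)) \<le> \<bar>\<gamma>\<bar> * (c3 * c2 * ((real n + 1) * ?N))"
  proof -
    have "h\<^sup>2 * (\<gamma> / h * (\<Sum>F\<in>?B. ?I2 F)) = \<gamma> * (\<Sum>F\<in>?B. h * ?I2 F)"
      using h_pos by (simp add: sum_distrib_left power2_eq_square mult_ac)
    also have "\<dots> \<le> \<bar>\<gamma>\<bar> * \<bar>\<Sum>F\<in>?B. h * ?I2 F\<bar>" unfolding abs_mult[symmetric] by (rule abs_ge_self)
    also have "\<dots> \<le> \<bar>\<gamma>\<bar> * (c3 * c2 * ((real n + 1) * ?N))"
    proof (rule mult_left_mono)
      have "\<bar>\<Sum>F\<in>?B. h * ?I2 F\<bar> \<le> (\<Sum>F\<in>?B. c3 * c2 * L2_inner (bK F) v v)"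
      proof (rule order.trans[OF sum_abs], rule sum_mono)
        fix F assume "F \<in> ?B"
        then show "\<bar>h * ?I2 F\<bar> \<le> c3 * c2 * L2_inner (bK F) v v" using i2[of F] h_pos by (simp add: abs_mult)
      qed
      also have "\<dots> \<le> c3 * c2 * ((real n + 1) * ?N)"
        unfolding sum_distrib_left[symmetric] using boundary_sum_le[OF v] c_pos by (intro mult_left_mono) auto
      finally show "\<bar>\<Sum>F\<in>?B. h * ?I2 F\<bar> \<le> c3 * c2 * ((real n + 1) * ?N)" .
    qed simp
    finally show ?thesis .
  qed
  have "h\<^sup>2 * nitsche \<gamma> v v = h\<^sup>2 * (\<Sum>K\<in>\<T>. measure lebesgue K * (elem_jac K v \<bullet> elem_jac K v))
      + - 2 * (h\<^sup>2 * (\<Sum>F\<in>?B. ?I1 F)) + h\<^sup>2 * (\<gamma> / h * (\<Sum>F\<in>?B. ?I2 F))"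
    unfolding nitsche_def by (simp add: algebra_simps)
  also have "\<dots> \<le> \<omega> * c1 * ?N + c3 * (c1 + c2) * ((real n + 1) * ?N) + \<bar>\<gamma>\<bar> * (c3 * c2 * ((real n + 1) * ?N))"
    using 1 2 3 by linarith
  also have "\<dots> = cA \<gamma> * ?N" by (simp add: cA_def algebra_simps)
  finally show ?thesis .
qed

subsection \<open>Stabilised convection\<close>

text \<open>The jump of a piecewise constant Jacobian is constant on the face, so it leaves the face integral,
  and what remains there is \<open>weight\<close>.\<close>

definition jmp :: "(real^'d) set \<Rightarrow> (real^'d \<Rightarrow> real^'d) \<Rightarrow> real^'d^'d" where
  "jmp F w = elem_jac (fst (sides \<T> F)) w - elem_jac (snd (sides \<T> F)) w"

definition weight :: "real \<Rightarrow> real \<Rightarrow> (real^'d \<Rightarrow> real^'d) \<Rightarrow> (real^'d) set \<Rightarrow> real" where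
  "weight \<epsilon> B b F = face_integral F (\<lambda>x. (diameter F)\<^sup>2 * (\<bar>b x \<bullet> unit_normal F\<bar> + B * \<epsilon>))"

lemma sides_mem:
  assumes "F \<in> interior_faces \<T>" "x \<in> F"
  shows "x \<in> fst (sides \<T> F)" "x \<in> snd (sides \<T> F)"
  using sides_props(4,5)[OF assms(1)] assms(2) by (auto dest!: facet_of_imp_subset)

lemma jump_jac:
  assumes "w \<in> V" "F \<in> interior_faces \<T>" "x \<in> F"
  shows "jump \<T> F (jac w) x = jmp F w"
  unfolding jump_def jmp_def side_value_jac[OF assms(1) sides_props(1)[OF assms(2)] sides_mem(1)[OF assms(2,3)]]
    side_value_jac[OF assms(1) sides_props(2)[OF assms(2)] sides_mem(2)[OF assms(2,3)]] ..

lemma jump_grad: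
  assumes "q \<in> W_space 1 \<Omega> \<T>" "F \<in> interior_faces \<T>" "x \<in> F"
  shows "jump \<T> F (grad q) x = elem_grad (fst (sides \<T> F)) q - elem_grad (snd (sides \<T> F)) q"
  unfolding jump_def side_value_grad[OF assms(1) sides_props(1)[OF assms(2)] sides_mem(1)[OF assms(2,3)]]
    side_value_grad[OF assms(1) sides_props(2)[OF assms(2)] sides_mem(2)[OF assms(2,3)]] ..

lemma s_u_eq:
  assumes "w \<in> V" "v \<in> V"
  shows "s_u \<gamma>\<^sub>u \<epsilon> B b \<Omega> \<T> w v = \<gamma>\<^sub>u * (\<Sum>F\<in>interior_faces \<T>. (jmp F w \<bullet> jmp F v) * weight \<epsilon> B b F)
    + (\<Sum>F\<in>boundary_faces \<Omega> \<T>. face_integral F (\<lambda>x. B * (w x \<bullet> bn F) * (v x \<bullet> bn F)))"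
proof -
  have "(\<Sum>F\<in>interior_faces \<T>. face_integral F (\<lambda>x. (diameter F)\<^sup>2 * (\<bar>b x \<bullet> unit_normal F\<bar> + B * \<epsilon>)
              * (jump \<T> F (jac w) x \<bullet> jump \<T> F (jac v) x)))
     = (\<Sum>F\<in>interior_faces \<T>. (jmp F w \<bullet> jmp F v) * weight \<epsilon> B b F)"
    unfolding weight_def face_integral_cmult[symmetric]
    by (rule sum.cong[OF refl], rule face_integral_cong) (auto simp: flat_interior jump_jac[OF assms(1)] jump_jac[OF assms(2)])
  then show ?thesis unfolding s_u_def boundary_eq by simp
qed

lemma jmp_linear: "v \<in> V \<Longrightarrow> w \<in> V \<Longrightarrow> F \<in> interior_faces \<T> \<Longrightarrow> jmp F (\<lambda>x. v x + s *\<^sub>R w x) = jmp F v + s *\<^sub>R jmp F w"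
  using sides_props(1,2)[of F] by (simp add: jmp_def elem_jac_add scaleR_diff_right del: One_nat_def)

lemma s_u_linear:
  assumes "u \<in> V" "v \<in> V" "w \<in> V"
  shows "s_u \<gamma>\<^sub>u \<epsilon> B b \<Omega> \<T> u (\<lambda>x. v x + s *\<^sub>R w x) = s_u \<gamma>\<^sub>u \<epsilon> B b \<Omega> \<T> u v + s * s_u \<gamma>\<^sub>u \<epsilon> B b \<Omega> \<T> u w"
proof -
  have 1: "(\<Sum>F\<in>interior_faces \<T>. (jmp F u \<bullet> jmp F (\<lambda>x. v x + s *\<^sub>R w x)) * weight \<epsilon> B b F)
      = (\<Sum>F\<in>interior_faces \<T>. (jmp F u \<bullet> jmp F v) * weight \<epsilon> B b F)
        + s * (\<Sum>F\<in>interior_faces \<T>. (jmp F u \<bullet> jmp F w) * weight \<epsilon> B b F)"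
    unfolding sum_distrib_left sum.distrib[symmetric]
    by (rule sum.cong) (auto simp: jmp_linear[OF assms(2,3)] inner_add_right algebra_simps)
  have 2: "(\<Sum>F\<in>boundary_faces \<Omega> \<T>. face_integral F (\<lambda>x. B * (u x \<bullet> bn F) * ((v x + s *\<^sub>R w x) \<bullet> bn F)))
      = (\<Sum>F\<in>boundary_faces \<Omega> \<T>. face_integral F (\<lambda>x. B * (u x \<bullet> bn F) * (v x \<bullet> bn F)))
        + s * (\<Sum>F\<in>boundary_faces \<Omega> \<T>. face_integral F (\<lambda>x. B * (u x \<bullet> bn F) * (w x \<bullet> bn F)))"
    unfolding sum_distrib_left sum.distrib[symmetric]
  proof (rule sum.cong[OF refl])
    fix F assume F: "F \<in> boundary_faces \<Omega> \<T>"
    have c: "continuous_on F (\<lambda>x. B * (u x \<bullet> bn F) * (y x \<bullet> bn F))" if "y \<in> V" for y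
      using F by (intro continuous_intros V_continuous_face[OF assms(1)] V_continuous_face[OF that]) auto
    show "face_integral F (\<lambda>x. B * (u x \<bullet> bn F) * ((v x + s *\<^sub>R w x) \<bullet> bn F))
        = face_integral F (\<lambda>x. B * (u x \<bullet> bn F) * (v x \<bullet> bn F)) + s * face_integral F (\<lambda>x. B * (u x \<bullet> bn F) * (w x \<bullet> bn F))"
      using face_integral_add[OF flat_boundary[OF F] c[OF assms(2)] continuous_on_mult_left[OF c[OF assms(3)]], of s]
      by (simp add: face_integral_cmult inner_add_left distrib_left mult_ac)
  qed
  show ?thesis unfolding s_u_eq[OF assms(1) V_comb[OF assms(2,3)]] s_u_eq[OF assms(1,2)] s_u_eq[OF assms(1,3)] 1 2
    by (simp add: algebra_simps)
qed

lemma s_u_sym: "u \<in> V \<Longrightarrow> v \<in> V \<Longrightarrow> s_u \<gamma>\<^sub>u \<epsilon> B b \<Omega> \<T> u v = s_u \<gamma>\<^sub>u \<epsilon> B b \<Omega> \<T> v u"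
  by (simp add: s_u_def inner_commute mult_ac)

lemma face_integral_nonneg: "(\<And>x. 0 \<le> f x) \<Longrightarrow> 0 \<le> face_integral F f"
  unfolding face_integral_def set_lebesgue_integral_def by (rule Bochner_Integration.integral_nonneg) simp

text \<open>The weights and the boundary term are nonnegative.\<close>

lemma psd_form_s_u:
  assumes "0 \<le> \<gamma>\<^sub>u" "0 \<le> \<epsilon>" "0 \<le> B"
  shows "psd_form V (s_u \<gamma>\<^sub>u \<epsilon> B b \<Omega> \<T>)"
proof
  fix f g u :: "real^'d \<Rightarrow> real^'d" and c :: real
  assume f: "f \<in> V"
  show "(\<lambda>x. c *\<^sub>R f x) \<in> V" by (rule V_scale[OF f])
  have w: "0 \<le> weight \<epsilon> B b F" for F unfolding weight_def by (rule face_integral_nonneg) (use assms in simp)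
  have "0 \<le> B * (f x \<bullet> bn F) * (f x \<bullet> bn F)" for x F using assms(3) by (simp add: mult.assoc)
  then have t: "0 \<le> face_integral F (\<lambda>x. B * (f x \<bullet> bn F) * (f x \<bullet> bn F))" for F
    by (rule face_integral_nonneg)
  show "0 \<le> s_u \<gamma>\<^sub>u \<epsilon> B b \<Omega> \<T> f f" unfolding s_u_eq[OF f f]
    by (intro add_nonneg_nonneg mult_nonneg_nonneg sum_nonneg) (use assms w t in auto)
  assume g: "g \<in> V"
  show "(\<lambda>x. f x + g x) \<in> V" by (rule V_add[OF f g])
  show "s_u \<gamma>\<^sub>u \<epsilon> B b \<Omega> \<T> f g = s_u \<gamma>\<^sub>u \<epsilon> B b \<Omega> \<T> g f" by (rule s_u_sym[OF f g])
  show "s_u \<gamma>\<^sub>u \<epsilon> B b \<Omega> \<T> (\<lambda>x. c *\<^sub>R f x) g = c * s_u \<gamma>\<^sub>u \<epsilon> B b \<Omega> \<T> f g"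
    using V_linear(2)[of "s_u \<gamma>\<^sub>u \<epsilon> B b \<Omega> \<T> g", OF s_u_linear[OF g] f, of c] s_u_sym[OF f g] s_u_sym[OF V_scale[OF f] g] by simp
  assume u: "u \<in> V"
  show "s_u \<gamma>\<^sub>u \<epsilon> B b \<Omega> \<T> (\<lambda>x. f x + g x) u = s_u \<gamma>\<^sub>u \<epsilon> B b \<Omega> \<T> f u + s_u \<gamma>\<^sub>u \<epsilon> B b \<Omega> \<T> g u"
    using V_linear(1)[of "s_u \<gamma>\<^sub>u \<epsilon> B b \<Omega> \<T> u", OF s_u_linear[OF u] f g] s_u_sym[OF f u] s_u_sym[OF g u] s_u_sym[OF V_add[OF f g] u] by simp
qed

lemma weight_le:
  assumes b: "continuous_on (closure \<Omega>) b" "\<And>x. x \<in> closure \<Omega> \<Longrightarrow> norm (b x) \<le> B" and F: "F \<in> interior_faces \<T>" and \<epsilon>: "0 \<le> \<epsilon>"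
  shows "weight \<epsilon> B b F \<le> h\<^sup>2 * (B * (1 + \<epsilon>)) * area F"
proof -
  have flat: "flat F" by (rule flat_interior[OF F])
  have sub: "F \<subseteq> closure \<Omega>" using face_subset_closure F by blast
  obtain K where K: "K \<in> \<T>" "F facet_of K" using F interior_face_iff by blast
  have "0 \<le> diameter F" by (rule diameter_ge_0) (use flat in \<open>simp add: flat_def compact_imp_bounded\<close>)
  moreover have "diameter F \<le> h"
    using diameter_subset[OF facet_of_imp_subset[OF K(2)] compact_imp_bounded[OF full_simplex_compact[OF simplex[OF K(1)]]]]
      diameter_le[OF K(1)] by linarith
  ultimately have dF: "0 \<le> diameter F" "diameter F \<le> h" .
  have "weight \<epsilon> B b F \<le> face_integral F (\<lambda>x. h\<^sup>2 * (B * (1 + \<epsilon>)))"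
    unfolding weight_def
  proof (rule face_integral_mono[OF flat])
    show "continuous_on F (\<lambda>x. (diameter F)\<^sup>2 * (\<bar>b x \<bullet> unit_normal F\<bar> + B * \<epsilon>))"
      by (intro continuous_intros continuous_on_subset[OF b(1) sub])
    fix x assume x: "x \<in> F"
    have "\<bar>b x \<bullet> unit_normal F\<bar> \<le> norm (b x) * norm (unit_normal F)" by (rule Cauchy_Schwarz_ineq2)
    also have "\<dots> \<le> B" using b(2) x sub flat by (auto simp: flat_def)
    finally have "\<bar>b x \<bullet> unit_normal F\<bar> + B * \<epsilon> \<le> B * (1 + \<epsilon>)" by (simp add: algebra_simps)
    moreover have "0 \<le> B" using b(2)[of x] x sub norm_ge_zero[of "b x"] by (meson order.trans subsetD)
    ultimately show "(diameter F)\<^sup>2 * (\<bar>b x \<bullet> unit_normal F\<bar> + B * \<epsilon>) \<le> h\<^sup>2 * (B * (1 + \<epsilon>))"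
      using dF \<epsilon> by (intro mult_mono power_mono) auto
  qed simp
  then show ?thesis by (simp add: face_integral_const)
qed

text \<open>The part \<open>B \<epsilon>\<close> of the weight is what bounds jumps from below on faces parallel to the field.\<close>

lemma weight_ge:
  assumes b: "continuous_on (closure \<Omega>) b" and F: "F \<in> interior_faces \<T>" and \<epsilon>: "0 \<le> \<epsilon>" and B: "0 \<le> B"
  shows "4 * h\<^sup>2 * (B * \<epsilon>) * area F \<le> \<rho>\<^sup>2 * weight \<epsilon> B b F"
proof -
  have flat: "flat F" by (rule flat_interior[OF F])
  have sub: "F \<subseteq> closure \<Omega>" using face_subset_closure F by blast
  obtain K where K: "K \<in> \<T>" "F facet_of K" using F interior_face_iff by blast
  have "(2 * h)\<^sup>2 \<le> (\<rho> * diameter F)\<^sup>2" using diameter_facet_ge[OF K] h_pos by (intro power_mono) auto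
  then have "4 * h\<^sup>2 * (B * \<epsilon>) \<le> \<rho>\<^sup>2 * (diameter F)\<^sup>2 * (B * \<epsilon>)"
    using \<epsilon> B by (intro mult_right_mono) (auto simp: power_mult_distrib)
  then have "4 * h\<^sup>2 * (B * \<epsilon>) * area F \<le> \<rho>\<^sup>2 * (diameter F)\<^sup>2 * (B * \<epsilon>) * area F"
    by (rule mult_right_mono[OF _ area_nonneg])
  also have "\<dots> = \<rho>\<^sup>2 * face_integral F (\<lambda>x. (diameter F)\<^sup>2 * (B * \<epsilon>))" by (simp add: face_integral_const)
  also have "\<dots> \<le> \<rho>\<^sup>2 * weight \<epsilon> B b F"
    unfolding weight_def
    by (intro mult_left_mono face_integral_mono[OF flat])
      (auto intro!: continuous_intros continuous_on_subset[OF b(1) sub] mult_left_mono)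
  finally show ?thesis .
qed

definition "cS \<gamma>\<^sub>u \<epsilon> = (real n + 1) * (4 * \<gamma>\<^sub>u * (1 + \<epsilon>) * c3 * c1 + c3 * c2)"

text \<open>Jumps are bounded by the gradients on the two sides, which the inverse inequality bounds.\<close>

lemma s_u_bound:
  assumes v: "v \<in> V" and b: "continuous_on (closure \<Omega>) b" "\<And>x. x \<in> closure \<Omega> \<Longrightarrow> norm (b x) \<le> B"
    and p: "0 \<le> \<gamma>\<^sub>u" "0 \<le> \<epsilon>" "0 \<le> B"
  shows "h * s_u \<gamma>\<^sub>u \<epsilon> B b \<Omega> \<T> v v \<le> cS \<gamma>\<^sub>u \<epsilon> * B * L2_inner \<Omega> v v"
proof -
  let ?I = "interior_faces \<T>" and ?B = "boundary_faces \<Omega> \<T>" and ?N = "L2_inner \<Omega> v v"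
  let ?E = "\<lambda>K. L2_inner K v v"
  let ?k1 = "\<lambda>F. fst (sides \<T> F)" and ?k2 = "\<lambda>F. snd (sides \<T> F)"
  have one: "h * (h\<^sup>2 * area F * (norm (elem_jac K v))\<^sup>2) \<le> c3 * c1 * ?E K" if "K \<in> \<T>" "F facet_of K" for K F
  proof -
    have "h * (h\<^sup>2 * area F * (norm (elem_jac K v))\<^sup>2) = (h * area F) * (h\<^sup>2 * (norm (elem_jac K v))\<^sup>2)" by simp
    also have "\<dots> \<le> (c3 * h ^ n) * (h\<^sup>2 * (norm (elem_jac K v))\<^sup>2)" by (intro mult_right_mono area_le[OF that]) simp
    also have "\<dots> = c3 * (h ^ (n + 2) * (norm (elem_jac K v))\<^sup>2)" by (simp add: power_add power2_eq_square[of h] mult_ac)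
    also have "\<dots> \<le> c3 * (c1 * ?E K)" using inverse_jac[OF v that(1)] c_pos by (intro mult_left_mono) auto
    finally show ?thesis by simp
  qed
  have 1: "h * (\<Sum>F\<in>?I. (jmp F v \<bullet> jmp F v) * weight \<epsilon> B b F) \<le> B * (1 + \<epsilon>) * (2 * (c3 * c1) * (2 * ((real n + 1) * ?N)))"
  proof -
    have "h * ((jmp F v \<bullet> jmp F v) * weight \<epsilon> B b F) \<le> B * (1 + \<epsilon>) * (2 * (c3 * c1) * (?E (?k1 F) + ?E (?k2 F)))"
      if F: "F \<in> ?I" for F
    proof -
      note s = sides_props[OF F]
      have "jmp F v \<bullet> jmp F v = (norm (jmp F v))\<^sup>2" by (simp add: power2_norm_eq_inner)
      also have "\<dots> \<le> (norm (elem_jac (?k1 F) v) + norm (elem_jac (?k2 F) v))\<^sup>2"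
        unfolding jmp_def by (intro power_mono norm_triangle_ineq4) simp
      also have "\<dots> \<le> 2 * (norm (elem_jac (?k1 F) v))\<^sup>2 + 2 * (norm (elem_jac (?k2 F) v))\<^sup>2" by (rule sq_sum_le)
      finally have j: "jmp F v \<bullet> jmp F v \<le> 2 * (norm (elem_jac (?k1 F) v))\<^sup>2 + 2 * (norm (elem_jac (?k2 F) v))\<^sup>2" .
      have "h * ((jmp F v \<bullet> jmp F v) * weight \<epsilon> B b F)
          \<le> h * ((2 * (norm (elem_jac (?k1 F) v))\<^sup>2 + 2 * (norm (elem_jac (?k2 F) v))\<^sup>2) * (h\<^sup>2 * (B * (1 + \<epsilon>)) * area F))"
        using h_pos p area_nonneg[of F] j weight_le[OF b F p(2)]
        by (intro mult_left_mono mult_mono) (auto simp: weight_def intro!: face_integral_nonneg)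
      also have "\<dots> = B * (1 + \<epsilon>) * (2 * (h * (h\<^sup>2 * area F * (norm (elem_jac (?k1 F) v))\<^sup>2) + h * (h\<^sup>2 * area F * (norm (elem_jac (?k2 F) v))\<^sup>2)))"
        by (simp add: algebra_simps)
      also have "\<dots> \<le> B * (1 + \<epsilon>) * (2 * (c3 * c1 * ?E (?k1 F) + c3 * c1 * ?E (?k2 F)))"
        using p by (intro mult_left_mono add_mono one s) auto
      finally show ?thesis by (simp add: algebra_simps)
    qed
    then have "h * (\<Sum>F\<in>?I. (jmp F v \<bullet> jmp F v) * weight \<epsilon> B b F)
        \<le> (\<Sum>F\<in>?I. B * (1 + \<epsilon>) * (2 * (c3 * c1) * (?E (?k1 F) + ?E (?k2 F))))"
      unfolding sum_distrib_left by (rule sum_mono)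
    also have "\<dots> = B * (1 + \<epsilon>) * (2 * (c3 * c1) * ((\<Sum>F\<in>?I. ?E (?k1 F)) + (\<Sum>F\<in>?I. ?E (?k2 F))))"
      by (simp add: sum_distrib_left sum.distrib distrib_left)
    also have "\<dots> \<le> B * (1 + \<epsilon>) * (2 * (c3 * c1) * (2 * ((real n + 1) * ?N)))"
    proof (intro mult_left_mono)
      have "(\<Sum>F\<in>?I. ?E (?k1 F)) \<le> (real n + 1) * ?N" unfolding total_L2[OF v, symmetric]
        by (rule facet_sum_le[where \<phi>="?E" and \<kappa>="?k1"]) (use finite_faces sides_props elem_L2_nonneg in auto)
      moreover have "(\<Sum>F\<in>?I. ?E (?k2 F)) \<le> (real n + 1) * ?N" unfolding total_L2[OF v, symmetric]
        by (rule facet_sum_le[where \<phi>="?E" and \<kappa>="?k2"]) (use finite_faces sides_props elem_L2_nonneg in auto)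
      ultimately show "(\<Sum>F\<in>?I. ?E (?k1 F)) + (\<Sum>F\<in>?I. ?E (?k2 F)) \<le> 2 * ((real n + 1) * ?N)" by linarith
    qed (use p c_pos in auto)
    finally show ?thesis .
  qed
  have 2: "h * (\<Sum>F\<in>?B. face_integral F (\<lambda>x. B * (v x \<bullet> bn F) * (v x \<bullet> bn F))) \<le> B * (c3 * c2 * ((real n + 1) * ?N))"
  proof -
    have "h * face_integral F (\<lambda>x. B * (v x \<bullet> bn F) * (v x \<bullet> bn F)) \<le> B * (c3 * c2 * ?E (bK F))" if F: "F \<in> ?B" for F
    proof -
      have "h * \<bar>face_integral F (\<lambda>x. (v x \<bullet> bn F) * (v x \<bullet> bn F))\<bar> \<le> c3 * (c2 * ?E (bK F))"
      proof (rule boundary_face_bound[OF F])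
        show "continuous_on F (\<lambda>x. (v x \<bullet> bn F) * (v x \<bullet> bn F))"
          using F by (intro continuous_intros V_continuous_face[OF v]) auto
        show "0 \<le> c2 * ?E (bK F)"
          by (rule mult_nonneg_nonneg[OF less_imp_le[OF c_pos(2)] elem_L2_nonneg[OF bK(1)[OF F]]])
        fix x assume x: "x \<in> F"
        have "\<bar>v x \<bullet> bn F\<bar> \<le> norm (v x)" using Cauchy_Schwarz_ineq2[of "v x" "bn F"] norm_bn[OF F] by simp
        then have "\<bar>v x \<bullet> bn F\<bar>\<^sup>2 \<le> (norm (v x))\<^sup>2" by (intro power_mono) auto
        then have "\<bar>(v x \<bullet> bn F) * (v x \<bullet> bn F)\<bar> \<le> (norm (v x))\<^sup>2" by (simp add: power2_eq_square)
        then have "h ^ n * \<bar>(v x \<bullet> bn F) * (v x \<bullet> bn F)\<bar> \<le> h ^ n * (norm (v x))\<^sup>2"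
          using h_pos by (intro mult_left_mono) auto
        then show "h ^ n * \<bar>(v x \<bullet> bn F) * (v x \<bullet> bn F)\<bar> \<le> c2 * ?E (bK F)" using boundary_sup[OF v F x] by linarith
      qed
      then have "h * face_integral F (\<lambda>x. (v x \<bullet> bn F) * (v x \<bullet> bn F)) \<le> c3 * (c2 * ?E (bK F))"
        using h_pos by (smt (verit, best) mult_left_mono)
      then have "B * (h * face_integral F (\<lambda>x. (v x \<bullet> bn F) * (v x \<bullet> bn F))) \<le> B * (c3 * (c2 * ?E (bK F)))"
        using p(3) by (rule mult_left_mono)
      then show ?thesis unfolding mult.assoc[of B] face_integral_cmult by (simp add: mult.left_commute mult.assoc)
    qed
    then have "h * (\<Sum>F\<in>?B. face_integral F (\<lambda>x. B * (v x \<bullet> bn F) * (v x \<bullet> bn F))) \<le> (\<Sum>F\<in>?B. B * (c3 * c2 * ?E (bK F)))"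
      unfolding sum_distrib_left by (rule sum_mono)
    also have "\<dots> = B * (c3 * c2 * (\<Sum>F\<in>?B. ?E (bK F)))" by (simp add: sum_distrib_left)
    also have "\<dots> \<le> B * (c3 * c2 * ((real n + 1) * ?N))"
      using boundary_sum_le[OF v] p c_pos by (intro mult_left_mono) auto
    finally show ?thesis .
  qed
  have "h * s_u \<gamma>\<^sub>u \<epsilon> B b \<Omega> \<T> v v = \<gamma>\<^sub>u * (h * (\<Sum>F\<in>?I. (jmp F v \<bullet> jmp F v) * weight \<epsilon> B b F))
      + h * (\<Sum>F\<in>?B. face_integral F (\<lambda>x. B * (v x \<bullet> bn F) * (v x \<bullet> bn F)))"
    unfolding s_u_eq[OF v v] by (simp add: distrib_left mult.left_commute)
  also have "\<dots> \<le> \<gamma>\<^sub>u * (B * (1 + \<epsilon>) * (2 * (c3 * c1) * (2 * ((real n + 1) * ?N)))) + B * (c3 * c2 * ((real n + 1) * ?N))"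
    using 2 mult_left_mono[OF 1 p(1)] by linarith
  also have "\<dots> = cS \<gamma>\<^sub>u \<epsilon> * B * ?N" by (simp add: cS_def algebra_simps)
  finally show ?thesis .
qed

lemma C_op_props:
  assumes w: "w \<in> V" and b: "continuous_on (closure \<Omega>) b" and v: "v \<in> V"
  shows "L2_inner \<Omega> (C_op 1 \<gamma>\<^sub>u \<epsilon> B b \<Omega> \<T> w) v
    = (\<Sum>K\<in>\<T>. LINT x:K|lebesgue. (elem_jac K w *v b x) \<bullet> v x) + s_u \<gamma>\<^sub>u \<epsilon> B b \<Omega> \<T> w v"
proof -
  let ?l = "\<lambda>v. (\<Sum>K\<in>\<T>. L2_inner K (\<lambda>x. jac w x *v b x) v) + s_u \<gamma>\<^sub>u \<epsilon> B b \<Omega> \<T> w v"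
  have cont: "continuous_on K (\<lambda>x. elem_jac K w *v b x)" if "K \<in> \<T>" for K
    by (intro matrix_vector_mult_linear_continuous_on[THEN continuous_on_compose2] continuous_on_subset[OF b subset_closure[OF that]]) auto
  have e: "L2_inner K (\<lambda>x. jac w x *v b x) u = (LINT x:K|lebesgue. (elem_jac K w *v b x) \<bullet> u x)" if K: "K \<in> \<T>" and u: "u \<in> V" for K u
    unfolding L2_inner_def
    by (rule elem_integral(2)[OF simplex[OF K]]) (use V_jac[OF w K] cont[OF K] V_continuous_elem[OF u K] in \<open>auto intro!: continuous_on_inner\<close>)
  have eq: "?l u = (\<Sum>K\<in>\<T>. LINT x:K|lebesgue. (elem_jac K w *v b x) \<bullet> u x) + s_u \<gamma>\<^sub>u \<epsilon> B b \<Omega> \<T> w u" if "u \<in> V" for u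
    using e[OF _ that] by simp
  have lin: "?l (\<lambda>x. y x + s *\<^sub>R z x) = ?l y + s * ?l z" if yz: "y \<in> V" "z \<in> V" for y z s
  proof -
    have "(\<Sum>K\<in>\<T>. LINT x:K|lebesgue. (elem_jac K w *v b x) \<bullet> (y x + s *\<^sub>R z x))
        = (\<Sum>K\<in>\<T>. LINT x:K|lebesgue. (elem_jac K w *v b x) \<bullet> y x) + s * (\<Sum>K\<in>\<T>. LINT x:K|lebesgue. (elem_jac K w *v b x) \<bullet> z x)"
      unfolding sum_distrib_left sum.distrib[symmetric] by (rule sum.cong[OF refl elem_linear[OF _ cont yz]])
    then show ?thesis unfolding eq[OF yz(1)] eq[OF yz(2)] eq[OF V_comb[OF yz]]
      unfolding s_u_linear[OF w yz] by (simp only:) (simp add: algebra_simps)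
  qed
  show ?thesis unfolding C_op_def by (subst V_represent(2)[OF _ v]) (rule lin, assumption+, rule eq[OF v])
qed

lemma G_op_props:
  assumes q: "q \<in> W_space 1 \<Omega> \<T>" and v: "v \<in> V"
  shows "L2_inner \<Omega> (G_op 1 \<Omega> \<T> q) v = (\<Sum>K\<in>\<T>. LINT x:K|lebesgue. elem_grad K q \<bullet> v x)"
proof -
  let ?l = "\<lambda>v. - L2_inner \<Omega> q (divergence v) + boundary_integral \<Omega> \<T> (\<lambda>K n x. q x * (v x \<bullet> n))"
  have lin: "?l (\<lambda>x. y x + s *\<^sub>R z x) = ?l y + s * ?l z" if yz: "y \<in> V" "z \<in> V" for y z s
    unfolding gradient_form[OF q yz(1)] gradient_form[OF q yz(2)] gradient_form[OF q V_comb[OF yz]]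
      sum_distrib_left sum.distrib[symmetric]
    by (rule sum.cong[OF refl elem_linear[OF _ _ yz]]) auto
  show ?thesis unfolding G_op_def by (subst V_represent(2)[OF _ v]) (rule lin, assumption+, rule gradient_form[OF q v])
qed

end

section \<open>Piecewise constants and nodal averaging\<close>

context shaped_mesh
begin

abbreviation "X0 \<equiv> X_space_vec 0 \<Omega> \<T>"

lemma X0_iff:
  "z \<in> X0 \<longleftrightarrow> (\<forall>K\<in>\<T>. \<exists>c. \<forall>x\<in>interior K. z x = c) \<and> (\<forall>x. x \<notin> closure \<Omega> \<longrightarrow> z x = 0)"
proof
  assume z: "z \<in> X0"
  have "\<exists>c. \<forall>x\<in>interior K. z x = c" if K: "K \<in> \<T>" for K
  proof -
    have "\<exists>c. \<forall>x\<in>interior K. z x $ i = c" for i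
    proof -
      obtain g where g: "poly_degree_le 0 g" "\<forall>x\<in>interior K. z x $ i = g x"
        using z K by (fastforce simp: X_space_vec_def X_space_def)
      then show ?thesis unfolding poly_degree_0_iff by auto
    qed
    then obtain c where "\<And>i x. x \<in> interior K \<Longrightarrow> z x $ i = c i" by metis
    then show ?thesis by (intro exI[of _ "\<chi> i. c i"]) (simp add: vec_eq_iff)
  qed
  then show "(\<forall>K\<in>\<T>. \<exists>c. \<forall>x\<in>interior K. z x = c) \<and> (\<forall>x. x \<notin> closure \<Omega> \<longrightarrow> z x = 0)"
    using z by (auto simp: X_space_vec_def X_space_def vec_eq_iff)
next
  assume z: "(\<forall>K\<in>\<T>. \<exists>c. \<forall>x\<in>interior K. z x = c) \<and> (\<forall>x. x \<notin> closure \<Omega> \<longrightarrow> z x = 0)"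
  have "\<exists>g. poly_degree_le 0 g \<and> (\<forall>x\<in>interior K. z x $ i = g x)" if K: "K \<in> \<T>" for K i
  proof -
    obtain c where "\<forall>x\<in>interior K. z x = c" using z K by blast
    then show ?thesis by (intro exI[of _ "\<lambda>x. c $ i"]) (auto simp: poly_degree_0_iff)
  qed
  then show "z \<in> X0" using z by (simp add: X_space_vec_def X_space_def)
qed

lemma X0_piecewise_continuous: "z \<in> X0 \<Longrightarrow> piecewise_continuous z"
  unfolding X0_iff piecewise_continuous_def by (metis continuous_on_const)

lemma X0_L2: "z \<in> X0 \<Longrightarrow> z \<in> L2_space \<Omega>"
  by (rule piecewise_continuous_L2[OF X0_piecewise_continuous])

text \<open>The piecewise constant function with values \<open>m K\<close>.\<close>

definition pw :: "((real^'d) set \<Rightarrow> real^'d) \<Rightarrow> real^'d \<Rightarrow> real^'d" where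
  "pw m x = (\<Sum>K\<in>\<T>. indicator (interior K) x *\<^sub>R m K)"

lemma pw_eq: "K \<in> \<T> \<Longrightarrow> x \<in> interior K \<Longrightarrow> pw m x = m K"
proof -
  assume K: "K \<in> \<T>" "x \<in> interior K"
  have "pw m x = (\<Sum>K'\<in>\<T>. if K' = K then m K else 0)"
    unfolding pw_def
  proof (rule sum.cong[OF refl])
    fix K' assume K': "K' \<in> \<T>"
    show "indicator (interior K') x *\<^sub>R m K' = (if K' = K then m K else 0)"
      using eq_if_interior_meets[OF K(1) K'] K(2) interior_subset[of K'] by (auto split: split_indicator)
  qed
  then show ?thesis using K finite_mesh by simp
qed

lemma pw_X0: "pw m \<in> X0"
  unfolding X0_iff
proof (intro conjI ballI allI impI)
  show "\<exists>c. \<forall>x\<in>interior K. pw m x = c" if "K \<in> \<T>" for K using pw_eq[OF that] by blast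
  show "pw m x = 0" if "x \<notin> closure \<Omega>" for x
    unfolding pw_def using that subset_closure interior_subset by (intro sum.neutral) (force split: split_indicator)
qed

lemma measure_elem_pos: "K \<in> \<T> \<Longrightarrow> 0 < measure lebesgue K"
proof -
  assume K: "K \<in> \<T>"
  have "0 < c4 * measure lebesgue K" using measure_elem_ge[OF K] h_pos by (meson less_le_trans zero_less_power)
  then show ?thesis using c_pos(4) by (simp add: zero_less_mult_iff)
qed

lemma elem_const_integral: "K \<in> \<T> \<Longrightarrow> (LINT x:K|lebesgue. (c::real)) = measure lebesgue K * c"
  using lmeasurable_compact[OF full_simplex_compact[OF simplex]] by (simp add: set_lebesgue_integral_def fmeasurableD)

text \<open>The element means satisfy the defining equations of the projection. Two solutions may differ on the
  skeleton, so the chosen one is described only by those equations.\<close>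

lemma X0_projection:
  assumes y: "y \<in> V"
  shows "L2_proj \<Omega> X0 y \<in> X0" "\<And>z. z \<in> X0 \<Longrightarrow> L2_inner \<Omega> (L2_proj \<Omega> X0 y) z = L2_inner \<Omega> y z"
proof -
  define m where "m = (\<lambda>K. (1 / measure lebesgue K) *\<^sub>R (LINT x:K|lebesgue. y x))"
  have "L2_inner \<Omega> (pw m) z = L2_inner \<Omega> y z" if z: "z \<in> X0" for z
  proof -
    have "L2_inner K (pw m) z = L2_inner K y z" if K: "K \<in> \<T>" for K
    proof -
      obtain c where c: "\<forall>x\<in>interior K. z x = c" using z K unfolding X0_iff by blast
      have "L2_inner K (pw m) z = (LINT x:K|lebesgue. m K \<bullet> c)"
        unfolding L2_inner_def by (rule elem_integral(2)[OF simplex[OF K]]) (use c pw_eq[OF K] in auto)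
      also have "\<dots> = (LINT x:K|lebesgue. y x) \<bullet> c"
        unfolding elem_const_integral[OF K] using measure_elem_pos[OF K] by (simp add: m_def)
      also have "\<dots> = (LINT x:K|lebesgue. y x \<bullet> c)"
      proof -
        have "integrable lebesgue (\<lambda>x. indicator K x *\<^sub>R y x)"
          using piecewise_continuous_integrable[OF V_piecewise_continuous[OF y] K] by (simp add: set_integrable_def)
        then show ?thesis unfolding set_lebesgue_integral_def by (simp add: integral_inner_left[symmetric])
      qed
      also have "\<dots> = L2_inner K y z"
        unfolding L2_inner_def
        by (rule elem_integral(2)[OF simplex[OF K], symmetric])
          (use c V_continuous_elem[OF y K] in \<open>auto intro!: continuous_intros\<close>)
      finally show ?thesis .
    qed
    then show ?thesis
      using L2_inner_elements[OF X0_piecewise_continuous[OF pw_X0] X0_piecewise_continuous[OF z]]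
        L2_inner_elements[OF V_piecewise_continuous[OF y] X0_piecewise_continuous[OF z]] by simp
  qed
  then have "\<exists>z. z \<in> X0 \<and> (\<forall>v\<in>X0. L2_inner \<Omega> z v = L2_inner \<Omega> y v)" using pw_X0 by blast
  from someI_ex[OF this] show "L2_proj \<Omega> X0 y \<in> X0" "\<And>z. z \<in> X0 \<Longrightarrow> L2_inner \<Omega> (L2_proj \<Omega> X0 y) z = L2_inner \<Omega> y z"
    unfolding L2_proj_def represent_def by blast+
qed

text \<open>Nodal interpolation: the continuous piecewise affine function with values \<open>g a\<close> at the nodes. The
  choice of the element is immaterial because coordinates agree on common faces.\<close>

definition interp :: "(real^'d \<Rightarrow> real^'d) \<Rightarrow> real^'d \<Rightarrow> real^'d" where
  "interp g x = (if x \<in> closure \<Omega> then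
     (\<Sum>a\<in>verts (SOME K. K \<in> \<T> \<and> x \<in> K). bary (SOME K. K \<in> \<T> \<and> x \<in> K) a x *\<^sub>R g a) else 0)"

lemma nodal_sum_agree:
  assumes K: "K \<in> \<T>" "K' \<in> \<T>" and x: "x \<in> K" "x \<in> K'"
  shows "(\<Sum>a\<in>verts K. bary K a x *\<^sub>R g a) = (\<Sum>a\<in>verts K'. bary K' a x *\<^sub>R (g a :: real^'d))"
proof -
  have restr: "(\<Sum>a\<in>verts L. bary L a x *\<^sub>R g a) = (\<Sum>a\<in>verts L \<inter> verts L'. bary L a x *\<^sub>R g a)"
    if "L \<in> \<T>" "L' \<in> \<T>" "x \<in> L" "x \<in> L'" for L L'
  proof (rule sum.mono_neutral_right)
    have xx: "x \<in> L \<inter> L'" using that by simp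
    note c = bary_common_face[OF simplex[OF that(1)] simplex[OF that(2)] face_inter[OF that(1,2)] face_inter'[OF that(1,2)] xx]
    show "\<forall>a\<in>verts L - verts L \<inter> verts L'. bary L a x *\<^sub>R g a = 0"
      using c(2,3) by (metis Diff_iff IntI scaleR_zero_left)
  qed (use verts_props(1)[OF simplex[OF that(1)]] in auto)
  have xx: "x \<in> K \<inter> K'" using x by simp
  have "(\<Sum>a\<in>verts K \<inter> verts K'. bary K a x *\<^sub>R g a) = (\<Sum>a\<in>verts K' \<inter> verts K. bary K' a x *\<^sub>R g a)"
    using bary_common_face(1)[OF simplex[OF K(1)] simplex[OF K(2)] face_inter[OF K] face_inter'[OF K] xx]
    by (intro sum.cong) auto
  then show ?thesis using restr[OF K x] restr[OF K(2,1) x(2,1)] by simp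
qed

lemma interp_eq:
  assumes "K \<in> \<T>" "x \<in> K"
  shows "interp g x = (\<Sum>a\<in>verts K. bary K a x *\<^sub>R g a)"
proof -
  have "(SOME K. K \<in> \<T> \<and> x \<in> K) \<in> \<T> \<and> x \<in> (SOME K. K \<in> \<T> \<and> x \<in> K)"
    by (rule someI[of _ K]) (use assms in simp)
  then show ?thesis unfolding interp_def using nodal_sum_agree[of "SOME K. K \<in> \<T> \<and> x \<in> K" K x g] assms subset_closure by auto
qed

lemma interp_V: "interp g \<in> V"
proof -
  have cont: "continuous_on (closure \<Omega>) (interp g)"
    unfolding Union_mesh[symmetric]
  proof -
    have "continuous_on (\<Union>K\<in>\<T>. K) (interp g)"
    proof (rule continuous_on_closed_Union[OF finite_mesh])
      fix K assume K: "K \<in> \<T>"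
      show "closed K" using full_simplex_compact[OF simplex[OF K]] by (rule compact_imp_closed)
      have "continuous_on K (\<lambda>x. \<Sum>a\<in>verts K. bary K a x *\<^sub>R g a)" by (intro continuous_intros)
      then show "continuous_on K (interp g)" using interp_eq[OF K] by (simp cong: continuous_on_cong)
    qed
    then show "continuous_on (\<Union>\<T>) (interp g)" by simp
  qed
  have "(\<lambda>x. interp g x $ i) \<in> W_space 1 \<Omega> \<T>" for i
  proof -
    have "\<exists>p. poly_degree_le 1 p \<and> (\<forall>x\<in>interior K. interp g x $ i = p x)" if K: "K \<in> \<T>" for K
    proof -
      have "poly_degree_le 1 (\<lambda>x. (\<Sum>a\<in>verts K. (g a $ i) *\<^sub>R bgrad K a) \<bullet> x + (\<Sum>a\<in>verts K. snd (bcoef K a) * g a $ i))"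
        unfolding poly_degree_1_iff by blast
      moreover have "interp g x $ i = (\<Sum>a\<in>verts K. (g a $ i) *\<^sub>R bgrad K a) \<bullet> x + (\<Sum>a\<in>verts K. snd (bcoef K a) * g a $ i)"
        if "x \<in> interior K" for x
        using interp_eq[OF K, of x g] that interior_subset[of K]
        by (auto simp: bary_def inner_sum_left sum.distrib[symmetric] algebra_simps intro!: sum.cong)
      ultimately show ?thesis by blast
    qed
    moreover have "continuous_on (closure \<Omega>) (\<lambda>x. interp g x $ i)" by (intro continuous_intros cont)
    ultimately show ?thesis by (simp add: W_space_def X_space_def interp_def)
  qed
  then show ?thesis by (simp add: V_space_def)
qed

text \<open>Convexity: on an element the interpolant is an average of the nodal values.\<close>

lemma interp_error:
  assumes K: "K \<in> \<T>" and x: "x \<in> K"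
  shows "norm (m - interp g x) \<le> (\<Sum>a\<in>verts K. norm (m - g a))"
proof -
  note S = simplex[OF K]
  have b0: "0 \<le> bary K a x" if "a \<in> verts K" for a using mem_simplex_iff[OF S] x that by blast
  have b1: "bary K a x \<le> 1" if "a \<in> verts K" for a
    using bary_sum(1)[OF S, of x] member_le_sum[OF that, of "\<lambda>b. bary K b x"] verts_props(1)[OF S] b0 by auto
  have "m - interp g x = (\<Sum>a\<in>verts K. bary K a x *\<^sub>R (m - g a))"
    using bary_sum(1)[OF S, of x] by (simp add: interp_eq[OF K x] scaleR_diff_right sum_subtractf scaleR_sum_left[symmetric])
  also have "norm \<dots> \<le> (\<Sum>a\<in>verts K. norm (bary K a x *\<^sub>R (m - g a)))" by (rule norm_sum)
  also have "\<dots> \<le> (\<Sum>a\<in>verts K. norm (m - g a))"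
    by (rule sum_mono) (use b0 b1 in \<open>auto intro: mult_left_le_one_le\<close>)
  finally show ?thesis .
qed

lemma elem_sq_le:
  fixes f :: "real^'d \<Rightarrow> real^'d"
  assumes K: "K \<in> \<T>" and f: "\<And>x. x \<in> interior K \<Longrightarrow> f x = g x" "continuous_on K g" and b: "\<And>x. x \<in> K \<Longrightarrow> norm (g x) \<le> c"
  shows "L2_inner K f f \<le> measure lebesgue K * c\<^sup>2"
proof -
  have "L2_inner K f f = (LINT x:K|lebesgue. g x \<bullet> g x)"
    unfolding L2_inner_def by (rule elem_integral(2)[OF simplex[OF K]]) (use f in \<open>auto intro!: continuous_intros\<close>)
  also have "\<dots> \<le> (LINT x:K|lebesgue. c\<^sup>2)"
  proof (rule set_integral_mono)
    show "set_integrable lebesgue K (\<lambda>x. g x \<bullet> g x)"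
      by (rule elem_integral(1)[OF simplex[OF K], of _ "\<lambda>x. g x \<bullet> g x"]) (use f in \<open>auto intro!: continuous_intros\<close>)
    show "set_integrable lebesgue K (\<lambda>x. c\<^sup>2)"
      by (rule elem_integral(1)[OF simplex[OF K], of _ "\<lambda>x. c\<^sup>2"]) auto
    fix x assume "x \<in> K"
    then have "(norm (g x))\<^sup>2 \<le> c\<^sup>2" using b by (intro power_mono) auto
    then show "g x \<bullet> g x \<le> c\<^sup>2" by (simp add: power2_norm_eq_inner)
  qed
  finally show ?thesis by (simp add: elem_const_integral[OF K])
qed

lemma pw_interp_distance:
  "L2_inner \<Omega> (\<lambda>x. pw m x - interp g x) (\<lambda>x. pw m x - interp g x)
    \<le> (\<Sum>K\<in>\<T>. measure lebesgue K * (\<Sum>a\<in>verts K. norm (m K - g a))\<^sup>2)"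
proof -
  have pc: "piecewise_continuous (\<lambda>x. pw m x - interp g x)"
    by (rule piecewise_continuous_comb[OF X0_piecewise_continuous[OF pw_X0] V_piecewise_continuous[OF interp_V]])
      (rule continuous_on_diff)
  have "L2_inner K (\<lambda>x. pw m x - interp g x) (\<lambda>x. pw m x - interp g x)
      \<le> measure lebesgue K * (\<Sum>a\<in>verts K. norm (m K - g a))\<^sup>2" if K: "K \<in> \<T>" for K
    by (rule elem_sq_le[OF K, of _ "\<lambda>x. m K - interp g x"])
      (use pw_eq[OF K] interp_error[OF K] V_continuous_elem[OF interp_V K] in \<open>auto intro!: continuous_intros\<close>)
  then show ?thesis unfolding L2_inner_elements[OF pc pc] by (rule sum_mono)
qed

text \<open>A function that is orthogonal to the piecewise constants sees a piecewise constant only through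
  its distance to the continuous space.\<close>

lemma orthogonality_estimate:
  assumes Y: "Y \<in> L2_space \<Omega>" and v: "v \<in> V" and z: "z \<in> X0" and w: "w \<in> V"
    and orth: "\<And>z. z \<in> X0 \<Longrightarrow> L2_inner \<Omega> Y z = 0" and proj: "\<And>w. w \<in> V \<Longrightarrow> L2_inner \<Omega> v w = L2_inner \<Omega> Y w"
  shows "(L2_inner \<Omega> z v)\<^sup>2 \<le> L2_inner \<Omega> (\<lambda>x. z x - w x) (\<lambda>x. z x - w x) * L2_inner \<Omega> Y Y"
proof -
  note L = V_L2[OF v] X0_L2[OF z] V_L2[OF w] Y
  have vY: "L2_inner \<Omega> v Y = L2_inner \<Omega> v v" using proj[OF v] L2.sym[OF L(1) L(4)] by simp
  have zv: "L2_inner \<Omega> z v = L2_inner \<Omega> (\<lambda>x. z x - w x) (\<lambda>x. v x - Y x)"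
    using orth[OF z] proj[OF w] L2.sym[OF L(2,4)] L2.sym[OF L(3,4)] L2.sym[OF L(3,1)] L
    by (simp add: L2.diff_left L2.diff_right L2.diff_closed)
  have "L2_inner \<Omega> (\<lambda>x. v x - Y x) (\<lambda>x. v x - Y x) = L2_inner \<Omega> Y Y - L2_inner \<Omega> v v"
    using vY L2.sym[OF L(1,4)] L by (simp add: L2.diff_left L2.diff_right L2.diff_closed)
  then have "L2_inner \<Omega> (\<lambda>x. v x - Y x) (\<lambda>x. v x - Y x) \<le> L2_inner \<Omega> Y Y" using L2.nonneg[OF L(1)] by simp
  moreover have "(L2_inner \<Omega> z v)\<^sup>2 \<le> L2_inner \<Omega> (\<lambda>x. z x - w x) (\<lambda>x. z x - w x) * L2_inner \<Omega> (\<lambda>x. v x - Y x) (\<lambda>x. v x - Y x)"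
    unfolding zv by (rule L2.cauchy_schwarz) (intro L2.diff_closed L)+
  ultimately show ?thesis
    using mult_left_mono[OF _ L2.nonneg[OF L2.diff_closed[OF L(2,3)]]] by (meson order.trans)
qed

text \<open>A projection does not increase the norm.\<close>

lemma projection_le:
  assumes Y: "Y \<in> L2_space \<Omega>" and v: "v \<in> V" and proj: "\<And>w. w \<in> V \<Longrightarrow> L2_inner \<Omega> v w = L2_inner \<Omega> Y w"
  shows "L2_inner \<Omega> v v \<le> L2_inner \<Omega> Y Y"
proof -
  note L = V_L2[OF v] Y
  have "0 \<le> L2_inner \<Omega> (\<lambda>x. v x - Y x) (\<lambda>x. v x - Y x)" by (rule L2.nonneg[OF L2.diff_closed[OF L]])
  also have "\<dots> = L2_inner \<Omega> Y Y - L2_inner \<Omega> v v"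
    using proj[OF v] L2.sym[OF L] L by (simp add: L2.diff_left L2.diff_right L2.diff_closed)
  finally show ?thesis by simp
qed

section \<open>Jumps control differences around a node\<close>

text \<open>The elements around \<open>x\<close> overlap only in null sets, all lie in the ball of radius \<open>h\<close> about \<open>x\<close>, and
  each contains a ball of radius \<open>h / \<rho>\<close>.\<close>

lemma card_star: "real (card {K\<in>\<T>. x \<in> K}) \<le> \<rho> ^ n"
proof -
  define S where "S = {K\<in>\<T>. x \<in> K}"
  have fin: "finite S" using finite_mesh by (simp add: S_def)
  have lm: "K \<in> lmeasurable" if "K \<in> S" for K
    using that lmeasurable_compact[OF full_simplex_compact[OF simplex]] by (simp add: S_def)
  have "pairwise (\<lambda>K K'. negligible (K \<inter> K')) S"
  proof (rule pairwiseI)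
    fix K K' assume K: "K \<in> S" "K' \<in> S" "K \<noteq> K'"
    then have "K \<inter> K' \<subseteq> frontier K"
      using eq_if_interior_meets[of K K'] closure_subset[of K] by (fastforce simp: S_def frontier_def)
    then show "negligible (K \<inter> K')"
      using negligible_convex_frontier[OF full_simplex_convex[OF simplex]] K(1) negligible_subset by (auto simp: S_def)
  qed
  then have "measure lebesgue (\<Union>S) = (\<Sum>K\<in>S. measure lebesgue K)"
    by (rule measure_negligible_finite_Union[OF fin, rotated]) (rule lm)
  moreover have "measure lebesgue (\<Union>S) \<le> measure lebesgue (cball x h)"
  proof (rule measure_mono_fmeasurable)
    show "\<Union>S \<subseteq> cball x h" using dist_le by (auto simp: S_def)
    show "\<Union>S \<in> sets lebesgue" using fin lm by (intro sets.finite_Union) (auto dest: fmeasurableD)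
  qed simp
  moreover have "measure lebesgue (cball x h) = \<omega> * h ^ n" using content_cball[of h x] h_pos by simp
  ultimately have "(\<Sum>K\<in>S. measure lebesgue K) \<le> \<omega> * h ^ n" by simp
  moreover have "real (card S) * h ^ n \<le> c4 * (\<Sum>K\<in>S. measure lebesgue K)"
    using sum_mono[of S "\<lambda>K. h ^ n" "\<lambda>K. c4 * measure lebesgue K"] measure_elem_ge
    by (simp add: sum_distrib_left S_def)
  ultimately have "real (card S) * h ^ n \<le> c4 * (\<omega> * h ^ n)"
    using c_pos(4) by (meson mult_left_mono less_imp_le order.trans)
  also have "\<dots> = \<rho> ^ n * h ^ n" using ball_vol_nz by (simp add: c4_def)
  finally show ?thesis using h_pos by (simp add: S_def)
qed

lemma inter_facet:
  assumes "K \<in> \<T>" "K' \<in> \<T>" "K \<inter> K' \<in> interior_faces \<T>"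
  shows "K \<inter> K' facet_of K"
proof -
  obtain L where L: "L \<in> \<T>" "K \<inter> K' facet_of L" using assms(3) interior_face_iff by blast
  then have "K \<inter> K' \<noteq> {}" "aff_dim (K \<inter> K') = int CARD('d) - 1"
    using aff_dim_simplex[OF simplex[OF L(1)]] by (auto simp: facet_of_def)
  then show ?thesis using face_inter[OF assms(1,2)] aff_dim_simplex[OF simplex[OF assms(1)]] by (simp add: facet_of_def)
qed

definition jump_sq :: "((real^'d) set \<Rightarrow> 'b::real_normed_vector) \<Rightarrow> (real^'d) set \<Rightarrow> real" where
  "jump_sq G F = (norm (G (fst (sides \<T> F)) - G (snd (sides \<T> F))))\<^sup>2"

text \<open>The squared jumps over all faces through the point \<open>x\<close>.\<close>

definition star_jumps :: "((real^'d) set \<Rightarrow> 'b::real_normed_vector) \<Rightarrow> real^'d \<Rightarrow> real" where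
  "star_jumps G x = (\<Sum>F\<in>{F\<in>interior_faces \<T>. x \<in> F}. jump_sq G F)"

lemma star_jumps_nonneg: "0 \<le> star_jumps G x"
  unfolding star_jumps_def jump_sq_def by (rule sum_nonneg) simp

lemma adjacent_difference:
  assumes "(K, K') \<in> adjacent_at x"
  shows "norm (G K - G K') \<le> sqrt (star_jumps G x)"
proof -
  define F where "F = K \<inter> K'"
  have K: "K \<in> \<T>" "K' \<in> \<T>" "K \<noteq> K'" "x \<in> F" "F \<in> interior_faces \<T>"
    using assms by (auto simp: adjacent_at_def F_def)
  have "F facet_of K" "F facet_of K'" using inter_facet[of K K'] inter_facet[of K' K] K by (auto simp: F_def Int_commute)
  then have "(K = fst (sides \<T> F) \<and> K' = snd (sides \<T> F)) \<or> (K' = fst (sides \<T> F) \<and> K = snd (sides \<T> F))"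
    using sides_cover[OF K(5)] K(1-3) by metis
  then have "(norm (G K - G K'))\<^sup>2 = jump_sq G F" unfolding jump_sq_def by (auto simp: norm_minus_commute)
  also have "\<dots> \<le> star_jumps G x"
    unfolding star_jumps_def
    by (rule member_le_sum[of F "{F\<in>interior_faces \<T>. x \<in> F}" "jump_sq G"])
      (use K finite_faces in \<open>auto simp: jump_sq_def\<close>)
  finally show ?thesis by (rule real_le_rsqrt)
qed

lemma chain_difference:
  "(K, K') \<in> adjacent_at x ^^ m \<Longrightarrow> norm (G K - G K') \<le> real m * sqrt (star_jumps G x)"
proof (induction m arbitrary: K')
  case (Suc m)
  then obtain L where L: "(K, L) \<in> adjacent_at x ^^ m" "(L, K') \<in> adjacent_at x" by auto
  have "norm (G K - G K') \<le> norm (G K - G L) + norm (G L - G K')" by (metis norm_diff_triangle_le order_refl)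
  also have "\<dots> \<le> real m * sqrt (star_jumps G x) + sqrt (star_jumps G x)"
    by (intro add_mono Suc.IH[OF L(1)] adjacent_difference[OF L(2)])
  finally show ?case by (simp add: distrib_right)
qed simp

text \<open>A chain of neighbours joins the two elements; it can be chosen no longer than the number of pairs of
  elements around \<open>x\<close>, which is at most \<open>\<rho> ^ (2 * n)\<close>.\<close>

lemma star_difference:
  assumes K: "K \<in> \<T>" "x \<in> K" and K': "K' \<in> \<T>" "x \<in> K'"
  shows "(norm (G K - G K'))\<^sup>2 \<le> \<rho> ^ (4 * n) * star_jumps G x"
proof -
  define S where "S = {K\<in>\<T>. x \<in> K}"
  have fS: "finite S" using finite_mesh by (simp add: S_def)
  have sub: "adjacent_at x \<subseteq> S \<times> S" by (auto simp: adjacent_at_def S_def)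
  then have fin: "finite (adjacent_at x)" using fS finite_subset by blast
  have "card (adjacent_at x) \<le> card S * card S" using card_mono[OF _ sub] fS by (simp add: card_cartesian_product)
  then have "real (card (adjacent_at x)) \<le> real (card S) * real (card S)" by (metis of_nat_le_iff of_nat_mult)
  also have "\<dots> \<le> \<rho> ^ n * \<rho> ^ n" using card_star[of x] by (intro mult_mono) (auto simp: S_def \<rho>_pos less_imp_le)
  finally have c: "real (card (adjacent_at x)) \<le> \<rho> ^ (2 * n)" by (simp add: mult_2 power_add)
  obtain m where m: "m \<le> card (adjacent_at x)" "(K, K') \<in> adjacent_at x ^^ m"
    using star_connected[OF K K'] unfolding rtrancl_finite_eq_relpow[OF fin] by blast
  have "norm (G K - G K') \<le> real m * sqrt (star_jumps G x)" by (rule chain_difference[OF m(2)])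
  also have "\<dots> \<le> \<rho> ^ (2 * n) * sqrt (star_jumps G x)"
    using m(1) c star_jumps_nonneg[of G x] by (intro mult_right_mono) auto
  finally have "(norm (G K - G K'))\<^sup>2 \<le> (\<rho> ^ (2 * n) * sqrt (star_jumps G x))\<^sup>2" by (intro power_mono) auto
  also have "\<dots> = \<rho> ^ (4 * n) * star_jumps G x"
    using star_jumps_nonneg[of G x] by (simp add: power_mult_distrib power_mult[symmetric] mult.commute)
  finally show ?thesis .
qed

text \<open>One element at each node whose value is taken as nodal value; averaging over all elements at the
  node, the usual Oswald operator, would serve as well.\<close>

definition node_elem :: "real^'d \<Rightarrow> (real^'d) set" where
  "node_elem a = (SOME K. K \<in> \<T> \<and> a \<in> K)"

lemma node_elem: "K \<in> \<T> \<Longrightarrow> a \<in> K \<Longrightarrow> node_elem a \<in> \<T> \<and> a \<in> node_elem a"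
  unfolding node_elem_def by (rule someI[of _ K]) simp

text \<open>Each face is counted once for every pair of a vertex of the face and an element at that vertex.\<close>

lemma sum_star_jumps:
  "(\<Sum>K\<in>\<T>. \<Sum>a\<in>verts K. star_jumps G a) \<le> (real n + 1) * \<rho> ^ n * (\<Sum>F\<in>interior_faces \<T>. jump_sq G F)"
proof -
  define P where "P = Sigma \<T> verts"
  have fP: "finite P" unfolding P_def using finite_mesh verts_props(1)[OF simplex] by auto
  have "(\<Sum>K\<in>\<T>. \<Sum>a\<in>verts K. star_jumps G a) = (\<Sum>p\<in>P. star_jumps G (snd p))"
    unfolding P_def using finite_mesh verts_props(1)[OF simplex]
    by (subst sum.Sigma) (auto simp: split_beta)
  also have "\<dots> = (\<Sum>F\<in>interior_faces \<T>. \<Sum>p\<in>{p\<in>P. snd p \<in> F}. jump_sq G F)"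
    unfolding star_jumps_def by (rule sum.swap_restrict[OF fP finite_faces(2)])
  also have "\<dots> = (\<Sum>F\<in>interior_faces \<T>. real (card {p\<in>P. snd p \<in> F}) * jump_sq G F)" by simp
  also have "\<dots> \<le> (\<Sum>F\<in>interior_faces \<T>. ((real n + 1) * \<rho> ^ n) * jump_sq G F)"
  proof (intro sum_mono mult_right_mono)
    fix F assume F: "F \<in> interior_faces \<T>"
    define L where "L = fst (sides \<T> F)"
    have L: "L \<in> \<T>" "F \<subseteq> L" using sides_props[OF F] facet_of_imp_subset by (auto simp: L_def)
    have sub: "{p\<in>P. snd p \<in> F} \<subseteq> (\<lambda>(a, K). (K, a)) ` Sigma (verts L) (\<lambda>a. {K\<in>\<T>. a \<in> K})"
    proof
      fix p assume p: "p \<in> {p\<in>P. snd p \<in> F}"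
      obtain K a where Ka: "p = (K, a)" "K \<in> \<T>" "a \<in> verts K" "a \<in> F" using p by (auto simp: P_def)
      have "a \<in> verts L"
        by (rule bary_common_face(3)[OF simplex[OF Ka(2)] simplex[OF L(1)] face_inter[OF Ka(2) L(1)] face_inter'[OF Ka(2) L(1)], of a])
          (use Ka L verts_subset in auto)
      then show "p \<in> (\<lambda>(a, K). (K, a)) ` Sigma (verts L) (\<lambda>a. {K\<in>\<T>. a \<in> K})"
        using Ka verts_subset by (auto simp: image_iff)
    qed
    have fin: "finite (Sigma (verts L) (\<lambda>a. {K\<in>\<T>. a \<in> K}))"
      using verts_props(1)[OF simplex[OF L(1)]] finite_mesh by auto
    have "card {p\<in>P. snd p \<in> F} \<le> card (Sigma (verts L) (\<lambda>a. {K\<in>\<T>. a \<in> K}))"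
      using card_mono[OF finite_imageI[OF fin] sub] card_image_le[OF fin, of "\<lambda>(a, K). (K, a)"] by linarith
    also have "\<dots> = (\<Sum>a\<in>verts L. card {K\<in>\<T>. a \<in> K})"
      using verts_props(1)[OF simplex[OF L(1)]] finite_mesh by (subst card_SigmaI) auto
    finally have "real (card {p\<in>P. snd p \<in> F}) \<le> (\<Sum>a\<in>verts L. real (card {K\<in>\<T>. a \<in> K}))"
      unfolding of_nat_sum[symmetric] of_nat_le_iff .
    also have "\<dots> \<le> (\<Sum>a\<in>verts L. \<rho> ^ n)" by (rule sum_mono) (rule card_star)
    also have "\<dots> = (real n + 1) * \<rho> ^ n" using verts_props(2)[OF simplex[OF L(1)]] by simp
    finally show "real (card {p\<in>P. snd p \<in> F}) \<le> (real n + 1) * \<rho> ^ n" .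
  qed (simp add: jump_sq_def)
  finally show ?thesis by (simp add: sum_distrib_left)
qed

definition "cO = \<omega> * (real n + 1) * \<rho> ^ (4 * n) * ((real n + 1) * \<rho> ^ n) * c4"

lemma cO_nonneg: "0 \<le> cO"
  using ball_vol_pos \<rho>_pos c_pos by (simp add: cO_def)

text \<open>The distance of a piecewise constant function to its nodal average, by \<open>star_difference\<close> at each
  node; the factor \<open>h\<close> is the ratio of volume to area.\<close>

lemma oswald:
  fixes G :: "(real^'d) set \<Rightarrow> 'b::real_normed_vector"
  shows "(\<Sum>K\<in>\<T>. measure lebesgue K * (\<Sum>a\<in>verts K. norm (G K - G (node_elem a)))\<^sup>2)
    \<le> cO * h * (\<Sum>F\<in>interior_faces \<T>. area F * jump_sq G F)"
proof -
  let ?c = "\<omega> * (real n + 1) * \<rho> ^ (4 * n)"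
  have c0: "0 \<le> ?c" using ball_vol_pos \<rho>_pos by simp
  have "(\<Sum>K\<in>\<T>. measure lebesgue K * (\<Sum>a\<in>verts K. norm (G K - G (node_elem a)))\<^sup>2)
      \<le> (\<Sum>K\<in>\<T>. ?c * h ^ n * (\<Sum>a\<in>verts K. star_jumps G a))"
  proof (rule sum_mono)
    fix K assume K: "K \<in> \<T>"
    note S = simplex[OF K]
    have "(\<Sum>a\<in>verts K. norm (G K - G (node_elem a)))\<^sup>2 \<le> (\<Sum>a\<in>verts K. (norm (G K - G (node_elem a)))\<^sup>2) * card (verts K)"
      by (rule sum_squared_le_sum_of_squares)
    also have "\<dots> = (real n + 1) * (\<Sum>a\<in>verts K. (norm (G K - G (node_elem a)))\<^sup>2)"
      using verts_props(2)[OF S] by simp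
    also have "\<dots> \<le> (real n + 1) * (\<Sum>a\<in>verts K. \<rho> ^ (4 * n) * star_jumps G a)"
    proof (intro mult_left_mono sum_mono)
      fix a assume a: "a \<in> verts K"
      then have "a \<in> K" using verts_subset by blast
      then show "(norm (G K - G (node_elem a)))\<^sup>2 \<le> \<rho> ^ (4 * n) * star_jumps G a"
        using node_elem[OF K] star_difference[OF K] by blast
    qed simp
    finally have "(\<Sum>a\<in>verts K. norm (G K - G (node_elem a)))\<^sup>2 \<le> (real n + 1) * (\<Sum>a\<in>verts K. \<rho> ^ (4 * n) * star_jumps G a)" .
    then have "measure lebesgue K * (\<Sum>a\<in>verts K. norm (G K - G (node_elem a)))\<^sup>2
        \<le> (\<omega> * h ^ n) * ((real n + 1) * (\<Sum>a\<in>verts K. \<rho> ^ (4 * n) * star_jumps G a))"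
      using measure_elem_le[OF K] ball_vol_pos h_pos by (intro mult_mono) auto
    then show "measure lebesgue K * (\<Sum>a\<in>verts K. norm (G K - G (node_elem a)))\<^sup>2 \<le> ?c * h ^ n * (\<Sum>a\<in>verts K. star_jumps G a)"
      unfolding sum_distrib_left[symmetric] by (simp add: mult_ac)
  qed
  also have "\<dots> = ?c * h ^ n * (\<Sum>K\<in>\<T>. \<Sum>a\<in>verts K. star_jumps G a)" by (simp add: sum_distrib_left)
  also have "\<dots> \<le> ?c * h ^ n * ((real n + 1) * \<rho> ^ n * (\<Sum>F\<in>interior_faces \<T>. jump_sq G F))"
    using c0 h_pos by (intro mult_left_mono sum_star_jumps) auto
  also have "\<dots> = ?c * ((real n + 1) * \<rho> ^ n) * (\<Sum>F\<in>interior_faces \<T>. h ^ n * jump_sq G F)"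
    by (simp add: sum_distrib_left mult_ac)
  also have "\<dots> \<le> ?c * ((real n + 1) * \<rho> ^ n) * (\<Sum>F\<in>interior_faces \<T>. c4 * (h * area F) * jump_sq G F)"
  proof (intro mult_left_mono sum_mono mult_right_mono)
    fix F assume "F \<in> interior_faces \<T>"
    then obtain K where "K \<in> \<T>" "F facet_of K" using interior_face_iff by blast
    then show "h ^ n \<le> c4 * (h * area F)" by (rule area_ge)
  qed (use c0 \<rho>_pos in \<open>auto simp: jump_sq_def\<close>)
  also have "\<dots> = cO * h * (\<Sum>F\<in>interior_faces \<T>. area F * jump_sq G F)"
    by (simp add: cO_def sum_distrib_left mult_ac)
  finally show ?thesis .
qed

section \<open>Pressure and convection terms\<close>

text \<open>The gradient of the pressure is constant on each element, so its jumps leave the face integrals.\<close>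

lemma s_p_eq:
  assumes q: "q \<in> W_space 1 \<Omega> \<T>"
  shows "s_p \<gamma>\<^sub>p \<mu> B \<T> q q = \<gamma>\<^sub>p * min 1 (inverse (reynolds \<mu> B \<T>)) * h ^ 3 / \<mu> *
    (\<Sum>F\<in>interior_faces \<T>. area F * jump_sq (\<lambda>K. elem_grad K q) F)"
proof -
  have "face_integral F (\<lambda>x. jump \<T> F (grad q) x \<bullet> jump \<T> F (grad q) x) = area F * jump_sq (\<lambda>K. elem_grad K q) F"
    if F: "F \<in> interior_faces \<T>" for F
  proof -
    have "face_integral F (\<lambda>x. jump \<T> F (grad q) x \<bullet> jump \<T> F (grad q) x) = face_integral F (\<lambda>x. jump_sq (\<lambda>K. elem_grad K q) F)"
      by (rule face_integral_cong[OF flat_interior[OF F]])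
        (simp add: jump_grad[OF q F] jump_sq_def power2_norm_eq_inner del: One_nat_def)
    then show ?thesis by (simp add: face_integral_const)
  qed
  then show ?thesis by (simp add: s_p_def Let_def)
qed

text \<open>The pressure gradient is piecewise constant, so \<open>orthogonality_estimate\<close> leaves its distance to the
  continuous space, and \<open>oswald\<close> bounds that distance by the jumps.\<close>

lemma pressure_estimate:
  assumes q: "q \<in> W_space 1 \<Omega> \<T>" and Y: "Y \<in> L2_space \<Omega>" and v: "v \<in> V"
    and orth: "\<And>z. z \<in> X0 \<Longrightarrow> L2_inner \<Omega> Y z = 0" and proj: "\<And>w. w \<in> V \<Longrightarrow> L2_inner \<Omega> v w = L2_inner \<Omega> Y w"
  shows "(L2_inner \<Omega> (G_op 1 \<Omega> \<T> q) v)\<^sup>2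
    \<le> cO * h * (\<Sum>F\<in>interior_faces \<T>. area F * jump_sq (\<lambda>K. elem_grad K q) F) * L2_inner \<Omega> Y Y"
proof -
  define m where "m = (\<lambda>K. elem_grad K q)"
  define g where "g = (\<lambda>a. m (node_elem a))"
  have "L2_inner K (pw m) v = (LINT x:K|lebesgue. elem_grad K q \<bullet> v x)" if K: "K \<in> \<T>" for K
    unfolding L2_inner_def
    by (rule elem_integral(2)[OF simplex[OF K]]) (use pw_eq[OF K] V_continuous_elem[OF v K] in \<open>auto intro!: continuous_intros simp: m_def\<close>)
  then have "L2_inner \<Omega> (G_op 1 \<Omega> \<T> q) v = L2_inner \<Omega> (pw m) v"
    unfolding G_op_props[OF q v] L2_inner_elements[OF X0_piecewise_continuous[OF pw_X0] V_piecewise_continuous[OF v]] by simp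
  then have "(L2_inner \<Omega> (G_op 1 \<Omega> \<T> q) v)\<^sup>2
      \<le> L2_inner \<Omega> (\<lambda>x. pw m x - interp g x) (\<lambda>x. pw m x - interp g x) * L2_inner \<Omega> Y Y"
    using orthogonality_estimate[OF Y v pw_X0 interp_V orth proj] by simp
  also have "\<dots> \<le> cO * h * (\<Sum>F\<in>interior_faces \<T>. area F * jump_sq m F) * L2_inner \<Omega> Y Y"
    by (intro mult_right_mono order.trans[OF pw_interp_distance] L2.nonneg[OF Y])
      (unfold g_def, rule oswald)
  finally show ?thesis by (simp add: m_def)
qed

text \<open>Factors of the stabilization and of the mass in \<open>convection_estimate\<close>.\<close>

definition "k1 \<gamma>\<^sub>u \<epsilon> = 6 * (cO * \<rho>\<^sup>2 / (4 * \<epsilon> * \<gamma>\<^sub>u)) + 3 * cS \<gamma>\<^sub>u \<epsilon>"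
definition "k2 = 6 * ((real n + 1)\<^sup>2 * (\<omega> * c1)) + 3 * (\<omega> * c1)"

lemma sum_jac_le:
  assumes u: "u \<in> V"
  shows "(\<Sum>K\<in>\<T>. measure lebesgue K * (h * norm (elem_jac K u))\<^sup>2) \<le> \<omega> * c1 * L2_inner \<Omega> u u"
  unfolding total_L2[OF u, symmetric] sum_distrib_left
proof (rule sum_mono)
  fix K assume K: "K \<in> \<T>"
  have "measure lebesgue K * (h * norm (elem_jac K u))\<^sup>2 \<le> (\<omega> * h ^ n) * (h * norm (elem_jac K u))\<^sup>2"
    by (intro mult_right_mono measure_elem_le[OF K]) simp
  also have "\<dots> = \<omega> * (h ^ (n + 2) * (norm (elem_jac K u))\<^sup>2)"
    by (simp add: power_add power_mult_distrib power2_eq_square[of h])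
  also have "\<dots> \<le> \<omega> * (c1 * L2_inner K u u)"
    using inverse_jac[OF u K] ball_vol_pos by (intro mult_left_mono) auto
  finally show "measure lebesgue K * (h * norm (elem_jac K u))\<^sup>2 \<le> \<omega> * c1 * L2_inner K u u" by simp
qed

text \<open>The field is frozen at one vertex of each element; the remainder is of first order in the mesh
  size, which the inverse inequality absorbs. The frozen part is piecewise constant, and its nodal
  average uses the values of the field at the nodes.\<close>

lemma convection_estimate:
  assumes u: "u \<in> V" and Y: "Y \<in> L2_space \<Omega>" and v: "v \<in> V"
    and orth: "\<And>z. z \<in> X0 \<Longrightarrow> L2_inner \<Omega> Y z = 0" and proj: "\<And>w. w \<in> V \<Longrightarrow> L2_inner \<Omega> v w = L2_inner \<Omega> Y w"
    and b: "continuous_on (closure \<Omega>) b" "\<And>x. x \<in> closure \<Omega> \<Longrightarrow> norm (b x) \<le> B"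
    and lip: "\<And>K x y. K \<in> \<T> \<Longrightarrow> x \<in> K \<Longrightarrow> y \<in> K \<Longrightarrow> norm (b x - b y) \<le> L * norm (x - y)" and L: "0 \<le> L"
    and p: "0 < \<gamma>\<^sub>u" "0 < \<epsilon>" "0 < B"
  shows "(L2_inner \<Omega> (C_op 1 \<gamma>\<^sub>u \<epsilon> B b \<Omega> \<T> u) v)\<^sup>2
    \<le> (k1 \<gamma>\<^sub>u \<epsilon> * (B / h) * s_u \<gamma>\<^sub>u \<epsilon> B b \<Omega> \<T> u u + k2 * L\<^sup>2 * L2_inner \<Omega> u u) * L2_inner \<Omega> Y Y"
proof -
  let ?U = "L2_inner \<Omega> u u" and ?YY = "L2_inner \<Omega> Y Y" and ?S = "s_u \<gamma>\<^sub>u \<epsilon> B b \<Omega> \<T> u u"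
  let ?M = "\<lambda>K. elem_jac K u"
  interpret S: psd_form V "s_u \<gamma>\<^sub>u \<epsilon> B b \<Omega> \<T>" by (rule psd_form_s_u) (use p in auto)
  have YY: "0 \<le> ?YY" by (rule L2.nonneg[OF Y])
  have U0: "0 \<le> ?U" by (rule L2.nonneg[OF V_L2[OF u]])
  have vY: "L2_inner \<Omega> v v \<le> ?YY" by (rule projection_le[OF Y v proj])
  define pt where "pt = (\<lambda>K :: (real^'d) set. SOME a. a \<in> verts K)"
  have pt: "pt K \<in> K" if K: "K \<in> \<T>" for K
  proof -
    obtain a where "a \<in> verts K"
      using verts_props(2)[OF simplex[OF K]] by (metis Suc_neq_Zero add_Suc_right card.empty equals0I One_nat_def)
    then have "pt K \<in> verts K" unfolding pt_def by (rule someI)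
    then show ?thesis using verts_subset by blast
  qed
  \<comment> \<open>The frozen convection term; its nodal values \<open>g\<close> use the field at the node itself, which is the same
    for all elements there, so that only the jumps of the Jacobian remain. The rest is \<open>zz\<close>.\<close>
  define m where "m = (\<lambda>K. ?M K *v b (pt K))"
  define g where "g = (\<lambda>a. ?M (node_elem a) *v b a)"
  define zz where "zz = (\<lambda>x. jac u x *v b x - pw m x)"
  have cb: "continuous_on K b" if "K \<in> \<T>" for K by (rule continuous_on_subset[OF b(1) subset_closure[OF that]])
  have cM: "continuous_on K (\<lambda>x. ?M K *v b x)" if "K \<in> \<T>" for K
    by (intro matrix_vector_mult_linear_continuous_on[THEN continuous_on_compose2] cb[OF that]) auto
  have zzK: "zz x = ?M K *v (b x - b (pt K))" if "K \<in> \<T>" "x \<in> interior K" for K x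
    using V_jac[OF u that] pw_eq[OF that] by (simp add: zz_def m_def matrix_vector_mult_diff_distrib)
  have czz: "continuous_on K (\<lambda>x. ?M K *v (b x - b (pt K)))" if "K \<in> \<T>" for K
    unfolding matrix_vector_mult_diff_distrib by (intro continuous_intros cM that)
  have pczz: "piecewise_continuous zz" unfolding piecewise_continuous_def using zzK czz by blast
  have pcm: "piecewise_continuous (pw m)" by (rule X0_piecewise_continuous[OF pw_X0])
  have split: "(\<Sum>K\<in>\<T>. LINT x:K|lebesgue. (?M K *v b x) \<bullet> v x) = L2_inner \<Omega> (pw m) v + L2_inner \<Omega> zz v"
    unfolding L2_inner_elements[OF pcm V_piecewise_continuous[OF v]] L2_inner_elements[OF pczz V_piecewise_continuous[OF v]]
      sum.distrib[symmetric]
  proof (rule sum.cong[OF refl])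
    fix K assume K: "K \<in> \<T>"
    have "(LINT x:K|lebesgue. (?M K *v b x) \<bullet> v x) = (LINT x:K|lebesgue. pw m x \<bullet> v x + zz x \<bullet> v x)"
      by (rule elem_integral(2)[OF simplex[OF K], symmetric])
        (use zzK[OF K] pw_eq[OF K] cM[OF K] V_continuous_elem[OF v K] in
          \<open>auto intro!: continuous_intros simp: m_def inner_add_left[symmetric] matrix_vector_mult_diff_distrib\<close>)
    then show "(LINT x:K|lebesgue. (?M K *v b x) \<bullet> v x) = L2_inner K (pw m) v + L2_inner K zz v"
      unfolding L2_inner_def
      using set_integral_add(2)[OF piecewise_continuous_integrable[OF piecewise_continuous_inner[OF pcm V_piecewise_continuous[OF v]] K]
          piecewise_continuous_integrable[OF piecewise_continuous_inner[OF pczz V_piecewise_continuous[OF v]] K]] by simp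
  qed
  have lip_h: "norm (b x - b y) \<le> L * h" if "K \<in> \<T>" "x \<in> K" "y \<in> K" for K x y
    using order.trans[OF lip[OF that] mult_left_mono[OF dist_le[OF that, unfolded dist_norm] L]] .
  have zzb: "L2_inner \<Omega> zz zz \<le> L\<^sup>2 * (\<omega> * c1 * ?U)"
  proof -
    have "L2_inner K zz zz \<le> measure lebesgue K * (norm (?M K) * (L * h))\<^sup>2" if K: "K \<in> \<T>" for K
    proof (rule elem_sq_le[OF K zzK[OF K] czz[OF K]])
      fix x assume x: "x \<in> K"
      have "norm (?M K *v (b x - b (pt K))) \<le> norm (?M K) * norm (b x - b (pt K))" by (rule norm_matrix_vector_le)
      also have "\<dots> \<le> norm (?M K) * (L * h)" using lip_h[OF K x pt[OF K]] by (intro mult_left_mono) auto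
      finally show "norm (?M K *v (b x - b (pt K))) \<le> norm (?M K) * (L * h)" .
    qed
    then have "L2_inner \<Omega> zz zz \<le> (\<Sum>K\<in>\<T>. L\<^sup>2 * (measure lebesgue K * (h * norm (?M K))\<^sup>2))"
      unfolding L2_inner_elements[OF pczz pczz] by (intro sum_mono) (fastforce simp: power_mult_distrib mult_ac)
    also have "\<dots> \<le> L\<^sup>2 * (\<omega> * c1 * ?U)"
      unfolding sum_distrib_left[symmetric] by (intro mult_left_mono sum_jac_le[OF u]) simp
    finally show ?thesis .
  qed
  have 2: "(L2_inner \<Omega> zz v)\<^sup>2 \<le> L\<^sup>2 * (\<omega> * c1 * ?U) * ?YY"
  proof -
    have "(L2_inner \<Omega> zz v)\<^sup>2 \<le> L2_inner \<Omega> zz zz * L2_inner \<Omega> v v"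
      by (rule L2.cauchy_schwarz[OF piecewise_continuous_L2[OF pczz] V_L2[OF v]])
    also have "\<dots> \<le> L\<^sup>2 * (\<omega> * c1 * ?U) * ?YY"
      using zzb vY L2.nonneg[OF V_L2[OF v]] L2.nonneg[OF piecewise_continuous_L2[OF pczz]]
      by (intro mult_mono) (auto intro: order.trans)
    finally show ?thesis .
  qed
  let ?J = "\<Sum>F\<in>interior_faces \<T>. area F * jump_sq ?M F"
  have J: "B\<^sup>2 * (h * ?J) \<le> \<rho>\<^sup>2 / (4 * \<epsilon> * \<gamma>\<^sub>u) * (B / h) * ?S"
  proof -
    have "4 * h\<^sup>2 * (B * \<epsilon>) * ?J = (\<Sum>F\<in>interior_faces \<T>. (4 * h\<^sup>2 * (B * \<epsilon>) * area F) * jump_sq ?M F)"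
      by (simp add: sum_distrib_left mult_ac)
    also have "\<dots> \<le> (\<Sum>F\<in>interior_faces \<T>. (\<rho>\<^sup>2 * weight \<epsilon> B b F) * jump_sq ?M F)"
      using p by (intro sum_mono mult_right_mono weight_ge b(1)) (auto simp: jump_sq_def)
    also have "\<dots> = \<rho>\<^sup>2 * (\<Sum>F\<in>interior_faces \<T>. (jmp F u \<bullet> jmp F u) * weight \<epsilon> B b F)"
      by (simp add: sum_distrib_left jump_sq_def jmp_def power2_norm_eq_inner mult_ac)
    finally have 1: "4 * h\<^sup>2 * (B * \<epsilon>) * ?J \<le> \<rho>\<^sup>2 * (\<Sum>F\<in>interior_faces \<T>. (jmp F u \<bullet> jmp F u) * weight \<epsilon> B b F)" .
    have "0 \<le> (\<Sum>F\<in>boundary_faces \<Omega> \<T>. face_integral F (\<lambda>x. B * (u x \<bullet> bn F) * (u x \<bullet> bn F)))"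
      using p by (intro sum_nonneg face_integral_nonneg) (simp add: mult.assoc)
    then have "\<gamma>\<^sub>u * (\<Sum>F\<in>interior_faces \<T>. (jmp F u \<bullet> jmp F u) * weight \<epsilon> B b F) \<le> ?S"
      unfolding s_u_eq[OF u u] by simp
    then have "\<rho>\<^sup>2 * (\<gamma>\<^sub>u * (\<Sum>F\<in>interior_faces \<T>. (jmp F u \<bullet> jmp F u) * weight \<epsilon> B b F)) \<le> \<rho>\<^sup>2 * ?S"
      by (rule mult_left_mono) simp
    then have "\<gamma>\<^sub>u * (4 * h\<^sup>2 * (B * \<epsilon>) * ?J) \<le> \<rho>\<^sup>2 * ?S"
      using mult_left_mono[OF 1 less_imp_le[OF p(1)]] unfolding mult.left_commute[of "\<rho>\<^sup>2" \<gamma>\<^sub>u] by linarith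
    then have "B / (4 * \<epsilon> * \<gamma>\<^sub>u * h) * (\<gamma>\<^sub>u * (4 * h\<^sup>2 * (B * \<epsilon>) * ?J)) \<le> B / (4 * \<epsilon> * \<gamma>\<^sub>u * h) * (\<rho>\<^sup>2 * ?S)"
      using p h_pos by (intro mult_left_mono) auto
    moreover have "B / (4 * \<epsilon> * \<gamma>\<^sub>u * h) * (\<gamma>\<^sub>u * (4 * h\<^sup>2 * (B * \<epsilon>) * ?J)) = B\<^sup>2 * (h * ?J)"
      using p h_pos by (simp add: power2_eq_square field_simps)
    ultimately show ?thesis by (simp add: field_simps)
  qed
  have 1: "(L2_inner \<Omega> (pw m) v)\<^sup>2 \<le> (2 * (cO * \<rho>\<^sup>2 / (4 * \<epsilon> * \<gamma>\<^sub>u)) * (B / h) * ?S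
      + 2 * ((real n + 1)\<^sup>2 * (\<omega> * c1)) * L\<^sup>2 * ?U) * ?YY"
  proof -
    have "(L2_inner \<Omega> (pw m) v)\<^sup>2 \<le> L2_inner \<Omega> (\<lambda>x. pw m x - interp g x) (\<lambda>x. pw m x - interp g x) * ?YY"
      by (rule orthogonality_estimate[OF Y v pw_X0 interp_V orth proj])
    also have "\<dots> \<le> (\<Sum>K\<in>\<T>. measure lebesgue K * (\<Sum>a\<in>verts K. norm (m K - g a))\<^sup>2) * ?YY"
      by (rule mult_right_mono[OF pw_interp_distance YY])
    also have "(\<Sum>K\<in>\<T>. measure lebesgue K * (\<Sum>a\<in>verts K. norm (m K - g a))\<^sup>2)
        \<le> (\<Sum>K\<in>\<T>. 2 * B\<^sup>2 * (measure lebesgue K * (\<Sum>a\<in>verts K. norm (?M K - ?M (node_elem a)))\<^sup>2)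
            + 2 * (real n + 1)\<^sup>2 * L\<^sup>2 * (measure lebesgue K * (h * norm (?M K))\<^sup>2))"
    proof (rule sum_mono)
      fix K assume K: "K \<in> \<T>"
      let ?A = "\<Sum>a\<in>verts K. norm (?M K - ?M (node_elem a))"
      have "(\<Sum>a\<in>verts K. norm (m K - g a)) \<le> (\<Sum>a\<in>verts K. B * norm (?M K - ?M (node_elem a)) + L * (h * norm (?M K)))"
      proof (rule sum_mono)
        fix a assume "a \<in> verts K"
        then have a: "a \<in> K" using verts_subset by blast
        have "m K - g a = (?M K - ?M (node_elem a)) *v b a + ?M K *v (b (pt K) - b a)"
          by (simp add: m_def g_def matrix_vector_mult_diff_distrib matrix_vector_mult_diff_rdistrib)
        then have "norm (m K - g a) \<le> norm ((?M K - ?M (node_elem a)) *v b a) + norm (?M K *v (b (pt K) - b a))"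
          by (metis norm_triangle_ineq)
        also have "\<dots> \<le> norm (?M K - ?M (node_elem a)) * norm (b a) + norm (?M K) * norm (b (pt K) - b a)"
          by (intro add_mono norm_matrix_vector_le)
        also have "\<dots> \<le> norm (?M K - ?M (node_elem a)) * B + norm (?M K) * (L * h)"
          using b(2) a subset_closure[OF K] lip_h[OF K pt[OF K] a] by (intro add_mono mult_left_mono) auto
        finally show "norm (m K - g a) \<le> B * norm (?M K - ?M (node_elem a)) + L * (h * norm (?M K))" by (simp add: mult_ac)
      qed
      also have "\<dots> = B * ?A + (real n + 1) * (L * (h * norm (?M K)))"
        using verts_props(2)[OF simplex[OF K]] by (simp add: sum.distrib sum_distrib_left)
      finally have "(\<Sum>a\<in>verts K. norm (m K - g a))\<^sup>2 \<le> (B * ?A + (real n + 1) * (L * (h * norm (?M K))))\<^sup>2"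
        by (intro power_mono sum_nonneg) auto
      also have "\<dots> \<le> 2 * (B * ?A)\<^sup>2 + 2 * ((real n + 1) * (L * (h * norm (?M K))))\<^sup>2" by (rule sq_sum_le)
      also have "\<dots> = 2 * B\<^sup>2 * ?A\<^sup>2 + 2 * (real n + 1)\<^sup>2 * L\<^sup>2 * (h * norm (?M K))\<^sup>2" by (simp only: power_mult_distrib mult.assoc)
      finally have "measure lebesgue K * (\<Sum>a\<in>verts K. norm (m K - g a))\<^sup>2
          \<le> measure lebesgue K * (2 * B\<^sup>2 * ?A\<^sup>2 + 2 * (real n + 1)\<^sup>2 * L\<^sup>2 * (h * norm (?M K))\<^sup>2)"
        by (rule mult_left_mono) simp
      then show "measure lebesgue K * (\<Sum>a\<in>verts K. norm (m K - g a))\<^sup>2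
          \<le> 2 * B\<^sup>2 * (measure lebesgue K * ?A\<^sup>2) + 2 * (real n + 1)\<^sup>2 * L\<^sup>2 * (measure lebesgue K * (h * norm (?M K))\<^sup>2)"
        by (simp only: distrib_left mult.left_commute mult.assoc)
    qed
    also have "\<dots> = 2 * B\<^sup>2 * (\<Sum>K\<in>\<T>. measure lebesgue K * (\<Sum>a\<in>verts K. norm (?M K - ?M (node_elem a)))\<^sup>2)
        + 2 * (real n + 1)\<^sup>2 * L\<^sup>2 * (\<Sum>K\<in>\<T>. measure lebesgue K * (h * norm (?M K))\<^sup>2)"
      by (simp only: sum.distrib sum_distrib_left)
    also have "\<dots> \<le> 2 * B\<^sup>2 * (cO * h * ?J) + 2 * (real n + 1)\<^sup>2 * L\<^sup>2 * (\<omega> * c1 * ?U)"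
      by (intro add_mono mult_left_mono oswald sum_jac_le[OF u]) auto
    also have "\<dots> = 2 * cO * (B\<^sup>2 * (h * ?J)) + 2 * ((real n + 1)\<^sup>2 * (\<omega> * c1)) * L\<^sup>2 * ?U" by (simp only: mult_ac)
    also have "\<dots> \<le> 2 * cO * (\<rho>\<^sup>2 / (4 * \<epsilon> * \<gamma>\<^sub>u) * (B / h) * ?S) + 2 * ((real n + 1)\<^sup>2 * (\<omega> * c1)) * L\<^sup>2 * ?U"
      using J cO_nonneg by (intro add_right_mono mult_left_mono) auto
    also have "\<dots> = 2 * (cO * \<rho>\<^sup>2 / (4 * \<epsilon> * \<gamma>\<^sub>u)) * (B / h) * ?S + 2 * ((real n + 1)\<^sup>2 * (\<omega> * c1)) * L\<^sup>2 * ?U" by (simp add: mult_ac)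
    finally show ?thesis using YY by (simp add: mult_right_mono)
  qed
  have 3: "(s_u \<gamma>\<^sub>u \<epsilon> B b \<Omega> \<T> u v)\<^sup>2 \<le> cS \<gamma>\<^sub>u \<epsilon> * (B / h) * ?S * ?YY"
  proof -
    have cS0: "0 \<le> cS \<gamma>\<^sub>u \<epsilon>" using c_pos p by (simp add: cS_def)
    have "h * s_u \<gamma>\<^sub>u \<epsilon> B b \<Omega> \<T> v v \<le> cS \<gamma>\<^sub>u \<epsilon> * B * L2_inner \<Omega> v v"
      by (rule s_u_bound[OF v b]) (use p in auto)
    also have "\<dots> \<le> cS \<gamma>\<^sub>u \<epsilon> * B * ?YY" using vY cS0 p by (intro mult_left_mono) auto
    finally have sv: "s_u \<gamma>\<^sub>u \<epsilon> B b \<Omega> \<T> v v \<le> cS \<gamma>\<^sub>u \<epsilon> * (B / h) * ?YY" using h_pos by (simp add: field_simps)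
    have "(s_u \<gamma>\<^sub>u \<epsilon> B b \<Omega> \<T> u v)\<^sup>2 \<le> ?S * s_u \<gamma>\<^sub>u \<epsilon> B b \<Omega> \<T> v v" by (rule S.cauchy_schwarz[OF u v])
    also have "\<dots> \<le> ?S * (cS \<gamma>\<^sub>u \<epsilon> * (B / h) * ?YY)" by (rule mult_left_mono[OF sv S.nonneg[OF u]])
    finally show ?thesis by (simp add: mult_ac)
  qed
  have three: "(x + y + z)\<^sup>2 \<le> 3 * x\<^sup>2 + 3 * y\<^sup>2 + 3 * z\<^sup>2" for x y z :: real
  proof -
    have "3 * x\<^sup>2 + 3 * y\<^sup>2 + 3 * z\<^sup>2 - (x + y + z)\<^sup>2 = (x - y)\<^sup>2 + (y - z)\<^sup>2 + (x - z)\<^sup>2"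
      by (simp add: power2_eq_square algebra_simps)
    then show ?thesis by (smt (verit, best) zero_le_power2)
  qed
  have "L2_inner \<Omega> (C_op 1 \<gamma>\<^sub>u \<epsilon> B b \<Omega> \<T> u) v = L2_inner \<Omega> (pw m) v + L2_inner \<Omega> zz v + s_u \<gamma>\<^sub>u \<epsilon> B b \<Omega> \<T> u v"
    unfolding C_op_props[OF u b(1) v] split ..
  then have "(L2_inner \<Omega> (C_op 1 \<gamma>\<^sub>u \<epsilon> B b \<Omega> \<T> u) v)\<^sup>2
      \<le> 3 * (L2_inner \<Omega> (pw m) v)\<^sup>2 + 3 * (L2_inner \<Omega> zz v)\<^sup>2 + 3 * (s_u \<gamma>\<^sub>u \<epsilon> B b \<Omega> \<T> u v)\<^sup>2"
    using three by simp
  also have "\<dots> \<le> 3 * ((2 * (cO * \<rho>\<^sup>2 / (4 * \<epsilon> * \<gamma>\<^sub>u)) * (B / h) * ?S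
      + 2 * ((real n + 1)\<^sup>2 * (\<omega> * c1)) * L\<^sup>2 * ?U) * ?YY) + 3 * (L\<^sup>2 * (\<omega> * c1 * ?U) * ?YY)
      + 3 * (cS \<gamma>\<^sub>u \<epsilon> * (B / h) * ?S * ?YY)"
    using 1 2 3 by linarith
  also have "\<dots> = (k1 \<gamma>\<^sub>u \<epsilon> * (B / h) * ?S + k2 * L\<^sup>2 * ?U) * ?YY"
  proof -
    have "3 * ((2 * c * s * S + 2 * d * l * U) * y) + 3 * (l * (o1 * U) * y) + 3 * (e * s * S * y)
        = ((6 * c + 3 * e) * s * S + (6 * d + 3 * o1) * l * U) * y" for c s S d l U y o1 e :: real
      by (simp add: algebra_simps)
    then show ?thesis unfolding k1_def k2_def .
  qed
  finally show ?thesis .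
qed

end

section \<open>One time step\<close>

context shaped_mesh
begin

lemma psd_form_nitsche:
  assumes "\<And>v. v \<in> V \<Longrightarrow> 0 \<le> nitsche \<gamma> v v"
  shows "psd_form V (nitsche \<gamma>)"
proof
  fix f g u :: "real^'d \<Rightarrow> real^'d" and c :: real
  assume f: "f \<in> V"
  show "(\<lambda>x. c *\<^sub>R f x) \<in> V" by (rule V_scale[OF f])
  show "0 \<le> nitsche \<gamma> f f" by (rule assms[OF f])
  assume g: "g \<in> V"
  show "(\<lambda>x. f x + g x) \<in> V" by (rule V_add[OF f g])
  show "nitsche \<gamma> f g = nitsche \<gamma> g f" by (rule nitsche_sym)
  show "nitsche \<gamma> (\<lambda>x. c *\<^sub>R f x) g = c * nitsche \<gamma> f g"
    using V_linear(2)[of "nitsche \<gamma> g", OF nitsche_linear[OF g] f, of c]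
    unfolding nitsche_sym[of _ _ g] .
  assume u: "u \<in> V"
  show "nitsche \<gamma> (\<lambda>x. f x + g x) u = nitsche \<gamma> f u + nitsche \<gamma> g u"
    using V_linear(1)[of "nitsche \<gamma> u", OF nitsche_linear[OF u] f g]
    unfolding nitsche_sym[of _ _ u] .
qed

text \<open>The parameter \<open>\<gamma>\<close> makes the energy nonnegative for every viscosity; as the viscosity grows, the
  diffusion form dominates the energy and is nonnegative itself.\<close>

lemma nitsche_nonneg:
  assumes "\<And>\<mu>. 0 < \<mu> \<Longrightarrow> norm_on V (\<lambda>v. sqrt (E_norm_sq 1 \<gamma>\<^sub>u \<epsilon> \<gamma> \<mu> B b \<Omega> \<T> v))" and v: "v \<in> V"
  shows "0 \<le> nitsche \<gamma> v v"
proof (rule ccontr)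
  let ?s = "s_u \<gamma>\<^sub>u \<epsilon> B b \<Omega> \<T> v v"
  assume "\<not> ?thesis"
  then have neg: "nitsche \<gamma> v v < 0" by simp
  define \<mu> where "\<mu> = (\<bar>?s\<bar> + 1) / (- nitsche \<gamma> v v)"
  have \<mu>: "0 < \<mu>" unfolding \<mu>_def using neg by (intro divide_pos_pos) auto
  have "0 \<le> sqrt (E_norm_sq 1 \<gamma>\<^sub>u \<epsilon> \<gamma> \<mu> B b \<Omega> \<T> v)"
    using assms(1)[OF \<mu>] v unfolding norm_on_def by blast
  then have "0 \<le> ?s + \<mu> * nitsche \<gamma> v v"
    unfolding E_norm_sq_def A_norm_eq[OF v] by (simp only: real_sqrt_ge_0_iff)
  moreover have "\<mu> * nitsche \<gamma> v v = - (\<bar>?s\<bar> + 1)" unfolding \<mu>_def using neg by simp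
  ultimately show False by linarith
qed

text \<open>Evaluating at \<open>v\<close> and at \<open>- v\<close> bounds the modulus. If the norm of \<open>v\<close> vanishes, the quotient in the
  supremum is a division by zero, and boundedness of \<open>l\<close> with respect to the \<open>L2\<close> norm takes over.\<close>

lemma dual_norm_bound:
  assumes l: "bounded_functional \<Omega> V l" and v: "v \<in> V"
    and nn: "\<And>v. v \<in> V \<Longrightarrow> 0 \<le> nitsche \<gamma> v v" and p: "0 \<le> \<gamma>\<^sub>u" "0 \<le> \<epsilon>" "0 \<le> B" "0 \<le> \<mu>"
  shows "(l v)\<^sup>2 \<le> (dual_norm 1 \<gamma>\<^sub>u \<epsilon> \<gamma> \<mu> B b \<Omega> \<T> l)\<^sup>2
    * (s_u \<gamma>\<^sub>u \<epsilon> B b \<Omega> \<T> v v + \<mu> * nitsche \<gamma> v v + L2_inner \<Omega> v v)"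
proof -
  interpret S: psd_form V "s_u \<gamma>\<^sub>u \<epsilon> B b \<Omega> \<T>" by (rule psd_form_s_u) (use p in auto)
  interpret N: psd_form V "nitsche \<gamma>" by (rule psd_form_nitsche[OF nn])
  define F where "F w = E_norm_sq 1 \<gamma>\<^sub>u \<epsilon> \<gamma> \<mu> B b \<Omega> \<T> w + (L2_norm \<Omega> w)\<^sup>2" for w
  define D where "D = dual_norm 1 \<gamma>\<^sub>u \<epsilon> \<gamma> \<mu> B b \<Omega> \<T> l"
  have F: "F w = s_u \<gamma>\<^sub>u \<epsilon> B b \<Omega> \<T> w w + \<mu> * nitsche \<gamma> w w + L2_inner \<Omega> w w" if "w \<in> V" for w
    unfolding F_def E_norm_sq_def A_norm_eq[OF that] L2_norm_sq[OF domain_sets] ..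
  have F_ge: "(L2_norm \<Omega> w)\<^sup>2 \<le> F w" if "w \<in> V" for w
    unfolding F[OF that] L2_norm_sq[OF domain_sets] using S.nonneg[OF that] nn[OF that] p(4) by simp
  have norm_le: "L2_norm \<Omega> w \<le> sqrt (F w)" if "w \<in> V" for w
    using F_ge[OF that] by (rule real_le_rsqrt)
  obtain b0 where b0: "\<And>w. w \<in> V \<Longrightarrow> \<bar>l w\<bar> \<le> b0 * L2_norm \<Omega> w"
    using l unfolding bounded_functional_def by blast
  have lb: "\<bar>l w\<bar> \<le> \<bar>b0\<bar> * sqrt (F w)" if w: "w \<in> V" for w
  proof -
    have "b0 * L2_norm \<Omega> w \<le> \<bar>b0\<bar> * sqrt (F w)"
      by (rule mult_mono[OF abs_ge_self norm_le[OF w] abs_ge_zero L2_norm_nonneg[OF domain_sets]])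
    then show ?thesis using b0[OF w] by linarith
  qed
  have up: "l w \<le> D * sqrt (F w)" if w: "w \<in> V" for w
  proof (cases "F w = 0")
    case True
    then show ?thesis using lb[OF w] by simp
  next
    case False
    have "0 \<le> F w" using F_ge[OF w] zero_le_power2 by (rule order.trans[rotated])
    then have pos: "0 < sqrt (F w)" using False by simp
    have "bdd_above ((\<lambda>w. l w / sqrt (F w)) ` V)"
    proof (rule bdd_aboveI2)
      fix w assume w: "w \<in> V"
      have "0 \<le> sqrt (F w)" using norm_le[OF w] L2_norm_nonneg[OF domain_sets] by (rule order.trans[rotated])
      then show "l w / sqrt (F w) \<le> \<bar>b0\<bar>"
        using lb[OF w] by (cases "sqrt (F w) = 0") (auto simp: divide_le_eq)
    qed
    then have "l w / sqrt (F w) \<le> D"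
      unfolding D_def dual_norm_def F_def[symmetric] by (rule cSUP_upper[OF w])
    then show ?thesis using pos by (simp add: divide_le_eq)
  qed
  define v' where "v' = (\<lambda>x. (- 1) *\<^sub>R v x)"
  have v': "v' \<in> V" unfolding v'_def by (rule V_scale[OF v])
  have "F v' = F v"
    unfolding F[OF v'] F[OF v] unfolding v'_def
    using S.scale_left[OF v v', of "-1"] S.scale_right[OF v v, of "-1"] N.scale_left[OF v v', of "-1"]
      N.scale_right[OF v v, of "-1"] unfolding v'_def by (simp add: L2_inner_def)
  moreover have "l v' = - 1 * l v" unfolding v'_def using l v unfolding bounded_functional_def by blast
  ultimately have "\<bar>l v\<bar> \<le> D * sqrt (F v)" using up[OF v] up[OF v'] by simp
  then have "\<bar>l v\<bar>\<^sup>2 \<le> (D * sqrt (F v))\<^sup>2" by (rule power_mono) simp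
  also have "\<dots> = D\<^sup>2 * F v"
    using F_ge[OF v] by (simp add: power_mult_distrib order.trans[OF zero_le_power2])
  finally show ?thesis unfolding F[OF v] D_def by simp
qed

definition "cstep \<gamma>\<^sub>u \<gamma>\<^sub>p \<epsilon> \<gamma> Co_max \<tau>_max = 4 * (1 + cA \<gamma> + (real n + 1)\<^sup>2 * k2 + k1 \<gamma>\<^sub>u \<epsilon> * (2 + cS \<gamma>\<^sub>u \<epsilon> * \<bar>Co_max\<bar>)
  + cO / \<gamma>\<^sub>p + (cS \<gamma>\<^sub>u \<epsilon> + cA \<gamma>) * \<bar>Co_max\<bar> + \<bar>\<tau>_max\<bar>)"

lemma constants_nonneg:
  "0 \<le> cA \<gamma>" "0 \<le> k2" "0 \<le> \<gamma>\<^sub>u \<Longrightarrow> 0 \<le> \<epsilon> \<Longrightarrow> 0 \<le> cS \<gamma>\<^sub>u \<epsilon>" "0 \<le> \<gamma>\<^sub>u \<Longrightarrow> 0 \<le> \<epsilon> \<Longrightarrow> 0 \<le> k1 \<gamma>\<^sub>u \<epsilon>"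
proof -
  note c = less_imp_le[OF c_pos(1)] less_imp_le[OF c_pos(2)] less_imp_le[OF c_pos(3)] less_imp_le[OF ball_vol_pos]
  show "0 \<le> cA \<gamma>" unfolding cA_def by (intro add_nonneg_nonneg mult_nonneg_nonneg c) auto
  show "0 \<le> k2" unfolding k2_def by (intro add_nonneg_nonneg mult_nonneg_nonneg c) auto
  assume p: "0 \<le> \<gamma>\<^sub>u" "0 \<le> \<epsilon>"
  show S: "0 \<le> cS \<gamma>\<^sub>u \<epsilon>" unfolding cS_def by (intro add_nonneg_nonneg mult_nonneg_nonneg c p) auto
  show "0 \<le> k1 \<gamma>\<^sub>u \<epsilon>" unfolding k1_def
    by (intro add_nonneg_nonneg mult_nonneg_nonneg divide_nonneg_nonneg c p S cO_nonneg) auto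
qed

text \<open>The estimate for one time step, in terms of the discrete functions that enter it: \<open>y\<close> is the
  increment, \<open>ua\<close> and \<open>ue\<close> are the averaged and the extrapolated velocity, which differ by half of the
  second difference \<open>d\<close>.\<close>

lemma one_step:
  fixes B1 :: real
  assumes V: "y \<in> V" "ua \<in> V" "ue \<in> V" "d \<in> V" and q: "q \<in> W_space 1 \<Omega> \<T>"
    and ue: "ue = (\<lambda>x. ua x + (- (1 / 2)) *\<^sub>R d x)"
    and eq: "\<And>v. v \<in> V \<Longrightarrow> inverse \<tau> * L2_inner \<Omega> y v + L2_inner \<Omega> (G_op 1 \<Omega> \<T> q) v
        + L2_inner \<Omega> (C_op 1 \<gamma>\<^sub>u \<epsilon> B b \<Omega> \<T> ue) v + L2_inner \<Omega> (A_op 1 \<gamma> \<mu> \<Omega> \<T> ua) v = l v"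
    and l: "bounded_functional \<Omega> V l"
    and nn: "\<And>v. v \<in> V \<Longrightarrow> 0 \<le> nitsche \<gamma> v v"
    and b: "continuous_on (closure \<Omega>) b" "\<And>x. x \<in> closure \<Omega> \<Longrightarrow> norm (b x) \<le> B"
    and lip: "\<And>K x y. K \<in> \<T> \<Longrightarrow> x \<in> K \<Longrightarrow> y \<in> K \<Longrightarrow> norm (b x - b y) \<le> (real n + 1) * B1 * norm (x - y)"
    and p: "0 < \<gamma>\<^sub>u" "0 < \<gamma>\<^sub>p" "0 < \<epsilon>" "0 < B" "0 \<le> B1" "0 < \<mu>" "0 < \<tau>"
    and Re: "1 \<le> reynolds \<mu> B \<T>" and Co: "courant \<tau> B \<T> \<le> Co_max" and \<tau>: "\<tau> \<le> \<tau>_max"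
  defines "Y \<equiv> \<lambda>x. y x - L2_proj \<Omega> X0 y x"
  shows "(L2_norm \<Omega> Y)\<^sup>2 \<le> cstep \<gamma>\<^sub>u \<gamma>\<^sub>p \<epsilon> \<gamma> Co_max \<tau>_max *
    (courant \<tau> B \<T> / reynolds \<mu> B \<T> * \<tau> * A_norm_sq 1 \<gamma> \<mu> \<Omega> \<T> ua
     + \<tau>\<^sup>2 * B1\<^sup>2 * (L2_norm \<Omega> ue)\<^sup>2
     + \<tau> * courant \<tau> B \<T> * s_u \<gamma>\<^sub>u \<epsilon> B b \<Omega> \<T> ua ua
     + \<tau> * courant \<tau> B \<T> * s_p \<gamma>\<^sub>p \<mu> B \<T> q q
     + \<tau> * (dual_norm 1 \<gamma>\<^sub>u \<epsilon> \<gamma> \<mu> B b \<Omega> \<T> l)\<^sup>2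
     + courant \<tau> B \<T> * (L2_norm \<Omega> d)\<^sup>2)"
proof -
  let ?s = "s_u \<gamma>\<^sub>u \<epsilon> B b \<Omega> \<T>" and ?N = "L2_inner \<Omega> Y Y" and ?D = "dual_norm 1 \<gamma>\<^sub>u \<epsilon> \<gamma> \<mu> B b \<Omega> \<T> l"
  interpret S: psd_form V ?s by (rule psd_form_s_u) (use p in auto)
  interpret N: psd_form V "nitsche \<gamma>" by (rule psd_form_nitsche[OF nn])
  define Co where "Co = courant \<tau> B \<T>"
  define Re where "Re = reynolds \<mu> B \<T>"
  note nonneg = constants_nonneg constants_nonneg(3,4)[OF less_imp_le[OF p(1)] less_imp_le[OF p(3)]]
  have Re1: "1 \<le> Re" using Re by (simp add: Re_def)
  have Re_inv: "\<mu> / h\<^sup>2 = B / h / Re" using p h_pos by (simp add: Re_def reynolds_def power2_eq_square)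
  have Bh: "0 \<le> B / h" using p h_pos by simp
  have Bh_Co: "\<tau> * (B / h) \<le> Co" unfolding Co_def courant_def using p h_pos by (simp add: field_simps)
  have Co0: "0 \<le> Co" using Bh_Co Bh p mult_nonneg_nonneg[of \<tau> "B / h"] by linarith
  have Co_max: "Co \<le> \<bar>Co_max\<bar>" using Co unfolding Co_def by linarith
  have \<tau>_max: "\<tau> \<le> \<bar>\<tau>_max\<bar>" using \<tau> by linarith

  \<comment> \<open>The Riesz representative \<open>v\<close> of \<open>Y\<close> turns \<open>(Y, Y)\<close> into an admissible test of the scheme.\<close>
  note P = X0_projection[OF V(1)]
  have yL: "y \<in> L2_space \<Omega>" by (rule V_L2[OF V(1)])
  have PL: "L2_proj \<Omega> X0 y \<in> L2_space \<Omega>" by (rule X0_L2[OF P(1)])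
  have YL: "Y \<in> L2_space \<Omega>" unfolding Y_def by (rule L2.diff_closed[OF yL PL])
  have orth: "L2_inner \<Omega> Y z = 0" if "z \<in> X0" for z
    unfolding Y_def L2.diff_left[OF yL PL X0_L2[OF that]] using P(2)[OF that] by simp
  obtain v where v: "v \<in> V" and proj: "\<And>w. w \<in> V \<Longrightarrow> L2_inner \<Omega> v w = L2_inner \<Omega> Y w"
    using V_riesz[of "L2_inner \<Omega> Y", OF L2_linear[OF YL]] by blast
  have N0: "0 \<le> ?N" by (rule L2.nonneg[OF YL])
  have vN: "L2_inner \<Omega> v v \<le> ?N" by (rule projection_le[OF YL v proj])
  let ?P = "L2_inner \<Omega> (G_op 1 \<Omega> \<T> q) v" and ?C = "L2_inner \<Omega> (C_op 1 \<gamma>\<^sub>u \<epsilon> B b \<Omega> \<T> ue) v"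
    and ?A = "L2_inner \<Omega> (A_op 1 \<gamma> \<mu> \<Omega> \<T> ua) v"
  have "?N = L2_inner \<Omega> Y y - L2_inner \<Omega> Y (L2_proj \<Omega> X0 y)"
    using L2.diff_right[OF yL PL YL] by (simp add: Y_def)
  also have "\<dots> = L2_inner \<Omega> y v" using orth[OF P(1)] proj[OF V(1)] L2.sym[OF V_L2[OF v] yL] by simp
  also have "\<dots> = \<tau> * (l v - ?P - ?C - ?A)" using eq[OF v] p(7) by (simp add: field_simps)
  finally have N_eq: "?N = \<tau> * (l v - ?P - ?C - ?A)" .

  have nv: "\<mu> * nitsche \<gamma> v v \<le> cA \<gamma> * (B / h / Re) * ?N"
  proof -
    have "h\<^sup>2 * nitsche \<gamma> v v \<le> cA \<gamma> * ?N"
      using order.trans[OF nitsche_bound[OF v] mult_left_mono[OF vN nonneg(1)]] .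
    then have "\<mu> / h\<^sup>2 * (h\<^sup>2 * nitsche \<gamma> v v) \<le> \<mu> / h\<^sup>2 * (cA \<gamma> * ?N)"
      by (rule mult_left_mono) (use p in simp)
    moreover have "\<mu> / h\<^sup>2 * (h\<^sup>2 * nitsche \<gamma> v v) = \<mu> * nitsche \<gamma> v v" using h_pos by simp
    ultimately show ?thesis unfolding Re_inv by (simp add: mult_ac)
  qed
  have s_le: "?s w w \<le> cS \<gamma>\<^sub>u \<epsilon> * (B / h) * L2_inner \<Omega> w w" if w: "w \<in> V" for w
    using s_u_bound[OF w b, of \<gamma>\<^sub>u \<epsilon>] p h_pos by (simp add: pos_le_divide_eq mult_ac)

  define XL where "XL = ?D\<^sup>2 * ((cS \<gamma>\<^sub>u \<epsilon> + cA \<gamma>) * (B / h) + 1)"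
  define XP where "XP = cO / \<gamma>\<^sub>p * (B / h) * s_p \<gamma>\<^sub>p \<mu> B \<T> q q"
  define XC where "XC = k1 \<gamma>\<^sub>u \<epsilon> * (B / h) * ?s ue ue + k2 * ((real n + 1) * B1)\<^sup>2 * L2_inner \<Omega> ue ue"
  define XA where "XA = cA \<gamma> * (B / h / Re) * (\<mu> * nitsche \<gamma> ua ua)"
  have L: "(l v)\<^sup>2 \<le> XL * ?N"
  proof -
    have "B / h / Re \<le> B / h" using divide_left_mono[OF Re1 Bh] Re1 by simp
    then have "cA \<gamma> * (B / h / Re) * ?N \<le> cA \<gamma> * (B / h) * ?N"
      by (intro mult_right_mono mult_left_mono N0 nonneg(1))
    moreover have "?s v v \<le> cS \<gamma>\<^sub>u \<epsilon> * (B / h) * ?N"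
      using order.trans[OF s_le[OF v] mult_left_mono[OF vN mult_nonneg_nonneg[OF nonneg(5) Bh]]] .
    ultimately have "?s v v + \<mu> * nitsche \<gamma> v v + L2_inner \<Omega> v v
        \<le> cS \<gamma>\<^sub>u \<epsilon> * (B / h) * ?N + cA \<gamma> * (B / h) * ?N + ?N"
      using nv vN by linarith
    also have "\<dots> = ((cS \<gamma>\<^sub>u \<epsilon> + cA \<gamma>) * (B / h) + 1) * ?N" by (simp add: algebra_simps)
    finally have "?D\<^sup>2 * (?s v v + \<mu> * nitsche \<gamma> v v + L2_inner \<Omega> v v)
        \<le> ?D\<^sup>2 * (((cS \<gamma>\<^sub>u \<epsilon> + cA \<gamma>) * (B / h) + 1) * ?N)"
      by (rule mult_left_mono) simp
    moreover have "(l v)\<^sup>2 \<le> ?D\<^sup>2 * (?s v v + \<mu> * nitsche \<gamma> v v + L2_inner \<Omega> v v)"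
      by (rule dual_norm_bound[OF l v nn]) (use p in auto)
    ultimately show ?thesis unfolding XL_def by (simp add: mult.assoc)
  qed
  let ?J = "\<Sum>F\<in>interior_faces \<T>. area F * jump_sq (\<lambda>K. elem_grad K q) F"
  have sp: "s_p \<gamma>\<^sub>p \<mu> B \<T> q q = \<gamma>\<^sub>p * h\<^sup>2 / B * ?J"
  proof -
    have "min 1 (inverse Re) = inverse Re" using le_imp_inverse_le[OF Re1] by (simp add: min_absorb2)
    then have "s_p \<gamma>\<^sub>p \<mu> B \<T> q q = \<gamma>\<^sub>p * inverse Re * h ^ 3 / \<mu> * ?J" unfolding s_p_eq[OF q] Re_def by simp
    then show ?thesis using p h_pos by (simp add: Re_def reynolds_def power2_eq_square power3_eq_cube)
  qed
  have J0: "0 \<le> ?J"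
    by (intro sum_nonneg mult_nonneg_nonneg) (auto simp: jump_sq_def area_def face_integral_nonneg)
  have sp0: "0 \<le> s_p \<gamma>\<^sub>p \<mu> B \<T> q q" unfolding sp by (intro mult_nonneg_nonneg J0) (use p in auto)
  have Pr: "?P\<^sup>2 \<le> XP * ?N"
  proof -
    have "cO * h * ?J = XP" unfolding XP_def sp using p h_pos by (simp add: power2_eq_square)
    then show ?thesis using pressure_estimate[OF q YL v orth proj] by simp
  qed
  have Cv: "?C\<^sup>2 \<le> XC * ?N" unfolding XC_def
    by (rule convection_estimate[OF V(3) YL v orth proj b lip]) (use p in auto)
  have Av: "?A\<^sup>2 \<le> XA * ?N"
  proof -
    have "?A\<^sup>2 = \<mu>\<^sup>2 * (nitsche \<gamma> ua v)\<^sup>2" unfolding A_op_props(2)[OF V(2) v] by (simp add: power_mult_distrib)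
    also have "\<dots> \<le> \<mu>\<^sup>2 * (nitsche \<gamma> ua ua * nitsche \<gamma> v v)"
      by (intro mult_left_mono N.cauchy_schwarz V v) simp
    also have "\<dots> = (\<mu> * nitsche \<gamma> ua ua) * (\<mu> * nitsche \<gamma> v v)" by (simp add: power2_eq_square mult_ac)
    also have "\<dots> \<le> (\<mu> * nitsche \<gamma> ua ua) * (cA \<gamma> * (B / h / Re) * ?N)"
      by (rule mult_left_mono[OF nv]) (use p nn[OF V(2)] in simp)
    finally show ?thesis unfolding XA_def by (simp add: mult_ac)
  qed

  have main: "?N \<le> 4 * (\<tau>\<^sup>2 * XL + \<tau>\<^sup>2 * XP + \<tau>\<^sup>2 * XC + \<tau>\<^sup>2 * XA)"
  proof (cases "?N = 0")
    case True
    have "0 \<le> XL" "0 \<le> XP" "0 \<le> XC" "0 \<le> XA" unfolding XL_def XP_def XC_def XA_def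
      using p Re1 h_pos
      by (intro mult_nonneg_nonneg add_nonneg_nonneg nonneg Bh divide_nonneg_nonneg cO_nonneg sp0 S.nonneg[OF V(3)]
          L2.nonneg[OF V_L2[OF V(3)]] nn[OF V(2)]; simp)+
    then show ?thesis using True by simp
  next
    case False
    then have pos: "0 < ?N" using N0 by simp
    have four: "(a - b - c - e)\<^sup>2 \<le> 4 * (a\<^sup>2 + b\<^sup>2 + c\<^sup>2 + e\<^sup>2)" for a b c e :: real
    proof -
      have "4 * (a\<^sup>2 + b\<^sup>2 + c\<^sup>2 + e\<^sup>2) - (a - b - c - e)\<^sup>2
        = (a + b)\<^sup>2 + (a + c)\<^sup>2 + (a + e)\<^sup>2 + (b - c)\<^sup>2 + (b - e)\<^sup>2 + (c - e)\<^sup>2"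
        by (simp add: power2_eq_square algebra_simps)
      then show ?thesis
        using sum_power2_ge_zero[of "a + b" "a + c"] sum_power2_ge_zero[of "a + e" "b - c"] sum_power2_ge_zero[of "b - e" "c - e"]
        by linarith
    qed
    have "?N * ?N = \<tau>\<^sup>2 * (l v - ?P - ?C - ?A)\<^sup>2"
      using arg_cong[OF N_eq, of "\<lambda>t. t\<^sup>2"] by (simp add: power_mult_distrib power2_eq_square)
    also have "\<dots> \<le> \<tau>\<^sup>2 * (4 * ((l v)\<^sup>2 + ?P\<^sup>2 + ?C\<^sup>2 + ?A\<^sup>2))" by (intro mult_left_mono four) simp
    also have "\<dots> \<le> \<tau>\<^sup>2 * (4 * (XL * ?N + XP * ?N + XC * ?N + XA * ?N))"
      by (intro mult_left_mono add_mono L Pr Cv Av) auto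
    also have "\<dots> = 4 * (\<tau>\<^sup>2 * XL + \<tau>\<^sup>2 * XP + \<tau>\<^sup>2 * XC + \<tau>\<^sup>2 * XA) * ?N" by (simp add: algebra_simps)
    finally show ?thesis by (rule mult_right_le_imp_le[OF _ pos])
  qed

  define T1 where "T1 = Co / Re * \<tau> * (\<mu> * nitsche \<gamma> ua ua)"
  define T2 where "T2 = \<tau>\<^sup>2 * B1\<^sup>2 * L2_inner \<Omega> ue ue"
  define T3 where "T3 = \<tau> * Co * ?s ua ua"
  define T4 where "T4 = \<tau> * Co * s_p \<gamma>\<^sub>p \<mu> B \<T> q q"
  define T5 where "T5 = \<tau> * ?D\<^sup>2"
  define T6 where "T6 = Co * L2_inner \<Omega> d d"
  have T: "0 \<le> T1" "0 \<le> T2" "0 \<le> T3" "0 \<le> T4" "0 \<le> T5" "0 \<le> T6"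
    unfolding T1_def T2_def T3_def T4_def T5_def T6_def using p Re1
    by (intro mult_nonneg_nonneg divide_nonneg_nonneg Co0 sp0 S.nonneg V nn L2.nonneg V_L2; simp)+
  have \<tau>Bh: "\<tau>\<^sup>2 * (B / h) \<le> \<tau> * Co"
    using mult_left_mono[OF Bh_Co less_imp_le[OF p(7)]] by (simp add: power2_eq_square)
  have \<tau>Bh2: "(\<tau> * (B / h))\<^sup>2 \<le> Co * \<bar>Co_max\<bar>"
    unfolding power2_eq_square
    by (rule mult_mono[OF Bh_Co order.trans[OF Bh_Co Co_max] Co0 mult_nonneg_nonneg[OF less_imp_le[OF p(7)] Bh]])
  have 1: "\<tau>\<^sup>2 * XA \<le> cA \<gamma> * T1"
  proof -
    have "\<tau>\<^sup>2 * (B / h) * (cA \<gamma> / Re * (\<mu> * nitsche \<gamma> ua ua)) \<le> \<tau> * Co * (cA \<gamma> / Re * (\<mu> * nitsche \<gamma> ua ua))"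
      by (intro mult_right_mono[OF \<tau>Bh] mult_nonneg_nonneg divide_nonneg_nonneg nonneg nn V) (use p Re1 in auto)
    then show ?thesis unfolding XA_def T1_def by (simp add: mult_ac)
  qed
  have 2: "\<tau>\<^sup>2 * XP \<le> cO / \<gamma>\<^sub>p * T4"
  proof -
    have "\<tau>\<^sup>2 * (B / h) * (cO / \<gamma>\<^sub>p * s_p \<gamma>\<^sub>p \<mu> B \<T> q q) \<le> \<tau> * Co * (cO / \<gamma>\<^sub>p * s_p \<gamma>\<^sub>p \<mu> B \<T> q q)"
      by (intro mult_right_mono[OF \<tau>Bh] mult_nonneg_nonneg divide_nonneg_nonneg cO_nonneg sp0) (use p in auto)
    then show ?thesis unfolding XP_def T4_def by (simp add: mult_ac)
  qed
  have 3: "\<tau>\<^sup>2 * XL \<le> ((cS \<gamma>\<^sub>u \<epsilon> + cA \<gamma>) * \<bar>Co_max\<bar> + \<bar>\<tau>_max\<bar>) * T5"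
  proof -
    have "(cS \<gamma>\<^sub>u \<epsilon> + cA \<gamma>) * (\<tau> * (B / h)) + \<tau> \<le> (cS \<gamma>\<^sub>u \<epsilon> + cA \<gamma>) * \<bar>Co_max\<bar> + \<bar>\<tau>_max\<bar>"
      by (intro add_mono mult_left_mono order.trans[OF Bh_Co Co_max] \<tau>_max add_nonneg_nonneg nonneg)
    then have "((cS \<gamma>\<^sub>u \<epsilon> + cA \<gamma>) * (\<tau> * (B / h)) + \<tau>) * T5 \<le> ((cS \<gamma>\<^sub>u \<epsilon> + cA \<gamma>) * \<bar>Co_max\<bar> + \<bar>\<tau>_max\<bar>) * T5"
      by (rule mult_right_mono[OF _ T(5)])
    moreover have "\<tau>\<^sup>2 * XL = ((cS \<gamma>\<^sub>u \<epsilon> + cA \<gamma>) * (\<tau> * (B / h)) + \<tau>) * T5"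
      unfolding XL_def T5_def power2_eq_square[of \<tau>] by (simp only: algebra_simps mult_1_right)
    ultimately show ?thesis by simp
  qed
  have 4: "\<tau>\<^sup>2 * XC \<le> k1 \<gamma>\<^sub>u \<epsilon> * (2 * T3 + cS \<gamma>\<^sub>u \<epsilon> * \<bar>Co_max\<bar> * T6) + (real n + 1)\<^sup>2 * k2 * T2"
  proof -
    have "?s ue ue \<le> 2 * ?s ua ua + 1 / 2 * ?s d d"
      using S.sum_sq_le[OF V(2,4), of "- (1 / 2)"] unfolding ue by (simp add: power2_eq_square)
    also have "\<dots> \<le> 2 * ?s ua ua + cS \<gamma>\<^sub>u \<epsilon> * (B / h) * L2_inner \<Omega> d d"
      using s_le[OF V(4)] S.nonneg[OF V(4)] by linarith
    finally have "\<tau>\<^sup>2 * (B / h) * ?s ue ue \<le> \<tau>\<^sup>2 * (B / h) * (2 * ?s ua ua + cS \<gamma>\<^sub>u \<epsilon> * (B / h) * L2_inner \<Omega> d d)"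
      by (rule mult_left_mono[OF _ mult_nonneg_nonneg[OF zero_le_power2 Bh]])
    also have "\<dots> = 2 * (\<tau>\<^sup>2 * (B / h) * ?s ua ua) + cS \<gamma>\<^sub>u \<epsilon> * ((\<tau> * (B / h))\<^sup>2 * L2_inner \<Omega> d d)"
      by (simp only: power2_eq_square algebra_simps)
    also have "\<dots> \<le> 2 * (\<tau> * Co * ?s ua ua) + cS \<gamma>\<^sub>u \<epsilon> * (Co * \<bar>Co_max\<bar> * L2_inner \<Omega> d d)"
      by (intro add_mono mult_left_mono mult_right_mono \<tau>Bh \<tau>Bh2 S.nonneg V L2.nonneg V_L2 nonneg) auto
    also have "\<dots> = 2 * T3 + cS \<gamma>\<^sub>u \<epsilon> * \<bar>Co_max\<bar> * T6" unfolding T3_def T6_def by (simp only: mult_ac)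
    finally have "k1 \<gamma>\<^sub>u \<epsilon> * (\<tau>\<^sup>2 * (B / h) * ?s ue ue) \<le> k1 \<gamma>\<^sub>u \<epsilon> * (2 * T3 + cS \<gamma>\<^sub>u \<epsilon> * \<bar>Co_max\<bar> * T6)"
      by (rule mult_left_mono[OF _ nonneg(6)])
    moreover have "\<tau>\<^sup>2 * XC = k1 \<gamma>\<^sub>u \<epsilon> * (\<tau>\<^sup>2 * (B / h) * ?s ue ue) + (real n + 1)\<^sup>2 * k2 * T2"
      unfolding XC_def T2_def power_mult_distrib by (simp only: distrib_left mult_ac)
    ultimately show ?thesis by simp
  qed
  have "?N \<le> cstep \<gamma>\<^sub>u \<gamma>\<^sub>p \<epsilon> \<gamma> Co_max \<tau>_max * (T1 + T2 + T3 + T4 + T5 + T6)"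
  proof -
    define a where "a = cA \<gamma>"
    define k where "k = (real n + 1)\<^sup>2 * k2"
    define k' where "k' = k1 \<gamma>\<^sub>u \<epsilon> * 2"
    define k'' where "k'' = k1 \<gamma>\<^sub>u \<epsilon> * (cS \<gamma>\<^sub>u \<epsilon> * \<bar>Co_max\<bar>)"
    define c where "c = cO / \<gamma>\<^sub>p"
    define e where "e = (cS \<gamma>\<^sub>u \<epsilon> + cA \<gamma>) * \<bar>Co_max\<bar> + \<bar>\<tau>_max\<bar>"
    have nn: "0 \<le> a" "0 \<le> k" "0 \<le> k'" "0 \<le> k''" "0 \<le> c" "0 \<le> e"
      unfolding a_def k_def k'_def k''_def c_def e_def
      by (intro add_nonneg_nonneg mult_nonneg_nonneg divide_nonneg_nonneg nonneg cO_nonneg abs_ge_zero; use p in simp)+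
    define M where "M = 1 + a + k + (k' + k'') + c + e"
    have M: "a \<le> M" "k \<le> M" "k' \<le> M" "k'' \<le> M" "c \<le> M" "e \<le> M" using nn unfolding M_def by auto
    have "?N \<le> 4 * (e * T5 + c * T4 + (k' * T3 + k'' * T6 + k * T2) + a * T1)"
      using main 1 2 3 4 unfolding a_def k_def k'_def k''_def c_def e_def by (simp add: distrib_left mult.assoc)
    also have "\<dots> \<le> 4 * (M * T5 + M * T4 + (M * T3 + M * T6 + M * T2) + M * T1)"
      by (intro mult_left_mono add_mono mult_right_mono M T) auto
    also have "\<dots> = 4 * M * (T1 + T2 + T3 + T4 + T5 + T6)" by (simp add: algebra_simps)
    also have "4 * M = cstep \<gamma>\<^sub>u \<gamma>\<^sub>p \<epsilon> \<gamma> Co_max \<tau>_max"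
      unfolding M_def cstep_def a_def k_def k'_def k''_def c_def e_def by (simp add: distrib_left)
    finally show ?thesis .
  qed
  then show ?thesis
    unfolding T1_def T2_def T3_def T4_def T5_def T6_def Co_def Re_def L2_norm_sq[OF domain_sets] A_norm_eq[OF V(2)] .
qed

lemma cstep_pos: "0 < \<gamma>\<^sub>u \<Longrightarrow> 0 < \<gamma>\<^sub>p \<Longrightarrow> 0 < \<epsilon> \<Longrightarrow> 0 < cstep \<gamma>\<^sub>u \<gamma>\<^sub>p \<epsilon> \<gamma> Co_max \<tau>_max"
  unfolding cstep_def
  by (intro mult_pos_pos add_pos_nonneg mult_nonneg_nonneg divide_nonneg_nonneg add_nonneg_nonneg
      constants_nonneg cO_nonneg abs_ge_zero) auto

end

section \<open>The advection field at a fixed time\<close>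

lemma W1inf_norm_ge_Linf_norm: "Linf_norm U f \<le> W1inf_norm U f"
  unfolding W1inf_norm_def by (rule Max_ge) auto

text \<open>An open null set is empty, so for continuous functions the almost everywhere bound holds everywhere.\<close>

lemma Linf_norm_bound:
  fixes f :: "'a::euclidean_space \<Rightarrow> 'b::euclidean_space"
  assumes U: "open U" and f: "continuous_on U f" "f \<in> Linf_space U" and z: "z \<in> U"
  shows "norm (f z) \<le> Linf_norm U f"
proof -
  let ?S = "{x\<in>U. Linf_norm U f < norm (f x)}"
  have "?S = U \<inter> (\<lambda>x. norm (f x)) -` {Linf_norm U f<..}" by auto
  moreover have "open (U \<inter> (\<lambda>x. norm (f x)) -` {Linf_norm U f<..})"
    by (rule continuous_open_preimage[OF continuous_on_norm[OF f(1)] U]) simp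
  ultimately have op: "open ?S" by simp
  have "AE x in lebesgue. x \<in> U \<longrightarrow> norm (f x) \<le> Linf_norm U f"
    using Linf_norm_AE[OF f(2)] U by (simp add: AE_restrict_space_iff borel_open)
  then have "negligible {x. \<not> (x \<in> U \<longrightarrow> norm (f x) \<le> Linf_norm U f)}"
    by (simp add: eventually_ae_filter_negligible) (metis (mono_tags, lifting) negligible_subset)
  moreover have "{x. \<not> (x \<in> U \<longrightarrow> norm (f x) \<le> Linf_norm U f)} = ?S" by auto
  ultimately have "negligible ?S" by simp
  then have "?S = {}" using open_not_negligible[OF op] by argo
  then have "z \<notin> ?S" by (simp only: empty_iff not_False_eq_True)
  then show ?thesis using z by simp
qed

lemma open_slab_time: "open \<Omega> \<Longrightarrow> open (\<Omega> \<times> {0<..<T::real})"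
  by (rule open_Times) auto

text \<open>The bound holds inside the space-time cylinder and extends to the boundary of the domain by
  continuity.\<close>

lemma advection_bound:
  fixes \<Omega> :: "(real^'d) set"
  assumes \<Omega>: "open \<Omega>" and \<beta>: "advection_field \<Omega> T \<beta>" and t: "0 < t" "t < T"
  shows "continuous_on (closure \<Omega>) (\<lambda>x. \<beta> (x, t))"
    and "x \<in> closure \<Omega> \<Longrightarrow> norm (\<beta> (x, t)) \<le> Linf_norm (\<Omega> \<times> {0<..<T}) \<beta>"
proof -
  let ?U = "\<Omega> \<times> {0<..<T}"
  have c: "continuous_on (closure \<Omega> \<times> {0..T}) \<beta>" and W: "\<beta> \<in> Linf_space ?U"
    using \<beta> by (auto simp: advection_field_def Let_def W1inf_space_def)
  have "continuous_on (closure \<Omega>) (\<beta> \<circ> (\<lambda>x. (x, t)))"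
  proof (rule continuous_on_compose)
    show "continuous_on (closure \<Omega>) (\<lambda>x. (x, t))" by (intro continuous_intros)
    show "continuous_on ((\<lambda>x. (x, t)) ` closure \<Omega>) \<beta>"
      by (rule continuous_on_subset[OF c]) (use t in auto)
  qed
  then show cb: "continuous_on (closure \<Omega>) (\<lambda>x. \<beta> (x, t))" by (simp add: comp_def)
  have cU: "continuous_on ?U \<beta>" by (rule continuous_on_subset[OF c]) (use closure_subset[of \<Omega>] in auto)
  have "\<forall>x\<in>\<Omega>. norm (\<beta> (x, t)) \<le> Linf_norm ?U \<beta>"
    using Linf_norm_bound[OF open_slab_time[OF \<Omega>] cU W] t by auto
  then show "x \<in> closure \<Omega> \<Longrightarrow> norm (\<beta> (x, t)) \<le> Linf_norm ?U \<beta>"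
    by (rule continuous_on_closure_norm_le[OF cb])
qed

text \<open>Segments between interior points of a convex set stay in the domain, where the bound on the weak
  derivatives is a Lipschitz bound; it extends to the boundary of the set by continuity. The factor
  is the dimension of space-time, since the norm bounds the partial derivatives separately.\<close>

lemma advection_lipschitz:
  fixes \<Omega> :: "(real^'d) set"
  assumes \<Omega>: "open \<Omega>" and \<beta>: "advection_field \<Omega> T \<beta>" and t: "0 < t" "t < T"
    and K: "convex K" "closure (interior K) = K" "interior K \<subseteq> \<Omega>" and xy: "x \<in> K" "y \<in> K"
  shows "norm (\<beta> (x, t) - \<beta> (y, t)) \<le> (real CARD('d) + 1) * W1inf_norm (\<Omega> \<times> {0<..<T}) \<beta> * norm (x - y)"
proof -
  let ?U = "\<Omega> \<times> {0<..<T}" and ?L = "(real CARD('d) + 1) * W1inf_norm (\<Omega> \<times> {0<..<T}) \<beta>" and ?I = "interior K"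
  have c: "continuous_on (closure \<Omega> \<times> {0..T}) \<beta>" and W: "\<beta> \<in> W1inf_space ?U"
    using \<beta> by (auto simp: advection_field_def Let_def)
  have L0: "0 \<le> W1inf_norm ?U \<beta>"
    using \<beta> W1inf_norm_ge_Linf_norm[of ?U \<beta>] by (simp add: advection_field_def Let_def)
  have cU: "continuous_on ?U \<beta>" by (rule continuous_on_subset[OF c]) (use closure_subset[of \<Omega>] in auto)
  have int: "norm (\<beta> (x, t) - \<beta> (y, t)) \<le> ?L * norm (x - y)" if xy: "x \<in> ?I" "y \<in> ?I" for x y
  proof -
    define e where "e = (x - y, 0::real)"
    have xe: "(y, t) + e = (x, t)" by (simp add: e_def)
    have "closed_segment (y, t) (x, t) \<subseteq> ?I \<times> {0<..<T}"
      by (rule closed_segment_subset) (use xy t in \<open>auto intro!: convex_Times convex_interior K(1) convex_real_interval\<close>)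
    then have seg: "closed_segment (y, t) ((y, t) + e) \<subseteq> ?U" unfolding xe using K(3) by auto
    have "norm (\<beta> ((y, t) + e) - \<beta> (y, t)) \<le> W1inf_norm ?U \<beta> * (\<Sum>b\<in>Basis. \<bar>e \<bullet> b\<bar>)"
      by (rule lipschitz_on_segment[OF open_slab_time[OF \<Omega>] cU, where g = "weak_derivative ?U \<beta>"])
        (use weak_derivative_bound[OF open_slab_time[OF \<Omega>] W] seg in auto)
    also have "\<dots> \<le> W1inf_norm ?U \<beta> * (\<Sum>b\<in>(Basis :: ((real^'d) \<times> real) set). norm (x - y))"
    proof (intro mult_left_mono sum_mono L0)
      fix b :: "(real^'d) \<times> real" assume "b \<in> Basis"
      then have "\<bar>e \<bullet> b\<bar> \<le> norm e" by (rule Basis_le_norm)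
      then show "\<bar>e \<bullet> b\<bar> \<le> norm (x - y)" by (simp add: e_def norm_Pair)
    qed
    also have "\<dots> = ?L * norm (x - y)" by (simp add: algebra_simps)
    finally show ?thesis unfolding xe .
  qed
  have KO: "K \<subseteq> closure \<Omega>" using closure_mono[OF K(3)] K(2) by simp
  have cl: "closure (?I \<times> ?I) = K \<times> K" by (simp add: closure_Times K(2))
  have cb: "continuous_on K (\<lambda>x. \<beta> (x, t))"
    by (rule continuous_on_subset[OF advection_bound(1)[OF \<Omega> \<beta> t] KO])
  let ?f = "\<lambda>p. ?L * norm (fst p - snd p) - norm (\<beta> (fst p, t) - \<beta> (snd p, t))"
  have cp: "continuous_on (K \<times> K) (\<lambda>p. \<beta> (fst p, t))" "continuous_on (K \<times> K) (\<lambda>p. \<beta> (snd p, t))"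
    by (rule continuous_on_compose2[OF cb], auto intro!: continuous_intros)+
  have "continuous_on (closure (?I \<times> ?I)) ?f" unfolding cl
    by (intro continuous_intros cp)
  moreover have "(x, y) \<in> closure (?I \<times> ?I)" unfolding cl using xy by simp
  moreover have "0 \<le> ?f p" if "p \<in> ?I \<times> ?I" for p using int[of "fst p" "snd p"] that by auto
  ultimately have "0 \<le> ?f (x, y)" by (rule continuous_ge_on_closure)
  then show ?thesis by simp
qed

section \<open>The estimate for the scheme\<close>

text \<open>The diameter is bounded by \<open>\<sigma>\<close> times the radius of an inscribed ball and the mesh size by \<open>\<sigma>\<close> times
  the diameter, which gives \<open>\<rho> = \<sigma>\<^sup>2\<close> for all meshes of the family.\<close>

lemma quasi_uniform_shape:
  fixes \<Omega> :: "(real^'d) set"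
  assumes "CARD('d) = 2 \<or> CARD('d) = 3" "polygonal_domain \<Omega>" "quasi_uniform_family \<Omega> \<M>" and n: "CARD('d) = n"
  obtains \<rho> where "\<And>\<T>. \<T> \<in> \<M> \<Longrightarrow> shaped_mesh \<Omega> \<T> \<rho> n"
proof -
  have "\<exists>\<sigma>>0. \<forall>\<T>\<in>\<M>. \<forall>K\<in>\<T>. (\<exists>c r. cball c r \<subseteq> K \<and> diameter K \<le> \<sigma> * r) \<and> mesh_size \<T> \<le> \<sigma> * diameter K"
    using assms(3) unfolding quasi_uniform_family_def by (rule conjunct2)
  then obtain \<sigma> where \<sigma>: "0 < \<sigma>" and shape: "\<And>\<T> K. \<T> \<in> \<M> \<Longrightarrow> K \<in> \<T> \<Longrightarrow>
      (\<exists>c r. cball c r \<subseteq> K \<and> diameter K \<le> \<sigma> * r) \<and> mesh_size \<T> \<le> \<sigma> * diameter K"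
    by (elim exE conjE) (rule that, assumption, drule (1) bspec, drule (1) bspec, assumption)
  have "shaped_mesh \<Omega> \<T> (\<sigma>\<^sup>2) n" if \<T>: "\<T> \<in> \<M>" for \<T>
  proof -
    have sm: "simplicial_mesh \<Omega> \<T>" using assms(3) \<T> unfolding quasi_uniform_family_def by blast
    interpret mesh \<Omega> \<T> by standard (fact assms sm)+
    show ?thesis
    proof
      fix K assume K: "K \<in> \<T>"
      obtain c r where r: "cball c r \<subseteq> K" "diameter K \<le> \<sigma> * r" and h: "mesh_size \<T> \<le> \<sigma> * diameter K"
        using shape[OF \<T> K] by blast
      obtain a where a: "a \<in> verts K" using other_vertex[OF simplex[OF K]] by metis
      obtain a' where a': "a' \<in> verts K" "a' \<noteq> a" using other_vertex[OF simplex[OF K]] by metis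
      have "0 < dist a a'" using a' by simp
      also have "\<dots> \<le> diameter K"
        using diameter_bounded_bound[OF compact_imp_bounded[OF full_simplex_compact[OF simplex[OF K]]]] a a'(1) verts_subset by blast
      finally have "0 < \<sigma> * r" using r(2) by linarith
      then have r0: "0 < r" using \<sigma> by (simp add: zero_less_mult_iff)
      have "mesh_size \<T> \<le> \<sigma>\<^sup>2 * r"
        using order.trans[OF h mult_left_mono[OF r(2)]] \<sigma> by (simp add: power2_eq_square)
      then show "\<exists>p r. 0 < r \<and> cball p r \<subseteq> K \<and> mesh_size \<T> \<le> \<sigma>\<^sup>2 * r" using r(1) r0 by blast
    qed (rule n)
  qed
  then show thesis by (rule that)
qed

theorem lemma4p5:
  fixes \<Omega> :: "(real^'d) set"
    and \<M> :: "(real^'d) set set set"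
    and \<gamma>\<^sub>u \<gamma>\<^sub>p \<epsilon> \<gamma> Co_max \<tau>_max :: real
  assumes "CARD('d) = 2 \<or> CARD('d) = 3"
    and "polygonal_domain \<Omega>"
    and "quasi_uniform_family \<Omega> \<M>"
    and "0 < \<gamma>\<^sub>u" and "0 < \<gamma>\<^sub>p" and "0 < \<epsilon>"
    and "sufficiently_large 1 \<gamma>\<^sub>u \<epsilon> \<Omega> \<M> \<gamma>"
  shows "\<exists>C>0. \<forall>T \<beta> \<mu> \<T> \<tau> N u0 u1 L L' u p.
    let B = Linf_norm (\<Omega> \<times> {0<..<T}) \<beta>;
        B1 = W1inf_norm (\<Omega> \<times> {0<..<T}) \<beta>;
        Re = reynolds \<mu> B \<T>;
        Co = courant \<tau> B \<T>
    in
      0 < T \<and> advection_field \<Omega> T \<beta> \<and> 0 < \<mu> \<and> \<T> \<in> \<M> \<and> 1 \<le> Re \<and>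
      0 < \<tau> \<and> real N * \<tau> \<le> T \<and> Co \<le> Co_max \<and> \<tau> \<le> \<tau>_max \<and>
      u0 \<in> L2_space \<Omega> \<and> u1 \<in> L2_space \<Omega> \<and>
      (\<forall>n. bounded_functional \<Omega> (V_space 1 \<Omega> \<T>) (L n)) \<and>
      (\<forall>n. bounded_functional \<Omega> (Q_space 1 \<Omega> \<T>) (L' n)) \<and>
      CN_solution 1 \<gamma>\<^sub>u \<gamma>\<^sub>p \<epsilon> \<gamma> \<mu> B \<beta> \<Omega> \<T> \<tau> N u0 u1 L L' u p
      \<longrightarrow>
      (\<forall>n. 1 \<le> n \<and> n < N \<longrightarrow>
        (let b = at_half \<beta> \<tau> n;
             Y = (\<lambda>x. delta u (n + 1) x - L2_proj \<Omega> (X_space_vec 0 \<Omega> \<T>) (delta u (n + 1)) x)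
         in
          (L2_norm \<Omega> Y)\<^sup>2 \<le>
            C * (Co / Re * \<tau> * A_norm_sq 1 \<gamma> \<mu> \<Omega> \<T> (averaged u (n + 1))
               + \<tau>\<^sup>2 * B1\<^sup>2 * (L2_norm \<Omega> (extrapolated u (n + 1)))\<^sup>2
               + \<tau> * Co * s_u \<gamma>\<^sub>u \<epsilon> B b \<Omega> \<T> (averaged u (n + 1)) (averaged u (n + 1))
               + \<tau> * Co * s_p \<gamma>\<^sub>p \<mu> B \<T> (p (n + 1)) (p (n + 1))
               + \<tau> * (dual_norm 1 \<gamma>\<^sub>u \<epsilon> \<gamma> \<mu> B b \<Omega> \<T> (L (n + 1)))\<^sup>2
               + Co * (L2_norm \<Omega> (delta (delta u) (n + 1)))\<^sup>2)))"
proof -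
  obtain n where card: "CARD('d) = n" by simp
  obtain \<rho> where shaped: "\<And>\<T>. \<T> \<in> \<M> \<Longrightarrow> shaped_mesh \<Omega> \<T> \<rho> n"
    using quasi_uniform_shape[OF assms(1-3) card] by metis
  \<comment> \<open>The step constant is known to be positive only if the family contains a mesh.\<close>
  define C0 where "C0 = shaped_mesh.cstep \<rho> n \<gamma>\<^sub>u \<gamma>\<^sub>p \<epsilon> \<gamma> Co_max \<tau>_max"
  define C where "C = (if \<M> = {} then 1 else C0)"
  have C_eq: "C = C0" if "\<T> \<in> \<M>" for \<T> using that by (auto simp: C_def)
  have C_pos: "0 < C"
  proof (cases "\<M> = {}")
    case False
    then obtain \<T> where "\<T> \<in> \<M>" by blast
    then interpret shaped_mesh \<Omega> \<T> \<rho> n by (rule shaped)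
    show ?thesis unfolding C_def C0_def using False cstep_pos[OF assms(4-6)] by simp
  qed (simp add: C_def)
  show ?thesis
  proof (rule exI[of _ C], rule conjI[OF C_pos], intro allI, unfold Let_def, intro impI allI, elim conjE)
    fix T \<beta> \<mu> \<T> \<tau> u0 u1 L L' u p and N m :: nat
    let ?B = "Linf_norm (\<Omega> \<times> {0<..<T}) \<beta>" and ?V = "V_space 1 \<Omega> \<T>" and ?b = "at_half \<beta> \<tau> m"
    assume T: "0 < T" and \<beta>: "advection_field \<Omega> T \<beta>" and \<mu>: "0 < \<mu>" and \<T>: "\<T> \<in> \<M>"
      and Re: "1 \<le> reynolds \<mu> ?B \<T>" and \<tau>: "0 < \<tau>" and N: "real N * \<tau> \<le> T"
      and Co: "courant \<tau> ?B \<T> \<le> Co_max" and \<tau>_max: "\<tau> \<le> \<tau>_max"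
      and u01: "u0 \<in> L2_space \<Omega>" "u1 \<in> L2_space \<Omega>" and L: "\<forall>n. bounded_functional \<Omega> ?V (L n)"
      and sol: "CN_solution 1 \<gamma>\<^sub>u \<gamma>\<^sub>p \<epsilon> \<gamma> \<mu> ?B \<beta> \<Omega> \<T> \<tau> N u0 u1 L L' u p"
      and m: "1 \<le> m" "m < N"
    interpret shaped_mesh \<Omega> \<T> \<rho> n by (rule shaped[OF \<T>])
    define t where "t = (real m + 1 / 2) * \<tau>"
    have t: "0 < t" "t < T"
    proof -
      show "0 < t" using \<tau> by (simp add: t_def)
      have "t < real N * \<tau>" unfolding t_def using m(2) \<tau> by (intro mult_strict_right_mono) auto
      then show "t < T" using N by linarith
    qed
    have b_eq: "?b = (\<lambda>x. \<beta> (x, t))" by (simp add: at_half_def t_def)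
    have B: "0 < ?B" using \<beta> by (simp add: advection_field_def Let_def)
    have u: "u i \<in> ?V" if "i \<le> N" for i
    proof -
      have "L2_proj \<Omega> ?V w \<in> ?V" if "w \<in> L2_space \<Omega>" for w
        unfolding L2_proj_def by (rule V_represent(1)[of "L2_inner \<Omega> w", OF L2_linear[OF that]])
      then have "u 0 \<in> ?V" "u 1 \<in> ?V" using sol u01 unfolding CN_solution_def by metis+
      moreover have "u (k + 1) \<in> ?V" if "1 \<le> k" "k < N" for k
        using sol that unfolding CN_solution_def by blast
      moreover have "i = 0 \<or> i = 1 \<or> (\<exists>k. i = k + 1 \<and> 1 \<le> k \<and> k < N)" using that by presburger
      ultimately show ?thesis by metis
    qed
    have um: "u (m - 1) \<in> ?V" "u m \<in> ?V" "u (m + 1) \<in> ?V" by (rule u, use m in simp)+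
    have y: "delta u (m + 1) \<in> ?V" unfolding delta_def using V_diff[OF um(3,2)] by simp
    have dd: "delta (delta u) (m + 1) \<in> ?V"
      unfolding delta_def using V_diff[OF V_diff[OF um(3,2)] V_diff[OF um(2,1)]] by simp
    have ua: "averaged u (m + 1) \<in> ?V" unfolding averaged_def using V_scale[OF V_add[OF um(3,2)]] by simp
    have ue: "extrapolated u (m + 1) \<in> ?V"
      unfolding extrapolated_def using V_diff[OF V_scale[OF um(2)] V_scale[OF um(1)]] by simp
    have ue_eq: "extrapolated u (m + 1) = (\<lambda>x. averaged u (m + 1) x + (- (1 / 2)) *\<^sub>R delta (delta u) (m + 1) x)"
    proof
      fix x
      have "(3 / 2) *\<^sub>R b - (1 / 2) *\<^sub>R a = (1 / 2) *\<^sub>R (c + b) + (- (1 / 2)) *\<^sub>R ((c - b) - (b - a))" for a b c :: "real^'d"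
        by (simp add: vec_eq_iff field_simps)
      then show "extrapolated u (m + 1) x = averaged u (m + 1) x + (- (1 / 2)) *\<^sub>R delta (delta u) (m + 1) x"
        unfolding extrapolated_def averaged_def delta_def by simp
    qed
    have q: "p (m + 1) \<in> W_space 1 \<Omega> \<T>" using sol m unfolding CN_solution_def Q_space_def by blast
    have nn: "0 \<le> nitsche \<gamma> v v" if "v \<in> ?V" for v
    proof (rule nitsche_nonneg[OF _ that])
      fix \<mu>' :: real assume "0 < \<mu>'"
      then show "norm_on ?V (\<lambda>v. sqrt (E_norm_sq 1 \<gamma>\<^sub>u \<epsilon> \<gamma> \<mu>' ?B (\<lambda>x. \<beta> (x, t)) \<Omega> \<T> v))"
        using assms(7) \<T> \<beta> T t unfolding sufficiently_large_def by (meson atLeastAtMost_iff less_imp_le)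
    qed
    have B1: "0 \<le> W1inf_norm (\<Omega> \<times> {0<..<T}) \<beta>"
      using B W1inf_norm_ge_Linf_norm[of "\<Omega> \<times> {0<..<T}" \<beta>] by linarith
    show "(L2_norm \<Omega> (\<lambda>x. delta u (m + 1) x - L2_proj \<Omega> (X_space_vec 0 \<Omega> \<T>) (delta u (m + 1)) x))\<^sup>2 \<le>
            C * (courant \<tau> ?B \<T> / reynolds \<mu> ?B \<T> * \<tau> * A_norm_sq 1 \<gamma> \<mu> \<Omega> \<T> (averaged u (m + 1))
               + \<tau>\<^sup>2 * (W1inf_norm (\<Omega> \<times> {0<..<T}) \<beta>)\<^sup>2 * (L2_norm \<Omega> (extrapolated u (m + 1)))\<^sup>2
               + \<tau> * courant \<tau> ?B \<T> * s_u \<gamma>\<^sub>u \<epsilon> ?B ?b \<Omega> \<T> (averaged u (m + 1)) (averaged u (m + 1))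
               + \<tau> * courant \<tau> ?B \<T> * s_p \<gamma>\<^sub>p \<mu> ?B \<T> (p (m + 1)) (p (m + 1))
               + \<tau> * (dual_norm 1 \<gamma>\<^sub>u \<epsilon> \<gamma> \<mu> ?B ?b \<Omega> \<T> (L (m + 1)))\<^sup>2
               + courant \<tau> ?B \<T> * (L2_norm \<Omega> (delta (delta u) (m + 1)))\<^sup>2)"
      unfolding C_eq[OF \<T>] C0_def
    proof (rule one_step[OF y ua ue dd q ue_eq])
      show "inverse \<tau> * L2_inner \<Omega> (delta u (m + 1)) v + L2_inner \<Omega> (G_op 1 \<Omega> \<T> (p (m + 1))) v
          + L2_inner \<Omega> (C_op 1 \<gamma>\<^sub>u \<epsilon> ?B ?b \<Omega> \<T> (extrapolated u (m + 1))) v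
          + L2_inner \<Omega> (A_op 1 \<gamma> \<mu> \<Omega> \<T> (averaged u (m + 1))) v = L (m + 1) v" if "v \<in> ?V" for v
        using sol m that unfolding CN_solution_def by blast
      show "bounded_functional \<Omega> ?V (L (m + 1))" using L by blast
      show "continuous_on (closure \<Omega>) ?b" unfolding b_eq by (rule advection_bound(1)[OF open_domain \<beta> t])
      show "norm (?b x) \<le> ?B" if "x \<in> closure \<Omega>" for x
        unfolding b_eq by (rule advection_bound(2)[OF open_domain \<beta> t that])
      show "norm (?b x - ?b y) \<le> (real n + 1) * W1inf_norm (\<Omega> \<times> {0<..<T}) \<beta> * norm (x - y)"
        if K: "K \<in> \<T>" and xy: "x \<in> K" "y \<in> K" for K x y
        unfolding b_eq card[symmetric]
        by (rule advection_lipschitz[OF open_domain \<beta> t full_simplex_convex[OF simplex[OF K]]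
              closure_interior_simplex[OF simplex[OF K]] interior_subset_domain[OF K] xy])
    qed (fact nn assms B B1 \<mu> \<tau> Re Co \<tau>_max)+
  qed
qed

end
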